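(* Let $\omega_0\in(-F(E_{n+1}),F(-E_{n+1}))$, $n\ge2$, and let $\Sigma\subset\overline{\mathbb{R}^{n+1}_+}$ be a star-shaped anisotropic $\omega_0$-capillary hypersurface. Then $$\frac{|\Sigma|_F+\omega_0|\widehat{\partial\Sigma}|}{|\mathcal{W}_{1,\omega_0}|_F+\omega_0|\widehat{\partial\mathcal{W}_{1,\omega_0}}|}\ \ge\ \left(\frac{|\widehat\Sigma|}{|\widehat{\mathcal{W}_{1,\omega_0}}|}\right)^{\frac{n}{n+1}} .$$ Moreover, equality holds if and only if $\Sigma$ is an $\omega_0$-capillary Wulff shape, and $|\mathcal{W}_{1,\omega_0}|_F+\omega_0|\widehat{\partial\mathcal{W}_{1,\omega_0}}|=(n+1)|\widehat{\mathcal{W}_{1,\omega_0}}|$.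
   Context: $\langle\cdot,\cdot\rangle$ is the Euclidean inner product on $\mathbb{R}^{n+1}$, $E_{n+1}$ the $(n+1)$-th coordinate unit vector, $\mathbb{R}^{n+1}_+=\{x:\langle x,E_{n+1}\rangle>0\}$. $F:\mathbb{S}^n\to(0,\infty)$ is smooth with $A_F:=\nabla^{\mathbb{S}}\nabla^{\mathbb{S}}F+F g^{\mathbb{S}^n}$ positive definite on $\mathbb{S}^n$, extended to $\mathbb{R}^{n+1}$ as a $1$-homogeneous function. $\Psi(x)=F(x)x+\nabla^{\mathbb{S}}F(x)$ for $x\in\mathbb{S}^n$; $\mathcal{W}=\Psi(\mathbb{S}^n)$ is the Wulff shape. The dual norm is $F^0(\xi)=\sup_{x\ne0}\langle x,\xi\rangle/F(x)$. Hypersurfaces $\Sigma\subset\overline{\mathbb{R}^{n+1}_+}$ are smooth, compact, embedded, orientable, with $\mathrm{int}(\Sigma)\subset\mathbb{R}^{n+1}_+$ and $\partial\Sigma\subset\partial\mathbb{R}^{n+1}_+$; $\widehat\Sigma$ is the bounded domain enclosed by $\Sigma$ and $\partial\mathbb{R}^{n+1}_+$, and $\nu$ is the unit normal of $\Sigma$ pointing outward of $\widehat\Sigma$. $\Sigma$ is anisotropic $\omega_0$-capillary if $\langle\Psi(\nu),-E_{n+1}\rangle=\omega_0$ on $\partial\Sigma$. Star-shaped (with respect to the origin) means that $\Sigma$ is a radial graph over the closed upper hemisphere, i.e. $\langle X,\nu\rangle>0$ on $\Sigma$. $\widehat{\partial\Sigma}=\widehat\Sigma\cap\partial\mathbb{R}^{n+1}_+$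 denotes the domain in $\mathbb{R}^n=\partial\mathbb{R}^{n+1}_+$ enclosed by $\partial\Sigma$; $|\cdot|$ is Lebesgue volume in $\mathbb{R}^n$ or $\mathbb{R}^{n+1}$; $|\Sigma|_F=\int_\Sigma F(\nu)\,d\mu_g$, with $d\mu_g$ the area element induced by the Euclidean metric. $E^F_{n+1}=\Psi(E_{n+1})/F(E_{n+1})$ if $\omega_0<0$, $E^F_{n+1}=-\Psi(-E_{n+1})/F(-E_{n+1})$ if $\omega_0>0$, and any unit vector if $\omega_0=0$ (it then only appears multiplied by $\omega_0$). For $r>0$, $\mathcal{W}_{r,\omega_0}=\{x\in\overline{\mathbb{R}^{n+1}_+}:F^0(x-r\omega_0E^F_{n+1})=r\}$. An $\omega_0$-capillary Wulff shape is a part in $\overline{\mathbb{R}^{n+1}_+}$ of a Wulff shape $\{x: F^0(x-x_0)=r\}$ ($r>0$, $x_0\in\mathbb{R}^{n+1}$) which satisfies the $\omega_0$-capillary boundary condition. *)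

theory Defs
  imports "HOL-Analysis.Analysis"
begin

text \<open>\<open>C_k_on k f U\<close>: \<open>f\<close> is of class \<open>C^k\<close> on the open set \<open>U\<close>. All directional
  derivatives are required to be of class \<open>C^(k-1)\<close>; in finite dimension this is the usual notion.\<close>

primrec C_k_on :: "nat \<Rightarrow> ('a::euclidean_space \<Rightarrow> 'b::euclidean_space) \<Rightarrow> 'a set \<Rightarrow> bool" where
  "C_k_on 0 f U \<longleftrightarrow> continuous_on U f"
| "C_k_on (Suc k) f U \<longleftrightarrow>
     (\<exists>f'. (\<forall>x\<in>U. (f has_derivative f' x) (at x)) \<and> (\<forall>v. C_k_on k (\<lambda>x. f' x v) U))"

definition smooth_on :: "('a::euclidean_space \<Rightarrow> 'b::euclidean_space) \<Rightarrow> 'a set \<Rightarrow> bool" where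
  "smooth_on f U \<longleftrightarrow> (\<forall>k. C_k_on k f U)"

definition diffeomorphism ::
    "'a::euclidean_space set \<Rightarrow> 'b::euclidean_space set \<Rightarrow> ('a \<Rightarrow> 'b) \<Rightarrow> bool" where
  "diffeomorphism U V f \<longleftrightarrow> open U \<and> open V \<and> smooth_on f U \<and>
     (\<exists>g. smooth_on g V \<and> f ` U = V \<and> g ` V = U \<and> (\<forall>x\<in>U. g (f x) = x) \<and> (\<forall>y\<in>V. f (g y) = y))"

definition gradient :: "('a::euclidean_space \<Rightarrow> real) \<Rightarrow> 'a \<Rightarrow> 'a" where
  "gradient f x = (THE d. GDERIV f x :> d)"

text \<open>Since \<open>sgn y = y / |y|\<close>, the map \<open>f \<circ> sgn\<close> is the \<open>0\<close>-homogeneous extension of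
  \<open>f\<close> restricted to the unit sphere. The definitions below depend on the values of \<open>f\<close> on the
  sphere only.\<close>

definition smooth_on_sphere :: "('a::euclidean_space \<Rightarrow> real) \<Rightarrow> bool" where
  "smooth_on_sphere f \<longleftrightarrow> smooth_on (f \<circ> sgn) (- {0})"

text \<open>The \<open>0\<close>-homogeneous extension is constant in the normal direction, so its Euclidean gradient
  on the sphere is tangential.\<close>

definition sphere_grad :: "('a::euclidean_space \<Rightarrow> real) \<Rightarrow> 'a \<Rightarrow> 'a" where
  "sphere_grad f x = gradient (f \<circ> sgn) x"

text \<open>The covariant Hessian \<open>\<langle>\<nabla>\<^sub>u \<nabla>f, v\<rangle>\<close> for \<open>u\<close>, \<open>v\<close> tangent to the sphere at \<open>x\<close>: the
  Levi-Civita connection is the tangential part of the ambient derivative, and pairing with the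
  tangent vector \<open>v\<close> discards the normal part.\<close>

definition sphere_hess :: "('a::euclidean_space \<Rightarrow> real) \<Rightarrow> 'a \<Rightarrow> 'a \<Rightarrow> 'a \<Rightarrow> real" where
  "sphere_hess f x u v = frechet_derivative (sphere_grad f \<circ> sgn) (at x) u \<bullet> v"

text \<open>\<open>F\<close> is a smooth positive function on the unit sphere with \<open>A\<^sub>F\<close> positive definite, extended
  \<open>1\<close>-homogeneously to the whole space.\<close>

definition anisotropy :: "('a::euclidean_space \<Rightarrow> real) \<Rightarrow> bool" where
  "anisotropy F \<longleftrightarrow>
     (\<forall>x\<in>sphere 0 1. 0 < F x) \<and>
     smooth_on_sphere F \<and>
     (\<forall>x\<in>sphere 0 1. \<forall>v. x \<bullet> v = 0 \<and> v \<noteq> 0 \<longrightarrow> 0 < sphere_hess F x v v + F x * (v \<bullet> v)) \<and>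
     (\<forall>x. \<forall>t\<ge>0. F (t *\<^sub>R x) = t * F x)"

definition Psi :: "('a::euclidean_space \<Rightarrow> real) \<Rightarrow> 'a \<Rightarrow> 'a" where
  "Psi F x = F x *\<^sub>R x + sphere_grad F x"

definition dual_norm :: "('a::euclidean_space \<Rightarrow> real) \<Rightarrow> 'a \<Rightarrow> real" where
  "dual_norm F \<xi> = (SUP x\<in>-{0}. (x \<bullet> \<xi>) / F x)"

text \<open>\<open>\<real>^(n+1)\<close> is modelled as \<open>\<real>^n \<times> \<real>\<close> with \<open>n = CARD('n)\<close>; the last coordinate is \<open>snd\<close>.\<close>

type_synonym 'n ambient = "(real ^ 'n) \<times> real"

definition E_last :: "'n::finite ambient" where
  "E_last = (0, 1)"

definition upper_halfspace :: "'n::finite ambient set" where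
  "upper_halfspace = {x. x \<bullet> E_last > 0}"

definition boundary_hyperplane :: "'n::finite ambient set" where
  "boundary_hyperplane = {x. x \<bullet> E_last = 0}"

definition closed_upper_halfspace :: "'n::finite ambient set" where
  "closed_upper_halfspace = {x. x \<bullet> E_last \<ge> 0}"

text \<open>Slice charts of the ambient space, flattening \<open>S\<close> near \<open>p\<close> to a hyperplane or to a closed half
  of it with \<open>p\<close> on the edge.\<close>

definition interior_chart ::
    "'n::finite ambient set \<Rightarrow> 'n ambient \<Rightarrow> 'n ambient set \<Rightarrow> ('n ambient \<Rightarrow> 'n ambient) \<Rightarrow> bool" where
  "interior_chart S p U \<phi> \<longleftrightarrow> p \<in> S \<inter> U \<and>
     (\<exists>V. diffeomorphism U V \<phi> \<and> \<phi> ` (S \<inter> U) = V \<inter> {x. snd x = 0})"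

definition boundary_chart ::
    "'n::finite ambient set \<Rightarrow> 'n ambient \<Rightarrow> 'n ambient set \<Rightarrow> ('n ambient \<Rightarrow> 'n ambient) \<Rightarrow> bool" where
  "boundary_chart S p U \<phi> \<longleftrightarrow> p \<in> S \<inter> U \<and>
     (\<exists>V k. diffeomorphism U V \<phi> \<and> \<phi> ` (S \<inter> U) = V \<inter> {x. snd x = 0 \<and> fst x $ k \<ge> 0} \<and>
        fst (\<phi> p) $ k = 0)"

definition manifold_interior :: "'n::finite ambient set \<Rightarrow> 'n ambient set" where
  "manifold_interior S = {p. \<exists>U \<phi>. interior_chart S p U \<phi>}"

definition manifold_boundary :: "'n::finite ambient set \<Rightarrow> 'n ambient set" where
  "manifold_boundary S = {p. \<exists>U \<phi>. boundary_chart S p U \<phi>}"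

definition embedded_hypersurface :: "'n::finite ambient set \<Rightarrow> bool" where
  "embedded_hypersurface S \<longleftrightarrow> S = manifold_interior S \<union> manifold_boundary S"

definition tangent_space :: "'n::finite ambient set \<Rightarrow> 'n ambient \<Rightarrow> 'n ambient set" where
  "tangent_space S p = {v. \<exists>U \<phi>. (interior_chart S p U \<phi> \<or> boundary_chart S p U \<phi>) \<and>
     snd (frechet_derivative \<phi> (at p) v) = 0}"

definition unit_normal_field ::
    "'n::finite ambient set \<Rightarrow> ('n ambient \<Rightarrow> 'n ambient) \<Rightarrow> bool" where
  "unit_normal_field S \<nu> \<longleftrightarrow> continuous_on S \<nu> \<and>
     (\<forall>p\<in>S. norm (\<nu> p) = 1 \<and> (\<forall>v\<in>tangent_space S p. \<nu> p \<bullet> v = 0))"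

definition orientable :: "'n::finite ambient set \<Rightarrow> bool" where
  "orientable S \<longleftrightarrow> (\<exists>\<nu>. unit_normal_field S \<nu>)"

definition halfspace_hypersurface :: "'n::finite ambient set \<Rightarrow> bool" where
  "halfspace_hypersurface S \<longleftrightarrow> compact S \<and> embedded_hypersurface S \<and> orientable S \<and>
     manifold_interior S \<subseteq> upper_halfspace \<and> manifold_boundary S \<subseteq> boundary_hyperplane"

text \<open>The region enclosed by \<open>S\<close> and the hyperplane, taken closed, so that its intersection with the
  hyperplane is the (closed) region of \<open>\<real>^n\<close> enclosed by the boundary of \<open>S\<close>.\<close>

definition enclosed :: "'n::finite ambient set \<Rightarrow> 'n ambient set" where
  "enclosed S = closure (inside (S \<union> boundary_hyperplane))"

definition enclosed_trace :: "'n::finite ambient set \<Rightarrow> (real ^ 'n) set" where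
  "enclosed_trace S = {y. (y, 0) \<in> enclosed S}"

text \<open>Outwardness is tested at interior points only: at a boundary point \<open>p\<close> the point
  \<open>p - t \<nu>\<close> may leave the half-space. There \<open>\<nu>\<close> is determined by continuity.\<close>

definition outward_normal_field ::
    "'n::finite ambient set \<Rightarrow> ('n ambient \<Rightarrow> 'n ambient) \<Rightarrow> bool" where
  "outward_normal_field S \<nu> \<longleftrightarrow> unit_normal_field S \<nu> \<and>
     (\<forall>p\<in>manifold_interior S. \<forall>\<^sub>F t in at_right 0.
        p + t *\<^sub>R \<nu> p \<notin> enclosed S \<and> p - t *\<^sub>R \<nu> p \<in> enclosed S)"

text \<open>Only the values on \<open>S\<close>, where the outward normal is unique, are meaningful.\<close>

definition outward_normal :: "'n::finite ambient set \<Rightarrow> 'n ambient \<Rightarrow> 'n ambient" where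
  "outward_normal S = (SOME \<nu>. outward_normal_field S \<nu>)"

definition star_shaped :: "'n::finite ambient set \<Rightarrow> bool" where
  "star_shaped S \<longleftrightarrow>
     (\<exists>\<rho>. (\<forall>\<theta>\<in>sphere 0 1 \<inter> closed_upper_halfspace. \<rho> \<theta> > 0) \<and>
        S = (\<lambda>\<theta>. \<rho> \<theta> *\<^sub>R \<theta>) ` (sphere 0 1 \<inter> closed_upper_halfspace)) \<and>
     (\<forall>p\<in>S. p \<bullet> outward_normal S p > 0)"

definition local_parametrization ::
    "'n::finite ambient set \<Rightarrow> (real ^ 'n) set \<Rightarrow> (real ^ 'n \<Rightarrow> 'n ambient) \<Rightarrow> bool" where
  "local_parametrization S V \<phi> \<longleftrightarrow> open V \<and> smooth_on \<phi> V \<and> inj_on \<phi> V \<and>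
     (\<forall>y\<in>V. inj (frechet_derivative \<phi> (at y))) \<and> \<phi> ` V \<subseteq> S"

definition gram_matrix :: "(real ^ 'n::finite \<Rightarrow> 'n ambient) \<Rightarrow> real ^ 'n \<Rightarrow> real ^ 'n ^ 'n" where
  "gram_matrix \<phi> y = (\<chi> i j.
     frechet_derivative \<phi> (at y) (axis i 1) \<bullet> frechet_derivative \<phi> (at y) (axis j 1))"

text \<open>The Riemannian area measure of \<open>S\<close> for the metric induced from the ambient space, as a Borel
  measure on the ambient space: it is concentrated on the interior of \<open>S\<close> and has density
  \<open>sqrt (det g)\<close> in local coordinates. Compact sets in coordinate domains suffice to determine it.\<close>

definition area_measure :: "'n::finite ambient set \<Rightarrow> 'n ambient measure" where
  "area_measure S = (THE M. sets M = sets borel \<and>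
     (\<exists>N\<in>null_sets M. - manifold_interior S \<subseteq> N) \<and>
     (\<forall>V \<phi> K. local_parametrization S V \<phi> \<and> compact K \<and> K \<subseteq> V \<longrightarrow>
        emeasure M (\<phi> ` K) = (\<integral>\<^sup>+ y\<in>K. ennreal (sqrt (det (gram_matrix \<phi> y))) \<partial>lborel)))"

definition anisotropic_area :: "('n::finite ambient \<Rightarrow> real) \<Rightarrow> 'n ambient set \<Rightarrow> real" where
  "anisotropic_area F S = (LINT p:S|area_measure S. F (outward_normal S p))"

definition capillary_condition ::
    "('n::finite ambient \<Rightarrow> real) \<Rightarrow> real \<Rightarrow> 'n ambient set \<Rightarrow> bool" where
  "capillary_condition F \<omega> S \<longleftrightarrow>
     (\<forall>p\<in>manifold_boundary S. Psi F (outward_normal S p) \<bullet> (- E_last) = \<omega>)"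

definition capillary_hypersurface ::
    "('n::finite ambient \<Rightarrow> real) \<Rightarrow> real \<Rightarrow> 'n ambient set \<Rightarrow> bool" where
  "capillary_hypersurface F \<omega> S \<longleftrightarrow> halfspace_hypersurface S \<and> capillary_condition F \<omega> S"

text \<open>For \<open>\<omega> = 0\<close> any unit vector may be chosen, as it only occurs multiplied by \<open>\<omega>\<close>.\<close>

definition E_F :: "('n::finite ambient \<Rightarrow> real) \<Rightarrow> real \<Rightarrow> 'n ambient" where
  "E_F F \<omega> =
     (if \<omega> < 0 then Psi F E_last /\<^sub>R F E_last
      else if \<omega> > 0 then - (Psi F (- E_last) /\<^sub>R F (- E_last))
      else E_last)"

definition model_wulff ::
    "('n::finite ambient \<Rightarrow> real) \<Rightarrow> real \<Rightarrow> real \<Rightarrow> 'n ambient set" where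
  "model_wulff F r \<omega> =
     {x \<in> closed_upper_halfspace. dual_norm F (x - (r * \<omega>) *\<^sub>R E_F F \<omega>) = r}"

definition capillary_wulff_shape ::
    "('n::finite ambient \<Rightarrow> real) \<Rightarrow> real \<Rightarrow> 'n ambient set \<Rightarrow> bool" where
  "capillary_wulff_shape F \<omega> S \<longleftrightarrow>
     (\<exists>r>0. \<exists>x0. S = {x \<in> closed_upper_halfspace. dual_norm F (x - x0) = r}) \<and>
     capillary_hypersurface F \<omega> S"

definition capillary_energy ::
    "('n::finite ambient \<Rightarrow> real) \<Rightarrow> real \<Rightarrow> 'n ambient set \<Rightarrow> real" where
  "capillary_energy F \<omega> S = anisotropic_area F S + \<omega> * measure lebesgue (enclosed_trace S)"

end

theory Submission
  imports Defs "HOL-Library.Option_ord"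
begin

text \<open>Let \<open>\<Omega>\<close> be the region enclosed by \<open>\<Sigma>\<close>, \<open>K\<close> the region enclosed by the model and \<open>N = n + 1\<close>. The
  gauge of \<open>\<Omega>\<close> has gradient \<open>\<nu> / (p \<bullet> \<nu>)\<close> at \<open>p \<in> \<Sigma>\<close>, so the volume of \<open>\<Omega> + \<epsilon>K\<close> grows to first order at most
  by \<open>\<epsilon>\<close> times the integral over \<open>\<Sigma>\<close> of \<open>F \<nu> + \<omega> E\<^sub>F \<bullet> \<nu>\<close>, which dominates the support function of \<open>K\<close>. As \<open>E\<^sub>F\<close> has last
  coordinate 1, the divergence theorem identifies this integral with the capillary energy, and the
  Brunn--Minkowski inequality bounds it below by \<open>N |K|^(1/N) |\<Omega>|^(n/N)\<close>. Integrals over \<open>\<Sigma>\<close> are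
  expressed as integrals over \<open>\<Omega>\<close>, since the cone over an area element \<open>dA\<close> has volume \<open>(p \<bullet> \<nu>) dA / N\<close>.

  For the equality case, \<open>\<Omega>\<close> and \<open>K\<close> are cut by parallel hyperplanes in the same volume ratio, and the
  argument is applied to the union of the two sums \<open>\<Omega>\<^sub>i + \<epsilon>K\<^sub>i\<close>, which is still large enough by
  Brunn--Minkowski. Equality forces the point \<open>T p = \<Psi> (\<nu> p) + \<omega> E\<^sub>F\<close> to lie in the piece of \<open>K\<close> that corresponds to the
  piece of \<open>\<Omega>\<close> containing \<open>p\<close>. Hence each coordinate of \<open>T p\<close> is a monotone function of the same coordinate of
  \<open>p\<close>, in every direction, so \<open>T\<close> is a homothety up to translation and \<open>\<Sigma>\<close> is part of a Wulff shape.\<close>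

text \<open>The region \<Omega> need not be convex and \<Sigma> has a boundary in the hyperplane, so
  neither a formula for parallel surfaces nor uniform estimates in charts up to the boundary are at
  hand. All geometry of \<Sigma> is therefore read off from its gauge: the growth of volume is
  estimated on each ray of the open half-space separately, and dominated convergence replaces
  uniformity near the boundary. Only an upper bound for the growth is proved, and this suffices.
  Applied to translations by c and by -c it becomes an equality, the divergence theorem; improved on
  an open set of rays it shows that equality is lost as soon as T p is missing from the piece
  matched with p. What is needed of \<Sigma> is collected in \<open>radial_surface\<close>. Wulff
  caps satisfy the same axioms, so the energy of the model comes from the same formulas. The range
  of \<omega> puts the origin strictly inside the Wulff shape centred at \<omega>
  \<open>E_F\<close>, and this makes the model itself a radial graph.\<close>

abbreviation upper :: "'n::finite ambient set" where "upper \<equiv> upper_halfspace"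

abbreviation cupper :: "'n::finite ambient set" where "cupper \<equiv> closed_upper_halfspace"

abbreviation vol :: "'a::euclidean_space set \<Rightarrow> real" where "vol \<equiv> measure lebesgue"

section \<open>Smooth maps and the inverse function theorem\<close>

lemma linear_basis_expansion:
  fixes f :: "'a::euclidean_space \<Rightarrow> 'b::real_vector"
  assumes "linear f"
  shows "f w = (\<Sum>b\<in>Basis. (w \<bullet> b) *\<^sub>R f b)"
proof -
  have "f w = f (\<Sum>b\<in>Basis. (w \<bullet> b) *\<^sub>R b)" by (simp add: euclidean_representation)
  then show ?thesis using assms by (simp add: linear_sum linear_cmul)
qed

lemma C_k_on_subset: "C_k_on k f U \<Longrightarrow> V \<subseteq> U \<Longrightarrow> C_k_on k f V"
proof (induction k arbitrary: f)
  case 0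
  then show ?case by (auto intro: continuous_on_subset)
next
  case (Suc k)
  then obtain f' where "\<forall>x\<in>U. (f has_derivative f' x) (at x)" "\<forall>v. C_k_on k (\<lambda>x. f' x v) U" by auto
  with Suc show ?case by (auto intro!: exI[of _ f'])
qed

lemma C_k_on_cong:
  assumes "open U" "\<And>x. x \<in> U \<Longrightarrow> f x = g x" "C_k_on k f U"
  shows "C_k_on k g U"
  using assms(2-)
proof (cases k)
  case 0
  with assms show ?thesis by (simp cong: continuous_on_cong)
next
  case (Suc j)
  with assms obtain f' where f': "\<forall>x\<in>U. (f has_derivative f' x) (at x)" "\<forall>v. C_k_on j (\<lambda>x. f' x v) U" by auto
  have "\<forall>x\<in>U. (g has_derivative f' x) (at x)" using f'(1) assms(1,2) by (metis has_derivative_transform_within_open)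
  with f'(2) Suc show ?thesis by auto
qed

lemma C_k_on_Suc_D: "C_k_on (Suc k) f U \<Longrightarrow> C_k_on k f U"
proof (induction k arbitrary: f)
  case 0
  then show ?case by (auto intro!: continuous_at_imp_continuous_on dest: has_derivative_continuous)
next
  case (Suc k)
  then obtain f' where "\<forall>x\<in>U. (f has_derivative f' x) (at x)" "\<forall>v. C_k_on (Suc k) (\<lambda>x. f' x v) U" by auto
  with Suc.IH show ?case by (auto intro!: exI[of _ f'] simp del: C_k_on.simps(1))
qed

lemma C_k_on_const: "C_k_on k (\<lambda>x. c) U"
  by (induction k arbitrary: c) (auto intro!: exI[of _ "\<lambda>x v. 0"])

lemma C_k_on_bounded_linear_compose:
  assumes "bounded_linear L" "C_k_on k f U"
  shows "C_k_on k (\<lambda>x. L (f x)) U"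
  using assms(2)
proof (induction k arbitrary: f)
  case 0
  then show ?case using bounded_linear.continuous_on[OF assms(1)] by auto
next
  case (Suc k)
  then obtain f' where f': "\<forall>x\<in>U. (f has_derivative f' x) (at x)" "\<forall>v. C_k_on k (\<lambda>x. f' x v) U" by auto
  have "\<forall>x\<in>U. ((\<lambda>x. L (f x)) has_derivative (\<lambda>v. L (f' x v))) (at x)"
    using f'(1) bounded_linear.has_derivative[OF assms(1)] by blast
  with Suc.IH f'(2) show ?case by (auto intro!: exI[of _ "\<lambda>x v. L (f' x v)"])
qed

lemma C_k_on_ident: "C_k_on k (\<lambda>x. x) U"
proof (cases k)
  case (Suc j)
  then show ?thesis by (auto intro!: exI[of _ "\<lambda>x v. v"] C_k_on_const)
qed auto

lemma C_k_on_add: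
  assumes "C_k_on k f U" "C_k_on k g U"
  shows "C_k_on k (\<lambda>x. f x + g x) U"
  using assms
proof (induction k arbitrary: f g)
  case 0
  then show ?case by (auto intro: continuous_intros)
next
  case (Suc k)
  obtain p' where p': "\<forall>x\<in>U. (f has_derivative p' x) (at x)" "\<forall>v. C_k_on k (\<lambda>x. p' x v) U"
    using Suc.prems by auto
  obtain q' where q': "\<forall>x\<in>U. (g has_derivative q' x) (at x)" "\<forall>v. C_k_on k (\<lambda>x. q' x v) U"
    using Suc.prems by auto
  show ?case using p' q' Suc.IH by (auto intro!: exI[of _ "\<lambda>x v. p' x v + q' x v"] has_derivative_add)
qed

lemma C_k_on_bilinear:
  assumes B: "bounded_bilinear B" and "C_k_on k f U" "C_k_on k g U"
  shows "C_k_on k (\<lambda>x. B (f x) (g x)) U"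
  using assms(2-)
proof (induction k arbitrary: f g)
  case 0
  then show ?case using bounded_bilinear.continuous_on[OF B] by auto
next
  case (Suc k)
  note fk = C_k_on_Suc_D[OF Suc.prems(1)] and gk = C_k_on_Suc_D[OF Suc.prems(2)]
  obtain f' where f': "\<forall>x\<in>U. (f has_derivative f' x) (at x)" "\<forall>v. C_k_on k (\<lambda>x. f' x v) U"
    using Suc.prems by auto
  obtain g' where g': "\<forall>x\<in>U. (g has_derivative g' x) (at x)" "\<forall>v. C_k_on k (\<lambda>x. g' x v) U"
    using Suc.prems by auto
  have d: "\<forall>x\<in>U. ((\<lambda>x. B (f x) (g x)) has_derivative (\<lambda>v. B (f x) (g' x v) + B (f' x v) (g x))) (at x)"
    using f'(1) g'(1) bounded_bilinear.FDERIV[OF B] by blast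
  have "C_k_on k (\<lambda>x. B (f x) (g' x v) + B (f' x v) (g x)) U" for v using f'(2) g'(2) fk gk by (intro C_k_on_add Suc.IH) auto
  with d show ?case by auto
qed

lemma C_k_on_sum:
  assumes "finite I" "\<And>i. i \<in> I \<Longrightarrow> C_k_on k (f i) U"
  shows "C_k_on k (\<lambda>x. \<Sum>i\<in>I. f i x) U"
  using assms by (induction I rule: finite_induct) (auto intro: C_k_on_const C_k_on_add)

text \<open>\<open>C_k_on\<close> speaks of derivatives in fixed directions only, whereas the chain
  rule evaluates \<open>f'\<close> in the moving direction \<open>g' x v\<close>. Expanding that
  direction in the basis gives a finite sum of products of functions that are already of class
  C^k.\<close>

lemma C_k_on_compose:
  fixes f :: "'b::euclidean_space \<Rightarrow> 'c::euclidean_space" and g :: "'a::euclidean_space \<Rightarrow> 'b"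
  assumes "C_k_on k f V" "C_k_on k g U" "g ` U \<subseteq> V"
  shows "C_k_on k (\<lambda>x. f (g x)) U"
  using assms
proof (induction k arbitrary: f)
  case 0
  then show ?case by (auto intro: continuous_on_compose2)
next
  case (Suc k)
  note gk = C_k_on_Suc_D[OF Suc.prems(2)]
  obtain f' where f': "\<forall>x\<in>V. (f has_derivative f' x) (at x)" "\<forall>v. C_k_on k (\<lambda>x. f' x v) V"
    using Suc.prems by auto
  obtain g' where g': "\<forall>x\<in>U. (g has_derivative g' x) (at x)" "\<forall>v. C_k_on k (\<lambda>x. g' x v) U"
    using Suc.prems by auto
  define h where "h x v = (\<Sum>b\<in>Basis. (g' x v \<bullet> b) *\<^sub>R f' (g x) b)" for x v
  have d: "((\<lambda>x. f (g x)) has_derivative h x) (at x)" if "x \<in> U" for x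
  proof -
    have f1: "(f has_derivative f' (g x)) (at (g x))" using that Suc.prems(3) f'(1) by blast
    have "((\<lambda>x. f (g x)) has_derivative (\<lambda>v. f' (g x) (g' x v))) (at x)"
      using has_derivative_compose[of g "g' x" x UNIV, OF _ f1] g'(1) that by blast
    moreover have "f' (g x) (g' x v) = h x v" for v
    proof -
      have "linear (f' (g x))" using f1 has_derivative_linear by blast
      then show ?thesis unfolding h_def by (rule linear_basis_expansion)
    qed
    ultimately show ?thesis by simp
  qed
  have "C_k_on k (\<lambda>x. h x v) U" for v unfolding h_def
  proof (rule C_k_on_sum)
    fix b :: 'b assume "b \<in> Basis"
    have 1: "C_k_on k (\<lambda>x. f' (g x) b) U" using Suc.IH f'(2) gk Suc.prems(3) by blast
    have 2: "C_k_on k (\<lambda>x. g' x v \<bullet> b) U" using C_k_on_bounded_linear_compose[OF bounded_linear_inner_left] g'(2) by blast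
    show "C_k_on k (\<lambda>x. (g' x v \<bullet> b) *\<^sub>R f' (g x) b) U" using C_k_on_bilinear[OF bounded_bilinear_scaleR 2 1] .
  qed auto
  with d show ?case by auto
qed

lemma smooth_onI: "(\<And>k. C_k_on k f U) \<Longrightarrow> smooth_on f U"
  by (simp add: smooth_on_def)

lemma smooth_on_subset: "smooth_on f U \<Longrightarrow> V \<subseteq> U \<Longrightarrow> smooth_on f V"
  unfolding smooth_on_def using C_k_on_subset by blast

lemma smooth_on_cong: "open U \<Longrightarrow> (\<And>x. x \<in> U \<Longrightarrow> f x = g x) \<Longrightarrow> smooth_on f U \<Longrightarrow> smooth_on g U"
  using C_k_on_cong unfolding smooth_on_def by blast

lemma smooth_on_const: "smooth_on (\<lambda>x. c) U"
  by (simp add: smooth_on_def C_k_on_const)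

lemma smooth_on_ident: "smooth_on (\<lambda>x. x) U"
  by (simp add: smooth_on_def C_k_on_ident)

lemma smooth_on_add: "smooth_on f U \<Longrightarrow> smooth_on g U \<Longrightarrow> smooth_on (\<lambda>x. f x + g x) U"
  by (simp add: smooth_on_def C_k_on_add)

lemma smooth_on_sum: "finite I \<Longrightarrow> (\<And>i. i \<in> I \<Longrightarrow> smooth_on (f i) U) \<Longrightarrow> smooth_on (\<lambda>x. \<Sum>i\<in>I. f i x) U"
  by (simp add: smooth_on_def C_k_on_sum)

lemma smooth_on_bilinear:
  "bounded_bilinear B \<Longrightarrow> smooth_on f U \<Longrightarrow> smooth_on g U \<Longrightarrow> smooth_on (\<lambda>x. B (f x) (g x)) U"
  by (simp add: smooth_on_def C_k_on_bilinear)

lemma smooth_on_bounded_linear_compose: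
  "bounded_linear L \<Longrightarrow> smooth_on f U \<Longrightarrow> smooth_on (\<lambda>x. L (f x)) U"
  by (simp add: smooth_on_def C_k_on_bounded_linear_compose)

lemma smooth_on_compose:
  "smooth_on f V \<Longrightarrow> smooth_on g U \<Longrightarrow> g ` U \<subseteq> V \<Longrightarrow> smooth_on (\<lambda>x. f (g x)) U"
  unfolding smooth_on_def using C_k_on_compose by blast

lemma smooth_on_imp_continuous_on: "smooth_on f U \<Longrightarrow> continuous_on U f"
  unfolding smooth_on_def by (metis C_k_on.simps(1))

lemma smooth_on_has_derivative:
  assumes "smooth_on f U" "x \<in> U"
  shows "(f has_derivative frechet_derivative f (at x)) (at x)"
proof -
  have "C_k_on (Suc 0) f U" using assms by (auto simp: smooth_on_def)
  then show ?thesis using assms(2) frechet_derivative_at by fastforce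
qed

lemma smooth_on_frechet_derivative:
  assumes "open U" "smooth_on f U"
  shows "smooth_on (\<lambda>x. frechet_derivative f (at x) v) U"
proof (rule smooth_onI)
  fix k
  have "C_k_on (Suc k) f U" using assms by (simp add: smooth_on_def)
  then obtain f' where f': "\<forall>x\<in>U. (f has_derivative f' x) (at x)" "C_k_on k (\<lambda>x. f' x v) U" by auto
  have "f' x v = frechet_derivative f (at x) v" if "x \<in> U" for x using frechet_derivative_at[of f "f' x" x] f'(1) that by simp
  from C_k_on_cong[OF assms(1) this f'(2)]
  show "C_k_on k (\<lambda>x. frechet_derivative f (at x) v) U" .
qed

text \<open>The derivative of 1/|x| is a polynomial in x and 1/|x| itself, so each order of
  differentiability yields the next.\<close>

lemma smooth_on_inverse_norm: "smooth_on (\<lambda>x::'a::euclidean_space. inverse (norm x)) (-{0})"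
proof (rule smooth_onI)
  fix k
  show "C_k_on k (\<lambda>x::'a. inverse (norm x)) (-{0})"
  proof (induction k)
    case 0
    then show ?case by (auto intro!: continuous_intros)
  next
    case (Suc k)
    let ?r = "\<lambda>x::'a. inverse (norm x)"
    have d: "\<forall>x\<in>-{0}. (?r has_derivative (\<lambda>v. (x \<bullet> v) * ((- ?r x) * (?r x * ?r x)))) (at x)"
    proof
      fix x :: 'a assume "x \<in> -{0}"
      then have x: "x \<noteq> 0" by auto
      have "(?r has_derivative (\<lambda>v. - (inverse (norm x) * (v \<bullet> sgn x) * inverse (norm x)))) (at x)"
        using x has_derivative_norm[OF x] by (intro Deriv.has_derivative_inverse) auto
      moreover have "(\<lambda>v. - (inverse (norm x) * (v \<bullet> sgn x) * inverse (norm x)))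
         = (\<lambda>v. (x \<bullet> v) * ((- ?r x) * (?r x * ?r x)))" by (auto simp: sgn_div_norm inner_commute fun_eq_iff)
      ultimately show "(?r has_derivative (\<lambda>v. (x \<bullet> v) * ((- ?r x) * (?r x * ?r x)))) (at x)" by simp
    qed
    have m: "C_k_on k (\<lambda>x. f x * g x) (-{0})"
      if "C_k_on k f (-{0})" "C_k_on k g (-{0})" for f g :: "'a \<Rightarrow> real" using C_k_on_bilinear[OF bounded_bilinear_mult that] .
    have "C_k_on k (\<lambda>x. (x \<bullet> v) * ((- ?r x) * (?r x * ?r x))) (-{0})" for v
      by (intro m Suc C_k_on_bounded_linear_compose[OF bounded_linear_inner_left C_k_on_ident]
          C_k_on_bounded_linear_compose[OF bounded_linear_minus[OF bounded_linear_ident]])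
    then show ?case unfolding C_k_on.simps using d by (intro exI[of _ "\<lambda>x v. (x \<bullet> v) * ((- ?r x) * (?r x * ?r x))"]) auto
  qed
qed

lemma smooth_on_sgn: "smooth_on (sgn :: 'a::euclidean_space \<Rightarrow> 'a) (-{0})"
proof -
  have "smooth_on (\<lambda>x::'a. inverse (norm x) *\<^sub>R x) (-{0})"
    by (intro smooth_on_bilinear[OF bounded_bilinear_scaleR] smooth_on_inverse_norm smooth_on_ident)
  then show ?thesis by (rule smooth_on_cong[rotated 2]) (auto simp: sgn_div_norm)
qed

text \<open>In finite dimension, convergence of A y on the basis is convergence in operator norm:
  with K the inverse at \<open>y0\<close>, \<eta> sums the defects of A y K from the identity over
  the basis. Where this sum is below 1/2, a Neumann-type estimate controls the inverses.\<close>

lemma inverse_family_tendsto: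
  fixes A Ai :: "'b::euclidean_space \<Rightarrow> 'a::euclidean_space \<Rightarrow> 'a"
  assumes V: "open V" "y0 \<in> V"
    and lin: "\<And>y. y \<in> V \<Longrightarrow> linear (A y)" "\<And>y. y \<in> V \<Longrightarrow> linear (Ai y)"
    and inv: "\<And>y v. y \<in> V \<Longrightarrow> A y (Ai y v) = v" "\<And>y v. y \<in> V \<Longrightarrow> Ai y (A y v) = v"
    and lim: "\<And>v. ((\<lambda>y. A y v) \<longlongrightarrow> A y0 v) (at y0)"
  obtains \<eta> where "(\<eta> \<longlongrightarrow> (0::real)) (at y0)" "\<And>y. \<eta> y \<ge> 0"
    "eventually (\<lambda>y. \<forall>w. norm (Ai y w - Ai y0 w) \<le> \<eta> y * norm w) (at y0)"
proof -
  define K where "K = Ai y0"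
  have K: "bounded_linear K" using lin(2)[OF V(2)] by (simp add: K_def linear_conv_bounded_linear)
  obtain C where C: "C > 0" "\<And>x. norm (K x) \<le> C * norm x" using bounded_linear.pos_bounded[OF K] by (auto simp: mult.commute)
  define \<eta> where "\<eta> y = (\<Sum>b\<in>Basis. norm (A y (K b) - b))" for y
  have "(\<eta> \<longlongrightarrow> (\<Sum>b\<in>Basis. norm (A y0 (K b) - b))) (at y0)"
    unfolding \<eta>_def by (intro tendsto_intros lim)
  then have \<eta>0: "(\<eta> \<longlongrightarrow> 0) (at y0)" using inv V by (simp add: K_def)
  have \<eta>nn: "\<eta> y \<ge> 0" for y unfolding \<eta>_def by (intro sum_nonneg) auto
  have \<eta>: "norm (A y (K w) - w) \<le> \<eta> y * norm w" if "y \<in> V" for y w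
  proof -
    have l: "linear (\<lambda>w. A y (K w) - w)" using lin(1)[OF that] bounded_linear.linear[OF K] by (simp add: linear_iff algebra_simps)
    have "norm (A y (K w) - w) = norm (\<Sum>b\<in>Basis. (w \<bullet> b) *\<^sub>R (A y (K b) - b))"
      using linear_sum[OF l, of "\<lambda>b. (w \<bullet> b) *\<^sub>R b" Basis] linear_cmul[OF l] by (simp add: euclidean_representation)
    also have "\<dots> \<le> (\<Sum>b\<in>Basis. norm w * norm (A y (K b) - b))"
      by (intro sum_norm_le) (auto intro!: mult_right_mono simp: Basis_le_norm)
    finally show ?thesis by (simp add: \<eta>_def sum_distrib_left mult.commute)
  qed
  have ev: "eventually (\<lambda>y. y \<in> V \<and> \<eta> y < 1/2) (at y0)"
    using V \<eta>0 by (intro eventually_conj eventually_at_in_open' order_tendstoD(2)) auto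
  have diff: "norm (Ai y w - K w) \<le> 2 * C * \<eta> y * norm w" if "y \<in> V" "\<eta> y < 1/2" for y w
  proof -
    define z where "z = A y0 (Ai y w)"
    have Kz: "K z = Ai y w" using inv V by (simp add: z_def K_def)
    have Az: "A y (K z) = w" using inv that by (simp add: Kz)
    have 1: "norm (w - z) \<le> \<eta> y * norm z" using \<eta>[OF that(1), of z] Az by simp
    also have "\<dots> \<le> 1/2 * norm z" using that by (intro mult_right_mono) auto
    finally have "norm z \<le> 2 * norm w" using norm_triangle_ineq2[of z w] by (simp add: norm_minus_commute)
    then have "\<eta> y * norm z \<le> \<eta> y * (2 * norm w)" using \<eta>nn by (intro mult_left_mono)
    then have 2: "norm (w - z) \<le> 2 * \<eta> y * norm w" using 1 by simp
    have "norm (Ai y w - K w) = norm (K (z - w))" using bounded_linear.linear[OF K] by (simp add: Kz linear_diff)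
    also have "\<dots> \<le> C * norm (z - w)" using C by simp
    also have "\<dots> \<le> C * (2 * \<eta> y * norm w)" using 2 C(1) by (intro mult_left_mono) (auto simp: norm_minus_commute)
    finally show ?thesis by (simp add: mult_ac)
  qed
  show ?thesis
  proof
    have "((\<lambda>y. 2 * C * \<eta> y) \<longlongrightarrow> 2 * C * 0) (at y0)" by (intro tendsto_intros \<eta>0)
    then show "((\<lambda>y. 2 * C * \<eta> y) \<longlongrightarrow> 0) (at y0)" by simp
    show "2 * C * \<eta> y \<ge> 0" for y using C \<eta>nn by simp
    show "\<forall>\<^sub>F y in at y0. \<forall>w. norm (Ai y w - Ai y0 w) \<le> 2 * C * \<eta> y * norm w"
      using ev by eventually_elim (use diff in \<open>simp add: K_def\<close>)
  qed
qed

text \<open>With K the inverse at \<open>y0\<close> and u y = (A y - A y0) (K v), the increment of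
  the inverse is - K (u y) minus (Ai y - K) (u y). The first part is differentiable; the second is
  an operator tending to 0 applied to a vector of order |y - y0|, so its derivative
  vanishes.\<close>

lemma has_derivative_inverse_family:
  fixes A Ai :: "'b::euclidean_space \<Rightarrow> 'a::euclidean_space \<Rightarrow> 'a"
  assumes V: "open V" "y0 \<in> V"
    and lin: "\<And>y. y \<in> V \<Longrightarrow> linear (A y)" "\<And>y. y \<in> V \<Longrightarrow> linear (Ai y)"
    and inv: "\<And>y v. y \<in> V \<Longrightarrow> A y (Ai y v) = v" "\<And>y v. y \<in> V \<Longrightarrow> Ai y (A y v) = v"
    and d: "\<And>v. ((\<lambda>y. A y v) has_derivative A' v) (at y0)"
  shows "((\<lambda>y. Ai y v) has_derivative (\<lambda>h. - Ai y0 (A' (Ai y0 v) h))) (at y0)"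
proof -
  define K where "K = Ai y0"
  have K: "bounded_linear K" using lin(2)[OF V(2)] by (simp add: K_def linear_conv_bounded_linear)
  have lim: "((\<lambda>y. A y v) \<longlongrightarrow> A y0 v) (at y0)" for v
    using has_derivative_continuous[OF d[of v]] by (simp add: isCont_def)
  obtain \<eta> where \<eta>0: "(\<eta> \<longlongrightarrow> 0) (at y0)"
    and \<eta>nn: "\<And>y. \<eta> y \<ge> 0" and "eventually (\<lambda>y. \<forall>w. norm (Ai y w - Ai y0 w) \<le> \<eta> y * norm w) (at y0)"
    by (rule inverse_family_tendsto[OF V lin inv lim]; (assumption | rule that))
  then have ev: "eventually (\<lambda>y. \<forall>w. norm (Ai y w - K w) \<le> \<eta> y * norm w) (at y0)" by (simp add: K_def)
  define u where "u y = A y (K v) - A y0 (K v)" for y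
  have du: "(u has_derivative A' (K v)) (at y0)" unfolding u_def using d[of "K v"] by (auto intro!: derivative_eq_intros)
  have du': "((\<lambda>y. - K (u y)) has_derivative (\<lambda>h. - K (A' (K v) h))) (at y0)"
    using bounded_linear.has_derivative[OF K du] has_derivative_minus by blast
  have eq: "Ai y v - K v = - K (u y) - (Ai y (u y) - K (u y))" if "y \<in> V" for y
  proof -
    have "Ai y (u y) = K v - Ai y v" using inv that V lin(2)[OF that] by (simp add: u_def linear_diff K_def)
    then show ?thesis by simp
  qed
  obtain B where B: "eventually (\<lambda>y. norm (u y) \<le> B * norm (y - y0)) (at y0)"
  proof -
    have bl: "bounded_linear (A' (K v))" using du has_derivative_bounded_linear by blast
    then obtain M where M: "\<And>x. norm (A' (K v) x) \<le> M * norm x" using bounded_linear.bounded by (metis mult.commute)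
    have "((\<lambda>y. norm (u y - u y0 - A' (K v) (y - y0)) / norm (y - y0)) \<longlongrightarrow> 0) (at y0)"
      using du unfolding has_derivative_iff_norm by simp
    then have "eventually (\<lambda>y. norm (u y - u y0 - A' (K v) (y - y0)) / norm (y - y0) < 1) (at y0)" by (rule order_tendstoD) auto
    then have "eventually (\<lambda>y. norm (u y) \<le> (M + 1) * norm (y - y0)) (at y0)"
      using eventually_at_in_open'[OF open_UNIV UNIV_I] eventually_neq_at_within[of y0 y0 UNIV]
    proof eventually_elim
      case (elim y)
      then have "norm (u y - A' (K v) (y - y0)) < norm (y - y0)" by (simp add: u_def field_simps)
      then show ?case using M[of "y - y0"] norm_triangle_ineq2[of "u y" "A' (K v) (y - y0)"] by (simp add: algebra_simps)
    qed
    then show ?thesis using that by blast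
  qed
  have "((\<lambda>y. - (Ai y (u y) - K (u y))) has_derivative (\<lambda>h. 0)) (at y0)" unfolding has_derivative_iff_norm
  proof (intro conjI)
    have lim: "((\<lambda>y. \<eta> y * B) \<longlongrightarrow> 0 * B) (at y0)" by (intro tendsto_intros \<eta>0)
    have u0: "u y0 = 0" by (simp add: u_def)
    show "((\<lambda>y. norm (- (Ai y (u y) - K (u y)) - - (Ai y0 (u y0) - K (u y0)) - 0) / norm (y - y0)) \<longlongrightarrow> 0) (at y0)"
    proof (rule tendsto_sandwich[OF _ _ tendsto_const])
      show "((\<lambda>y. \<eta> y * B) \<longlongrightarrow> 0) (at y0)" using lim by simp
      show "\<forall>\<^sub>F y in at y0. norm (- (Ai y (u y) - K (u y)) - - (Ai y0 (u y0) - K (u y0)) - 0) / norm (y - y0) \<le> \<eta> y * B"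
        using ev B eventually_neq_at_within[of y0 y0 UNIV]
      proof eventually_elim
        case (elim y)
        have "norm (Ai y (u y) - K (u y)) \<le> \<eta> y * norm (u y)" using elim by blast
        also have "\<dots> \<le> \<eta> y * (B * norm (y - y0))" using elim \<eta>nn by (intro mult_left_mono) auto
        finally show ?case using elim by (simp add: u0 K_def norm_minus_commute field_simps)
      qed
    qed (auto simp: divide_nonneg_nonneg)
  qed auto
  from has_derivative_add[OF has_derivative_const[of "K v"] has_derivative_add[OF du' this]]
  have "((\<lambda>y. K v + (- K (u y) + - (Ai y (u y) - K (u y)))) has_derivative (\<lambda>h. - K (A' (K v) h))) (at y0)" by simp
  then have "((\<lambda>y. Ai y v) has_derivative (\<lambda>h. - K (A' (K v) h))) (at y0)"
    by (rule has_derivative_transform_within_open[OF _ V]) (use eq in \<open>force simp: algebra_simps\<close>)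
  then show ?thesis by (simp add: K_def)
qed

text \<open>The derivative - Ai A' Ai is an expression in the derivative of A and the inverse
  itself, so the regularity of the inverse bootstraps up to that of A. Basis expansions remove the
  moving arguments, as in the chain rule.\<close>

lemma C_k_on_inverse_family:
  fixes A Ai :: "'b::euclidean_space \<Rightarrow> 'a::euclidean_space \<Rightarrow> 'a"
  assumes V: "open V"
    and lin: "\<And>y. y \<in> V \<Longrightarrow> linear (A y)" "\<And>y. y \<in> V \<Longrightarrow> linear (Ai y)"
    and inv: "\<And>y v. y \<in> V \<Longrightarrow> A y (Ai y v) = v" "\<And>y v. y \<in> V \<Longrightarrow> Ai y (A y v) = v"
    and C: "\<And>v. C_k_on (Suc k) (\<lambda>y. A y v) V"
  shows "C_k_on (Suc k) (\<lambda>y. Ai y v) V"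
  using C
proof (induction k arbitrary: v)
  case k: 0
  have "\<exists>A'. (\<forall>y\<in>V. ((\<lambda>y. A y v) has_derivative A' y) (at y)) \<and> (\<forall>h. continuous_on V (\<lambda>y. A' y h))" for v
    using k by simp
  then obtain A' where A': "\<And>v y. y \<in> V \<Longrightarrow> ((\<lambda>y. A y v) has_derivative A' v y) (at y)"
    "\<And>v h. continuous_on V (\<lambda>y. A' v y h)" by metis
  have d: "((\<lambda>y. Ai y v) has_derivative (\<lambda>h. - Ai y (A' (Ai y v) y h))) (at y)" if "y \<in> V" for y v
    using has_derivative_inverse_family[OF V that lin inv A'(1)[OF that]] by blast
  have c: "continuous_on V (\<lambda>y. Ai y v)" for v using d by (auto intro!: continuous_at_imp_continuous_on has_derivative_continuous)
  have exp: "Ai y (A' w y h) = (\<Sum>b\<in>Basis. (A' w y h \<bullet> b) *\<^sub>R Ai y b)" if "y \<in> V" for y w h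
    using linear_basis_expansion[OF lin(2)[OF that]] .
  have A'lin: "A' w y h = (\<Sum>b\<in>Basis. (w \<bullet> b) *\<^sub>R A' b y h)" if "y \<in> V" for y w h
  proof -
    have 1: "((\<lambda>y. \<Sum>b\<in>Basis. (w \<bullet> b) *\<^sub>R A y b) has_derivative (\<lambda>h. \<Sum>b\<in>Basis. (w \<bullet> b) *\<^sub>R A' b y h)) (at y)"
      by (intro derivative_intros A' that)
    have "((\<lambda>y. A y w) has_derivative (\<lambda>h. \<Sum>b\<in>Basis. (w \<bullet> b) *\<^sub>R A' b y h)) (at y)"
      by (rule has_derivative_transform_within_open[OF 1 V that])
        (simp add: linear_basis_expansion[OF lin(1), symmetric])
    from has_derivative_unique[OF this A'(1)[OF that]] show ?thesis by metis
  qed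
  have "continuous_on V (\<lambda>y. - (\<Sum>b\<in>Basis. ((\<Sum>b'\<in>Basis. (Ai y v \<bullet> b') *\<^sub>R A' b' y h) \<bullet> b) *\<^sub>R Ai y b))" for h
    by (intro continuous_intros c A')
  then have "continuous_on V (\<lambda>y. - Ai y (A' (Ai y v) y h))" for h using exp A'lin by (simp cong: continuous_on_cong)
  with d show ?case by (auto intro!: exI[of _ "\<lambda>y h. - Ai y (A' (Ai y v) y h)"])
next
  case (Suc k)
  have "\<exists>A'. (\<forall>y\<in>V. ((\<lambda>y. A y v) has_derivative A' y) (at y)) \<and> (\<forall>h. C_k_on (Suc k) (\<lambda>y. A' y h) V)" for v
    using Suc.prems[of v] by (subst (asm) C_k_on.simps) blast
  then obtain A' where A': "\<And>v y. y \<in> V \<Longrightarrow> ((\<lambda>y. A y v) has_derivative A' v y) (at y)"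
    "\<And>v h. C_k_on (Suc k) (\<lambda>y. A' v y h) V" by metis
  have d: "((\<lambda>y. Ai y v) has_derivative (\<lambda>h. - Ai y (A' (Ai y v) y h))) (at y)" if "y \<in> V" for y v
    using has_derivative_inverse_family[OF V that lin inv A'(1)[OF that]] by blast
  have c: "C_k_on (Suc k) (\<lambda>y. Ai y v) V" for v using Suc.IH C_k_on_Suc_D Suc.prems by blast
  have exp: "Ai y (A' w y h) = (\<Sum>b\<in>Basis. (A' w y h \<bullet> b) *\<^sub>R Ai y b)" if "y \<in> V" for y w h
    using linear_basis_expansion[OF lin(2)[OF that]] .
  have A'lin: "A' w y h = (\<Sum>b\<in>Basis. (w \<bullet> b) *\<^sub>R A' b y h)" if "y \<in> V" for y w h
  proof -
    have 1: "((\<lambda>y. \<Sum>b\<in>Basis. (w \<bullet> b) *\<^sub>R A y b) has_derivative (\<lambda>h. \<Sum>b\<in>Basis. (w \<bullet> b) *\<^sub>R A' b y h)) (at y)"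
      by (intro derivative_intros A' that)
    have "((\<lambda>y. A y w) has_derivative (\<lambda>h. \<Sum>b\<in>Basis. (w \<bullet> b) *\<^sub>R A' b y h)) (at y)"
      by (rule has_derivative_transform_within_open[OF 1 V that])
        (simp add: linear_basis_expansion[OF lin(1), symmetric])
    from has_derivative_unique[OF this A'(1)[OF that]] show ?thesis by metis
  qed
  have inn: "C_k_on (Suc k) (\<lambda>y. f y \<bullet> b) V" if "C_k_on (Suc k) f V" for f :: "'b \<Rightarrow> 'a" and b
    using C_k_on_bounded_linear_compose[OF bounded_linear_inner_left that] .
  have "C_k_on (Suc k) (\<lambda>y. - (\<Sum>b\<in>Basis. ((\<Sum>b'\<in>Basis. (Ai y v \<bullet> b') *\<^sub>R A' b' y h) \<bullet> b) *\<^sub>R Ai y b)) V" for h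
    by (intro C_k_on_bounded_linear_compose[OF bounded_linear_minus[OF bounded_linear_ident]]
       C_k_on_sum C_k_on_bilinear[OF bounded_bilinear_scaleR] inn c A' finite_Basis)
  moreover have "- (\<Sum>b\<in>Basis. ((\<Sum>b'\<in>Basis. (Ai y v \<bullet> b') *\<^sub>R A' b' y h) \<bullet> b) *\<^sub>R Ai y b)
      = - Ai y (A' (Ai y v) y h)" if "y \<in> V" for y h by (subst exp[OF that], subst A'lin[OF that, of "Ai y v"]) (rule refl)
  ultimately have "C_k_on (Suc k) (\<lambda>y. - Ai y (A' (Ai y v) y h)) V" for h by (rule C_k_on_cong[OF V, rotated])
  with d show ?case
    by (auto intro!: exI[of _ "\<lambda>y h. - Ai y (A' (Ai y v) y h)"] simp del: C_k_on.simps(2) simp: C_k_on.simps(2)[of "Suc k"])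
qed

text \<open>The derivative of \<open>g\<close> at y inverts the derivative of \<open>f\<close> at
  \<open>g y\<close>. If \<open>g\<close> is of class C^k with k > 0, so is the family to be
  inverted, hence so is \<open>g'\<close>, and \<open>g\<close> gains one order. The start,
  continuity of \<open>g'\<close>, comes from \<open>inverse_family_tendsto\<close>.\<close>

lemma smooth_on_inverse_map:
  fixes f g :: "'a::euclidean_space \<Rightarrow> 'a"
  assumes U: "open U" and V: "open V" and f: "smooth_on f U" and gV: "g ` V \<subseteq> U"
    and d: "\<And>y. y \<in> V \<Longrightarrow> (g has_derivative g' y) (at y)"
    and inv: "\<And>y v. y \<in> V \<Longrightarrow> frechet_derivative f (at (g y)) (g' y v) = v"
      "\<And>y v. y \<in> V \<Longrightarrow> g' y (frechet_derivative f (at (g y)) v) = v"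
  shows "smooth_on g V"
proof (rule smooth_onI)
  let ?f' = "\<lambda>x. frechet_derivative f (at x)"
  have lin: "linear (?f' (g y))" "linear (g' y)" if "y \<in> V" for y
    using smooth_on_has_derivative[OF f] d gV that has_derivative_linear by blast+
  have cols: "C_k_on k (\<lambda>y. ?f' (g y) v) V" if "C_k_on k g V" for k v
    using smooth_on_frechet_derivative[OF U f] C_k_on_compose[OF _ that gV] unfolding smooth_on_def by blast
  have 0: "C_k_on 0 g V" using d by (auto intro!: continuous_at_imp_continuous_on has_derivative_continuous)
  have cont: "continuous_on V (\<lambda>y. g' y v)" for v
  proof (intro continuous_at_imp_continuous_on ballI)
    fix y0 assume y0: "y0 \<in> V"
    have lim: "((\<lambda>y. ?f' (g y) v) \<longlongrightarrow> ?f' (g y0) v) (at y0)" for v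
      using cols[OF 0, of v] V y0 by (simp add: continuous_on_eq_continuous_at isCont_def)
    obtain \<eta> where \<eta>0: "(\<eta> \<longlongrightarrow> 0) (at y0)" "\<And>y. \<eta> y \<ge> 0"
      and ev: "eventually (\<lambda>y. \<forall>w. norm (g' y w - g' y0 w) \<le> \<eta> y * norm w) (at y0)"
      by (rule inverse_family_tendsto[OF V y0 lin inv lim]; (assumption | rule that))
    have "((\<lambda>y. g' y v - g' y0 v) \<longlongrightarrow> 0) (at y0)"
    proof (rule Lim_null_comparison)
      show "\<forall>\<^sub>F y in at y0. norm (g' y v - g' y0 v) \<le> \<eta> y * norm v" using ev by eventually_elim blast
      have "((\<lambda>y. \<eta> y * norm v) \<longlongrightarrow> 0 * norm v) (at y0)" by (intro tendsto_intros \<eta>0)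
      then show "((\<lambda>y. \<eta> y * norm v) \<longlongrightarrow> 0) (at y0)" by simp
    qed
    then show "isCont (\<lambda>y. g' y v) y0" using Lim_null isCont_def by metis
  qed
  fix k
  have "C_k_on (Suc k) g V"
  proof (induction k)
    case 0
    then show ?case using d cont by auto
  next
    case (Suc k)
    have "C_k_on (Suc k) (\<lambda>y. g' y v) V" for v by (rule C_k_on_inverse_family[OF V lin inv cols[OF Suc]])
    then show ?case using d by (subst C_k_on.simps) blast
  qed
  then show "C_k_on k g V" by (rule C_k_on_Suc_D)
qed

text \<open>The library's theorem for C^1 maps, stated with derivatives as bounded linear functions,
  supplies a differentiable local inverse; \<open>smooth_on_inverse_map\<close> raises it to all
  orders.\<close>

theorem smooth_inverse_function:
  fixes f :: "'a::euclidean_space \<Rightarrow> 'a"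
  assumes U: "open U" "x0 \<in> U" and f: "smooth_on f U"
    and inj: "\<And>v. frechet_derivative f (at x0) v = 0 \<Longrightarrow> v = 0"
  obtains U' V where "U' \<subseteq> U" "x0 \<in> U'" "diffeomorphism U' V f"
proof -
  let ?f' = "\<lambda>x. frechet_derivative f (at x)"
  have bl: "bounded_linear (?f' x)" if "x \<in> U" for x using smooth_on_has_derivative[OF f that] has_derivative_bounded_linear by blast
  define B where "B x = Blinfun (?f' x)" for x
  have B: "blinfun_apply (B x) = ?f' x" if "x \<in> U" for x using bl[OF that] by (simp add: B_def bounded_linear_Blinfun_apply)
  have d: "(f has_derivative blinfun_apply (B x)) (at x)" if "x \<in> U" for x using smooth_on_has_derivative[OF f that] B[OF that] by simp
  have c: "continuous_on U B"
  proof (rule continuous_on_blinfun_componentwise)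
    fix i :: 'a
    have "continuous_on U (\<lambda>x. ?f' x i)" using smooth_on_frechet_derivative[OF U(1) f] smooth_on_imp_continuous_on by blast
    then show "continuous_on U (\<lambda>x. blinfun_apply (B x) i)" using B by (simp cong: continuous_on_cong)
  qed
  have "inj (?f' x0)" using inj bl[OF U(2)] by (simp add: linear_injective_0 bounded_linear.linear)
  then obtain h where h: "linear h" "h \<circ> ?f' x0 = id" using linear_injective_left_inverse bl[OF U(2)] bounded_linear.linear by blast
  then have hl: "bounded_linear h" using linear_conv_bounded_linear by blast
  have invf: "Blinfun h o\<^sub>L B x0 = id_blinfun"
    by (rule blinfun_eqI) (use h(2) in \<open>simp add: B[OF U(2)] bounded_linear_Blinfun_apply[OF hl] o_def fun_eq_iff\<close>)
  obtain U' V g g' where 1: "open U'" "U' \<subseteq> U" "x0 \<in> U'" "open V" "f x0 \<in> V" "homeomorphism U' V f g"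
    and 2: "\<And>y. y \<in> V \<Longrightarrow> (g has_derivative (g' y)) (at y)"
      "\<And>y. y \<in> V \<Longrightarrow> g' y = inv (blinfun_apply (B (g y)))"
      "\<And>y. y \<in> V \<Longrightarrow> bij (blinfun_apply (B (g y)))" using inverse_function_theorem[OF U(1) d c U(2) invf] by metis
  have gV: "g ` V = U'" "f ` U' = V" "\<And>x. x \<in> U' \<Longrightarrow> g (f x) = x" "\<And>y. y \<in> V \<Longrightarrow> f (g y) = y"
    using 1(6) by (auto simp: homeomorphism_def)
  have Bg: "blinfun_apply (B (g y)) = ?f' (g y)" if "y \<in> V" for y using gV(1) 1(2) that by (intro B) auto
  have "smooth_on g V"
  proof (rule smooth_on_inverse_map[OF U(1) 1(4) f _ 2(1)])
    show "g ` V \<subseteq> U" using gV 1 by blast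
    show "?f' (g y) (g' y v) = v" "g' y (?f' (g y) v) = v" if "y \<in> V" for y v
      using 2(2,3)[OF that] Bg[OF that] by (auto simp: bij_is_surj surj_f_inv_f bij_is_inj inv_f_f)
  qed
  then have "diffeomorphism U' V f" unfolding diffeomorphism_def using 1 gV smooth_on_subset[OF f 1(2)] by blast
  then show ?thesis using that 1 by blast
qed

section \<open>The Brunn--Minkowski inequality\<close>

text \<open>As c varies, the indicator functions converge off the limiting hyperplane, which is a
  null set; dominated convergence applies.\<close>

lemma halfspace_measure_continuous:
  fixes u :: "'a::euclidean_space"
  assumes A: "A \<in> lmeasurable" and u: "u \<noteq> 0"
  shows "continuous_on UNIV (\<lambda>c. vol (A \<inter> {x. x \<bullet> u \<le> c}))"
proof (intro continuous_at_imp_continuous_on ballI)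
  fix c :: real
  have H[measurable]: "{x. x \<bullet> u \<le> c} \<in> sets lebesgue" for c
    by (simp add: closed_halfspace_le inner_commute[of _ u] lborelD)
  have A[measurable]: "A \<in> sets lebesgue" using A by (rule fmeasurableD)
  show "isCont (\<lambda>c. vol (A \<inter> {x. x \<bullet> u \<le> c})) c" unfolding continuous_at_sequentially
  proof (intro allI impI)
    fix s :: "nat \<Rightarrow> real" assume s: "s \<longlonglongrightarrow> c"
    have int: "integral\<^sup>L lebesgue (indicator (A \<inter> {x. x \<bullet> u \<le> c})) = vol (A \<inter> {x. x \<bullet> u \<le> c})" for c
      by simp
    have ae: "AE x in lebesgue. x \<bullet> u \<noteq> c"
    proof -
      have "negligible {x. x \<bullet> u = c}" using negligible_hyperplane[of u c] u by (simp add: inner_commute)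
      then have "{x. x \<bullet> u = c} \<in> null_sets lebesgue" by (simp add: negligible_iff_null_sets)
      then show ?thesis by (rule AE_I') auto
    qed
    have "(\<lambda>k. integral\<^sup>L lebesgue (indicator (A \<inter> {x. x \<bullet> u \<le> s k}) :: 'a \<Rightarrow> real))
      \<longlonglongrightarrow> integral\<^sup>L lebesgue (indicator (A \<inter> {x. x \<bullet> u \<le> c}))"
    proof (rule integral_dominated_convergence[where w = "indicator A"])
      show "integrable lebesgue (indicator A :: 'a \<Rightarrow> real)" using assms(1) by (simp add: fmeasurable_def)
      show "AE x in lebesgue. (\<lambda>k. indicator (A \<inter> {x. x \<bullet> u \<le> s k}) x :: real)
          \<longlonglongrightarrow> indicator (A \<inter> {x. x \<bullet> u \<le> c}) x" using ae
      proof eventually_elim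
        case (elim x)
        have "eventually (\<lambda>k. (x \<bullet> u \<le> s k) = (x \<bullet> u \<le> c)) sequentially"
        proof (cases "x \<bullet> u < c")
          case True
          then have "eventually (\<lambda>k. x \<bullet> u < s k) sequentially" using s order_tendstoD by blast
          then show ?thesis by eventually_elim (use True in auto)
        next
          case False
          then have "x \<bullet> u > c" using elim by auto
          then have "eventually (\<lambda>k. x \<bullet> u > s k) sequentially" using s order_tendstoD by blast
          then show ?thesis by eventually_elim (use False elim in auto)
        qed
        then have "eventually (\<lambda>k. indicator (A \<inter> {x. x \<bullet> u \<le> s k}) x = (indicator (A \<inter> {x. x \<bullet> u \<le> c}) x :: real)) sequentially"
          by eventually_elim (auto simp: indicator_def)
        then show ?case by (rule tendsto_eventually)
      qed
    qed (auto simp: indicator_def)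
    then show "((\<lambda>c. vol (A \<inter> {x. x \<bullet> u \<le> c})) \<circ> s) \<longlonglongrightarrow> vol (A \<inter> {x. x \<bullet> u \<le> c})"
      by (simp add: int o_def)
  qed
qed

lemma halfspace_measure_IVT:
  fixes u :: "'a::euclidean_space"
  assumes A: "A \<in> lmeasurable" "bounded A" and u: "u \<noteq> 0" and t: "0 \<le> t" "t \<le> 1"
  obtains c where "vol (A \<inter> {x. x \<bullet> u \<le> c}) = t * vol A"
proof -
  obtain B where B: "\<And>x. x \<in> A \<Longrightarrow> norm x \<le> B" using A(2) bounded_iff by blast
  define L where "L = \<bar>B\<bar> * norm u + 1"
  have L: "\<bar>x \<bullet> u\<bar> < L" if "x \<in> A" for x
  proof -
    have "\<bar>x \<bullet> u\<bar> \<le> norm x * norm u" by (rule Cauchy_Schwarz_ineq2)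
    also have "\<dots> \<le> \<bar>B\<bar> * norm u" using B[OF that] by (intro mult_right_mono) auto
    finally show ?thesis by (simp add: L_def)
  qed
  have 1: "A \<inter> {x. x \<bullet> u \<le> -L} = {}" using L by fastforce
  have 2: "A \<inter> {x. x \<bullet> u \<le> L} = A" using L by fastforce
  have "\<exists>c. -L \<le> c \<and> c \<le> L \<and> vol (A \<inter> {x. x \<bullet> u \<le> c}) = t * vol A"
  proof (rule IVT')
    show "continuous_on {-L..L} (\<lambda>c. vol (A \<inter> {x. x \<bullet> u \<le> c}))"
      using halfspace_measure_continuous[OF A(1) u] continuous_on_subset by blast
    show "vol (A \<inter> {x. x \<bullet> u \<le> -L}) \<le> t * vol A" using 1 t by simp
    show "t * vol A \<le> vol (A \<inter> {x. x \<bullet> u \<le> L})" using 2 t by (simp add: mult_left_le_one_le)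
    show "- L \<le> L" unfolding L_def by (simp add: add_nonneg_nonneg)
  qed
  then show ?thesis using that by blast
qed

definition minkowski_sum :: "'a::euclidean_space set \<Rightarrow> 'a set \<Rightarrow> 'a set" where
  "minkowski_sum A B = {x + y | x y. x \<in> A \<and> y \<in> B}"

lemma minkowski_sum_commute: "minkowski_sum A B = minkowski_sum B A"
  unfolding minkowski_sum_def by (auto; metis add.commute)

lemma open_minkowski_sum: "open A \<Longrightarrow> open (minkowski_sum A B)"
proof -
  have "minkowski_sum A B = (\<Union>x\<in>A. \<Union>y\<in>B. {x + y})" by (auto simp: minkowski_sum_def)
  then show "open A \<Longrightarrow> ?thesis" using open_sums[of A B] by simp
qed

lemma compact_minkowski_sum: "compact A \<Longrightarrow> compact B \<Longrightarrow> compact (minkowski_sum A B)"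
  unfolding minkowski_sum_def by (rule compact_sums)

lemma bounded_minkowski_sum: "bounded A \<Longrightarrow> bounded B \<Longrightarrow> bounded (minkowski_sum A B)"
  unfolding minkowski_sum_def using bounded_sums[of A B] by (rule bounded_subset) auto

lemma minkowski_sum_halfspaces:
  "minkowski_sum (A \<inter> {x. x \<bullet> u < s}) (B \<inter> {x. x \<bullet> u < t}) \<subseteq> minkowski_sum A B \<inter> {x. x \<bullet> u < s + t}"
  "minkowski_sum (A \<inter> {x. x \<bullet> u > s}) (B \<inter> {x. x \<bullet> u > t}) \<subseteq> minkowski_sum A B \<inter> {x. x \<bullet> u > s + t}"
  unfolding minkowski_sum_def by (auto simp: inner_add_left)

text \<open>Each coordinate of z divides its interval in some ratio t i; the summands are the points
  that divide the sides of the two given boxes in the same ratios.\<close>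

lemma box_sum_subset:
  fixes a b c d :: "'a::euclidean_space"
  assumes "box a b \<noteq> {}" "box c d \<noteq> {}"
  shows "box (a + c) (b + d) \<subseteq> minkowski_sum (box a b) (box c d)"
proof
  fix z assume z: "z \<in> box (a + c) (b + d)"
  have ab: "a \<bullet> i < b \<bullet> i" "c \<bullet> i < d \<bullet> i" if "i \<in> Basis" for i
    using assms that by (auto simp: box_ne_empty)
  define t where "t i = (z \<bullet> i - a \<bullet> i - c \<bullet> i) / (b \<bullet> i + d \<bullet> i - a \<bullet> i - c \<bullet> i)" for i
  have t: "0 < t i" "t i < 1" if "i \<in> Basis" for i using z ab[OF that] that by (auto simp: t_def mem_box inner_add_left field_simps)
  define x where "x = (\<Sum>i\<in>Basis. (a \<bullet> i + t i * (b \<bullet> i - a \<bullet> i)) *\<^sub>R i)"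
  define y where "y = (\<Sum>i\<in>Basis. (c \<bullet> i + t i * (d \<bullet> i - c \<bullet> i)) *\<^sub>R i)"
  have lt: "p < p + s * (q - p) \<and> p + s * (q - p) < q" if "0 < s" "s < 1" "p < q" for p q s :: real
  proof -
    have "0 < s * (q - p)" "s * (q - p) < 1 * (q - p)" using that by (auto intro!: mult_strict_right_mono)
    then show ?thesis by simp
  qed
  have "x \<in> box a b" "y \<in> box c d" using ab t lt by (auto simp: x_def y_def mem_box)
  moreover have "z = x + y"
  proof (rule euclidean_eqI)
    fix i :: 'a assume i: "i \<in> Basis"
    have "t i * (b \<bullet> i + d \<bullet> i - a \<bullet> i - c \<bullet> i) = z \<bullet> i - a \<bullet> i - c \<bullet> i"
      using ab[OF i] by (simp add: t_def)
    moreover have "x \<bullet> i = a \<bullet> i + t i * (b \<bullet> i - a \<bullet> i)" "y \<bullet> i = c \<bullet> i + t i * (d \<bullet> i - c \<bullet> i)"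
      using i by (simp_all add: x_def y_def)
    ultimately show "z \<bullet> i = (x + y) \<bullet> i" by (simp add: inner_add_left algebra_simps)
  qed
  ultimately show "z \<in> minkowski_sum (box a b) (box c d)" by (auto simp: minkowski_sum_def)
qed

text \<open>The arithmetic-geometric mean inequality is applied to the ratios a i / (a i + b i) and
  to b i / (a i + b i); the two arithmetic means add up to 1. This is Brunn--Minkowski for two boxes
  with side lengths a and b.\<close>

lemma root_prod_add_le:
  fixes a b :: "'i \<Rightarrow> real"
  assumes fin: "finite I" "I \<noteq> {}" and a: "\<And>i. i \<in> I \<Longrightarrow> a i > 0" and b: "\<And>i. i \<in> I \<Longrightarrow> b i > 0"
  shows "root (card I) (\<Prod>i\<in>I. a i) + root (card I) (\<Prod>i\<in>I. b i) \<le> root (card I) (\<Prod>i\<in>I. a i + b i)"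
proof -
  let ?n = "card I"
  have n: "?n > 0" using fin by (simp add: card_gt_0_iff)
  define P where "P = (\<Prod>i\<in>I. a i + b i)"
  have ab: "a i + b i > 0" if "i \<in> I" for i using a[OF that] b[OF that] by simp
  have P: "P > 0" unfolding P_def by (intro prod_pos) (use ab in auto)
  have gm: "root ?n (\<Prod>i\<in>I. x i) \<le> (\<Sum>i\<in>I. x i / ?n)" if "\<And>i. i \<in> I \<Longrightarrow> x i \<ge> 0" for x :: "'i \<Rightarrow> real"
    using arith_geom_mean[OF fin that] n prod_nonneg[of I x] that by (simp add: root_powr_inverse)
  have "root ?n (\<Prod>i\<in>I. a i) / root ?n P + root ?n (\<Prod>i\<in>I. b i) / root ?n P
      = root ?n (\<Prod>i\<in>I. a i / (a i + b i)) + root ?n (\<Prod>i\<in>I. b i / (a i + b i))"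
    by (simp add: P_def prod_dividef real_root_divide)
  also have "\<dots> \<le> (\<Sum>i\<in>I. (a i / (a i + b i)) / ?n) + (\<Sum>i\<in>I. (b i / (a i + b i)) / ?n)"
    using a b ab by (intro add_mono gm) (auto intro!: divide_nonneg_pos less_imp_le)
  also have "\<dots> = (\<Sum>i\<in>I. 1 / ?n)" unfolding sum.distrib[symmetric]
  proof (rule sum.cong)
    fix i assume "i \<in> I"
    then have "a i + b i \<noteq> 0" using ab[of i] by simp
    then show "a i / (a i + b i) / real ?n + b i / (a i + b i) / real ?n = 1 / real ?n" by (simp add: add_divide_distrib[symmetric])
  qed simp
  also have "\<dots> = 1" using n by simp
  finally have "(root ?n (\<Prod>i\<in>I. a i) + root ?n (\<Prod>i\<in>I. b i)) / root ?n P \<le> 1" by (simp add: add_divide_distrib)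
  then show ?thesis using n P by (simp add: P_def[symmetric] divide_le_eq)
qed

section \<open>Brunn--Minkowski for finite unions of boxes\<close>

definition box_family :: "'a::euclidean_space set set \<Rightarrow> bool" where
  "box_family \<A> \<longleftrightarrow> finite \<A> \<and> \<A> \<noteq> {} \<and> (\<forall>X\<in>\<A>. X \<noteq> {} \<and> (\<exists>a b. X = box a b)) \<and> disjoint \<A>"

lemma box_Int_halfspaces:
  fixes i :: "'a::euclidean_space"
  assumes "i \<in> Basis"
  shows "\<exists>c d. box a b \<inter> {x. x \<bullet> i < t} = box c d" "\<exists>c d. box a b \<inter> {x. x \<bullet> i > t} = box c d"
proof -
  have "box a b \<inter> {x. x \<bullet> i < t} = box a (\<Sum>j\<in>Basis. (if j = i then min (b \<bullet> i) t else b \<bullet> j) *\<^sub>R j)"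
    using assms by (auto simp: mem_box split: if_splits)
  then show "\<exists>c d. box a b \<inter> {x. x \<bullet> i < t} = box c d" by blast
  have "box a b \<inter> {x. x \<bullet> i > t} = box (\<Sum>j\<in>Basis. (if j = i then max (a \<bullet> i) t else a \<bullet> j) *\<^sub>R j) b"
    using assms by (auto simp: mem_box split: if_splits)
  then show "\<exists>c d. box a b \<inter> {x. x \<bullet> i > t} = box c d" by blast
qed

lemma box_family_open: "box_family \<A> \<Longrightarrow> open (\<Union>\<A>)"
  unfolding box_family_def by (metis open_Union open_box)

lemma box_family_bounded: "box_family \<A> \<Longrightarrow> bounded (\<Union>\<A>)"
  unfolding box_family_def by (metis bounded_Union bounded_box)

lemma lmeasurable_open_bounded: "open S \<Longrightarrow> bounded S \<Longrightarrow> S \<in> lmeasurable"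
  by (rule lmeasurable_open[OF _ _]) auto

lemma open_measure_pos:
  assumes "open S" "bounded S" "S \<noteq> {}"
  shows "vol S > 0"
proof -
  have "S \<in> lmeasurable" using assms lmeasurable_open_bounded by blast
  then show ?thesis using open_not_negligible[OF assms(1,3)] negligible_iff_measure[of S] by (metis measure_nonneg less_eq_real_def)
qed

text \<open>The strict decrease in the last claim, when some box lies on the other side of the cut,
  drives the induction in \<open>brunn_minkowski_boxes\<close>.\<close>

lemma box_family_split:
  fixes i :: "'a::euclidean_space"
  assumes A: "box_family \<A>" and i: "i \<in> Basis"
    and P: "P = (\<lambda>x. x < (t::real)) \<or> P = (\<lambda>x. x > t)"
    and ne: "\<Union>\<A> \<inter> {x. P (x \<bullet> i)} \<noteq> {}"
  defines "\<B> \<equiv> (\<lambda>X. X \<inter> {x. P (x \<bullet> i)}) ` {X \<in> \<A>. X \<inter> {x. P (x \<bullet> i)} \<noteq> {}}"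
  shows "box_family \<B>" "\<Union>\<B> = \<Union>\<A> \<inter> {x. P (x \<bullet> i)}" "card \<B> \<le> card \<A>"
    "Y \<in> \<A> \<Longrightarrow> Y \<inter> {x. P (x \<bullet> i)} = {} \<Longrightarrow> card \<B> < card \<A>"
proof -
  have fin: "finite \<A>" using A by (simp add: box_family_def)
  have bx: "\<exists>c d. X \<inter> {x. P (x \<bullet> i)} = box c d" if "X \<in> \<A>" for X
  proof -
    have "\<exists>a b. X = box a b" using A that by (simp add: box_family_def)
    then obtain a b where X: "X = box a b" by blast
    from P show ?thesis using box_Int_halfspaces[OF i, of a b t] by (elim disjE) (simp_all add: X)
  qed
  have "disjoint \<B>"
  proof (rule pairwiseI)
    fix X Y assume "X \<in> \<B>" "Y \<in> \<B>" "X \<noteq> Y"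
    then obtain X' Y' where XY: "X' \<in> \<A>" "Y' \<in> \<A>" "X' \<noteq> Y'" "X \<subseteq> X'" "Y \<subseteq> Y'"
      unfolding \<B>_def by auto
    then have "disjnt X' Y'" using A by (simp add: box_family_def pairwise_def)
    then show "disjnt X Y" using XY(4,5) disjnt_subset1 disjnt_subset2 by metis
  qed
  moreover have "\<B> \<noteq> {}" using ne by (auto simp: \<B>_def)
  moreover have "\<forall>X\<in>\<B>. X \<noteq> {} \<and> (\<exists>a b. X = box a b)" using bx by (simp add: \<B>_def)
  moreover have "finite \<B>" using fin by (simp add: \<B>_def)
  ultimately show "box_family \<B>" unfolding box_family_def by (intro conjI)
  show "\<Union>\<B> = \<Union>\<A> \<inter> {x. P (x \<bullet> i)}" by (auto simp: \<B>_def)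
  have 1: "card \<B> \<le> card {X \<in> \<A>. X \<inter> {x. P (x \<bullet> i)} \<noteq> {}}"
    unfolding \<B>_def using fin by (intro card_image_le) auto
  also have "\<dots> \<le> card \<A>" using fin by (intro card_mono) auto
  finally show "card \<B> \<le> card \<A>" .
  assume Y: "Y \<in> \<A>" "Y \<inter> {x. P (x \<bullet> i)} = {}"
  then have "card {X \<in> \<A>. X \<inter> {x. P (x \<bullet> i)} \<noteq> {}} < card \<A>" using fin by (intro psubset_card_mono) auto
  with 1 show "card \<B> < card \<A>" by simp
qed

lemma measure_halfspace_split:
  fixes u :: "'a::euclidean_space"
  assumes A: "A \<in> lmeasurable" and u: "u \<noteq> 0"
  shows "vol (A \<inter> {x. x \<bullet> u < t}) = vol (A \<inter> {x. x \<bullet> u \<le> t})"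
    "vol (A \<inter> {x. x \<bullet> u > t}) = vol A - vol (A \<inter> {x. x \<bullet> u \<le> t})"
    "vol (A \<inter> {x. x \<bullet> u \<ge> t}) = vol A - vol (A \<inter> {x. x \<bullet> u \<le> t})"
proof -
  have H: "{x. x \<bullet> u \<le> t} \<in> sets lebesgue" "{x. x \<bullet> u \<ge> t} \<in> sets lebesgue"
    using closed_halfspace_le[of u t] closed_halfspace_ge[of t u] by (auto simp: inner_commute[of _ u] intro: lborelD)
  have neg: "negligible {x. x \<bullet> u = t}" using negligible_hyperplane[of u t] u by (simp add: inner_commute)
  have m: "A \<inter> {x. x \<bullet> u \<le> t} \<in> lmeasurable" "A \<inter> {x. x \<bullet> u \<ge> t} \<in> lmeasurable"
    using fmeasurable_Int_fmeasurable[OF A] H by auto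
  show "vol (A \<inter> {x. x \<bullet> u < t}) = vol (A \<inter> {x. x \<bullet> u \<le> t})"
    by (rule measure_negligible_symdiff[OF m(1)]) (rule negligible_subset[OF neg], auto)
  have eq: "A \<inter> {x. x \<bullet> u > t} = A - (A \<inter> {x. x \<bullet> u \<le> t})" by auto
  show 2: "vol (A \<inter> {x. x \<bullet> u > t}) = vol A - vol (A \<inter> {x. x \<bullet> u \<le> t})"
    unfolding eq by (rule measurable_measure_Diff[OF A]) (use m in \<open>auto dest: fmeasurableD\<close>)
  have "vol (A \<inter> {x. x \<bullet> u > t}) = vol (A \<inter> {x. x \<bullet> u \<ge> t})"
    by (rule measure_negligible_symdiff[OF m(2)]) (rule negligible_subset[OF neg], auto)
  then show "vol (A \<inter> {x. x \<bullet> u \<ge> t}) = vol A - vol (A \<inter> {x. x \<bullet> u \<le> t})" using 2 by simp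
qed

text \<open>The argument of Hadwiger and Ohmann, by induction on the total number of boxes. Two
  disjoint boxes of one family are separated by a coordinate hyperplane, and the other family is cut
  by a parallel hyperplane in the same volume ratio. Each pair of halves has fewer boxes, and the
  two sums of halves lie on opposite sides of a hyperplane, so their volumes add.\<close>

lemma brunn_minkowski_boxes:
  fixes \<A> \<B> :: "'a::euclidean_space set set"
  assumes "box_family \<A>" "box_family \<B>"
  shows "root DIM('a) (vol (\<Union>\<A>)) + root DIM('a) (vol (\<Union>\<B>))
    \<le> root DIM('a) (vol (minkowski_sum (\<Union>\<A>) (\<Union>\<B>)))" using assms
proof (induction "card \<A> + card \<B>" arbitrary: \<A> \<B> rule: less_induct)
  case less
  let ?N = "DIM('a)" and ?m = "measure (lebesgue :: 'a measure)"
  have N: "?N > 0" by simp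
  \<comment> \<open>The induction hypothesis is a premise here because the two families have to
    exchange their roles.\<close>
  have step: "root ?N (?m (\<Union>\<A>)) + root ?N (?m (\<Union>\<B>)) \<le> root ?N (?m (minkowski_sum (\<Union>\<A>) (\<Union>\<B>)))"
    if A: "box_family \<A>" and B: "box_family \<B>" and card: "card \<A> \<ge> 2"
      and IH: "\<And>\<A>' \<B>'. card \<A>' < card \<A> \<Longrightarrow> card \<B>' \<le> card \<B> \<Longrightarrow> box_family \<A>' \<Longrightarrow> box_family \<B>' \<Longrightarrow>
        root ?N (?m (\<Union>\<A>')) + root ?N (?m (\<Union>\<B>')) \<le> root ?N (?m (minkowski_sum (\<Union>\<A>') (\<Union>\<B>')))"
    for \<A> \<B> :: "'a set set"
  proof -
    obtain X Y where XY: "X \<in> \<A>" "Y \<in> \<A>" "X \<noteq> Y"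
      using card by (metis One_nat_def Suc_1 card_le_Suc0_iff_eq not_less_eq_eq box_family_def A)
    then have disj: "X \<inter> Y = {}" using A by (auto simp: box_family_def pairwise_def disjnt_def)
    obtain a b c d where bx: "X = box a b" "Y = box c d" "X \<noteq> {}" "Y \<noteq> {}" using XY A unfolding box_family_def by metis
    have "\<exists>i\<in>Basis. b \<bullet> i \<le> c \<bullet> i \<or> d \<bullet> i \<le> a \<bullet> i"
      using disj bx by (auto simp: disjoint_interval box_ne_empty box_eq_empty)
    then obtain i t X Y where i: "i \<in> Basis" and XY: "X \<in> \<A>" "Y \<in> \<A>" "X \<noteq> {}" "Y \<noteq> {}"
      "X \<subseteq> {x. x \<bullet> i < t}" "Y \<subseteq> {x. x \<bullet> i > t}"
    proof (elim bexE disjE)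
      fix i :: 'a assume i: "i \<in> Basis" "b \<bullet> i \<le> c \<bullet> i"
      have "X \<subseteq> {x. x \<bullet> i < b \<bullet> i}" "Y \<subseteq> {x. x \<bullet> i > b \<bullet> i}"
        using i by (auto simp: bx mem_box) force
      then show thesis using that[OF i(1) XY(1,2) bx(3,4)] by blast
    next
      fix i :: 'a assume i: "i \<in> Basis" "d \<bullet> i \<le> a \<bullet> i"
      have "Y \<subseteq> {x. x \<bullet> i < d \<bullet> i}" "X \<subseteq> {x. x \<bullet> i > d \<bullet> i}"
        using i by (auto simp: bx mem_box) force
      then show thesis using that[OF i(1) XY(2,1) bx(4,3)] by blast
    qed
    have i0: "i \<noteq> 0" using i nonzero_Basis by blast
    let ?A = "\<Union>\<A>" and ?B = "\<Union>\<B>"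
    have mA: "?A \<in> lmeasurable" and mB: "?B \<in> lmeasurable"
      using A B box_family_open box_family_bounded lmeasurable_open_bounded by blast+
    have oA: "open ?A" "bounded ?A" and oB: "open ?B" "bounded ?B" using A B box_family_open box_family_bounded by blast+
    have posA: "?m ?A > 0" and posB: "?m ?B > 0" using A B by (auto intro!: open_measure_pos oA oB simp: box_family_def)
    define l where "l = ?m (?A \<inter> {x. x \<bullet> i \<le> t}) / ?m ?A"
    have A1: "?m (?A \<inter> {x. x \<bullet> i < t}) = l * ?m ?A" and A2: "?m (?A \<inter> {x. x \<bullet> i > t}) = (1 - l) * ?m ?A"
      using measure_halfspace_split[OF mA i0, of t] posA by (simp_all add: l_def algebra_simps)
    have op: "open {x. x \<bullet> i < t}" "open {x. x \<bullet> i > t}" for t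
      using open_halfspace_lt[of i t] open_halfspace_gt[of t i] by (simp_all add: inner_commute)
    have "?m (?A \<inter> {x. x \<bullet> i < t}) > 0" "?m (?A \<inter> {x. x \<bullet> i > t}) > 0"
      using XY op oA by (intro open_measure_pos; auto intro: bounded_subset)+
    then have l: "0 < l" "l < 1" using A1 A2 posA by (auto simp: zero_less_mult_iff)
    obtain s where s: "?m (?B \<inter> {x. x \<bullet> i \<le> s}) = l * ?m ?B" using halfspace_measure_IVT[OF mB oB(2) i0, of l] l by auto
    have B1: "?m (?B \<inter> {x. x \<bullet> i < s}) = l * ?m ?B" and B2: "?m (?B \<inter> {x. x \<bullet> i > s}) = (1 - l) * ?m ?B"
      using measure_halfspace_split[OF mB i0, of s] s by (simp_all add: algebra_simps)
    have ne: "?A \<inter> {x. x \<bullet> i < t} \<noteq> {}" "?A \<inter> {x. x \<bullet> i > t} \<noteq> {}" using XY by auto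
    have ne': "?B \<inter> {x. x \<bullet> i < s} \<noteq> {}" "?B \<inter> {x. x \<bullet> i > s} \<noteq> {}"
      using B1 B2 posB l by (metis measure_empty mult_eq_0_iff less_irrefl diff_gt_0_iff_gt)+
    have XYe: "X \<inter> {x. x \<bullet> i > t} = {}" "Y \<inter> {x. x \<bullet> i < t} = {}" using XY by force+
    have comb: "root ?N (p * ?m ?A) + root ?N (p * ?m ?B) = root ?N p * (root ?N (?m ?A) + root ?N (?m ?B))" for p
      by (simp add: real_root_mult algebra_simps)
    define R where "R = root ?N (?m ?A) + root ?N (?m ?B)"
    have Rp: "R \<ge> 0" unfolding R_def by simp
    note SA1 = box_family_split[OF A i disjI1[OF refl] ne(1)] and SB1 = box_family_split[OF B i disjI1[OF refl] ne'(1)]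
    note SA2 = box_family_split[OF A i disjI2[OF refl] ne(2)] and SB2 = box_family_split[OF B i disjI2[OF refl] ne'(2)]
    have M1: "root ?N l * R \<le> root ?N (?m (minkowski_sum (?A \<inter> {x. x \<bullet> i < t}) (?B \<inter> {x. x \<bullet> i < s})))"
      using IH[OF SA1(4)[OF XY(2) XYe(2)] SB1(3) SA1(1) SB1(1)] unfolding SA1(2) SB1(2) A1 B1 comb R_def .
    have M2: "root ?N (1 - l) * R \<le> root ?N (?m (minkowski_sum (?A \<inter> {x. x \<bullet> i > t}) (?B \<inter> {x. x \<bullet> i > s})))"
      using IH[OF SA2(4)[OF XY(1) XYe(1)] SB2(3) SA2(1) SB2(1)] unfolding SA2(2) SB2(2) A2 B2 comb R_def .
    \<comment> \<open>Taking N-th powers turns the bounds for the halves into l and 1 - l times R^N,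
      which add up to R^N.\<close>
    have pw: "p * R ^ ?N \<le> q" if "root ?N p * R \<le> root ?N q" "0 \<le> p" "0 \<le> q" for p q
    proof -
      have "(root ?N p * R) ^ ?N \<le> (root ?N q) ^ ?N" using that Rp by (intro power_mono) auto
      then show ?thesis using that by (simp add: power_mult_distrib)
    qed
    let ?M = "minkowski_sum ?A ?B"
    let ?M1 = "minkowski_sum (?A \<inter> {x. x \<bullet> i < t}) (?B \<inter> {x. x \<bullet> i < s})"
    let ?M2 = "minkowski_sum (?A \<inter> {x. x \<bullet> i > t}) (?B \<inter> {x. x \<bullet> i > s})"
    have om: "open ?M" "bounded ?M" "open ?M1" "open ?M2" by (intro open_minkowski_sum bounded_minkowski_sum open_Int oA oB op)+
    have sub: "?M1 \<subseteq> ?M \<inter> {x. x \<bullet> i < t + s}" "?M2 \<subseteq> ?M \<inter> {x. x \<bullet> i > t + s}"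
      using minkowski_sum_halfspaces by blast+
    have lm: "?M \<in> lmeasurable" "?M1 \<in> lmeasurable" "?M2 \<in> lmeasurable"
      by (intro lmeasurable_open_bounded om bounded_subset[OF om(2) order_trans[OF sub(1)]]
          bounded_subset[OF om(2) order_trans[OF sub(2)]]; blast)+
    have "R ^ ?N = l * R ^ ?N + (1 - l) * R ^ ?N" by (simp add: algebra_simps)
    also have "\<dots> \<le> ?m ?M1 + ?m ?M2" using pw[OF M1] pw[OF M2] l by (intro add_mono) auto
    also have "\<dots> = ?m (?M1 \<union> ?M2)"
    proof -
      have "?M1 \<inter> ?M2 = {}" using sub by fastforce
      then show ?thesis by (subst measure_Un3[OF lm(2,3)]) simp
    qed
    also have "\<dots> \<le> ?m ?M" using sub by (intro measure_mono_fmeasurable fmeasurableD fmeasurable.Un lm) blast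
    finally have "root ?N (R ^ ?N) \<le> root ?N (?m ?M)" by simp
    then show ?thesis using Rp by (simp add: real_root_power_cancel R_def)
  qed
  show ?case
  proof (cases "card \<A> \<ge> 2 \<or> card \<B> \<ge> 2")
    case True
    then show ?thesis
    proof
      assume "card \<A> \<ge> 2"
      then show ?thesis by (rule step[OF less.prems _ less.hyps]) simp
    next
      assume "card \<B> \<ge> 2"
      then have "root ?N (?m (\<Union>\<B>)) + root ?N (?m (\<Union>\<A>)) \<le> root ?N (?m (minkowski_sum (\<Union>\<B>) (\<Union>\<A>)))"
        by (rule step[OF less.prems(2,1) _ less.hyps]) simp
      then show ?thesis unfolding minkowski_sum_commute[of "\<Union>\<B>"] by (simp only: add.commute)
    qed
  next
    case False
    moreover have "card \<A> \<noteq> 0" "card \<B> \<noteq> 0" using less.prems by (auto simp: box_family_def)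
    ultimately have "card \<A> = 1" "card \<B> = 1" by auto
    then obtain X Y where XY: "\<A> = {X}" "\<B> = {Y}" using card_1_singletonE by metis
    then have "\<exists>a b. X = box a b" "\<exists>c d. Y = box c d" and ne: "X \<noteq> {}" "Y \<noteq> {}"
      using less.prems by (simp_all add: box_family_def)
    then obtain a b c d where bx: "X = box a b" "Y = box c d" by blast
    have lt: "a \<bullet> i < b \<bullet> i" "c \<bullet> i < d \<bullet> i" if "i \<in> Basis" for i
      using ne that by (auto simp: bx box_ne_empty)
    have mb: "?m (box p q) = (\<Prod>i\<in>Basis. (q - p) \<bullet> i)" if "\<And>i. i \<in> Basis \<Longrightarrow> p \<bullet> i < q \<bullet> i" for p q :: 'a
      using that by (simp add: measure_lborel_box_eq less_imp_le)
    have "root ?N (?m X) + root ?N (?m Y) \<le> root ?N (?m (box (a + c) (b + d)))"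
    proof -
      have "root ?N (\<Prod>i\<in>Basis. (b - a) \<bullet> i) + root ?N (\<Prod>i\<in>Basis. (d - c) \<bullet> i)
         \<le> root ?N (\<Prod>i\<in>Basis. (b - a) \<bullet> i + (d - c) \<bullet> i)"
        using lt by (intro root_prod_add_le) (auto simp: inner_diff_left)
      moreover have "?m (box (a + c) (b + d)) = (\<Prod>i\<in>Basis. (b - a) \<bullet> i + (d - c) \<bullet> i)"
        using lt by (subst mb) (auto simp: inner_add_left inner_diff_left add_strict_mono algebra_simps intro!: prod.cong)
      moreover have "?m X = (\<Prod>i\<in>Basis. (b - a) \<bullet> i)" "?m Y = (\<Prod>i\<in>Basis. (d - c) \<bullet> i)"
        unfolding bx by (rule mb; simp add: lt)+
      ultimately show ?thesis by metis
    qed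
    also have "\<dots> \<le> root ?N (?m (minkowski_sum X Y))"
    proof -
      have "bounded (minkowski_sum X Y)" "open (minkowski_sum X Y)" using bx by (auto intro: open_minkowski_sum bounded_minkowski_sum)
      then have "?m (box (a + c) (b + d)) \<le> ?m (minkowski_sum X Y)" using box_sum_subset[of a b c d] ne
        by (intro measure_mono_fmeasurable lmeasurable_open_bounded) (auto simp: bx)
      then show ?thesis by simp
    qed
    finally show ?thesis using XY by simp
  qed
qed

text \<open>The boxes are the interiors of those cells of a fine division of a large cube that meet
  A. What they miss of A lies in the boundaries of cells, a null set, and the cells are so small
  that they stay within e of A.\<close>

lemma box_family_approx:
  fixes A :: "'a::euclidean_space set"
  assumes A: "compact A" "A \<noteq> {}" "vol A > 0" and e: "e > 0"
  obtains \<A> where "box_family \<A>" "vol A \<le> vol (\<Union>\<A>)"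
    "\<And>x. x \<in> \<Union>\<A> \<Longrightarrow> \<exists>y\<in>A. dist x y < e"
proof -
  obtain a b where ab: "A \<subseteq> cbox a b" using bounded_subset_cbox_symmetric[OF compact_imp_bounded[OF A(1)]] by metis
  have "gauge (\<lambda>x. ball x (e/2))" using e by auto
  then obtain p where p: "p tagged_division_of cbox a b" "(\<lambda>x. ball x (e/2)) fine p" by (rule fine_division_exists)
  define D where "D = snd ` p"
  have D: "D division_of cbox a b" unfolding D_def using p(1) by (rule division_of_tagged_division)
  have small: "dist x y < e" if "K \<in> D" "x \<in> K" "y \<in> K" for K x y
  proof -
    obtain z where "(z, K) \<in> p" using \<open>K \<in> D\<close> by (auto simp: D_def)
    then have "K \<subseteq> ball z (e/2)" using p(2) by (auto simp: fine_def)
    then have "dist z x < e/2" "dist z y < e/2" using that by auto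
    then show ?thesis by (metis dist_commute dist_triangle_half_r)
  qed
  define D' where "D' = {K \<in> D. K \<inter> A \<noteq> {}}"
  define \<A> where "\<A> = interior ` {K \<in> D'. interior K \<noteq> {}}"
  have fin: "finite D" using D by blast
  have inter: "interior K = box c d" if "K = cbox c d" for K :: "'a set" and c d using that by simp
  have Kb: "\<exists>c d. K = cbox c d" if "K \<in> D" for K using D that by blast
  have neg: "negligible (\<Union>K\<in>D. K - interior K)"
  proof (rule negligible_Union)
    fix X assume "X \<in> (\<lambda>K. K - interior K) ` D"
    then obtain K where K: "K \<in> D" "X = K - interior K" by blast
    then obtain c d where "K = cbox c d" using Kb by blast
    then show "negligible X" using negligible_frontier_interval[of c d] by (simp add: K(2))
  qed (use fin in simp)
  have sub: "A - \<Union>\<A> \<subseteq> (\<Union>K\<in>D. K - interior K)"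
  proof
    fix x assume x: "x \<in> A - \<Union>\<A>"
    then obtain K where K: "K \<in> D" "x \<in> K" using ab division_ofD(6)[OF D] by blast
    then have "x \<notin> interior K" using x by (auto simp: \<A>_def D'_def)
    then show "x \<in> (\<Union>K\<in>D. K - interior K)" using K by auto
  qed
  have boxes: "\<exists>c d. X = box c d" if X: "X \<in> \<A>" for X
  proof -
    obtain K where K: "K \<in> D" "X = interior K" using X by (auto simp: \<A>_def D'_def)
    then show ?thesis using Kb[OF K(1)] inter by blast
  qed
  have bdd: "bounded (\<Union>\<A>)" "open (\<Union>\<A>)"
    using boxes fin by (auto simp: \<A>_def D'_def intro!: bounded_Union) (metis Kb bounded_cbox bounded_subset interior_subset)
  then have lm: "\<Union>\<A> \<in> lmeasurable" by (simp add: lmeasurable_open_bounded)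
  have lA: "A \<in> lmeasurable" using A(1) by (rule lmeasurable_compact)
  have le: "vol A \<le> vol (\<Union>\<A>)"
  proof -
    have "vol A = vol (A \<inter> \<Union>\<A>)"
      by (rule measure_negligible_symdiff) (use lA lm sub neg in \<open>auto intro: negligible_subset\<close>)
    also have "\<dots> \<le> vol (\<Union>\<A>)" using lm lA by (intro measure_mono_fmeasurable) (auto dest: fmeasurableD)
    finally show ?thesis .
  qed
  have "box_family \<A>" unfolding box_family_def
  proof (intro conjI ballI)
    show "finite \<A>" using fin by (simp add: \<A>_def D'_def)
    show "\<A> \<noteq> {}" using le A(3) by auto
    show "disjoint \<A>" using division_ofD(5)[OF D] by (auto simp: \<A>_def D'_def pairwise_def disjnt_def)
  qed (use boxes in \<open>auto simp: \<A>_def\<close>)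
  moreover have "\<exists>y\<in>A. dist x y < e" if x: "x \<in> \<Union>\<A>" for x
  proof -
    obtain K where K: "K \<in> D" "K \<inter> A \<noteq> {}" "x \<in> interior K" using x by (auto simp: \<A>_def D'_def)
    then show ?thesis using small[of K x] interior_subset[of K] by blast
  qed
  ultimately show ?thesis using that le by blast
qed

text \<open>Box approximations within 1/(k+1) of A and B have their sum in the closed
  2/(k+1)-neighbourhood \<open>C k\<close> of A + B. These compact neighbourhoods decrease to A + B,
  so their volumes converge. If one set is null, a translate of the other one inside A + B
  suffices.\<close>

theorem brunn_minkowski:
  fixes A B :: "'a::euclidean_space set"
  assumes A: "compact A" "A \<noteq> {}" and B: "compact B" "B \<noteq> {}"
  shows "root DIM('a) (vol A) + root DIM('a) (vol B)
    \<le> root DIM('a) (vol (minkowski_sum A B))"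
proof -
  let ?N = "DIM('a)" and ?m = "measure (lebesgue :: 'a measure)"
  let ?M = "minkowski_sum A B"
  have M: "compact ?M" using A B compact_minkowski_sum by blast
  have lm: "compact S \<Longrightarrow> S \<in> lmeasurable" for S :: "'a set" by (rule lmeasurable_compact)
  have tr: "?m ((\<lambda>x. b + x) ` S) = ?m S" for b and S :: "'a set" by (rule measure_translation)
  consider "?m A = 0" | "?m B = 0" | "?m A > 0" "?m B > 0" by (metis measure_nonneg less_eq_real_def)
  then show ?thesis
  proof cases
    case 1
    obtain a where "a \<in> A" using A by auto
    then have "(\<lambda>x. a + x) ` B \<subseteq> ?M" by (auto simp: minkowski_sum_def)
    then have "?m ((\<lambda>x. a + x) ` B) \<le> ?m ?M"
      using B M by (intro measure_mono_fmeasurable lm fmeasurableD[OF lm] compact_translation) auto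
    then show ?thesis using 1 tr by simp
  next
    case 2
    obtain b where "b \<in> B" using B by auto
    then have "(\<lambda>x. b + x) ` A \<subseteq> ?M" by (auto simp: minkowski_sum_def) (metis add.commute)
    then have "?m ((\<lambda>x. b + x) ` A) \<le> ?m ?M"
      using A M by (intro measure_mono_fmeasurable lm fmeasurableD[OF lm] compact_translation) auto
    then show ?thesis using 2 tr by simp
  next
    case 3
    define C where "C k = {x. infdist x ?M \<le> 2 / real (Suc k)}" for k
    have Mne: "?M \<noteq> {}" using A B by (auto simp: minkowski_sum_def)
    have Ccomp: "compact (C k)" for k unfolding C_def by (rule compact_infdist_le[OF Mne M]) simp
    have le: "root ?N (?m A) + root ?N (?m B) \<le> root ?N (?m (C k))" for k
    proof -
      have e: "1 / real (Suc k) > 0" by simp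
      obtain \<A> where \<A>: "box_family \<A>" "?m A \<le> ?m (\<Union>\<A>)"
        "\<And>x. x \<in> \<Union>\<A> \<Longrightarrow> \<exists>y\<in>A. dist x y < 1 / real (Suc k)"
        using box_family_approx[OF A 3(1) e] by metis
      obtain \<B> where \<B>: "box_family \<B>" "?m B \<le> ?m (\<Union>\<B>)"
        "\<And>x. x \<in> \<Union>\<B> \<Longrightarrow> \<exists>y\<in>B. dist x y < 1 / real (Suc k)"
        using box_family_approx[OF B 3(2) e] by metis
      have "minkowski_sum (\<Union>\<A>) (\<Union>\<B>) \<subseteq> C k"
      proof
        fix z assume "z \<in> minkowski_sum (\<Union>\<A>) (\<Union>\<B>)"
        then obtain x y where z: "z = x + y" "x \<in> \<Union>\<A>" "y \<in> \<Union>\<B>" unfolding minkowski_sum_def by blast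
        obtain x' where x': "x' \<in> A" "dist x x' < 1 / real (Suc k)" using \<A>(3)[OF z(2)] by blast
        obtain y' where y': "y' \<in> B" "dist y y' < 1 / real (Suc k)" using \<B>(3)[OF z(3)] by blast
        have "infdist z ?M \<le> dist z (x' + y')" using x' y' by (intro infdist_le) (auto simp: minkowski_sum_def)
        also have "\<dots> \<le> dist x x' + dist y y'" unfolding z by (rule dist_triangle_add)
        also have "\<dots> \<le> 2 / real (Suc k)" using x' y' by simp
        finally show "z \<in> C k" by (simp add: C_def)
      qed
      moreover have "minkowski_sum (\<Union>\<A>) (\<Union>\<B>) \<in> sets lebesgue"
        using box_family_open[OF \<A>(1)] open_minkowski_sum by (metis lmeasurable_open_bounded bounded_minkowski_sum \<A>(1) \<B>(1) box_family_bounded fmeasurableD)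
      ultimately have "?m (minkowski_sum (\<Union>\<A>) (\<Union>\<B>)) \<le> ?m (C k)"
        using lm[OF Ccomp] by (intro measure_mono_fmeasurable)
      then have "root ?N (?m (\<Union>\<A>)) + root ?N (?m (\<Union>\<B>)) \<le> root ?N (?m (C k))"
        using brunn_minkowski_boxes[OF \<A>(1) \<B>(1)] by (meson order_trans real_root_le_mono DIM_positive)
      moreover have "root ?N (?m A) \<le> root ?N (?m (\<Union>\<A>))" "root ?N (?m B) \<le> root ?N (?m (\<Union>\<B>))"
        using \<A>(2) \<B>(2) by simp_all
      ultimately show ?thesis by linarith
    qed
    have "(\<lambda>k. ?m (C k)) \<longlonglongrightarrow> ?m (\<Inter>k. C k)"
    proof (rule Lim_measure_decseq)
      show "range C \<subseteq> sets lebesgue" using fmeasurableD[OF lm[OF Ccomp]] by auto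
      show "decseq C"
      proof (rule antimonoI)
        fix i j :: nat assume "i \<le> j"
        then have "2 / real (Suc j) \<le> 2 / real (Suc i)" by (simp add: frac_le)
        then show "C j \<subseteq> C i" by (auto simp: C_def)
      qed
      show "emeasure lebesgue (C i) \<noteq> \<infinity>" for i using lm[OF Ccomp[of i]] by (auto simp: fmeasurable_def)
    qed
    moreover have "(\<Inter>k. C k) = ?M"
    proof
      show "?M \<subseteq> (\<Inter>k. C k)" by (auto simp: C_def)
      show "(\<Inter>k. C k) \<subseteq> ?M"
      proof
        fix x assume x: "x \<in> (\<Inter>k. C k)"
        have "infdist x ?M \<le> 0"
        proof (rule field_le_epsilon)
          fix e :: real assume "e > 0"
          then obtain n where "inverse (real (Suc n)) < e / 2" using reals_Archimedean[of "e/2"] by auto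
          moreover have "infdist x ?M \<le> 2 / real (Suc n)" using x by (auto simp: C_def)
          moreover have "2 / real (Suc n) = 2 * inverse (real (Suc n))" by (simp only: divide_inverse)
          ultimately show "infdist x ?M \<le> 0 + e" by linarith
        qed
        then have "infdist x ?M = 0" using infdist_nonneg[of x ?M] by linarith
        then show "x \<in> ?M" using in_closed_iff_infdist_zero[OF compact_imp_closed[OF M] Mne] by blast
      qed
    qed
    ultimately have "(\<lambda>k. root ?N (?m (C k))) \<longlonglongrightarrow> root ?N (?m ?M)" using tendsto_real_root by metis
    then show ?thesis by (rule LIMSEQ_le_const) (use le in blast)
  qed
qed

section \<open>Change of variables\<close>

text \<open>The change of variables theorems of the library require a well-ordered index type. Index types
  that are merely finite are handled through an order-isomorphic copy of an initial segment of the
  natural numbers.\<close>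

typedef (overloaded) ('n::finite) index = "{..<CARD('n)}" by (auto intro!: exI[of _ 0] simp: zero_less_card_finite)

instantiation index :: (finite) linorder
begin

definition less_eq_index :: "'a index \<Rightarrow> 'a index \<Rightarrow> bool" where
  "less_eq_index x y \<longleftrightarrow> Rep_index x \<le> Rep_index y"

definition less_index :: "'a index \<Rightarrow> 'a index \<Rightarrow> bool" where
  "less_index x y \<longleftrightarrow> Rep_index x < Rep_index y"

instance by standard (auto simp: less_eq_index_def less_index_def Rep_index_inject)

end

instance index :: (finite) wellorder
proof
  fix P :: "'a index \<Rightarrow> bool" and a
  assume *: "\<And>x. (\<And>y. y < x \<Longrightarrow> P y) \<Longrightarrow> P x"
  show "P a"
  proof (induction "Rep_index a" arbitrary: a rule: less_induct)
    case less
    then show ?case using * by (auto simp: less_index_def)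
  qed
qed

instance index :: (finite) finite
proof
  have "(UNIV :: 'a index set) = Abs_index ` {..<CARD('a)}" by (metis Rep_index Rep_index_inverse UNIV_eq_I image_eqI)
  then show "finite (UNIV :: 'a index set)" by (metis finite_imageI finite_lessThan)
qed

lemma card_index: "CARD('n::finite index) = CARD('n)"
proof -
  have "bij_betw Rep_index (UNIV :: 'n index set) {..<CARD('n)}" by (rule bij_betwI[where g = Abs_index])
      (use Rep_index in \<open>auto simp: Rep_index_inverse Abs_index_inverse\<close>)
  then show ?thesis using bij_betw_same_card by fastforce
qed

text \<open>Sending basis vectors bijectively to basis vectors only relabels coordinates: boxes pull
  back to boxes with the same side lengths, so Lebesgue measure is preserved. The sums over the
  basis write out the inverse map.\<close>

lemma basis_isometry:
  fixes T :: "'a::euclidean_space \<Rightarrow> 'b::euclidean_space"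
  assumes T: "linear T" and bij: "bij_betw T Basis Basis"
  shows "T x \<bullet> T y = x \<bullet> y"
    and "T (\<Sum>b\<in>Basis. (z \<bullet> T b) *\<^sub>R b) = z"
    and "(\<Sum>b\<in>Basis. (T x \<bullet> T b) *\<^sub>R b) = x"
    and "distr lborel borel T = lborel"
proof -
  have orth: "T b \<bullet> T c = (if b = c then 1 else 0)" if "b \<in> Basis" "c \<in> Basis" for b c
  proof -
    have "T b \<in> Basis" "T c \<in> Basis" "T b = T c \<longleftrightarrow> b = c"
      using bij that by (auto simp: bij_betw_def inj_on_eq_iff)
    then show ?thesis by (simp add: inner_Basis)
  qed
  have Tx: "T x = (\<Sum>b\<in>Basis. (x \<bullet> b) *\<^sub>R T b)" for x using linear_basis_expansion[OF T] .
  have Txb: "T x \<bullet> T b = x \<bullet> b" if "b \<in> Basis" for x b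
  proof -
    have "T x \<bullet> T b = (\<Sum>c\<in>Basis. (x \<bullet> c) * (T c \<bullet> T b))" by (subst Tx) (simp add: inner_sum_left)
    also have "\<dots> = (\<Sum>c\<in>Basis. if c = b then x \<bullet> c else 0)" using orth that by (intro sum.cong) auto
    finally show ?thesis using that by simp
  qed
  show inner: "T x \<bullet> T y = x \<bullet> y" for x y
    by (subst (2) Tx) (simp add: inner_sum_right Txb euclidean_inner[of x y] mult.commute)
  show TT: "T (\<Sum>b\<in>Basis. (z \<bullet> T b) *\<^sub>R b) = z" for z
  proof -
    have "T (\<Sum>b\<in>Basis. (z \<bullet> T b) *\<^sub>R b) = (\<Sum>b\<in>Basis. (z \<bullet> T b) *\<^sub>R T b)"
      using T by (simp add: linear_sum linear_cmul)
    also have "\<dots> = (\<Sum>c\<in>Basis. (z \<bullet> c) *\<^sub>R c)"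
      using sum.reindex_bij_betw[OF bij, of "\<lambda>c. (z \<bullet> c) *\<^sub>R c"] .
    finally show ?thesis by (simp add: euclidean_representation)
  qed
  show "(\<Sum>b\<in>Basis. (T x \<bullet> T b) *\<^sub>R b) = x" by (simp add: Txb euclidean_representation cong: sum.cong)
  have cont: "continuous_on UNIV T" using T linear_continuous_on linear_conv_bounded_linear by blast
  then have [measurable]: "T \<in> borel_measurable borel" by (rule borel_measurable_continuous_onI)
  have "lborel = distr lborel borel T"
  proof (rule lborel_eqI)
    fix l u :: 'b assume lu: "\<And>b. b \<in> Basis \<Longrightarrow> l \<bullet> b \<le> u \<bullet> b"
    let ?l = "\<Sum>b\<in>Basis. (l \<bullet> T b) *\<^sub>R b" and ?u = "\<Sum>b\<in>Basis. (u \<bullet> T b) *\<^sub>R b"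
    have TB: "T b \<in> Basis" if "b \<in> Basis" for b using bij that by (auto simp: bij_betw_def)
    have ex: "\<exists>b\<in>Basis. c = T b" if "c \<in> Basis" for c using bij that by (auto simp: bij_betw_def)
    have "T -` box l u = box ?l ?u"
    proof (intro set_eqI iffI)
      fix x assume "x \<in> T -` box l u"
      then show "x \<in> box ?l ?u" using TB Txb by (force simp: mem_box)
    next
      fix x assume x: "x \<in> box ?l ?u"
      show "x \<in> T -` box l u"
      proof (simp add: mem_box, intro ballI)
        fix c :: 'b assume "c \<in> Basis"
        then obtain b where "b \<in> Basis" "c = T b" using ex by blast
        then show "l \<bullet> c < T x \<bullet> c \<and> T x \<bullet> c < u \<bullet> c" using x Txb by (simp add: mem_box)
      qed
    qed
    then have "emeasure (distr lborel borel T) (box l u) = emeasure lborel (box ?l ?u)" by (simp add: emeasure_distr)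
    also have "\<dots> = (\<Prod>b\<in>Basis. (u - l) \<bullet> T b)"
      using lu TB by (subst emeasure_lborel_box) (auto simp: inner_diff_left)
    also have "(\<Prod>b\<in>Basis. (u - l) \<bullet> T b) = (\<Prod>b\<in>Basis. (u - l) \<bullet> b)"
      using prod.reindex_bij_betw[OF bij, of "\<lambda>c. (u - l) \<bullet> c"] .
    finally show "emeasure (distr lborel borel T) (box l u) = (\<Prod>b\<in>Basis. (u - l) \<bullet> b)" by simp
  qed simp
  then show "distr lborel borel T = lborel" by simp
qed

lemma exists_basis_isometry:
  assumes "DIM('a::euclidean_space) = DIM('b::euclidean_space)"
  shows "\<exists>T :: 'a \<Rightarrow> 'b. linear T \<and> bij_betw T Basis Basis"
proof -
  obtain f :: "'a \<Rightarrow> 'b" where f: "bij_betw f Basis Basis"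
    using assms finite_same_card_bij[OF finite_Basis finite_Basis] by blast
  define T where "T x = (\<Sum>b\<in>Basis. (x \<bullet> b) *\<^sub>R f b)" for x
  have "T b = f b" if "b \<in> Basis" for b
    using that by (simp add: T_def inner_Basis if_distrib[of "\<lambda>r. r *\<^sub>R _"] cong: if_cong)
  then have "bij_betw T Basis Basis" using f bij_betw_cong by metis
  moreover have "linear T" unfolding T_def by (intro linearI) (simp_all add: inner_add_left scaleR_add_left sum.distrib scaleR_sum_right)
  ultimately show ?thesis by blast
qed

lemma measure_basis_isometry_image:
  fixes T :: "'a::euclidean_space \<Rightarrow> 'b::euclidean_space"
  assumes T: "linear T" and bij: "bij_betw T Basis Basis" and S: "compact S"
  shows "vol (T ` S) = vol S"
proof -
  note iso = basis_isometry[OF T bij]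
  have cont: "continuous_on UNIV T" using T linear_continuous_on linear_conv_bounded_linear by blast
  then have [measurable]: "T \<in> borel_measurable borel" by (rule borel_measurable_continuous_onI)
  have cTS: "compact (T ` S)" using S cont compact_continuous_image continuous_on_subset by blast
  then have b: "T ` S \<in> sets borel" "S \<in> sets borel" using S by (simp_all add: borel_compact)
  have inj: "inj T" by (rule inj_on_inverseI[where g = "\<lambda>y. \<Sum>b\<in>Basis. (y \<bullet> T b) *\<^sub>R b"]) (simp add: iso(3))
  have "measure lborel (T ` S) = measure (distr lborel borel T) (T ` S)" by (simp only: iso(4))
  also have "\<dots> = measure lborel (T -` (T ` S))" using b by (simp add: measure_distr)
  also have "T -` (T ` S) = S" using inj by (simp add: inj_vimage_image_eq)
  finally show ?thesis using b by simp
qed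

text \<open>For an endomorphism this is the absolute value of the determinant, in a form that makes
  sense for the product type \<open>ambient\<close>, whose elements are not indexed vectors.\<close>

definition vol_factor :: "('a::euclidean_space \<Rightarrow> 'b::euclidean_space) \<Rightarrow> real" where
  "vol_factor L = vol (L ` cbox 0 One)"

lemma vol_factor_conjugate:
  fixes T :: "real ^ 'm::{finite,wellorder} \<Rightarrow> 'a::euclidean_space"
  assumes T: "linear T" "bij_betw T Basis Basis" and L: "linear (L :: 'a \<Rightarrow> 'a)" and A: "compact A"
  defines "T' \<equiv> \<lambda>y. \<Sum>b\<in>Basis. (y \<bullet> T b) *\<^sub>R b"
  shows "vol (L ` A) = \<bar>det (matrix (T' \<circ> L \<circ> T))\<bar> * vol A"
    and "vol_factor L = \<bar>det (matrix (T' \<circ> L \<circ> T))\<bar>"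
proof -
  note iso = basis_isometry[OF T]
  have T'l: "linear T'" unfolding T'_def by (intro linearI) (simp_all add: inner_add_left scaleR_add_left sum.distrib scaleR_sum_right)
  have TT': "T (T' z) = z" "T' (T x) = x" for z x using iso by (simp_all add: T'_def)
  have cont: "continuous_on S T'" "continuous_on S' T" "continuous_on S'' L" for S S' S''
    using T T'l L linear_continuous_on linear_conv_bounded_linear by blast+
  have *: "vol (L ` A) = \<bar>det (matrix (T' \<circ> L \<circ> T))\<bar> * vol A" if A: "compact A" for A
  proof -
    let ?A = "T' ` A" and ?g = "T' \<circ> L \<circ> T"
    have cA: "compact ?A" using A cont compact_continuous_image by blast
    have TA: "T ` ?A = A" using TT' by (force simp: image_iff)
    have g: "linear ?g" using T T'l L by (auto intro: linear_compose)
    have "compact (?g ` ?A)" using cA g linear_continuous_on linear_conv_bounded_linear compact_continuous_image by blast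
    then have "vol (T ` (?g ` ?A)) = vol (?g ` ?A)" by (rule measure_basis_isometry_image[OF T])
    also have "\<dots> = \<bar>det (matrix ?g)\<bar> * vol ?A" using g lmeasurable_compact[OF cA] by (rule measure_linear_image)
    also have "vol ?A = vol A" using measure_basis_isometry_image[OF T cA] TA by simp
    also have "T ` (?g ` ?A) = L ` A" using TT' by (force simp: image_iff)
    finally show ?thesis .
  qed
  show "vol (L ` A) = \<bar>det (matrix (T' \<circ> L \<circ> T))\<bar> * vol A" using *[OF A] .
  have "vol (cbox 0 (One::'a)) = 1" by (simp add: content_cbox)
  then show "vol_factor L = \<bar>det (matrix (T' \<circ> L \<circ> T))\<bar>"
    using *[OF compact_cbox, of 0 One] by (simp add: vol_factor_def)
qed

text \<open>Conjugation by the isometry T moves the statement to an indexed vector space, where the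
  library theorem applies; \<open>vec\<close> turns the scalar integrand into the one-dimensional
  vector that this theorem expects.\<close>

lemma change_of_variables_compact_aux:
  fixes T :: "real ^ 'm::{finite,wellorder} \<Rightarrow> 'a::euclidean_space" and g :: "'a \<Rightarrow> 'a" and f :: "'a \<Rightarrow> real"
  assumes T: "linear T" "bij_betw T Basis Basis"
    and S: "compact S" and d: "\<And>x. x \<in> S \<Longrightarrow> (g has_derivative g' x) (at x within S)" and inj: "inj_on g S"
    and f: "continuous_on (g ` S) f"
  shows "set_integrable lborel S (\<lambda>x. vol_factor (g' x) * f (g x)) \<Longrightarrow>
     (LINT x:g ` S|lborel. f x) = (LINT x:S|lborel. vol_factor (g' x) * f (g x))"
proof -
  assume int: "set_integrable lborel S (\<lambda>x. vol_factor (g' x) * f (g x))"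
  define T' where "T' = (\<lambda>y. \<Sum>b\<in>Basis. (y \<bullet> T b) *\<^sub>R b)"
  note iso = basis_isometry[OF T]
  have T'l: "linear T'" unfolding T'_def by (intro linearI) (simp_all add: inner_add_left scaleR_add_left sum.distrib scaleR_sum_right)
  have TT': "T (T' z) = z" "T' (T x) = x" for z x using iso by (simp_all add: T'_def)
  have cont: "continuous_on S T'" "continuous_on S' T" for S S' using T T'l linear_continuous_on linear_conv_bounded_linear by blast+
  then have [measurable]: "T \<in> borel_measurable borel" by (intro borel_measurable_continuous_onI)
  have bl: "bounded_linear T" "bounded_linear T'" using T T'l linear_conv_bounded_linear by blast+
  define S' where "S' = T' ` S"
  define h where "h = T' \<circ> g \<circ> T"
  define h' where "h' x = T' \<circ> g' (T x) \<circ> T" for x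
  have TS: "T ` S' = S" using TT' by (force simp: S'_def image_iff)
  have mem: "T x \<in> A \<longleftrightarrow> x \<in> T' ` A" for x A using TT' by (metis imageE imageI)
  have cS': "compact S'" unfolding S'_def using S cont compact_continuous_image by blast
  have dh: "(h has_derivative h' x) (at x within S')" if "x \<in> S'" for x
  proof -
    have "(T has_derivative T) (at x within S')" "(T' has_derivative T') (at y within A)" for y A
      using bl bounded_linear_imp_has_derivative by blast+
    moreover have "(g has_derivative g' (T x)) (at (T x) within T ` S')" using d[of "T x"] that TS by auto
    ultimately have "(g \<circ> T has_derivative g' (T x) \<circ> T) (at x within S')" using diff_chain_within by blast
    then have "(T' \<circ> (g \<circ> T) has_derivative T' \<circ> (g' (T x) \<circ> T)) (at x within S')"
      using diff_chain_within[OF _ \<open>(T' has_derivative T') (at (( g \<circ> T) x) within (g \<circ> T) ` S')\<close>] by blast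
    then show ?thesis by (simp add: h_def h'_def o_assoc)
  qed
  have "inj_on h S'" using inj TT' unfolding h_def inj_on_def S'_def by auto metis
  note cov = has_absolute_integral_change_of_variables_compact[OF cS' dh this, of "\<lambda>x. vec (f (T x)) :: real^1"]
  have lin: "linear (g' x)" if "x \<in> S" for x using d[OF that] has_derivative_linear by blast
  have vf: "\<bar>det (matrix (h' x))\<bar> = vol_factor (g' (T x))" if "x \<in> S'" for x
    using vol_factor_conjugate(2)[OF T lin compact_empty] that TS by (auto simp: h'_def T'_def)
  have conv: "(LINT x:A|lborel. p x) = integral (T' ` A) (\<lambda>x. p (T x)) \<and>
      (\<lambda>x. p (T x)) absolutely_integrable_on (T' ` A)"
    if "set_integrable lborel A p" "A \<in> sets borel" for A :: "'a set" and p :: "'a \<Rightarrow> real"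
  proof -
    have "integrable (distr lborel borel T) (\<lambda>x. indicator A x *\<^sub>R p x)" using that iso(4) by (simp add: set_integrable_def)
    then have i: "integrable lborel (\<lambda>x. indicator A (T x) *\<^sub>R p (T x))"
      by (subst (asm) integrable_distr_eq) (use that in \<open>auto simp: set_integrable_def dest: borel_measurable_integrable\<close>)
    have ind: "indicator A (T x) = (indicator (T' ` A) x :: real)" for x using mem by (auto simp: indicator_def)
    have si: "set_integrable lborel (T' ` A) (\<lambda>x. p (T x))" using i by (simp add: set_integrable_def ind)
    have "(LINT x:A|lborel. p x) = integral\<^sup>L (distr lborel borel T) (\<lambda>x. indicator A x *\<^sub>R p x)"
      using iso(4) by (simp add: set_lebesgue_integral_def)
    also have "\<dots> = integral\<^sup>L lborel (\<lambda>x. indicator A (T x) *\<^sub>R p (T x))"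
      by (rule integral_distr) (use that in \<open>auto simp: set_integrable_def dest: borel_measurable_integrable\<close>)
    also have "\<dots> = (LINT x:T' ` A|lborel. p (T x))" by (simp add: set_lebesgue_integral_def ind)
    also have "\<dots> = integral (T' ` A) (\<lambda>x. p (T x))" using set_borel_integral_eq_integral[OF si] by simp
    finally show ?thesis using si by (simp add: set_integrable_def integrable_completion borel_measurable_integrable)
  qed
  have cg: "continuous_on S g" using d has_derivative_continuous_on by blast
  have cgS: "compact (g ` S)" using S cg compact_continuous_image by blast
  have fi: "set_integrable lborel (g ` S) f" unfolding set_integrable_def by (rule borel_integrable_compact[OF cgS f])
  have im: "h ` S' = T' ` (g ` S)" by (auto simp: h_def S'_def TT' image_iff)
  have a1: "(\<lambda>x. vec (f (T x)) :: real^1) absolutely_integrable_on h ` S'"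
    using conv[OF fi] cgS unfolding im absolutely_integrable_on_1_iff by (simp add: borel_compact)
  have "integral S' (\<lambda>x. \<bar>det (matrix (h' x))\<bar> *\<^sub>R (vec (f (T (h x))) :: real^1)) = integral (h ` S') (\<lambda>x. vec (f (T x)))"
    and a2: "(\<lambda>x. \<bar>det (matrix (h' x))\<bar> *\<^sub>R (vec (f (T (h x))) :: real^1)) absolutely_integrable_on S'"
    using cov a1 by blast+
  then have "integral S' (\<lambda>x. \<bar>det (matrix (h' x))\<bar> * f (T (h x))) = integral (h ` S') (\<lambda>x. f (T x))"
    using a1 a2 by (simp add: integral_on_1_eq absolutely_integrable_on_def integrable_on_1_iff vec_eq_iff)
  also have "integral S' (\<lambda>x. \<bar>det (matrix (h' x))\<bar> * f (T (h x))) = integral S' (\<lambda>x. vol_factor (g' (T x)) * f (g (T x)))"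
    by (rule integral_cong) (simp add: vf h_def TT')
  finally show ?thesis using conv[OF fi] conv[OF int] cgS S unfolding im[symmetric] S'_def[symmetric] by (simp add: borel_compact)
qed

text \<open>Relabelling rows and columns by one bijection between two index types respects products
  and sends elementary matrices to elementary matrices of the same kind, so the generation of all
  matrices by elementary ones gives an induction.\<close>

lemma det_reindex:
  fixes A :: "real ^ 'n ^ 'n" and k :: "'m::finite \<Rightarrow> 'n::finite"
  assumes k: "bij k"
  shows "det (\<chi> i j. A $ k i $ k j) = det A"
proof (induction A rule: induct_matrix_elementary)
  case (1 A B)
  have "(\<chi> i j. (A ** B) $ k i $ k j) = (\<chi> i j. A $ k i $ k j) ** (\<chi> i j. B $ k i $ k j)"
  proof -
    have "(\<Sum>l\<in>UNIV. A $ k i $ l * B $ l $ k j) = (\<Sum>l\<in>UNIV. A $ k i $ k l * B $ k l $ k j)" for i j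
      using sum.reindex_bij_betw[OF k, of "\<lambda>l. A $ k i $ l * B $ l $ k j"] by simp
    then show ?thesis by (simp add: matrix_matrix_mult_def vec_eq_iff)
  qed
  then show ?case using 1 by (simp add: det_mul)
next
  case (2 A i)
  obtain i' where "k i' = i" using k by (metis bij_pointE)
  then have "row i' (\<chi> i j. A $ k i $ k j) = 0" using 2 by (auto simp: row_def vec_eq_iff)
  then show ?case using 2 det_zero_row by metis
next
  case (3 A)
  have "det (\<chi> i j. A $ k i $ k j) = (\<Prod>i\<in>UNIV. A $ k i $ k i)"
    by (subst det_diagonal) (use 3 k in \<open>auto simp: bij_is_inj inj_eq\<close>)
  also have "\<dots> = (\<Prod>i\<in>UNIV. A $ i $ i)" using prod.reindex_bij_betw[OF k, of "\<lambda>i. A $ i $ i"] .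
  also have "\<dots> = det A" using 3 by (subst det_diagonal) auto
  finally show ?case .
next
  case (4 m n)
  obtain m' n' where mn: "k m' = m" "k n' = n" using k by (metis bij_pointE)
  then have ne: "m' \<noteq> n'" using 4 by auto
  have tr: "Transposition.transpose m n (k j) = k (Transposition.transpose m' n' j)" for j
    using mn k by (auto simp: Transposition.transpose_def bij_is_inj inj_eq)
  have e: "det (\<chi> i j. mat 1 $ i $ Transposition.transpose p q j :: real^'x^'x) = -1" if "p \<noteq> q" for p q :: "'x::finite"
    using that by (simp add: det_permute_columns permutes_swap_id sign_swap_id)
  have "(\<chi> i j. (\<chi> i j. mat 1 $ i $ Transposition.transpose m n j :: real^'n^'n) $ k i $ k j)
     = (\<chi> i j. mat 1 $ i $ Transposition.transpose m' n' j :: real^'m^'m)"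
    using k by (simp add: vec_eq_iff tr mat_def bij_is_inj inj_eq)
  then show ?case using e[OF ne] e[OF 4] by simp
next
  case (5 m n c)
  obtain m' n' where mn: "k m' = m" "k n' = n" using k by (metis bij_pointE)
  then have ne: "m' \<noteq> n'" using 5 by auto
  have e: "det (\<chi> i j. if i = p \<and> j = q then c else of_bool (i = j) :: real^'x^'x) = 1" if "p \<noteq> q" for p q :: "'x::finite"
  proof -
    have "(\<chi> i. if i = p then row p (mat 1) + c *s row q (mat 1) else row i (mat 1) :: real^'x^'x)
       = (\<chi> i j. if i = p \<and> j = q then c else of_bool (i = j))" using that by (auto simp: vec_eq_iff row_def mat_def)
    then show ?thesis using det_row_operation[OF that, of "mat 1 :: real^'x^'x" c] by simp
  qed
  have "(\<chi> i j. (\<chi> i j. if i = m \<and> j = n then c else of_bool (i = j) :: real^'n^'n) $ k i $ k j)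
     = (\<chi> i j. if i = m' \<and> j = n' then c else of_bool (i = j) :: real^'m^'m)"
    using k mn by (auto simp: vec_eq_iff bij_is_inj inj_eq)
  then show ?case using e[OF ne] e[OF 5] by simp
qed

text \<open>The index type has n + 1 elements, and \<open>option\<close> over a well-ordered type is
  again well-ordered, as the change of variables theorem demands.\<close>

lemma exists_ambient_isometry:
  "\<exists>T :: real ^ ('n::finite index option) \<Rightarrow> 'n ambient. linear T \<and> bij_betw T Basis Basis"
  by (rule exists_basis_isometry) (simp add: card_option card_index)

text \<open>The isometry T is chosen to be a relabelling of coordinates by a bijection k, so that
  the conjugated matrix is a reindexed one and \<open>det_reindex\<close> compares the
  determinants.\<close>

lemma vol_factor_matrix:
  fixes B :: "real ^ 'n::finite \<Rightarrow> real ^ 'n"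
  assumes B: "linear B"
  shows "vol_factor B = \<bar>det (matrix B)\<bar>"
    and "compact A \<Longrightarrow> vol (B ` A) = \<bar>det (matrix B)\<bar> * vol A"
proof -
  obtain k :: "'n index \<Rightarrow> 'n" where k: "bij k"
    using finite_same_card_bij[of "UNIV :: 'n index set" "UNIV :: 'n set"] card_index by auto
  define T :: "real ^ 'n index \<Rightarrow> real ^ 'n" where "T x = (\<chi> i. x $ inv k i)" for x
  have ki: "inv k (k i) = i" "k (inv k j) = j" for i j using k by (simp_all add: bij_is_inj bij_is_surj surj_f_inv_f)
  have Tax: "T (axis i 1) = axis (k i) 1" for i using ki by (auto simp: T_def axis_def vec_eq_iff)
  have lin: "linear T" unfolding T_def by (intro linearI) (simp_all add: vec_eq_iff)
  have bij: "bij_betw T Basis Basis"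
  proof (rule bij_betw_imageI)
    show "inj_on T Basis" using ki unfolding inj_on_def T_def by (metis (no_types, lifting) vec_eq_iff vec_lambda_beta)
    show "T ` Basis = Basis" using ki by (auto simp: Basis_vec_def Tax image_iff) metis
  qed
  define T' where "T' = (\<lambda>y. \<Sum>b\<in>Basis. (y \<bullet> T b) *\<^sub>R b)"
  have T': "T' y = (\<chi> j. y $ k j)" for y
  proof -
    have "T (\<chi> j. y $ k j) = y" by (simp add: T_def ki)
    then show ?thesis using basis_isometry(3)[OF lin bij, of "\<chi> j. y $ k j"] by (simp add: T'_def)
  qed
  have "matrix (T' \<circ> B \<circ> T) = (\<chi> i j. matrix B $ k i $ k j)" by (simp add: matrix_def T' Tax vec_eq_iff)
  then have d: "det (matrix (T' \<circ> B \<circ> T)) = det (matrix B)" by (simp add: det_reindex[OF k])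
  show "vol_factor B = \<bar>det (matrix B)\<bar>" using vol_factor_conjugate(2)[OF lin bij B compact_empty] d by (simp add: T'_def)
  show "compact A \<Longrightarrow> vol (B ` A) = \<bar>det (matrix B)\<bar> * vol A"
    using vol_factor_conjugate(1)[OF lin bij B] d by (simp add: T'_def)
qed

lemma measure_linear_image_ambient:
  fixes L :: "'n::finite ambient \<Rightarrow> 'n ambient"
  assumes "linear L" "compact A"
  shows "vol (L ` A) = vol_factor L * vol A"
proof -
  obtain T :: "real ^ ('n index option) \<Rightarrow> 'n ambient" where T: "linear T" "bij_betw T Basis Basis"
    using exists_ambient_isometry by blast
  show ?thesis using vol_factor_conjugate[OF T assms] by simp
qed

lemma change_of_variables_ambient:
  fixes g :: "'n::finite ambient \<Rightarrow> 'n ambient" and f :: "'n ambient \<Rightarrow> real"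
  assumes "compact S" "\<And>x. x \<in> S \<Longrightarrow> (g has_derivative g' x) (at x within S)" "inj_on g S"
    and "continuous_on (g ` S) f" "set_integrable lborel S (\<lambda>x. vol_factor (g' x) * f (g x))"
  shows "(LINT x:g ` S|lborel. f x) = (LINT x:S|lborel. vol_factor (g' x) * f (g x))"
proof -
  obtain T :: "real ^ ('n index option) \<Rightarrow> 'n ambient" where T: "linear T" "bij_betw T Basis Basis"
    using exists_ambient_isometry by blast
  show ?thesis using change_of_variables_compact_aux[OF T assms] .
qed

section \<open>Anisotropies and dual norms\<close>

lemma has_derivative_sgn:
  fixes x :: "'a::euclidean_space"
  assumes "x \<noteq> 0"
  shows "(sgn has_derivative (\<lambda>v. (v - (v \<bullet> sgn x) *\<^sub>R sgn x) /\<^sub>R norm x)) (at x)"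
proof -
  have "((\<lambda>x. inverse (norm x) *\<^sub>R x) has_derivative
      (\<lambda>v. inverse (norm x) *\<^sub>R v + (- (inverse (norm x) * (v \<bullet> sgn x) * inverse (norm x))) *\<^sub>R x)) (at x)"
    using assms by (intro has_derivative_scaleR Deriv.has_derivative_inverse has_derivative_norm has_derivative_ident) auto
  moreover have "inverse (norm x) *\<^sub>R v + (- (inverse (norm x) * (v \<bullet> sgn x) * inverse (norm x))) *\<^sub>R x
     = (v - (v \<bullet> sgn x) *\<^sub>R sgn x) /\<^sub>R norm x" for v by (simp add: sgn_div_norm algebra_simps)
  ultimately have "((\<lambda>x. inverse (norm x) *\<^sub>R x) has_derivative (\<lambda>v. (v - (v \<bullet> sgn x) *\<^sub>R sgn x) /\<^sub>R norm x)) (at x)"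
    by simp
  then show ?thesis
    by (rule has_derivative_transform_within_open[of _ _ _ UNIV "-{0}"]) (use assms in \<open>auto simp: sgn_div_norm\<close>)
qed

lemma diffeomorphism_inverse:
  assumes "diffeomorphism U V f"
  obtains g where "diffeomorphism V U g" "\<And>x. x \<in> U \<Longrightarrow> g (f x) = x" "\<And>y. y \<in> V \<Longrightarrow> f (g y) = y"
    "f ` U = V" "g ` V = U"
proof -
  obtain g where "smooth_on g V" "f ` U = V" "g ` V = U" "\<forall>x\<in>U. g (f x) = x" "\<forall>y\<in>V. f (g y) = y"
    using assms by (auto simp: diffeomorphism_def)
  then show ?thesis using assms by (intro that[of g]) (auto simp: diffeomorphism_def)
qed

locale anisotropic =
  fixes F :: "'a::euclidean_space \<Rightarrow> real"
  assumes F: "anisotropy F"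
begin

lemma F_scale: "t \<ge> 0 \<Longrightarrow> F (t *\<^sub>R x) = t * F x"
  using F by (simp add: anisotropy_def)

lemma F_0 [simp]: "F 0 = 0"
  using F_scale[of 0 0] by simp

lemma F_sgn: "F x = norm x * F (sgn x)"
  using F_scale[of "norm x" "sgn x"] by (cases "x = 0") (simp_all add: sgn_div_norm)

lemma F_pos: "x \<noteq> 0 \<Longrightarrow> F x > 0"
proof -
  assume x: "x \<noteq> 0"
  then have "F (sgn x) > 0" using F by (simp add: anisotropy_def norm_sgn)
  then show ?thesis using x by (subst F_sgn) simp
qed

definition tgrad :: "'a \<Rightarrow> 'a" where
  "tgrad x = gradient (F \<circ> sgn) x"

text \<open>The 0-homogeneous extension of \<open>Psi F\<close> from the sphere. By
  \<open>F_derivative\<close> it is the Euclidean gradient of F away from the origin; its values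
  there form the Wulff shape.\<close>

definition wulff :: "'a \<Rightarrow> 'a" where
  "wulff x = Psi F (sgn x)"

lemma F_smooth: "smooth_on (F \<circ> sgn) (-{0})"
  using F by (simp add: anisotropy_def smooth_on_sphere_def)

lemma tgrad:
  assumes "x \<noteq> 0"
  shows "((F \<circ> sgn) has_derivative (\<lambda>v. v \<bullet> tgrad x)) (at x)"
    and "tgrad x = (\<Sum>b\<in>Basis. frechet_derivative (F \<circ> sgn) (at x) b *\<^sub>R b)"
proof -
  let ?f = "F \<circ> sgn" and ?d = "\<Sum>b\<in>Basis. frechet_derivative (F \<circ> sgn) (at x) b *\<^sub>R b"
  have d: "(?f has_derivative frechet_derivative ?f (at x)) (at x)" using smooth_on_has_derivative[OF F_smooth] assms by auto
  have e: "frechet_derivative ?f (at x) v = v \<bullet> ?d" for v using linear_basis_expansion[OF has_derivative_linear[OF d], of v]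
    by (simp add: inner_sum_right mult.commute)
  have g: "GDERIV ?f x :> ?d" unfolding gderiv_def by (rule has_derivative_eq_rhs[OF d ext[OF e]])
  have "gradient ?f x = ?d" unfolding gradient_def
  proof (rule the_equality)
    fix d' assume "GDERIV ?f x :> d'"
    then have "(\<lambda>v. v \<bullet> d') = (\<lambda>v. v \<bullet> ?d)" using g unfolding gderiv_def by (rule has_derivative_unique)
    then show "d' = ?d" using vector_eq_ldot by metis
  qed (rule g)
  then show "tgrad x = ?d" by (simp add: tgrad_def)
  with g show "(?f has_derivative (\<lambda>v. v \<bullet> tgrad x)) (at x)" by (simp add: gderiv_def)
qed

lemma tgrad_scale:
  assumes "x \<noteq> 0" "t > 0"
  shows "tgrad (t *\<^sub>R x) = tgrad x /\<^sub>R t"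
proof -
  let ?f = "F \<circ> sgn"
  have "((\<lambda>y. t *\<^sub>R y) has_derivative (\<lambda>y. t *\<^sub>R y)) (at x)" by (auto intro!: derivative_eq_intros)
  from has_derivative_compose[OF this tgrad(1)[of "t *\<^sub>R x"]]
  have "((\<lambda>y. ?f (t *\<^sub>R y)) has_derivative (\<lambda>v. t *\<^sub>R v \<bullet> tgrad (t *\<^sub>R x))) (at x)"
    using assms by simp
  moreover have "(\<lambda>y. ?f (t *\<^sub>R y)) = ?f" using assms by (simp add: fun_eq_iff sgn_scaleR)
  ultimately have "(\<lambda>v. t *\<^sub>R v \<bullet> tgrad (t *\<^sub>R x)) = (\<lambda>v. v \<bullet> tgrad x)"
    using has_derivative_unique tgrad(1)[OF assms(1)] by metis
  then have "v \<bullet> (t *\<^sub>R tgrad (t *\<^sub>R x)) = v \<bullet> tgrad x" for v by (simp add: fun_eq_iff)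
  then have "t *\<^sub>R tgrad (t *\<^sub>R x) = tgrad x" using vector_eq_ldot by blast
  then show ?thesis using assms by (metis divideR_right less_irrefl)
qed

lemma wulff_eq: "x \<noteq> 0 \<Longrightarrow> wulff x = F (sgn x) *\<^sub>R sgn x + tgrad (sgn x)"
  by (simp add: wulff_def Psi_def sphere_grad_def tgrad_def)

lemma wulff_unit: "norm z = 1 \<Longrightarrow> wulff z = Psi F z"
  by (simp add: wulff_def sgn_div_norm)

lemma wulff_scale: "t > 0 \<Longrightarrow> wulff (t *\<^sub>R x) = wulff x"
  by (simp add: wulff_def sgn_scaleR)

lemma tgrad_smooth: "smooth_on tgrad (-{0})"
proof -
  have "smooth_on (\<lambda>x. \<Sum>b\<in>Basis. frechet_derivative (F \<circ> sgn) (at x) b *\<^sub>R b) (-{0})"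
    by (intro smooth_on_sum smooth_on_bilinear[OF bounded_bilinear_scaleR] smooth_on_const
        smooth_on_frechet_derivative F_smooth) auto
  then show ?thesis by (rule smooth_on_cong[rotated 2]) (auto simp: tgrad(2))
qed

lemma sgn_nz: "sgn ` (-{0::'a}) \<subseteq> -{0}"
  by (auto simp: sgn_zero_iff)

lemma wulff_smooth: "smooth_on wulff (-{0})"
proof -
  have "smooth_on (\<lambda>x. F (sgn x) *\<^sub>R sgn x + tgrad (sgn x)) (-{0})"
    using F_smooth by (intro smooth_on_add smooth_on_bilinear[OF bounded_bilinear_scaleR] smooth_on_sgn
        smooth_on_compose[OF tgrad_smooth smooth_on_sgn sgn_nz]) (simp add: o_def)
  then show ?thesis by (rule smooth_on_cong[rotated 2]) (auto simp: wulff_eq)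
qed

text \<open>F is |x| times the 0-homogeneous function \<open>F \<circ> sgn\<close>. The product rule
  gives |x| \<open>tgrad x\<close> + F (sgn x) sgn x, and since \<open>tgrad\<close> has degree -1
  the first term is \<open>tgrad (sgn x)\<close>.\<close>

lemma F_derivative:
  assumes x: "x \<noteq> 0"
  shows "(F has_derivative (\<lambda>v. v \<bullet> wulff x)) (at x)"
proof -
  have "((\<lambda>x. norm x * (F \<circ> sgn) x) has_derivative (\<lambda>v. norm x * (v \<bullet> tgrad x) + (v \<bullet> sgn x) * (F \<circ> sgn) x)) (at x)"
    using tgrad(1)[OF x] has_derivative_norm[OF x] by (rule has_derivative_mult[rotated])
  moreover have "norm x * (v \<bullet> tgrad x) + (v \<bullet> sgn x) * (F \<circ> sgn) x = v \<bullet> wulff x" for v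
  proof -
    have "tgrad (sgn x) = norm x *\<^sub>R tgrad x" using tgrad_scale[OF x, of "inverse (norm x)"] x by (simp add: sgn_div_norm)
    then show ?thesis using x by (simp add: wulff_eq inner_add_right algebra_simps)
  qed
  ultimately have "((\<lambda>x. norm x * (F \<circ> sgn) x) has_derivative (\<lambda>v. v \<bullet> wulff x)) (at x)" by simp
  then show ?thesis using F_sgn by (metis (no_types, lifting) comp_apply ext)
qed

text \<open>Euler's identity for the 1-homogeneous F: F (t x) = t F x is differentiated at t =
  1.\<close>

lemma wulff_inner_self:
  assumes x: "x \<noteq> 0"
  shows "x \<bullet> wulff x = F x"
proof -
  have "((\<lambda>t. t *\<^sub>R x) has_derivative (\<lambda>t. t *\<^sub>R x)) (at (1::real))" by (auto intro!: derivative_eq_intros)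
  from has_derivative_compose[OF this F_derivative[of "1 *\<^sub>R x"]]
  have 1: "((\<lambda>t. F (t *\<^sub>R x)) has_derivative (\<lambda>t. t *\<^sub>R x \<bullet> wulff x)) (at 1)" using x by simp
  have "((\<lambda>t. t * F x) has_derivative (\<lambda>t. t * F x)) (at (1::real))" by (auto intro!: derivative_eq_intros)
  then have "((\<lambda>t. F (t *\<^sub>R x)) has_derivative (\<lambda>t. t * F x)) (at 1)"
    by (rule has_derivative_transform_within_open[of _ _ _ UNIV "{0<..}"]) (auto simp: F_scale)
  from has_derivative_unique[OF 1 this] show ?thesis by (auto dest: fun_cong[of _ _ 1])
qed

section \<open>The Hessian of F and strict convexity\<close>

definition dwulff :: "'a \<Rightarrow> 'a \<Rightarrow> 'a" where
  "dwulff x = frechet_derivative wulff (at x)"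

lemma dwulff: "x \<noteq> 0 \<Longrightarrow> (wulff has_derivative dwulff x) (at x)"
  unfolding dwulff_def using smooth_on_has_derivative[OF wulff_smooth] by auto

text \<open>Differentiating Euler's identity reproduces the derivative of F, and the term that is
  left over must vanish.\<close>

lemma dwulff_inner_self:
  assumes x: "x \<noteq> 0"
  shows "dwulff x v \<bullet> x = 0"
proof -
  have "((\<lambda>x. x \<bullet> wulff x) has_derivative (\<lambda>v. x \<bullet> dwulff x v + v \<bullet> wulff x)) (at x)"
    by (intro has_derivative_inner has_derivative_ident dwulff x)
  then have "(F has_derivative (\<lambda>v. x \<bullet> dwulff x v + v \<bullet> wulff x)) (at x)"
    by (rule has_derivative_transform_within_open[of _ _ _ UNIV "-{0}"]) (use x in \<open>auto simp: wulff_inner_self\<close>)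
  from has_derivative_unique[OF this F_derivative[OF x]]
  have "x \<bullet> dwulff x v + v \<bullet> wulff x = v \<bullet> wulff x" by metis
  then show ?thesis by (simp add: inner_commute)
qed

lemma dwulff_scale:
  assumes x: "x \<noteq> 0" and t: "t > 0"
  shows "dwulff (t *\<^sub>R x) (t *\<^sub>R v) = dwulff x v"
proof -
  have "((\<lambda>y. t *\<^sub>R y) has_derivative (\<lambda>y. t *\<^sub>R y)) (at x)" by (auto intro!: derivative_eq_intros)
  from has_derivative_compose[OF this dwulff[of "t *\<^sub>R x"]]
  have "((\<lambda>y. wulff (t *\<^sub>R y)) has_derivative (\<lambda>v. dwulff (t *\<^sub>R x) (t *\<^sub>R v))) (at x)"
    using assms by simp
  moreover have "(\<lambda>y. wulff (t *\<^sub>R y)) = wulff" using t by (simp add: wulff_scale)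
  ultimately have "(\<lambda>v. dwulff (t *\<^sub>R x) (t *\<^sub>R v)) = dwulff x" using has_derivative_unique dwulff[OF x] by metis
  then show ?thesis by metis
qed

text \<open>For v tangent at e, the derivative of F (sgn x) sgn x contributes (F e) v and a multiple
  of e, which is orthogonal to v. The quadratic form is therefore the one that
  \<open>anisotropy\<close> requires to be positive.\<close>

lemma dwulff_pos_unit:
  assumes e: "norm e = 1" and v: "e \<bullet> v = 0" "v \<noteq> 0"
  shows "dwulff e v \<bullet> v > 0"
proof -
  have e0: "e \<noteq> 0" and se: "sgn e = e" using e by (auto simp: sgn_div_norm)
  let ?g = "sphere_grad F \<circ> sgn"
  have "smooth_on (\<lambda>x. tgrad (sgn x)) (-{0})" by (rule smooth_on_compose[OF tgrad_smooth smooth_on_sgn sgn_nz])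
  then have "smooth_on ?g (-{0})" by (simp add: o_def tgrad_def sphere_grad_def)
  then have dg: "(?g has_derivative frechet_derivative ?g (at e)) (at e)" using smooth_on_has_derivative e0 by blast
  have "((\<lambda>x. (F \<circ> sgn) x *\<^sub>R sgn x + ?g x) has_derivative
     (\<lambda>v. (F \<circ> sgn) e *\<^sub>R ((v - (v \<bullet> sgn e) *\<^sub>R sgn e) /\<^sub>R norm e) + (v \<bullet> tgrad e) *\<^sub>R sgn e + frechet_derivative ?g (at e) v)) (at e)"
    by (intro has_derivative_add has_derivative_scaleR tgrad has_derivative_sgn dg e0)
  then have "(wulff has_derivative
     (\<lambda>v. (F \<circ> sgn) e *\<^sub>R ((v - (v \<bullet> sgn e) *\<^sub>R sgn e) /\<^sub>R norm e) + (v \<bullet> tgrad e) *\<^sub>R sgn e + frechet_derivative ?g (at e) v)) (at e)"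
    by (rule has_derivative_transform_within_open[of _ _ _ UNIV "-{0}"])
      (use e0 in \<open>auto simp: wulff_eq sphere_grad_def tgrad_def\<close>)
  from has_derivative_unique[OF dwulff[OF e0] this]
  have "dwulff e v = F e *\<^sub>R v + (v \<bullet> tgrad e) *\<^sub>R e + frechet_derivative ?g (at e) v"
    using v e by (simp add: se fun_eq_iff inner_commute)
  then have "dwulff e v \<bullet> v = F e * (v \<bullet> v) + sphere_hess F e v v" using v by (simp add: inner_add_left sphere_hess_def)
  moreover have "sphere_hess F e v v + F e * (v \<bullet> v) > 0" using F e v by (auto simp: anisotropy_def)
  ultimately show ?thesis by simp
qed

text \<open>The Hessian of F annihilates the radial direction and takes values orthogonal to it, so
  only the tangential part of w counts, and it is nonzero since w is not a multiple of p.\<close>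

lemma dwulff_pos:
  assumes p: "p \<noteq> 0" and w: "\<And>c. w \<noteq> c *\<^sub>R p"
  shows "dwulff p w \<bullet> w > 0"
proof -
  define e where "e = sgn p"
  have e: "norm e = 1" "e \<noteq> 0" using p by (auto simp: e_def norm_sgn sgn_zero_iff)
  have pe: "p = norm p *\<^sub>R e" using p by (simp add: e_def sgn_div_norm)
  define v where "v = w - (w \<bullet> e) *\<^sub>R e"
  have lin: "linear (dwulff e)" "linear (dwulff p)" using dwulff[OF e(2)] dwulff[OF p] has_derivative_linear by blast+
  have ve: "e \<bullet> v = 0" using e by (simp add: v_def inner_diff_right dot_square_norm inner_commute)
  have "v \<noteq> 0"
  proof
    assume "v = 0"
    then have "w = ((w \<bullet> e) / norm p) *\<^sub>R p" using p by (subst pe) (simp add: v_def)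
    then show False using w by blast
  qed
  then have pos: "dwulff e v \<bullet> v > 0" using dwulff_pos_unit e ve by blast
  have ee: "dwulff e e = 0"
  proof -
    have "((\<lambda>t. t *\<^sub>R e) has_derivative (\<lambda>t. t *\<^sub>R e)) (at (1::real))" by (auto intro!: derivative_eq_intros)
    from has_derivative_compose[OF this dwulff[of "1 *\<^sub>R e"]]
    have 1: "((\<lambda>t. wulff (t *\<^sub>R e)) has_derivative (\<lambda>t. dwulff e (t *\<^sub>R e))) (at 1)" using e by simp
    have "((\<lambda>t. wulff e) has_derivative (\<lambda>t. 0)) (at (1::real))" by simp
    then have "((\<lambda>t. wulff (t *\<^sub>R e)) has_derivative (\<lambda>t. 0)) (at 1)"
      by (rule has_derivative_transform_within_open[of _ _ _ UNIV "{0<..}"]) (auto simp: wulff_scale)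
    from has_derivative_unique[OF 1 this] show ?thesis by (auto dest: fun_cong[of _ _ 1])
  qed
  have "w = v + (w \<bullet> e) *\<^sub>R e" by (simp add: v_def)
  then have dw: "dwulff e w = dwulff e v" using lin(1) ee by (metis (no_types) add.right_neutral linear_add linear_cmul scaleR_zero_right)
  have "dwulff e w \<bullet> w = dwulff e v \<bullet> v + (w \<bullet> e) * (dwulff e v \<bullet> e)"
    unfolding dw by (subst \<open>w = v + (w \<bullet> e) *\<^sub>R e\<close>) (simp add: inner_add_right)
  then have "dwulff e w \<bullet> w > 0" using pos dwulff_inner_self[OF e(2)] by simp
  moreover have "norm p *\<^sub>R dwulff p w = dwulff e w" using dwulff_scale[OF e(2), of "norm p" w] p pe linear_cmul[OF lin(2)] by simp
  ultimately have "norm p * (dwulff p w \<bullet> w) > 0" by (metis inner_scaleR_left)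
  then show ?thesis using p by (simp add: zero_less_mult_iff)
qed

text \<open>Strict convexity of F along the line from z through x, which avoids the origin unless x
  is a multiple of z: by the mean value theorem F x - F z is a derivative at an inner point of the
  segment, and the derivative increases strictly by \<open>dwulff_pos\<close>. Negative multiples of
  z are settled by signs.\<close>

lemma wulff_inner_less:
  assumes z: "z \<noteq> 0" and x: "\<And>c. c \<ge> 0 \<Longrightarrow> x \<noteq> c *\<^sub>R z"
  shows "x \<bullet> wulff z < F x"
proof (cases "\<exists>c. x = c *\<^sub>R z")
  case True
  then obtain c where c: "x = c *\<^sub>R z" "c < 0" using x by (metis not_le)
  have "x \<noteq> 0" using c z by auto
  have "x \<bullet> wulff z < 0" using c wulff_inner_self[OF z] F_pos[OF z] by (simp add: mult_neg_pos)
  then show ?thesis using F_pos[OF \<open>x \<noteq> 0\<close>] by simp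
next
  case False
  define w where "w = x - z"
  have p0: "z + s *\<^sub>R w \<noteq> 0" for s
  proof
    assume *: "z + s *\<^sub>R w = 0"
    then have "s *\<^sub>R x = (s - 1) *\<^sub>R z" by (simp add: w_def algebra_simps)
    then have "s \<noteq> 0 \<Longrightarrow> x = ((s - 1) / s) *\<^sub>R z" by (metis divideR_right scaleR_scaleR divide_inverse_commute)
    then show False using False * z by (cases "s = 0") auto
  qed
  \<comment> \<open>The direction w is radial at no point of the line, as \<open>dwulff_pos\<close>
    demands.\<close>
  have nw: "w \<noteq> c *\<^sub>R (z + s *\<^sub>R w)" for c s
  proof
    assume "w = c *\<^sub>R (z + s *\<^sub>R w)"
    then have e: "(1 - c * s) *\<^sub>R w = c *\<^sub>R z" by (simp add: algebra_simps)
    show False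
    proof (cases "1 - c * s = 0")
      case True
      then have "c *\<^sub>R z = 0" "c \<noteq> 0" using e by auto
      then show False using z by simp
    next
      case f: False
      then have "w = (c / (1 - c * s)) *\<^sub>R z" using e by (metis divideR_right scaleR_scaleR divide_inverse_commute)
      then have "x = (1 + c / (1 - c * s)) *\<^sub>R z" by (simp add: w_def algebra_simps)
      then show False using False by blast
    qed
  qed
  define h where "h s = F (z + s *\<^sub>R w)" for s
  define h' where "h' s = w \<bullet> wulff (z + s *\<^sub>R w)" for s
  have line: "((\<lambda>s. z + s *\<^sub>R w) has_derivative (\<lambda>t. t *\<^sub>R w)) (at s)" for s
    by (auto intro!: derivative_eq_intros)
  have dh: "(h has_real_derivative h' s) (at s)" for s using has_derivative_compose[OF line[of s] F_derivative[OF p0]]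
    by (auto simp: h_def[abs_def] h'_def has_field_derivative_def mult.commute o_def elim!: has_derivative_eq_rhs)
  have dh': "(h' has_real_derivative (w \<bullet> dwulff (z + s *\<^sub>R w) w)) (at s)" for s
  proof -
    have "linear (dwulff (z + s *\<^sub>R w))" using dwulff[OF p0] has_derivative_linear by blast
    then have "(\<lambda>t. w \<bullet> dwulff (z + s *\<^sub>R w) (t *\<^sub>R w)) = (\<lambda>t. t * (w \<bullet> dwulff (z + s *\<^sub>R w) w))"
      by (simp add: linear_cmul)
    then show ?thesis using has_derivative_inner_right[OF has_derivative_compose[OF line[of s] dwulff[OF p0]], of w]
      by (simp add: h'_def[abs_def] has_field_derivative_def mult_commute_abs)
  qed
  have "\<exists>s>0. s < 1 \<and> h 1 - h 0 = (1 - 0) * h' s" using MVT2[of 0 1 h h'] dh by auto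
  then obtain s where s: "0 < s" "s < 1" "h 1 - h 0 = h' s" by auto
  have "h' 0 < h' s"
  proof (rule DERIV_pos_imp_increasing[OF s(1)])
    fix t :: real
    show "\<exists>y. (h' has_real_derivative y) (at t) \<and> 0 < y" using dh'[of t] dwulff_pos[OF p0[of t] nw] by (metis inner_commute)
  qed
  then have "F z + w \<bullet> wulff z < F x" using s by (simp add: h_def h'_def w_def)
  then show ?thesis using wulff_inner_self[OF z] by (simp add: w_def inner_diff_left)
qed

lemma wulff_inner_le:
  assumes z: "z \<noteq> 0"
  shows "x \<bullet> wulff z \<le> F x"
proof (cases "\<exists>c\<ge>0. x = c *\<^sub>R z")
  case True
  then show ?thesis using wulff_inner_self[OF z] F_scale by auto
next
  case False
  then show ?thesis using wulff_inner_less[OF z] by force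
qed

lemma F_continuous: "continuous_on UNIV F"
proof (intro continuous_at_imp_continuous_on ballI)
  fix x :: 'a
  show "isCont F x"
  proof (cases "x = 0")
    case False
    then show ?thesis using F_derivative has_derivative_continuous by blast
  next
    case True
    have cs: "continuous_on (sphere 0 1) F"
    proof (intro continuous_at_imp_continuous_on ballI)
      fix z :: 'a assume "z \<in> sphere 0 1"
      then have "z \<noteq> 0" by auto
      then show "isCont F z" using F_derivative has_derivative_continuous by blast
    qed
    obtain C where C: "\<And>z. z \<in> sphere 0 1 \<Longrightarrow> F z \<le> C"
      using compact_continuous_image[OF cs compact_sphere] compact_imp_bounded bounded_imp_bdd_above by (metis bdd_above_def imageI)
    have le: "norm (F y) \<le> norm y * C" for y
    proof (cases "y = 0")
      case False
      then have "F (sgn y) \<le> C" "0 < F y" by (auto intro!: C F_pos simp: norm_sgn)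
      then show ?thesis using F_sgn[of y] by (simp add: mult_left_mono)
    qed simp
    have "((\<lambda>y. norm y * C) \<longlongrightarrow> norm (0::'a) * C) (at (0::'a))"
      by (rule tendsto_mult[OF tendsto_norm[OF tendsto_ident_at] tendsto_const])
    then have "((\<lambda>y. norm y * C) \<longlongrightarrow> 0) (at (0::'a))" by simp
    moreover have "\<forall>\<^sub>F y in at 0. norm (F y) \<le> norm y * C" using le by simp
    ultimately have "(F \<longlongrightarrow> 0) (at 0)" by (rule Lim_null_comparison[rotated])
    then show ?thesis using True by (simp add: isCont_def)
  qed
qed

text \<open>By homogeneity the quotient is constant on rays, so its supremum is a maximum over the
  compact sphere.\<close>

lemma dual_norm_facts:
  shows dual_norm_ge: "x \<bullet> \<xi> \<le> dual_norm F \<xi> * F x"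
    and dual_norm_attained: "\<exists>z. norm z = 1 \<and> z \<bullet> \<xi> = dual_norm F \<xi> * F z"
proof -
  let ?q = "\<lambda>x. (x \<bullet> \<xi>) / F x"
  have ne: "sphere (0::'a) 1 \<noteq> {}" by (simp add: sphere_eq_empty)
  have "continuous_on (sphere 0 1) ?q"
  proof (intro continuous_intros continuous_on_subset[OF F_continuous])
    show "\<forall>x\<in>sphere 0 1. F x \<noteq> 0"
    proof
      fix x :: 'a assume "x \<in> sphere 0 1"
      then have "x \<noteq> 0" by auto
      then show "F x \<noteq> 0" using F_pos by force
    qed
  qed simp
  then obtain z where z: "z \<in> sphere 0 1" "\<And>y. y \<in> sphere 0 1 \<Longrightarrow> ?q y \<le> ?q z"
    using continuous_attains_sup[OF compact_sphere ne] by blast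
  have qle: "?q x \<le> ?q z" if "x \<noteq> 0" for x
  proof -
    have "?q x = ?q (sgn x)" using that F_sgn[of x] by (simp add: sgn_div_norm divide_inverse)
    then show ?thesis using z(2)[of "sgn x"] that by (simp add: norm_sgn)
  qed
  have z0: "z \<noteq> 0" using z(1) by auto
  have dn: "dual_norm F \<xi> = ?q z" unfolding dual_norm_def by (rule cSup_eq_maximum) (use qle z0 in auto)
  show "x \<bullet> \<xi> \<le> dual_norm F \<xi> * F x"
  proof (cases "x = 0")
    case False
    then show ?thesis using qle[OF False] F_pos[OF False] by (simp add: dn divide_le_eq)
  qed simp
  show "\<exists>z. norm z = 1 \<and> z \<bullet> \<xi> = dual_norm F \<xi> * F z"
    using z(1) F_pos[OF z0] by (intro exI[of _ z]) (simp add: dn)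
qed

lemma dual_norm_leI:
  assumes "\<And>z. norm z = 1 \<Longrightarrow> z \<bullet> \<xi> \<le> c * F z"
  shows "dual_norm F \<xi> \<le> c"
proof -
  obtain z where z: "norm z = 1" "z \<bullet> \<xi> = dual_norm F \<xi> * F z" using dual_norm_attained by blast
  have "F z > 0" using z(1) by (intro F_pos) auto
  then show ?thesis using assms[OF z(1)] z(2) by simp
qed

lemma dual_norm_pos: "\<xi> \<noteq> 0 \<Longrightarrow> dual_norm F \<xi> > 0"
  using dual_norm_ge[of \<xi> \<xi>] F_pos[of \<xi>] by (metis inner_gt_zero_iff less_le_trans zero_less_mult_pos2)

lemma dual_norm_zero: "dual_norm F 0 = 0"
proof -
  obtain z where z: "norm z = 1" "z \<bullet> 0 = dual_norm F 0 * F z" using dual_norm_attained by blast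
  then have "F z > 0" by (intro F_pos) auto
  then show ?thesis using z by simp
qed

lemma dual_norm_nonneg: "dual_norm F \<xi> \<ge> 0"
  using dual_norm_pos dual_norm_zero by (cases "\<xi> = 0") (auto intro: less_imp_le)

lemma dual_norm_wulff: "norm z = 1 \<Longrightarrow> dual_norm F (wulff z) = 1"
proof (rule antisym)
  assume z: "norm z = 1"
  then have z0: "z \<noteq> 0" by auto
  show "dual_norm F (wulff z) \<le> 1" using wulff_inner_le[OF z0] by (intro dual_norm_leI) simp
  show "1 \<le> dual_norm F (wulff z)" using dual_norm_ge[of z "wulff z"] wulff_inner_self[OF z0] F_pos[OF z0] by simp
qed

text \<open>Equality makes z a global minimum of the nonnegative function x -> r F x - x . \<xi>. As
  F is differentiable at z, the gradient r \<open>wulff z\<close> - \<xi> vanishes.\<close>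

lemma support_point_unique:
  assumes z: "norm z = 1" and r: "dual_norm F \<xi> = r" "r > 0" and eq: "z \<bullet> \<xi> = r * F z"
  shows "\<xi> = r *\<^sub>R wulff z"
proof -
  have z0: "z \<noteq> 0" using z by auto
  have d: "((\<lambda>x. r * F x - x \<bullet> \<xi>) has_derivative (\<lambda>v. r * (v \<bullet> wulff z) - v \<bullet> \<xi>)) (at z)"
    by (intro derivative_intros has_derivative_mult_right F_derivative z0)
  have "(\<lambda>v. r * (v \<bullet> wulff z) - v \<bullet> \<xi>) = (\<lambda>v. 0)"
  proof (rule differential_zero_maxmin[OF _ open_UNIV d])
    show "(\<forall>y\<in>UNIV. r * F y - y \<bullet> \<xi> \<le> r * F z - z \<bullet> \<xi>) \<or> (\<forall>y\<in>UNIV. r * F z - z \<bullet> \<xi> \<le> r * F y - y \<bullet> \<xi>)"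
      using dual_norm_ge[of _ \<xi>] r eq by simp
  qed simp
  then have "v \<bullet> (r *\<^sub>R wulff z) = v \<bullet> \<xi>" for v by (metis eq_iff_diff_eq_0 inner_scaleR_right)
  then have "r *\<^sub>R wulff z = \<xi>" using vector_eq_ldot by blast
  then show ?thesis ..
qed

lemma dual_norm_eqE:
  assumes "dual_norm F \<xi> = r" "r > 0"
  obtains z where "norm z = 1" "\<xi> = r *\<^sub>R wulff z" using dual_norm_attained[of \<xi>] support_point_unique assms by blast

lemma wulff_inj:
  assumes "norm z = 1" "norm z' = 1" "wulff z = wulff z'"
  shows "z = z'"
proof (rule ccontr)
  assume ne: "z \<noteq> z'"
  have "z' \<noteq> 0" "z \<noteq> 0" using assms by auto
  have "z \<noteq> c *\<^sub>R z'" if "c \<ge> 0" for c using that assms ne by auto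
  then have "z \<bullet> wulff z' < F z" using wulff_inner_less[OF \<open>z' \<noteq> 0\<close>] by blast
  then show False using wulff_inner_self[OF \<open>z \<noteq> 0\<close>] assms by simp
qed

lemma dual_norm_scale: "t \<ge> 0 \<Longrightarrow> dual_norm F (t *\<^sub>R \<xi>) = t * dual_norm F \<xi>"
proof (rule antisym)
  assume t: "t \<ge> 0"
  show "dual_norm F (t *\<^sub>R \<xi>) \<le> t * dual_norm F \<xi>"
    using t mult_left_mono[OF dual_norm_ge t] by (intro dual_norm_leI) (simp add: mult_ac)
  obtain z where z: "norm z = 1" "z \<bullet> \<xi> = dual_norm F \<xi> * F z" using dual_norm_attained by blast
  have "F z > 0" using z(1) by (intro F_pos) auto
  then show "t * dual_norm F \<xi> \<le> dual_norm F (t *\<^sub>R \<xi>)" using dual_norm_ge[of z "t *\<^sub>R \<xi>"] z(2) by simp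
qed

lemma dual_norm_triangle: "dual_norm F (\<xi> + \<eta>) \<le> dual_norm F \<xi> + dual_norm F \<eta>"
  using add_mono[OF dual_norm_ge dual_norm_ge] by (intro dual_norm_leI) (simp add: inner_add_right algebra_simps)

lemma dual_norm_convex:
  assumes "0 \<le> t" "t \<le> 1" "dual_norm F p \<le> r" "dual_norm F q \<le> r"
  shows "dual_norm F ((1 - t) *\<^sub>R p + t *\<^sub>R q) \<le> r"
proof -
  have "dual_norm F ((1 - t) *\<^sub>R p + t *\<^sub>R q) \<le> (1 - t) * dual_norm F p + t * dual_norm F q"
    using dual_norm_triangle[of "(1 - t) *\<^sub>R p" "t *\<^sub>R q"] assms by (simp add: dual_norm_scale)
  also have "\<dots> \<le> (1 - t) * r + t * r" using assms by (intro add_mono mult_left_mono) auto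
  finally show ?thesis by (simp add: algebra_simps)
qed

text \<open>If the inner point had dual norm r, the normal z of a supporting hyperplane there would
  support both end points as well, and \<open>support_point_unique\<close> would put both of them at
  r \<open>wulff z\<close>.\<close>

lemma dual_norm_strictly_convex:
  assumes t: "0 < t" "t < 1" and p: "dual_norm F p \<le> r" "dual_norm F q \<le> r" and ne: "p \<noteq> q"
  shows "dual_norm F ((1 - t) *\<^sub>R p + t *\<^sub>R q) < r"
proof (rule ccontr)
  let ?x = "(1 - t) *\<^sub>R p + t *\<^sub>R q"
  assume "\<not> ?thesis"
  then have x: "dual_norm F ?x = r" using dual_norm_convex[of t p r q] t p by simp
  have r: "r > 0" using p ne dual_norm_pos[of p] dual_norm_pos[of q] by (cases "p = 0") auto
  obtain z where z: "norm z = 1" "z \<bullet> ?x = r * F z" using dual_norm_attained x by metis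
  have Fz: "F z > 0" using z(1) by (intro F_pos) auto
  have le: "z \<bullet> y \<le> r * F z" if "dual_norm F y \<le> r" for y
    using dual_norm_ge[of z y] that Fz by (meson less_imp_le mult_right_mono order_trans)
  have sum: "(1 - t) * (z \<bullet> p) + t * (z \<bullet> q) = r * F z" using z(2) by (simp add: inner_add_right)
  have eqs: "z \<bullet> p = r * F z" "z \<bullet> q = r * F z"
  proof -
    have a: "(1 - t) * (z \<bullet> p) \<le> (1 - t) * (r * F z)" "t * (z \<bullet> q) \<le> t * (r * F z)"
      using t le[OF p(1)] le[OF p(2)] by (auto intro!: mult_left_mono)
    have "(1 - t) * (z \<bullet> p) = (1 - t) * (r * F z)" "t * (z \<bullet> q) = t * (r * F z)"
    proof -
      have "(1 - t) * (r * F z) + t * (r * F z) = r * F z" by (simp add: algebra_simps)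
      then show "(1 - t) * (z \<bullet> p) = (1 - t) * (r * F z)" "t * (z \<bullet> q) = t * (r * F z)" using a sum by linarith+
    qed
    then show "z \<bullet> p = r * F z" "z \<bullet> q = r * F z" using t by auto
  qed
  have sup: "y = r *\<^sub>R wulff z" if "z \<bullet> y = r * F z" "dual_norm F y \<le> r" for y
  proof -
    have "r * F z \<le> dual_norm F y * F z" using dual_norm_ge[of z y] that by simp
    then have "dual_norm F y = r" using that Fz by simp
    then show ?thesis using support_point_unique[OF z(1)] r that by blast
  qed
  show False using sup[OF eqs(1) p(1)] sup[OF eqs(2) p(2)] ne by simp
qed

lemma dual_norm_continuous: "continuous_on S (dual_norm F)"
proof -
  have "convex_on UNIV (dual_norm F)"
  proof (rule convex_onI)
    fix t x y assume "0 < (t::real)" "t < 1"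
    then show "dual_norm F ((1 - t) *\<^sub>R x + t *\<^sub>R y) \<le> (1 - t) * dual_norm F x + t * dual_norm F y"
      using dual_norm_triangle[of "(1 - t) *\<^sub>R x" "t *\<^sub>R y"] by (simp add: dual_norm_scale)
  qed simp
  then have "continuous_on UNIV (dual_norm F)" by (intro convex_on_continuous) auto
  then show ?thesis using continuous_on_subset by blast
qed

lemma dual_norm_bounds:
  obtains C c where "C > 0" "c > 0" "\<And>\<xi>. dual_norm F \<xi> \<le> C * norm \<xi>" "\<And>\<xi>. c * norm \<xi> \<le> dual_norm F \<xi>"
proof -
  have ne: "sphere (0::'a) 1 \<noteq> {}" by (simp add: sphere_eq_empty)
  obtain z1 where z1: "norm z1 = 1" "\<And>y. norm y = 1 \<Longrightarrow> dual_norm F y \<le> dual_norm F z1"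
    using continuous_attains_sup[OF compact_sphere ne dual_norm_continuous] by auto
  obtain z2 where z2: "norm z2 = 1" "\<And>y. norm y = 1 \<Longrightarrow> dual_norm F z2 \<le> dual_norm F y"
    using continuous_attains_inf[OF compact_sphere ne dual_norm_continuous] by auto
  have dn: "dual_norm F \<xi> = norm \<xi> * dual_norm F (sgn \<xi>)" for \<xi>
    using dual_norm_scale[of "norm \<xi>" "sgn \<xi>"] by (cases "\<xi> = 0") (simp_all add: sgn_div_norm)
  show ?thesis
  proof
    show "dual_norm F z1 > 0" "dual_norm F z2 > 0" using z1(1) z2(1) by (auto intro!: dual_norm_pos)
    show "dual_norm F \<xi> \<le> dual_norm F z1 * norm \<xi>" for \<xi>
      using z1(2)[of "sgn \<xi>"] by (cases "\<xi> = 0") (auto simp: dual_norm_zero dn[of \<xi>] norm_sgn mult.commute mult_right_mono)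
    show "dual_norm F z2 * norm \<xi> \<le> dual_norm F \<xi>" for \<xi>
      using z2(2)[of "sgn \<xi>"] by (cases "\<xi> = 0") (auto simp: dual_norm_zero dn[of \<xi>] norm_sgn mult.commute mult_right_mono)
  qed
qed

text \<open>For nonzero \<xi>, the outer unit normal at \<xi> of the level set of the dual norm; on
  the Wulff shape it is the inverse of \<open>wulff\<close>.\<close>

definition gauss :: "'a \<Rightarrow> 'a" where
  "gauss \<xi> = (THE z. norm z = 1 \<and> \<xi> = dual_norm F \<xi> *\<^sub>R wulff z)"

lemma gauss:
  assumes "\<xi> \<noteq> 0"
  shows "norm (gauss \<xi>) = 1" "\<xi> = dual_norm F \<xi> *\<^sub>R wulff (gauss \<xi>)"
proof -
  have pos: "dual_norm F \<xi> > 0" using assms by (rule dual_norm_pos)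
  obtain z where z: "norm z = 1" "\<xi> = dual_norm F \<xi> *\<^sub>R wulff z" using dual_norm_eqE[OF refl pos] .
  have "\<exists>!z. norm z = 1 \<and> \<xi> = dual_norm F \<xi> *\<^sub>R wulff z"
  proof (rule ex1I[of _ z])
    fix y assume y: "norm y = 1 \<and> \<xi> = dual_norm F \<xi> *\<^sub>R wulff y"
    then have "dual_norm F \<xi> *\<^sub>R wulff y = dual_norm F \<xi> *\<^sub>R wulff z" using z by metis
    then have "wulff y = wulff z" using pos by simp
    then show "y = z" using y z wulff_inj by blast
  qed (use z in simp)
  from theI'[OF this] show "norm (gauss \<xi>) = 1" "\<xi> = dual_norm F \<xi> *\<^sub>R wulff (gauss \<xi>)" unfolding gauss_def by blast+
qed

lemma gauss_wulff: "norm z = 1 \<Longrightarrow> gauss (wulff z) = z"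
proof -
  assume z: "norm z = 1"
  have "wulff z \<noteq> 0" using dual_norm_wulff[OF z] dual_norm_zero by auto
  from gauss[OF this] show ?thesis using wulff_inj z dual_norm_wulff[OF z] by simp
qed

lemma gauss_scale: "t > 0 \<Longrightarrow> \<xi> \<noteq> 0 \<Longrightarrow> gauss (t *\<^sub>R \<xi>) = gauss \<xi>"
proof -
  assume t: "t > 0" and x: "\<xi> \<noteq> 0"
  have tx: "t *\<^sub>R \<xi> \<noteq> 0" using t x by simp
  have "t *\<^sub>R \<xi> = (t * dual_norm F \<xi>) *\<^sub>R wulff (gauss (t *\<^sub>R \<xi>))" using gauss(2)[OF tx] t by (simp add: dual_norm_scale)
  then have "t *\<^sub>R dual_norm F \<xi> *\<^sub>R wulff (gauss \<xi>) = t *\<^sub>R dual_norm F \<xi> *\<^sub>R wulff (gauss (t *\<^sub>R \<xi>))"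
    using gauss(2)[OF x] by simp
  then have "wulff (gauss \<xi>) = wulff (gauss (t *\<^sub>R \<xi>))" using t dual_norm_pos[OF x] by simp
  then show ?thesis using wulff_inj gauss(1)[OF x] gauss(1)[OF tx] by metis
qed

lemma gauss_inner: "\<xi> \<noteq> 0 \<Longrightarrow> gauss \<xi> \<bullet> \<xi> = dual_norm F \<xi> * F (gauss \<xi>)"
proof -
  assume x: "\<xi> \<noteq> 0"
  have "gauss \<xi> \<noteq> 0" using gauss(1)[OF x] by auto
  then have "gauss \<xi> \<bullet> wulff (gauss \<xi>) = F (gauss \<xi>)" by (rule wulff_inner_self)
  then show ?thesis by (subst (2) gauss(2)[OF x]) simp
qed

lemma wulff_continuous: "continuous_on (-{0}) wulff"
  using wulff_smooth smooth_on_imp_continuous_on by blast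

lemma gauss_continuous_level:
  "continuous_on {\<xi>. dual_norm F \<xi> = 1} gauss"
proof -
  have c: "continuous_on (sphere 0 1) wulff" by (rule continuous_on_subset[OF wulff_continuous]) auto
  have im: "{\<xi>. dual_norm F \<xi> = 1} = wulff ` sphere 0 1"
  proof
    show "{\<xi>. dual_norm F \<xi> = 1} \<subseteq> wulff ` sphere 0 1"
    proof
      fix \<xi> assume "\<xi> \<in> {\<xi>. dual_norm F \<xi> = 1}"
      then obtain z where "norm z = 1" "\<xi> = 1 *\<^sub>R wulff z" using dual_norm_eqE[of \<xi> 1] by auto
      then show "\<xi> \<in> wulff ` sphere 0 1" by auto
    qed
  qed (auto simp: dual_norm_wulff)
  show ?thesis unfolding im by (rule continuous_on_inv[OF c compact_sphere]) (simp add: gauss_wulff)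
qed

end

section \<open>Radial graphs\<close>

lemma inner_E_last [simp]: "x \<bullet> E_last = snd x" "E_last \<bullet> x = snd x"
  by (simp_all add: E_last_def inner_prod_def)

lemma snd_E_last [simp]: "snd E_last = 1"
  by (simp add: E_last_def)

lemma E_last_nonzero [simp]: "E_last \<noteq> 0"
  by (simp add: E_last_def zero_prod_def)

lemma halfspaces_snd:
  "upper = {x. snd x > 0}" "cupper = {x. snd x \<ge> 0}" "boundary_hyperplane = {x. snd x = 0}"
  by (auto simp: upper_halfspace_def closed_upper_halfspace_def boundary_hyperplane_def)

lemma open_upper_halfspace [simp]: "open (upper :: 'n::finite ambient set)"
  unfolding halfspaces_snd by (intro open_Collect_less continuous_intros)

lemma closed_closed_upper_halfspace [simp]: "closed (cupper :: 'n::finite ambient set)"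
  unfolding halfspaces_snd by (intro closed_Collect_le continuous_intros)

lemma upper_subset_closed_upper: "upper \<subseteq> cupper"
  by (auto simp: halfspaces_snd)

lemma convex_upper_halfspace: "convex (upper :: 'n::finite ambient set)"
  unfolding upper_halfspace_def using convex_halfspace_gt[of 0 E_last] by (simp add: inner_commute)

lemma convex_closed_upper_halfspace: "convex (cupper :: 'n::finite ambient set)"
  unfolding closed_upper_halfspace_def using convex_halfspace_ge[of 0 E_last] by (simp add: inner_commute)

text \<open>The radial function is merely positive here; continuity of the gauge is derived from
  compactness in \<open>gauge_continuous\<close>.\<close>

locale radial_graph =
  fixes S :: "'n::finite ambient set"
  assumes S_compact: "compact S"
    and S_radial: "\<exists>\<rho>. (\<forall>\<theta>\<in>sphere 0 1 \<inter> cupper. \<rho> \<theta> > 0) \<and>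
        S = (\<lambda>\<theta>. \<rho> \<theta> *\<^sub>R \<theta>) ` (sphere 0 1 \<inter> cupper)"
begin

text \<open>The Minkowski gauge of the enclosed region, through the point where the ray of x crosses
  S. It is meaningful on the closed half-space; 0 is the default at the origin.\<close>

definition gaugeS :: "'n ambient \<Rightarrow> real" where
  "gaugeS x = (if x = 0 then 0 else THE s. s > 0 \<and> x /\<^sub>R s \<in> S)"

definition proj :: "'n ambient \<Rightarrow> 'n ambient" where
  "proj x = x /\<^sub>R gaugeS x"

definition region :: "'n ambient set" where
  "region = {x \<in> upper. gaugeS x < 1}"

definition cregion :: "'n ambient set" where
  "cregion = {x \<in> cupper. gaugeS x \<le> 1}"

lemma S_not_zero: "p \<in> S \<Longrightarrow> p \<noteq> 0"
proof -
  assume p: "p \<in> S"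
  from S_radial obtain \<rho> \<theta> where "\<theta> \<in> sphere 0 1 \<inter> cupper" "\<rho> \<theta> > (0::real)" "p = \<rho> \<theta> *\<^sub>R \<theta>"
    using p by blast
  moreover from this have "\<theta> \<noteq> 0" by auto
  ultimately show "p \<noteq> 0" by simp
qed

lemma S_closed_upper: "S \<subseteq> cupper"
proof
  fix p assume p: "p \<in> S"
  from S_radial obtain \<rho> \<theta> where "\<theta> \<in> sphere 0 1 \<inter> cupper" "\<rho> \<theta> > (0::real)" "p = \<rho> \<theta> *\<^sub>R \<theta>"
    using p by blast
  then show "p \<in> cupper" by (simp add: halfspaces_snd)
qed

lemma S_ray_unique: "p \<in> S \<Longrightarrow> t > 0 \<Longrightarrow> t *\<^sub>R p \<in> S \<Longrightarrow> t = 1"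
proof -
  assume p: "p \<in> S" and t: "t > 0" "t *\<^sub>R p \<in> S"
  obtain \<rho> where r: "\<forall>\<theta>\<in>sphere 0 1 \<inter> cupper. \<rho> \<theta> > 0"
     "S = (\<lambda>\<theta>. \<rho> \<theta> *\<^sub>R \<theta>) ` (sphere 0 1 \<inter> cupper)" using S_radial by blast
  have e: "q = \<rho> (sgn q) *\<^sub>R sgn q" if "q \<in> S" for q
  proof -
    obtain \<theta> where "\<theta> \<in> sphere 0 1 \<inter> cupper" "q = \<rho> \<theta> *\<^sub>R \<theta>"
      using \<open>q \<in> S\<close> unfolding r(2) by blast
    moreover have "\<rho> \<theta> > 0" using r(1) calculation(1) by blast
    moreover from calculation have "sgn q = \<theta>" by (simp add: sgn_scaleR) (simp add: sgn_div_norm)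
    ultimately show ?thesis by simp
  qed
  have "sgn (t *\<^sub>R p) = sgn p" using t by (simp add: sgn_scaleR)
  then have "t *\<^sub>R p = p" using e[OF p] e[OF t(2)] by simp
  then have "(t - 1) *\<^sub>R p = 0" by (simp add: algebra_simps)
  then show "t = 1" using S_not_zero[OF p] by simp
qed

lemma ray_meets_S: "x \<in> cupper \<Longrightarrow> x \<noteq> 0 \<Longrightarrow> \<exists>s>0. x /\<^sub>R s \<in> S"
proof -
  assume x: "x \<in> cupper" "x \<noteq> 0"
  obtain \<rho> where r: "\<forall>\<theta>\<in>sphere 0 1 \<inter> cupper. \<rho> \<theta> > 0"
     "S = (\<lambda>\<theta>. \<rho> \<theta> *\<^sub>R \<theta>) ` (sphere 0 1 \<inter> cupper)" using S_radial by blast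
  have s: "sgn x \<in> sphere 0 1 \<inter> cupper" using x by (simp add: norm_sgn halfspaces_snd sgn_div_norm)
  have "\<rho> (sgn x) > 0" using r(1) s by blast
  moreover have "x /\<^sub>R (norm x / \<rho> (sgn x)) = \<rho> (sgn x) *\<^sub>R sgn x"
    by (simp add: sgn_div_norm divide_inverse mult.commute)
  ultimately show "\<exists>s>0. x /\<^sub>R s \<in> S" using r(2) s x by (intro exI[of _ "norm x / \<rho> (sgn x)"]) auto
qed

lemma gauge_0 [simp]: "gaugeS 0 = 0"
  by (simp add: gaugeS_def)

lemma gauge_eqI:
  assumes "s > 0" "x /\<^sub>R s \<in> S"
  shows "gaugeS x = s"
proof -
  have x0: "x \<noteq> 0" using S_not_zero[OF assms(2)] by auto
  have "(THE s. s > 0 \<and> x /\<^sub>R s \<in> S) = s"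
  proof (rule the_equality)
    fix s' assume s': "0 < s' \<and> x /\<^sub>R s' \<in> S"
    have "(s / s') * inverse s = inverse s'" using assms(1) by (simp add: field_simps)
    then have "(s / s') *\<^sub>R (x /\<^sub>R s) = x /\<^sub>R s'" by (simp only: scaleR_scaleR)
    then have "(s / s') *\<^sub>R (x /\<^sub>R s) \<in> S" using s' by metis
    then have "s / s' = 1" using S_ray_unique[OF assms(2), of "s / s'"] s' assms(1) by simp
    then show "s' = s" using s' by simp
  qed (use assms in simp)
  then show ?thesis using x0 by (simp add: gaugeS_def)
qed

lemma gauge_pos: "x \<in> cupper \<Longrightarrow> x \<noteq> 0 \<Longrightarrow> gaugeS x > 0"
  and proj_in_S: "x \<in> cupper \<Longrightarrow> x \<noteq> 0 \<Longrightarrow> proj x \<in> S"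
proof -
  assume x: "x \<in> cupper" "x \<noteq> 0"
  obtain s where "s > 0" "x /\<^sub>R s \<in> S" using ray_meets_S[OF x] by blast
  with gauge_eqI[of s x] show "gaugeS x > 0" "proj x \<in> S" by (simp_all add: proj_def)
qed

lemma gauge_nonneg: "x \<in> cupper \<Longrightarrow> gaugeS x \<ge> 0"
  using gauge_pos[of x] by (cases "x = 0") (simp_all add: less_imp_le)

lemma gauge_scale: "t \<ge> 0 \<Longrightarrow> x \<in> cupper \<Longrightarrow> gaugeS (t *\<^sub>R x) = t * gaugeS x"
proof (cases "t = 0 \<or> x = 0")
  case False
  assume t: "t \<ge> 0" and x: "x \<in> cupper"
  have "gaugeS x > 0" "x /\<^sub>R gaugeS x \<in> S" using gauge_pos[OF x] proj_in_S[OF x] False by (auto simp: proj_def)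
  then show ?thesis using t False by (intro gauge_eqI) (auto simp: field_simps)
qed auto

lemma gauge_S: "p \<in> S \<Longrightarrow> gaugeS p = 1"
  by (rule gauge_eqI) auto

lemma S_eq: "S = {x \<in> cupper. gaugeS x = 1}"
proof
  show "S \<subseteq> {x \<in> cupper. gaugeS x = 1}" using gauge_S S_closed_upper by auto
  show "{x \<in> cupper. gaugeS x = 1} \<subseteq> S"
  proof
    fix x assume x: "x \<in> {x \<in> cupper. gaugeS x = 1}"
    then have "x \<noteq> 0" by auto
    with x show "x \<in> S" using proj_in_S[of x] by (simp add: proj_def)
  qed
qed

lemma S_iff: "x \<in> S \<longleftrightarrow> x \<in> cupper \<and> gaugeS x = 1"
  using S_eq by blast

lemma proj_S: "p \<in> S \<Longrightarrow> proj p = p"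
  by (simp add: proj_def gauge_S)

lemma proj_scale: "t > 0 \<Longrightarrow> x \<in> cupper \<Longrightarrow> proj (t *\<^sub>R x) = proj x"
  by (simp add: proj_def gauge_scale)

lemma gauge_proj: "x \<in> cupper \<Longrightarrow> x = gaugeS x *\<^sub>R proj x"
  using gauge_pos[of x] by (cases "x = 0") (auto simp: proj_def)

lemma upper_not_zero: "x \<in> upper \<Longrightarrow> x \<noteq> 0"
  by (auto simp: halfspaces_snd)

lemma proj_upper: "x \<in> upper \<Longrightarrow> proj x \<in> S \<inter> upper"
  using proj_in_S[of x] gauge_pos[of x] upper_subset_closed_upper upper_not_zero[of x] by (auto simp: proj_def halfspaces_snd)

lemma S_nonempty: "S \<noteq> {}"
  using proj_upper[of E_last] by (auto simp: halfspaces_snd)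

lemma S_norm_bounds:
  obtains m M where "m > 0" "M > 0" "\<forall>p\<in>S. m \<le> norm p" "\<forall>p\<in>S. norm p \<le> M"
proof -
  have c: "continuous_on S norm" by (intro continuous_intros)
  obtain a where a: "a \<in> S" "\<forall>p\<in>S. norm a \<le> norm p" using continuous_attains_inf[OF S_compact S_nonempty c] by blast
  obtain b where b: "b \<in> S" "\<forall>p\<in>S. norm p \<le> norm b" using continuous_attains_sup[OF S_compact S_nonempty c] by blast
  show ?thesis using that[of "norm a" "norm b"] a b S_not_zero by simp
qed

lemma gauge_bounds:
  obtains c C where "c > 0" "C > 0" "\<forall>x\<in>cupper. c * norm x \<le> gaugeS x"
    "\<forall>x\<in>cupper. gaugeS x \<le> C * norm x"
proof -
  obtain m M where mM0: "m > 0" "M > 0" "\<forall>p\<in>S. m \<le> norm p" "\<forall>p\<in>S. norm p \<le> M"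
    by (rule S_norm_bounds) (rule that)
  note mM = mM0(1,2) bspec[OF mM0(3)] bspec[OF mM0(4)]
  have nx: "norm x = gaugeS x * norm (proj x)" if "x \<in> cupper" for x
    using gauge_nonneg[OF that] arg_cong[OF gauge_proj[OF that], of norm] by simp
  show ?thesis
  proof (rule that[of "1/M" "1/m"]; (intro ballI)?)
    fix x :: "'n ambient" assume x: "x \<in> cupper"
    show "1 / M * norm x \<le> gaugeS x" using mM(2) mM(4)[OF proj_in_S[OF x]] nx[OF x] gauge_nonneg[OF x]
      by (cases "x = 0") (simp_all add: divide_le_eq mult_left_mono)
    show "gaugeS x \<le> 1 / m * norm x" using mM(1) mM(3)[OF proj_in_S[OF x]] nx[OF x] gauge_nonneg[OF x]
      by (cases "x = 0") (simp_all add: le_divide_eq mult_left_mono)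
  qed (use mM in auto)
qed

text \<open>\<open>sgn\<close> maps the compact S continuously and injectively onto the closed
  half-sphere, so its inverse \<open>proj\<close> is continuous there, and the gauge is |x| / |proj
  x|. At the origin the linear bound of \<open>gauge_bounds\<close> takes over.\<close>

lemma gauge_continuous: "continuous_on cupper gaugeS"
proof -
  have sgn_S: "sgn ` S = sphere 0 1 \<inter> cupper"
  proof
    show "sgn ` S \<subseteq> sphere 0 1 \<inter> cupper"
    proof (rule image_subsetI)
      fix p assume "p \<in> S"
      then have "p \<noteq> 0" "p \<in> cupper" using S_not_zero S_closed_upper by blast+
      then show "sgn p \<in> sphere 0 1 \<inter> cupper" by (simp add: norm_sgn halfspaces_snd) (simp add: sgn_div_norm)
    qed
    show "sphere 0 1 \<inter> cupper \<subseteq> sgn ` S"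
    proof
      fix x :: "'n ambient" assume x: "x \<in> sphere 0 1 \<inter> cupper"
      then have "x \<noteq> 0" by auto
      then have "proj x \<in> S" "sgn (proj x) = sgn x" "sgn x = x"
        using x proj_in_S[of x] gauge_pos[of x] by (auto simp: proj_def sgn_scaleR sgn_div_norm)
      then show "x \<in> sgn ` S" by force
    qed
  qed
  have inj: "proj (sgn p) = p" if "p \<in> S" for p
    using that proj_scale[of "inverse (norm p)" p] proj_S[OF that] S_not_zero[OF that] S_closed_upper by (auto simp: sgn_div_norm)
  have "continuous_on S sgn" using S_not_zero by (intro continuous_on_sgn continuous_intros) auto
  then have c1: "continuous_on (sphere 0 1 \<inter> cupper) proj" using continuous_on_inv[OF _ S_compact, of sgn proj] inj sgn_S by simp
  have sg: "sgn x \<in> sphere 0 1 \<inter> cupper" if "x \<in> cupper - {0}" for x :: "'n ambient"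
    using that by (simp add: norm_sgn halfspaces_snd) (simp add: sgn_div_norm)
  have "continuous_on (cupper - {0}) (\<lambda>x. norm x / norm (proj (sgn x)))"
  proof (intro continuous_intros continuous_on_compose2[OF c1])
    show "\<forall>x\<in>cupper - {0}. norm (proj (sgn x)) \<noteq> 0"
      using sg S_not_zero proj_in_S by (metis Diff_iff IntD2 norm_eq_zero sgn_zero_iff singletonI)
  qed (use sg in blast)+
  moreover have "norm x / norm (proj (sgn x)) = gaugeS x" if "x \<in> cupper - {0}" for x
  proof -
    have "proj (sgn x) = proj x" using that proj_scale[of "inverse (norm x)" x] by (simp add: sgn_div_norm)
    moreover have "norm x = gaugeS x * norm (proj x)" using that gauge_nonneg[of x] arg_cong[OF gauge_proj[of x], of norm] by simp
    moreover have "proj x \<noteq> 0" using that S_not_zero proj_in_S by blast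
    ultimately show ?thesis by simp
  qed
  ultimately have c2: "continuous_on (cupper - {0}) gaugeS" by (rule continuous_on_eq)
  obtain c C where "c > 0" and C0: "C > 0" and "\<forall>x\<in>cupper. c * norm x \<le> gaugeS x"
    and C: "\<forall>x\<in>cupper. gaugeS x \<le> C * norm x"
    by (rule gauge_bounds) (rule that)
  show ?thesis unfolding continuous_on_eq_continuous_within
  proof
    fix x :: "'n ambient" assume x: "x \<in> cupper"
    show "continuous (at x within cupper) gaugeS"
    proof (cases "x = 0")
      case True
      have "((\<lambda>y. C * norm y) \<longlongrightarrow> C * norm (0::'n ambient)) (at (0::'n ambient) within cupper)"
        by (rule tendsto_mult[OF tendsto_const tendsto_norm[OF tendsto_ident_at]])
      then have "((\<lambda>y. C * norm y) \<longlongrightarrow> 0) (at (0::'n ambient) within cupper)" by simp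
      moreover have "\<forall>\<^sub>F y in at (0::'n ambient) within cupper. norm (gaugeS y) \<le> C * norm y"
        unfolding eventually_at_filter using C gauge_nonneg by (intro always_eventually) simp
      ultimately have "(gaugeS \<longlongrightarrow> 0) (at 0 within cupper)" by (rule Lim_null_comparison[rotated])
      then show ?thesis using True by (simp add: continuous_within)
    next
      case False
      then have "continuous (at x within cupper - {0}) gaugeS" using c2 x by (simp add: continuous_on_eq_continuous_within)
      moreover have "at x within cupper - {0} = at x within cupper" using False by (intro at_within_nhd[of x "-{0}"]) auto
      ultimately show ?thesis by simp
    qed
  qed
qed

lemma proj_continuous: "continuous_on (cupper - {0}) proj"
  unfolding proj_def
proof (intro continuous_intros continuous_on_subset[OF gauge_continuous])
  show "\<forall>x\<in>cupper - {0}. gaugeS x \<noteq> 0" using gauge_pos by force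
qed simp

lemma cregion_compact: "compact cregion"
proof -
  obtain c C where c0: "c > 0" and "C > 0" and c2: "\<forall>x\<in>cupper. c * norm x \<le> gaugeS x"
    and "\<forall>x\<in>cupper. gaugeS x \<le> C * norm x"
    by (rule gauge_bounds) (rule that)
  note c = c0 c2
  have "bounded cregion" unfolding bounded_iff cregion_def
  proof (intro exI[of _ "1/c"] ballI)
    fix x assume "x \<in> {x \<in> cupper. gaugeS x \<le> 1}"
    then have "c * norm x \<le> 1" using c(2) by force
    then show "norm x \<le> 1 / c" using c(1) by (simp add: le_divide_eq mult.commute)
  qed
  moreover have "closed cregion"
  proof -
    have "cregion = cupper \<inter> gaugeS -` {..1}" by (auto simp: cregion_def)
    then show ?thesis using continuous_closed_preimage[OF gauge_continuous] by simp
  qed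
  ultimately show ?thesis by (simp add: compact_eq_bounded_closed)
qed

lemma gauge_continuous_upper: "continuous_on upper gaugeS"
  using gauge_continuous upper_subset_closed_upper continuous_on_subset by blast

lemma region_open: "open region"
proof -
  have "region = upper \<inter> gaugeS -` {..<1}" by (auto simp: region_def)
  then show ?thesis using continuous_open_preimage[OF gauge_continuous_upper] by simp
qed

lemma region_subset_cregion: "region \<subseteq> cregion"
  using upper_subset_closed_upper by (auto simp: region_def cregion_def)

text \<open>A point of the closed region may lie on S, on the hyperplane, or on both. Shrinking it
  towards the origin brings the gauge below 1, and a small upward shift then leads into the open
  half-space.\<close>

lemma closure_region: "closure region = cregion"
proof
  show "closure region \<subseteq> cregion" using region_subset_cregion compact_imp_closed[OF cregion_compact] by (rule closure_minimal)
  show "cregion \<subseteq> closure region"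
  proof
    fix x assume x: "x \<in> cregion"
    show "x \<in> closure region" unfolding closure_approachable
    proof (intro allI impI)
      fix e :: real assume e: "e > 0"
      \<comment> \<open>This keeps y within e / 2 of x, also for x = 0; the upward shift s stays
        below the other half of e.\<close>
      define t where "t = min (1/2) (e / (2 * (norm x + 1)))"
      have t: "0 < t" "t < 1" "t * (norm x + 1) \<le> e / 2" using e by (auto simp: t_def min_def field_simps add_pos_nonneg)
      define y where "y = (1 - t) *\<^sub>R x"
      have y: "y \<in> cupper" "gaugeS y < 1"
      proof -
        show "y \<in> cupper" using x t by (simp add: y_def cregion_def halfspaces_snd)
        have "gaugeS y = (1 - t) * gaugeS x" using x t by (simp add: y_def gauge_scale cregion_def)
        also have "\<dots> \<le> (1 - t) * 1" using x t by (intro mult_left_mono) (auto simp: cregion_def)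
        finally show "gaugeS y < 1" using t by simp
      qed
      have dxy: "dist y x \<le> e / 2"
      proof -
        have "y - x = - (t *\<^sub>R x)" by (simp add: y_def algebra_simps)
        then have "dist y x = t * norm x" using t by (simp add: dist_norm)
        also have "\<dots> \<le> t * (norm x + 1)" using t by (simp add: mult_left_mono)
        finally show ?thesis using t by linarith
      qed
      have "(gaugeS \<longlongrightarrow> gaugeS y) (at y within cupper)" using gauge_continuous y(1) by (simp add: continuous_on_def)
      then have "eventually (\<lambda>z. gaugeS z < 1) (at y within cupper)" using y(2) order_tendstoD(2) by blast
      then obtain d where d: "d > 0" "\<And>z. z \<in> cupper \<Longrightarrow> z \<noteq> y \<Longrightarrow> dist z y < d \<Longrightarrow> gaugeS z < 1"
        unfolding eventually_at by auto
      define s where "s = min (d/2) (e/4)"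
      define z where "z = y + s *\<^sub>R E_last"
      have s: "s > 0" "s < d" "s < e/2" using d e by (auto simp: s_def)
      have nE: "norm (E_last :: 'n ambient) = 1" by (simp add: E_last_def)
      have z: "snd z > 0" using y(1) s by (simp add: z_def halfspaces_snd)
      have dzy: "dist z y = s" using s nE by (simp add: z_def dist_norm)
      have "gaugeS z < 1" by (rule d(2)) (use z dzy s in \<open>auto simp: halfspaces_snd\<close>)
      then have "z \<in> region" using z by (simp add: region_def halfspaces_snd)
      moreover have "dist z x < e" using dist_triangle[of z x y] dxy dzy s by linarith
      ultimately show "\<exists>y\<in>region. dist y x < e" by blast
    qed
  qed
qed

text \<open>Off S and the hyperplane, space is the disjoint union of the open sets
  \<open>region\<close> and \<open>out\<close>. The first is bounded, while every point of the
  second escapes to infinity along its ray.\<close>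

lemma inside_eq_region: "inside (S \<union> boundary_hyperplane) = region"
proof
  let ?W = "- (S \<union> boundary_hyperplane)"
  define out where "out = {x. snd x < 0} \<union> {x \<in> upper. gaugeS x > 1}"
  have "{x \<in> upper. gaugeS x > 1} = upper \<inter> gaugeS -` {1<..}" by auto
  then have "open {x \<in> upper. gaugeS x > 1}" using continuous_open_preimage[OF gauge_continuous_upper] by simp
  moreover have "open {x::'n ambient. snd x < 0}" by (intro open_Collect_less continuous_intros)
  ultimately have oout: "open out" by (simp add: out_def open_Un)
  have split: "?W = region \<union> out"
  proof (rule set_eqI)
    fix x
    show "x \<in> ?W \<longleftrightarrow> x \<in> region \<union> out" by (simp add: S_iff region_def out_def halfspaces_snd) linarith
  qed
  have disj: "region \<inter> out = {}" unfolding region_def out_def halfspaces_snd by auto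
  show "inside (S \<union> boundary_hyperplane) \<subseteq> region"
  proof
    fix x assume "x \<in> inside (S \<union> boundary_hyperplane)"
    then have x: "x \<in> ?W" "bounded (connected_component_set ?W x)" by (auto simp: inside_def)
    show "x \<in> region"
    proof (rule ccontr)
      assume "x \<notin> region"
      then have xo: "x \<in> out" using x split by blast
      then have x0: "x \<noteq> 0" by (auto simp: out_def halfspaces_snd)
      let ?R = "(\<lambda>t. t *\<^sub>R x) ` {1..}"
      have "t *\<^sub>R x \<in> out" if "t \<ge> 1" for t
      proof (cases "snd x < 0")
        case True
        then show ?thesis using that by (simp add: out_def mult_pos_neg)
      next
        case False
        then have u: "snd x > 0" "gaugeS x > 1" using xo by (auto simp: out_def halfspaces_snd)
        then have "gaugeS (t *\<^sub>R x) = t * gaugeS x" using that by (simp add: gauge_scale halfspaces_snd)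
        moreover have "t * gaugeS x > 1" using that u(2) by (smt (verit) mult_le_cancel_right1)
        ultimately show ?thesis using u that by (simp add: out_def halfspaces_snd)
      qed
      then have sub: "?R \<subseteq> ?W" using split by blast
      have "connected ?R" by (intro connected_continuous_image continuous_intros) auto
      then have "?R \<subseteq> connected_component_set ?W x"
        using sub by (intro connected_component_maximal) (auto intro: image_eqI[of _ _ 1])
      then have "bounded ?R" using x(2) bounded_subset by blast
      then obtain B where B: "\<And>y. y \<in> ?R \<Longrightarrow> norm y \<le> B" unfolding bounded_iff by blast
      have "norm ((\<bar>B\<bar> / norm x + 1) *\<^sub>R x) \<le> B" by (rule B) (auto intro!: imageI)
      then have "(\<bar>B\<bar> / norm x + 1) * norm x \<le> B" using x0 by (simp add: add_nonneg_nonneg)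
      then have "\<bar>B\<bar> + norm x \<le> B" using x0 by (simp add: distrib_right)
      moreover have "norm x > 0" using x0 by simp
      ultimately show False by linarith
    qed
  qed
  show "region \<subseteq> inside (S \<union> boundary_hyperplane)"
  proof
    fix x assume x: "x \<in> region"
    let ?K = "connected_component_set ?W x"
    have xW: "x \<in> ?W" using x split by blast
    have "?K \<subseteq> region \<union> out" using connected_component_subset[of ?W x] split by blast
    moreover have "connected ?K" by simp
    moreover have "x \<in> ?K" using xW by simp
    ultimately have "?K \<subseteq> region" using connectedD[of ?K region out] region_open oout disj x by blast
    then have "bounded ?K" using region_subset_cregion compact_imp_bounded[OF cregion_compact] bounded_subset by blast
    then show "x \<in> inside (S \<union> boundary_hyperplane)" using xW by (simp add: inside_def)
  qed
qed

lemma enclosed_eq: "enclosed S = cregion"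
  by (simp add: enclosed_def inside_eq_region closure_region)

text \<open>Each ray from the origin meets the closed set S only once.\<close>

lemma S_negligible: "negligible S"
proof (rule starlike_negligible[where a = 0])
  show "closed S" using S_compact by (rule compact_imp_closed)
  fix c x assume "0 + x \<in> S" "0 \<le> c" "0 + c *\<^sub>R x \<in> S"
  then show "c = 1" using S_ray_unique[of x c] S_not_zero[of "c *\<^sub>R x"] by (cases "c = 0") auto
qed

lemma hyperplane_negligible: "negligible (boundary_hyperplane :: 'n ambient set)"
proof -
  have "boundary_hyperplane = {x::'n ambient. E_last \<bullet> x = 0}" by (auto simp: halfspaces_snd)
  moreover have "(E_last :: 'n ambient) \<noteq> 0" by simp
  ultimately show ?thesis using negligible_hyperplane[of "E_last :: 'n ambient" 0] by simp
qed

lemma cregion_minus_region_negligible: "negligible (cregion - region)"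
proof -
  have "cregion - region \<subseteq> S \<union> boundary_hyperplane" by (auto simp: S_iff cregion_def region_def halfspaces_snd)
  then show ?thesis using S_negligible hyperplane_negligible negligible_Un negligible_subset by blast
qed

lemma measure_cregion: "vol cregion = vol region"
proof -
  have "region \<in> lmeasurable"
    using region_open region_subset_cregion compact_imp_bounded[OF cregion_compact] bounded_subset lmeasurable_open_bounded by blast
  moreover have "region - cregion \<union> (cregion - region) = cregion - region" using region_subset_cregion by blast
  ultimately show ?thesis using measure_negligible_symdiff[of region cregion] cregion_minus_region_negligible by simp
qed

end

section \<open>Differentiability of the gauge and normals\<close>

declare split_paired_All [simp del] split_paired_Ex [simp del]

lemma has_derivative_quotient_tendsto:
  fixes f :: "real \<Rightarrow> 'a::real_normed_vector"
  assumes "(f has_derivative (\<lambda>t. t *\<^sub>R v)) (at 0)"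
  shows "((\<lambda>t. (f t - f 0) /\<^sub>R t) \<longlongrightarrow> v) (at_right 0)"
proof -
  have "((\<lambda>t. norm (f t - f 0 - (t - 0) *\<^sub>R v) / norm (t - 0)) \<longlongrightarrow> 0) (at 0)"
    using assms unfolding has_derivative_iff_norm by simp
  then have 1: "((\<lambda>t. norm (f t - f 0 - (t - 0) *\<^sub>R v) / norm (t - 0)) \<longlongrightarrow> 0) (at_right 0)"
    by (rule filterlim_mono) (auto simp: at_within_le_at)
  have "((\<lambda>t. (f t - f 0) /\<^sub>R t - v) \<longlongrightarrow> 0) (at_right 0)"
  proof (rule Lim_null_comparison[OF _ 1])
    show "\<forall>\<^sub>F t in at_right 0. norm ((f t - f 0) /\<^sub>R t - v) \<le> norm (f t - f 0 - (t - 0) *\<^sub>R v) / norm (t - 0)"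
      unfolding eventually_at_right_field
    proof (intro exI[of _ 1] conjI allI impI)
      fix t :: real assume t: "0 < t" "t < 1"
      have "(f t - f 0) /\<^sub>R t - v = (f t - f 0 - t *\<^sub>R v) /\<^sub>R t" using t by (simp add: scaleR_diff_right)
      then show "norm ((f t - f 0) /\<^sub>R t - v) \<le> norm (f t - f 0 - (t - 0) *\<^sub>R v) / norm (t - 0)"
        using t by (simp add: divide_inverse mult.commute)
    qed simp
  qed
  then show ?thesis using Lim_null by blast
qed

lemma diffeomorphism_derivative:
  fixes \<phi> :: "'a::euclidean_space \<Rightarrow> 'b::euclidean_space"
  assumes "diffeomorphism U V \<phi>" "p \<in> U"
  shows "(\<phi> has_derivative frechet_derivative \<phi> (at p)) (at p)"
    "\<exists>D. (\<forall>w. frechet_derivative \<phi> (at p) (D w) = w) \<and> (\<forall>v. D (frechet_derivative \<phi> (at p) v) = v)"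
    "linear (frechet_derivative \<phi> (at p))"
proof -
  obtain g where g: "diffeomorphism V U g" "\<And>x. x \<in> U \<Longrightarrow> g (\<phi> x) = x" "\<And>y. y \<in> V \<Longrightarrow> \<phi> (g y) = y"
    "\<phi> ` U = V" "g ` V = U" using diffeomorphism_inverse[OF assms(1)] by metis
  have o: "open U" "open V" "smooth_on \<phi> U" "smooth_on g V" using assms(1) g(1) by (auto simp: diffeomorphism_def)
  show d1: "(\<phi> has_derivative frechet_derivative \<phi> (at p)) (at p)" using smooth_on_has_derivative[OF o(3) assms(2)] .
  then show "linear (frechet_derivative \<phi> (at p))" using has_derivative_linear by blast
  have pV: "\<phi> p \<in> V" using g(4) assms(2) by blast
  have d2: "(g has_derivative frechet_derivative g (at (\<phi> p))) (at (\<phi> p))" using smooth_on_has_derivative[OF o(4) pV] .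
  have "((\<lambda>x. g (\<phi> x)) has_derivative (\<lambda>v. frechet_derivative g (at (\<phi> p)) (frechet_derivative \<phi> (at p) v))) (at p)"
    using has_derivative_compose[OF d1 d2] .
  moreover have "((\<lambda>x. g (\<phi> x)) has_derivative (\<lambda>v. v)) (at p)"
    by (rule has_derivative_transform_within_open[OF has_derivative_ident o(1) assms(2)]) (simp add: g)
  ultimately have 1: "(\<lambda>v. frechet_derivative g (at (\<phi> p)) (frechet_derivative \<phi> (at p) v)) = (\<lambda>v. v)"
    by (rule has_derivative_unique)
  have d1': "(\<phi> has_derivative frechet_derivative \<phi> (at p)) (at (g (\<phi> p)))" using d1 g(2)[OF assms(2)] by simp
  have "((\<lambda>y. \<phi> (g y)) has_derivative (\<lambda>v. frechet_derivative \<phi> (at p) (frechet_derivative g (at (\<phi> p)) v))) (at (\<phi> p))"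
    using has_derivative_compose[OF d2 d1'] .
  moreover have "((\<lambda>y. \<phi> (g y)) has_derivative (\<lambda>v. v)) (at (\<phi> p))"
    by (rule has_derivative_transform_within_open[OF has_derivative_ident o(2) pV]) (simp add: g)
  ultimately have 2: "(\<lambda>v. frechet_derivative \<phi> (at p) (frechet_derivative g (at (\<phi> p)) v)) = (\<lambda>v. v)"
    by (rule has_derivative_unique)
  show "\<exists>D. (\<forall>w. frechet_derivative \<phi> (at p) (D w) = w) \<and> (\<forall>v. D (frechet_derivative \<phi> (at p) v) = v)"
    using 1 2 by (intro exI[of _ "frechet_derivative g (at (\<phi> p))"]) (simp add: fun_eq_iff)
qed

text \<open>The curve is the preimage under the chart of a straight segment whose direction is the
  image of v. Only t > 0 is considered, so that boundary charts are covered too, as long as the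
  segment points into the half-space.\<close>

lemma chart_curve:
  fixes \<phi> :: "'a::euclidean_space \<Rightarrow> 'b::euclidean_space"
  assumes dif: "diffeomorphism U V \<phi>" and p: "p \<in> U" and im: "\<phi> ` (S \<inter> U) = V \<inter> A"
    and ev: "eventually (\<lambda>t. \<phi> p + t *\<^sub>R frechet_derivative \<phi> (at p) v \<in> A) (at_right 0)"
  shows "\<exists>\<gamma> :: real \<Rightarrow> 'a. ((\<lambda>t. (\<gamma> t - p) /\<^sub>R t) \<longlongrightarrow> v) (at_right 0) \<and>
    eventually (\<lambda>t. \<gamma> t \<in> S) (at_right 0)"
proof -
  obtain g where g: "diffeomorphism V U g" "\<And>x. x \<in> U \<Longrightarrow> g (\<phi> x) = x" "\<And>y. y \<in> V \<Longrightarrow> \<phi> (g y) = y"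
    "\<phi> ` U = V" "g ` V = U" using diffeomorphism_inverse[OF dif] by metis
  have o: "open U" "open V" "smooth_on \<phi> U" "smooth_on g V" using dif g(1) by (auto simp: diffeomorphism_def)
  let ?w = "frechet_derivative \<phi> (at p) v"
  define \<gamma> where "\<gamma> t = g (\<phi> p + t *\<^sub>R ?w)" for t
  have pV: "\<phi> p \<in> V" using g(4) p by blast
  have d2: "(g has_derivative frechet_derivative g (at (\<phi> p))) (at (\<phi> p))" using smooth_on_has_derivative[OF o(4) pV] .
  have d1: "(\<phi> has_derivative frechet_derivative \<phi> (at p)) (at p)" using diffeomorphism_derivative[OF dif p] by blast
  have "((\<lambda>x. g (\<phi> x)) has_derivative (\<lambda>v. frechet_derivative g (at (\<phi> p)) (frechet_derivative \<phi> (at p) v))) (at p)"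
    using has_derivative_compose[OF d1 d2] .
  moreover have "((\<lambda>x. g (\<phi> x)) has_derivative (\<lambda>v. v)) (at p)"
    by (rule has_derivative_transform_within_open[OF has_derivative_ident o(1) p]) (simp add: g)
  ultimately have 1: "(\<lambda>v. frechet_derivative g (at (\<phi> p)) (frechet_derivative \<phi> (at p) v)) = (\<lambda>v. v)"
    by (rule has_derivative_unique)
  have line: "((\<lambda>t. \<phi> p + t *\<^sub>R ?w) has_derivative (\<lambda>t. t *\<^sub>R ?w)) (at 0)"
    by (auto intro!: derivative_eq_intros)
  have "(\<gamma> has_derivative (\<lambda>t. frechet_derivative g (at (\<phi> p)) (t *\<^sub>R ?w))) (at 0)"
    unfolding \<gamma>_def using has_derivative_compose[OF line, of g "frechet_derivative g (at (\<phi> p))"] d2 by simp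
  moreover have "frechet_derivative g (at (\<phi> p)) (t *\<^sub>R ?w) = t *\<^sub>R v" for t
    using linear_cmul[OF has_derivative_linear[OF d2]] fun_cong[OF 1, of v] by simp
  ultimately have dg: "(\<gamma> has_derivative (\<lambda>t. t *\<^sub>R v)) (at 0)" by simp
  have g0: "\<gamma> 0 = p" by (simp add: \<gamma>_def g p)
  have "((\<lambda>t. \<phi> p + t *\<^sub>R ?w) \<longlongrightarrow> \<phi> p + 0 *\<^sub>R ?w) (at_right 0)" by (intro tendsto_intros)
  then have "eventually (\<lambda>t. \<phi> p + t *\<^sub>R ?w \<in> V) (at_right 0)" using o(2) pV by (intro topological_tendstoD) auto
  with ev have "eventually (\<lambda>t. \<gamma> t \<in> S) (at_right 0)"
  proof eventually_elim
    case (elim t)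
    then have "\<phi> p + t *\<^sub>R ?w \<in> \<phi> ` (S \<inter> U)" using im by blast
    then obtain s where "s \<in> S" "s \<in> U" "\<phi> p + t *\<^sub>R ?w = \<phi> s" by blast
    then show ?case using g(2) by (simp add: \<gamma>_def)
  qed
  then show ?thesis using has_derivative_quotient_tendsto[OF dg] g0 by (intro exI[of _ \<gamma>]) simp
qed

lemma linear_functional_kernel:
  fixes l m :: "'a::real_vector \<Rightarrow> real"
  assumes lin: "linear l" "l u = 1" and m: "linear m" and ker: "\<And>v. l v = 0 \<Longrightarrow> m v = 0"
  shows "m x = l x * m u"
proof -
  have "l (x - l x *\<^sub>R u) = 0" using lin by (simp add: linear_diff linear_cmul)
  then have "m (x - l x *\<^sub>R u) = 0" by (rule ker)
  then show ?thesis using m by (simp add: linear_diff linear_cmul)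
qed

lemma linear_snd_frechet:
  assumes "linear (D :: 'a::real_vector \<Rightarrow> 'b::real_vector \<times> real)"
  shows "linear (\<lambda>v. snd (D v))"
  using assms by (intro linearI) (simp_all add: linear_add linear_cmul)

text \<open>What the variational argument has to know about a surface. The axiom
  \<open>first_order\<close> says that S is tangent at p to the hyperplane orthogonal to \<nu> p. It
  makes sense at boundary points as well, and for a Wulff cap it follows from convexity, without
  boundary charts.\<close>

locale radial_surface = radial_graph S for S :: "'n::finite ambient set" +
  fixes \<nu> :: "'n ambient \<Rightarrow> 'n ambient"
  assumes chart: "S \<inter> upper \<subseteq> manifold_interior S"
    and nu_cont: "continuous_on S \<nu>"
    and nu_norm: "p \<in> S \<Longrightarrow> norm (\<nu> p) = 1"
    and nu_pos: "p \<in> S \<Longrightarrow> p \<bullet> \<nu> p > 0"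
    and first_order: "p \<in> S \<Longrightarrow> ((\<lambda>q. \<nu> p \<bullet> (q - p) / norm (q - p)) \<longlongrightarrow> 0) (at p within S)"
begin

text \<open>With q = proj y and g the gauge of y one has y - p = g (q - p) + (g - 1) p. In the
  product with \<nu> p the term in q - p is of higher order by \<open>first_order\<close>, which
  leaves (g - 1) (p . \<nu> p).\<close>

lemma gauge_derivative_S:
  assumes p: "p \<in> S" "p \<in> upper"
  shows "(gaugeS has_derivative (\<lambda>v. v \<bullet> (\<nu> p /\<^sub>R (p \<bullet> \<nu> p)))) (at p)"
  unfolding has_derivative_at_alt
proof (intro conjI allI impI)
  show "bounded_linear (\<lambda>v. v \<bullet> (\<nu> p /\<^sub>R (p \<bullet> \<nu> p)))" by (rule bounded_linear_inner_left)
  fix e :: real assume e: "e > 0"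
  define c where "c = p \<bullet> \<nu> p"
  have c: "c > 0" using nu_pos p by (simp add: c_def)
  \<comment> \<open>The error below is \<epsilon> (|y - p| + |g - 1| |p|). Once \<epsilon> \<le> 1
    and \<epsilon> |p| \<le> c / 2, the estimate itself yields |g - 1| \<le> 4 |y - p| / c; K is the
    resulting factor.\<close>
  define K where "K = 1 + 4 * norm p / c"
  have K: "K > 0" using c by (simp add: K_def add_pos_nonneg)
  define \<epsilon> where "\<epsilon> = min (min 1 (c / (2 * (norm p + 1)))) (e * c / K)"
  have n0: "norm p + 1 > 0" by (simp add: add_nonneg_pos)
  have \<epsilon>: "\<epsilon> > 0" "\<epsilon> \<le> 1" using c e K n0 by (simp_all add: \<epsilon>_def)
  have "\<epsilon> \<le> e * c / K" "\<epsilon> \<le> c / 2 / (norm p + 1)" by (simp_all add: \<epsilon>_def)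
  then have \<epsilon>K: "\<epsilon> * K \<le> e * c" and "\<epsilon> * (norm p + 1) \<le> c / 2"
    using K n0 by (simp_all only: pos_le_divide_eq)
  then have \<epsilon>p: "\<epsilon> * norm p \<le> c / 2" using \<epsilon>(1) by (simp add: distrib_left)
  have "\<forall>\<^sub>F q in at p within S. \<bar>\<nu> p \<bullet> (q - p) / norm (q - p)\<bar> < \<epsilon>"
    using tendstoD[OF first_order[OF p(1)] \<epsilon>(1)] by (simp add: dist_real_def)
  then obtain d1 where d1: "d1 > 0" "\<forall>q\<in>S. q \<noteq> p \<and> dist q p < d1 \<longrightarrow> \<bar>\<nu> p \<bullet> (q - p) / norm (q - p)\<bar> < \<epsilon>"
    unfolding eventually_at by blast
  have near: "\<bar>\<nu> p \<bullet> (q - p)\<bar> \<le> \<epsilon> * norm (q - p)" if "q \<in> S" "dist q p < d1" for q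
  proof (cases "q = p")
    case False
    then have "\<bar>\<nu> p \<bullet> (q - p) / norm (q - p)\<bar> < \<epsilon>" using d1 that by blast
    then show ?thesis using False by (simp add: divide_less_eq)
  qed simp
  have "continuous_on upper proj" by (rule continuous_on_subset[OF proj_continuous]) (use upper_subset_closed_upper upper_not_zero in blast)
  then obtain d2 where d2: "d2 > 0" "\<forall>y\<in>upper. dist y p < d2 \<longrightarrow> dist (proj y) (proj p) < d1"
    using p(2) d1(1) unfolding continuous_on_iff by blast
  obtain d3 where d3: "d3 > 0" "ball p d3 \<subseteq> upper" using p(2) open_upper_halfspace open_contains_ball by blast
  show "\<exists>d>0. \<forall>y. norm (y - p) < d \<longrightarrow>
      norm (gaugeS y - gaugeS p - (y - p) \<bullet> (\<nu> p /\<^sub>R (p \<bullet> \<nu> p))) \<le> e * norm (y - p)"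
  proof (intro exI[of _ "min d2 d3"] conjI allI impI)
    show "0 < min d2 d3" using d2 d3 by simp
    fix y assume y: "norm (y - p) < min d2 d3"
    have "y \<in> ball p d3" using y by (simp add: dist_norm norm_minus_commute)
    then have yu: "y \<in> upper" using d3 by blast
    then have yc: "y \<in> cupper" using upper_subset_closed_upper by blast
    define q where "q = proj y"
    have q: "q \<in> S" "dist q p < d1" using proj_upper[OF yu] d2(2) yu y proj_S[OF p(1)] by (auto simp: q_def dist_norm)
    define g where "g = gaugeS y"
    have g0: "g \<ge> 0" unfolding g_def by (rule gauge_nonneg[OF yc])
    have yq: "y = g *\<^sub>R q" unfolding g_def q_def using gauge_proj[OF yc] .
    define a where "a = \<bar>g - 1\<bar>"
    define b where "b = norm (y - p)"
    have "(g - 1) * c - \<nu> p \<bullet> (y - p) = - (g * (\<nu> p \<bullet> (q - p)))"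
      by (simp add: yq c_def inner_diff_right inner_commute[of p] algebra_simps)
    then have "\<bar>(g - 1) * c - \<nu> p \<bullet> (y - p)\<bar> = g * \<bar>\<nu> p \<bullet> (q - p)\<bar>" using g0 by (simp add: abs_mult)
    also have "\<dots> \<le> g * (\<epsilon> * norm (q - p))" using near[OF q] g0 by (rule mult_left_mono)
    also have "\<dots> = \<epsilon> * norm ((y - p) - (g - 1) *\<^sub>R p)"
    proof -
      have "(y - p) - (g - 1) *\<^sub>R p = g *\<^sub>R (q - p)" by (simp add: yq algebra_simps)
      then show ?thesis using g0 by simp
    qed
    also have "\<dots> \<le> \<epsilon> * (b + a * norm p)"
      using norm_triangle_ineq4[of "y - p" "(g - 1) *\<^sub>R p"] \<epsilon>(1) by (intro mult_left_mono) (auto simp: a_def b_def)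
    finally have I: "\<bar>(g - 1) * c - \<nu> p \<bullet> (y - p)\<bar> \<le> \<epsilon> * b + (\<epsilon> * norm p) * a" by (simp add: algebra_simps)
    have a0: "a \<ge> 0" and b0: "b \<ge> 0" by (simp_all add: a_def b_def)
    have "\<bar>\<nu> p \<bullet> (y - p)\<bar> \<le> b" using Cauchy_Schwarz_ineq2[of "\<nu> p" "y - p"] nu_norm[OF p(1)] by (simp add: b_def)
    moreover have "a * c = \<bar>(g - 1) * c\<bar>" using c by (simp add: a_def abs_mult)
    moreover note mult_right_mono[OF \<epsilon>(2) b0] mult_right_mono[OF \<epsilon>p a0]
    ultimately have "a * c \<le> 4 * b" using I by (simp add: mult.commute)
    then have "(\<epsilon> * norm p) * a \<le> (\<epsilon> * norm p) * (4 * b / c)" using c \<epsilon>(1) by (intro mult_left_mono) (simp_all add: le_divide_eq)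
    then have "\<bar>(g - 1) * c - \<nu> p \<bullet> (y - p)\<bar> \<le> \<epsilon> * K * b" using I by (simp add: K_def algebra_simps)
    also have "\<dots> \<le> e * c * b" using \<epsilon>K b0 by (rule mult_right_mono)
    finally have fin: "\<bar>(g - 1) * c - \<nu> p \<bullet> (y - p)\<bar> \<le> e * c * b" .
    have "gaugeS y - gaugeS p - (y - p) \<bullet> (\<nu> p /\<^sub>R (p \<bullet> \<nu> p)) = ((g - 1) * c - \<nu> p \<bullet> (y - p)) / c"
      using c by (simp add: g_def gauge_S[OF p(1)] c_def[symmetric] inner_commute[of "y - p"] field_simps)
    then show "norm (gaugeS y - gaugeS p - (y - p) \<bullet> (\<nu> p /\<^sub>R (p \<bullet> \<nu> p))) \<le> e * norm (y - p)"
      using fin c by (simp add: b_def divide_le_eq abs_divide mult_ac)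
  qed
qed

definition grad :: "'n ambient \<Rightarrow> 'n ambient" where
  "grad x = \<nu> (proj x) /\<^sub>R (proj x \<bullet> \<nu> (proj x))"

lemma gauge_derivative:
  assumes x: "x \<in> upper"
  shows "(gaugeS has_derivative (\<lambda>v. v \<bullet> grad x)) (at x)"
proof -
  define s where "s = gaugeS x"
  have xc: "x \<in> cupper" using x upper_subset_closed_upper by blast
  have s: "s > 0" using gauge_pos[OF xc] upper_not_zero[OF x] by (simp add: s_def)
  have p: "proj x \<in> S" "proj x \<in> upper" using proj_upper[OF x] by auto
  have xs: "x /\<^sub>R s = proj x" by (simp add: s_def proj_def)
  have "((\<lambda>y::'n ambient. y /\<^sub>R s) has_derivative (\<lambda>y. y /\<^sub>R s)) (at x)" by (auto intro!: derivative_eq_intros)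
  from has_derivative_compose[OF this, of gaugeS "\<lambda>v. v \<bullet> grad x"] gauge_derivative_S[OF p]
  have "((\<lambda>y. gaugeS (y /\<^sub>R s)) has_derivative (\<lambda>v. (v /\<^sub>R s) \<bullet> grad x)) (at x)"
    by (simp add: xs grad_def)
  then have "((\<lambda>y. s * gaugeS (y /\<^sub>R s)) has_derivative (\<lambda>v. s * ((v /\<^sub>R s) \<bullet> grad x))) (at x)"
    by (rule has_derivative_mult_right)
  moreover have "(\<lambda>v. s * ((v /\<^sub>R s) \<bullet> grad x)) = (\<lambda>v. v \<bullet> grad x)"
    by (rule ext) (use s in \<open>simp add: field_simps\<close>)
  ultimately have "((\<lambda>y. s * gaugeS (y /\<^sub>R s)) has_derivative (\<lambda>v. v \<bullet> grad x)) (at x)" by simp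
  then show ?thesis
  proof (rule has_derivative_transform_within_open[OF _ open_upper_halfspace x])
    fix y :: "'n ambient" assume "y \<in> upper"
    then have "y \<in> cupper" using upper_subset_closed_upper by blast
    then show "s * gaugeS (y /\<^sub>R s) = gaugeS y" using s by (simp add: gauge_scale)
  qed
qed

lemma nu_lower_bound:
  obtains \<delta> where "\<delta> > 0" "\<forall>p\<in>S. p \<bullet> \<nu> p \<ge> \<delta>"
proof -
  have "continuous_on S (\<lambda>p. p \<bullet> \<nu> p)" by (intro continuous_intros nu_cont)
  then obtain a where "a \<in> S" "\<forall>p\<in>S. a \<bullet> \<nu> a \<le> p \<bullet> \<nu> p"
    using continuous_attains_inf[OF S_compact S_nonempty] by blast
  then show ?thesis using that[of "a \<bullet> \<nu> a"] nu_pos by blast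
qed

text \<open>The gradient has norm 1 / (p . \<nu> p), which is bounded by compactness of S; the open
  half-space is convex, and continuity extends the estimate to its closure.\<close>

lemma gauge_lipschitz:
  obtains L where "L > 0" "\<forall>x\<in>cupper. \<forall>y\<in>cupper. \<bar>gaugeS x - gaugeS y\<bar> \<le> L * norm (x - y)"
proof -
  obtain \<delta> where d0: "\<delta> > 0" and d: "\<forall>p\<in>S. p \<bullet> \<nu> p \<ge> \<delta>" by (rule nu_lower_bound) (rule that)
  define L where "L = 1 / \<delta>"
  have gr: "norm (grad x) \<le> L" if "x \<in> upper" for x
  proof -
    have "proj x \<in> S" using proj_upper[OF that] by blast
    then have "norm (grad x) = 1 / (proj x \<bullet> \<nu> (proj x))" "proj x \<bullet> \<nu> (proj x) \<ge> \<delta>"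
      using nu_norm nu_pos d by (simp_all add: grad_def divide_inverse less_imp_le)
    then show ?thesis using d0 by (simp add: L_def frac_le)
  qed
  have up: "norm (gaugeS x - gaugeS y) \<le> L * norm (x - y)" if "x \<in> upper" "y \<in> upper" for x y
  proof (rule differentiable_bound[OF convex_upper_halfspace _ _ that])
    fix z :: "'n ambient" assume z: "z \<in> upper"
    show "(gaugeS has_derivative (\<lambda>v. v \<bullet> grad z)) (at z within upper)"
      using gauge_derivative[OF z] by (rule has_derivative_at_withinI)
    show "onorm (\<lambda>v. v \<bullet> grad z) \<le> L"
    proof (rule onorm_bound)
      show "0 \<le> L" using d0 by (simp add: L_def)
      fix v :: "'n ambient"
      have "norm (v \<bullet> grad z) \<le> norm v * norm (grad z)" using Cauchy_Schwarz_ineq2 by simp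
      also have "\<dots> \<le> norm v * L" using gr[OF z] by (intro mult_left_mono) auto
      finally show "norm (v \<bullet> grad z) \<le> L * norm v" by (simp add: mult.commute)
    qed
  qed
  have "closure upper = (cupper :: 'n ambient set)" using closure_halfspace_gt[of "E_last :: 'n ambient" 0] by (simp add: halfspaces_snd)
  moreover have "L-lipschitz_on upper gaugeS" using up d0 by (intro lipschitz_onI) (auto simp: dist_norm L_def)
  ultimately have "L-lipschitz_on cupper gaugeS" using lipschitz_on_closure[of L upper gaugeS] gauge_continuous by simp
  then show ?thesis using d0 by (intro that[of L]) (auto simp: L_def dist_norm dest: lipschitz_onD)
qed

text \<open>A one-sided velocity is enough: \<gamma> t - p divided by t converges, and by
  \<open>first_order\<close> its component along \<nu> p tends to 0.\<close>

lemma normal_curve: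
  assumes p: "p \<in> S" and lim: "((\<lambda>t. (\<gamma> t - p) /\<^sub>R t) \<longlongrightarrow> w) (at_right 0)"
    and ev: "eventually (\<lambda>t. \<gamma> t \<in> S) (at_right 0)"
  shows "\<nu> p \<bullet> w = 0"
proof -
  define h where "h q = \<nu> p \<bullet> (q - p) / norm (q - p)" for q
  have pos: "eventually (\<lambda>t::real. t > 0) (at_right 0)" by (simp add: eventually_at_right_less)
  have "((\<lambda>t. p + t *\<^sub>R ((\<gamma> t - p) /\<^sub>R t)) \<longlongrightarrow> p + 0 *\<^sub>R w) (at_right 0)" by (intro tendsto_intros lim)
  moreover have "eventually (\<lambda>t. p + t *\<^sub>R ((\<gamma> t - p) /\<^sub>R t) = \<gamma> t) (at_right 0)"
    using pos by eventually_elim simp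
  ultimately have g: "(\<gamma> \<longlongrightarrow> p) (at_right 0)" using Lim_transform_eventually by fastforce
  have "((\<lambda>t. h (\<gamma> t)) \<longlongrightarrow> 0) (at_right 0)"
  proof (rule tendstoI)
    fix e :: real assume e: "e > 0"
    have "eventually (\<lambda>q. dist (h q) 0 < e) (at p within S)" using tendstoD[OF first_order[OF p] e] by (simp add: h_def)
    then obtain d where d: "d > 0" "\<forall>q\<in>S. q \<noteq> p \<and> dist q p < d \<longrightarrow> dist (h q) 0 < e"
      unfolding eventually_at by blast
    have "eventually (\<lambda>t. dist (\<gamma> t) p < d) (at_right 0)" using tendstoD[OF g d(1)] .
    with ev show "eventually (\<lambda>t. dist (h (\<gamma> t)) 0 < e) (at_right 0)"
    proof eventually_elim
      case (elim t)
      then show ?case using d(2) e by (cases "\<gamma> t = p") (auto simp: h_def)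
    qed
  qed
  then have "((\<lambda>t. h (\<gamma> t) * norm ((\<gamma> t - p) /\<^sub>R t)) \<longlongrightarrow> 0 * norm w) (at_right 0)"
    by (intro tendsto_intros lim)
  moreover have "eventually (\<lambda>t. h (\<gamma> t) * norm ((\<gamma> t - p) /\<^sub>R t) = \<nu> p \<bullet> ((\<gamma> t - p) /\<^sub>R t)) (at_right 0)"
    using pos
  proof eventually_elim
    case (elim t)
    then show ?case by (cases "\<gamma> t = p") (simp_all add: h_def)
  qed
  ultimately have "((\<lambda>t. \<nu> p \<bullet> ((\<gamma> t - p) /\<^sub>R t)) \<longlongrightarrow> 0) (at_right 0)"
    using Lim_transform_eventually by fastforce
  moreover have "((\<lambda>t. \<nu> p \<bullet> ((\<gamma> t - p) /\<^sub>R t)) \<longlongrightarrow> \<nu> p \<bullet> w) (at_right 0)" by (intro tendsto_intros lim)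
  ultimately show ?thesis using tendsto_unique trivial_limit_at_right_real by blast
qed

lemma upper_curve:
  assumes p: "p \<in> S" "snd p = 0" and lim: "((\<lambda>t. (\<gamma> t - p) /\<^sub>R t) \<longlongrightarrow> w) (at_right 0)"
    and ev: "eventually (\<lambda>t. \<gamma> t \<in> S) (at_right 0)"
  shows "snd w \<ge> 0"
proof -
  have "((\<lambda>t. snd ((\<gamma> t - p) /\<^sub>R t)) \<longlongrightarrow> snd w) (at_right 0)" by (intro tendsto_intros lim)
  moreover have "eventually (\<lambda>t. 0 \<le> snd ((\<gamma> t - p) /\<^sub>R t)) (at_right 0)" using ev eventually_at_right_less[of 0]
  proof eventually_elim
    case (elim t)
    then have "snd (\<gamma> t) \<ge> 0" using S_closed_upper by (auto simp: halfspaces_snd)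
    then show ?case using elim p(2) by simp
  qed
  ultimately show ?thesis by (intro tendsto_lowerbound[of _ _ "at_right 0"]) auto
qed

text \<open>With an interior chart at a point p of the hyperplane, every tangent vector and its
  negative would be velocities of curves in S. As S stays in the closed half-space, all tangent
  vectors would be horizontal; by dimension the horizontal vector p would then be tangent, against p
  . \<nu> p > 0.\<close>

lemma manifold_interior_S: "manifold_interior S = S \<inter> upper"
proof
  show "manifold_interior S \<subseteq> S \<inter> upper"
  proof
    fix p assume "p \<in> manifold_interior S"
    then obtain U \<phi> where "interior_chart S p U \<phi>" unfolding manifold_interior_def by blast
    then obtain V where ch: "p \<in> S" "p \<in> U" "diffeomorphism U V \<phi>" "\<phi> ` (S \<inter> U) = V \<inter> {x. snd x = 0}"
      unfolding interior_chart_def by blast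
    have "snd p \<noteq> 0"
    proof
      assume sp: "snd p = 0"
      let ?D = "frechet_derivative \<phi> (at p)"
      have "\<phi> p \<in> \<phi> ` (S \<inter> U)" using ch by blast
      then have s0: "snd (\<phi> p) = 0" using ch(4) by blast
      have lin: "linear ?D" using diffeomorphism_derivative[OF ch(3,2)] by blast
      have tang: "\<nu> p \<bullet> v = 0 \<and> snd v \<ge> 0" if v: "snd (?D v) = 0" for v
      proof -
        have "eventually (\<lambda>t. \<phi> p + t *\<^sub>R ?D v \<in> {x. snd x = 0}) (at_right 0)" using v s0 by simp
        from chart_curve[OF ch(3,2,4) this]
      obtain \<gamma> where "((\<lambda>t. (\<gamma> t - p) /\<^sub>R t) \<longlongrightarrow> v) (at_right 0)" "eventually (\<lambda>t. \<gamma> t \<in> S) (at_right 0)" by blast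
        then show ?thesis using normal_curve[OF ch(1)] upper_curve[OF ch(1) sp] by blast
      qed
      have snd0: "snd v = 0" if v: "snd (?D v) = 0" for v using tang[OF v] tang[of "- v"] v lin by (simp add: linear_neg)
      obtain u where u: "?D u = (0, 1)" using diffeomorphism_derivative(2)[OF ch(3,2)] by metis
      have "snd x = snd (?D x) * snd u" for x :: "'n ambient"
        by (rule linear_functional_kernel[OF linear_snd_frechet[OF lin]]) (simp_all add: u snd0 linear_snd)
      from this[of E_last] this[of p] sp have "snd (?D p) = 0" by auto
      then have "\<nu> p \<bullet> p = 0" using tang by blast
      then show False using nu_pos[OF ch(1)] by (simp add: inner_commute)
    qed
    then show "p \<in> S \<inter> upper" using ch(1) S_closed_upper by (force simp: halfspaces_snd)
  qed
  show "S \<inter> upper \<subseteq> manifold_interior S" by (rule chart)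
qed

text \<open>In a boundary chart only tangent vectors pointing into the half-space are obtained as
  velocities of curves in S; the others are negatives of such vectors.\<close>

lemma nu_tangent_space:
  assumes p: "p \<in> S" and v: "v \<in> tangent_space S p"
  shows "\<nu> p \<bullet> v = 0"
proof -
  obtain U \<phi> where c: "interior_chart S p U \<phi> \<or> boundary_chart S p U \<phi>" and v0: "snd (frechet_derivative \<phi> (at p) v) = 0"
    using v by (auto simp: tangent_space_def)
  let ?D = "frechet_derivative \<phi> (at p)"
  show ?thesis
  proof (cases "interior_chart S p U \<phi>")
    case True
    then obtain V where ch: "p \<in> U" "diffeomorphism U V \<phi>" "\<phi> ` (S \<inter> U) = V \<inter> {x. snd x = 0}"
      by (auto simp: interior_chart_def)
    have "\<phi> p \<in> \<phi> ` (S \<inter> U)" using ch p by blast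
    then have s0: "snd (\<phi> p) = 0" using ch(3) by blast
    have "eventually (\<lambda>t. \<phi> p + t *\<^sub>R ?D v \<in> {x. snd x = 0}) (at_right 0)" using v0 s0 by simp
    from chart_curve[OF ch(2,1,3) this]
    obtain \<gamma> where "((\<lambda>t. (\<gamma> t - p) /\<^sub>R t) \<longlongrightarrow> v) (at_right 0)" "eventually (\<lambda>t. \<gamma> t \<in> S) (at_right 0)" by blast
    then show ?thesis using normal_curve[OF p] by blast
  next
    case False
    with c obtain V k where ch: "p \<in> U" "diffeomorphism U V \<phi>"
        "\<phi> ` (S \<inter> U) = V \<inter> {x. snd x = 0 \<and> fst x $ k \<ge> 0}" "fst (\<phi> p) $ k = 0"
      by (auto simp: boundary_chart_def)
    have "\<phi> p \<in> \<phi> ` (S \<inter> U)" using ch p by blast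
    then have s0: "snd (\<phi> p) = 0" using ch(3) by blast
    have lin: "linear ?D" using diffeomorphism_derivative[OF ch(2,1)] by blast
    have *: "\<nu> p \<bullet> v = 0" if v: "snd (?D v) = 0" "fst (?D v) $ k \<ge> 0" for v
    proof -
      have "eventually (\<lambda>t. \<phi> p + t *\<^sub>R ?D v \<in> {x. snd x = 0 \<and> fst x $ k \<ge> 0}) (at_right 0)"
        using eventually_at_right_less[of 0] by eventually_elim (use v s0 ch(4) in simp)
      from chart_curve[OF ch(2,1,3) this]
      obtain \<gamma> where "((\<lambda>t. (\<gamma> t - p) /\<^sub>R t) \<longlongrightarrow> v) (at_right 0)" "eventually (\<lambda>t. \<gamma> t \<in> S) (at_right 0)" by blast
      then show ?thesis using normal_curve[OF p] by blast
    qed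
    show ?thesis
    proof (cases "fst (?D v) $ k \<ge> 0")
      case True
      then show ?thesis using * v0 by blast
    next
      case False
      then have "\<nu> p \<bullet> (- v) = 0" using v0 lin by (intro *) (simp_all add: linear_neg)
      then show ?thesis by simp
    qed
  qed
qed

lemma unit_normal_nu: "unit_normal_field S \<nu>"
  unfolding unit_normal_field_def using nu_cont nu_norm nu_tangent_space by blast

text \<open>The gauge has positive derivative 1 / (p . \<nu> p) in the direction \<nu> p, so it
  crosses the value 1 there.\<close>

lemma outward_nu: "outward_normal_field S \<nu>"
  unfolding outward_normal_field_def
proof (intro conjI ballI unit_normal_nu)
  fix p assume "p \<in> manifold_interior S"
  then have p: "p \<in> S" "p \<in> upper" using manifold_interior_S by auto
  have pc: "p \<in> cupper" using p S_closed_upper by blast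
  define c where "c = 1 / (p \<bullet> \<nu> p)"
  have c: "c > 0" using nu_pos[OF p(1)] by (simp add: c_def)
  have nn: "\<nu> p \<bullet> \<nu> p = 1" using nu_norm[OF p(1)] by (simp add: dot_square_norm)
  have dq: "((\<lambda>t. (gaugeS (p + t *\<^sub>R (s *\<^sub>R \<nu> p)) - 1) /\<^sub>R t) \<longlongrightarrow> s * c) (at_right 0)" for s
  proof -
    have line: "((\<lambda>t. p + t *\<^sub>R (s *\<^sub>R \<nu> p)) has_derivative (\<lambda>t. t *\<^sub>R (s *\<^sub>R \<nu> p))) (at 0)"
      by (auto intro!: derivative_eq_intros)
    have "((\<lambda>t. gaugeS (p + t *\<^sub>R (s *\<^sub>R \<nu> p))) has_derivative (\<lambda>t. t *\<^sub>R (s *\<^sub>R \<nu> p) \<bullet> (\<nu> p /\<^sub>R (p \<bullet> \<nu> p)))) (at 0)"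
      using has_derivative_compose[OF line, of gaugeS "\<lambda>v. v \<bullet> (\<nu> p /\<^sub>R (p \<bullet> \<nu> p))"] gauge_derivative_S[OF p] by simp
    moreover have "(\<lambda>t. t *\<^sub>R (s *\<^sub>R \<nu> p) \<bullet> (\<nu> p /\<^sub>R (p \<bullet> \<nu> p))) = (\<lambda>t. t *\<^sub>R (s * c))"
      using nn by (simp add: c_def divide_inverse fun_eq_iff)
    ultimately show ?thesis
      using has_derivative_quotient_tendsto[of "\<lambda>t. gaugeS (p + t *\<^sub>R (s *\<^sub>R \<nu> p))" "s * c"] by (simp add: gauge_S[OF p(1)])
  qed
  have "eventually (\<lambda>t. (gaugeS (p + t *\<^sub>R (1 *\<^sub>R \<nu> p)) - 1) /\<^sub>R t > 0) (at_right 0)"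
    by (rule order_tendstoD(1)[OF dq[of 1]]) (use c in simp)
  moreover have "eventually (\<lambda>t. (gaugeS (p + t *\<^sub>R ((-1) *\<^sub>R \<nu> p)) - 1) /\<^sub>R t < 0) (at_right 0)"
    by (rule order_tendstoD(2)[OF dq[of "-1"]]) (use c in simp)
  moreover have "eventually (\<lambda>t. p - t *\<^sub>R \<nu> p \<in> upper) (at_right 0)"
  proof -
    have "((\<lambda>t. p - t *\<^sub>R \<nu> p) \<longlongrightarrow> p - 0 *\<^sub>R \<nu> p) (at_right 0)" by (intro tendsto_intros)
    then show ?thesis using p(2) by (intro topological_tendstoD) auto
  qed
  ultimately show "\<forall>\<^sub>F t in at_right 0. p + t *\<^sub>R \<nu> p \<notin> enclosed S \<and> p - t *\<^sub>R \<nu> p \<in> enclosed S"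
    using eventually_at_right_less[of 0]
  proof eventually_elim
    case (elim t)
    have 1: "gaugeS (p + t *\<^sub>R \<nu> p) > 1" using elim by (simp add: zero_less_mult_iff)
    have 2: "gaugeS (p - t *\<^sub>R \<nu> p) < 1" using elim by (simp add: mult_less_0_iff)
    show ?case unfolding enclosed_eq cregion_def using 1 2 elim upper_subset_closed_upper by auto
  qed
qed

lemma S_upper_limit:
  assumes p: "p \<in> S"
  shows "((\<lambda>t. proj (p + t *\<^sub>R E_last)) \<longlongrightarrow> p) (at_right 0)"
    "eventually (\<lambda>t. proj (p + t *\<^sub>R E_last) \<in> S \<inter> upper) (at_right 0)"
proof -
  have up: "eventually (\<lambda>t. p + t *\<^sub>R E_last \<in> upper) (at_right 0)" using eventually_at_right_less[of 0]
    by eventually_elim (use p S_closed_upper in \<open>auto simp: halfspaces_snd subset_iff intro: add_nonneg_pos\<close>)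
  then show "eventually (\<lambda>t. proj (p + t *\<^sub>R E_last) \<in> S \<inter> upper) (at_right 0)"
    by eventually_elim (rule proj_upper)
  have "((\<lambda>t. p + t *\<^sub>R E_last) \<longlongrightarrow> p + 0 *\<^sub>R E_last) (at_right 0)" by (intro tendsto_intros)
  then have "((\<lambda>t. p + t *\<^sub>R E_last) \<longlongrightarrow> p) (at_right 0)" by simp
  moreover have "p \<in> cupper - {0}" using p S_closed_upper S_not_zero by blast
  moreover have "eventually (\<lambda>t. p + t *\<^sub>R E_last \<in> cupper - {0}) (at_right 0)"
    using up by eventually_elim (use upper_subset_closed_upper upper_not_zero in blast)
  ultimately have "((\<lambda>t. proj (p + t *\<^sub>R E_last)) \<longlongrightarrow> proj p) (at_right 0)"
    using continuous_on_tendsto_compose[OF proj_continuous] by blast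
  then show "((\<lambda>t. proj (p + t *\<^sub>R E_last)) \<longlongrightarrow> p) (at_right 0)" by (simp add: proj_S p)
qed

text \<open>Points of S on the hyperplane are limits of the points proj (p + t
  \<open>E_last\<close>), which lie in the open half-space.\<close>

lemma eq_on_S:
  fixes f h :: "'n ambient \<Rightarrow> 'b::t2_space"
  assumes f: "continuous_on S f" and h: "continuous_on S h" and eq: "\<And>q. q \<in> S \<inter> upper \<Longrightarrow> f q = h q"
    and p: "p \<in> S"
  shows "f p = h p"
proof -
  let ?q = "\<lambda>t. proj (p + t *\<^sub>R E_last)"
  have evS: "eventually (\<lambda>t. ?q t \<in> S) (at_right 0)" using S_upper_limit(2)[OF p] by eventually_elim blast
  have lf: "((\<lambda>t. f (?q t)) \<longlongrightarrow> f p) (at_right 0)" and lh: "((\<lambda>t. h (?q t)) \<longlongrightarrow> h p) (at_right 0)"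
    using continuous_on_tendsto_compose[OF f S_upper_limit(1)[OF p] p evS]
      continuous_on_tendsto_compose[OF h S_upper_limit(1)[OF p] p evS] by auto
  have "eventually (\<lambda>t. f (?q t) = h (?q t)) (at_right 0)" using S_upper_limit(2)[OF p] by eventually_elim (rule eq)
  from Lim_transform_eventually[OF lf this] have "((\<lambda>t. h (?q t)) \<longlongrightarrow> f p) (at_right 0)" .
  then show ?thesis using lh tendsto_unique trivial_limit_at_right_real by blast
qed

text \<open>At an interior point both normals annihilate the kernel of the same functional, so they
  agree up to sign, and outwardness excludes the opposite sign. Continuity covers the
  boundary.\<close>

lemma outward_normal_unique:
  assumes n: "outward_normal_field S n" and p: "p \<in> S"
  shows "n p = \<nu> p"
proof (rule eq_on_S[OF _ nu_cont _ p])
  show "continuous_on S n" using n by (simp add: outward_normal_field_def unit_normal_field_def)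
  fix p assume p: "p \<in> S \<inter> upper"
  then have pS: "p \<in> S" by blast
  have pi: "p \<in> manifold_interior S" using p chart by blast
  then obtain U \<phi> where ch0: "interior_chart S p U \<phi>" unfolding manifold_interior_def by blast
  then obtain V where ch1: "p \<in> U" "diffeomorphism U V \<phi>" unfolding interior_chart_def by blast
  note ch = ch0 ch1
  let ?D = "frechet_derivative \<phi> (at p)"
  have lin: "linear ?D" using diffeomorphism_derivative[OF ch(3,2)] by blast
  obtain D' where "\<forall>w. ?D (D' w) = w" using diffeomorphism_derivative(2)[OF ch(3,2)] by blast
  then have "?D (D' (0, 1)) = (0, 1)" by blast
  then obtain u where u: "?D u = (0, 1)" by blast
  have tan: "v \<in> tangent_space S p" if "snd (?D v) = 0" for v using ch(1) that by (auto simp: tangent_space_def)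
  have lm: "linear (\<lambda>v. m \<bullet> v)" for m :: "'n ambient" by (intro linearI) (simp_all add: inner_add_right)
  have e1: "\<nu> p \<bullet> x = snd (?D x) * (\<nu> p \<bullet> u)" for x
    by (rule linear_functional_kernel[OF linear_snd_frechet[OF lin] _ lm]) (simp add: u, blast intro: tan nu_tangent_space[OF pS])
  have nt: "n p \<bullet> v = 0" if "v \<in> tangent_space S p" for v
    using n pS that by (simp add: outward_normal_field_def unit_normal_field_def)
  have e2: "n p \<bullet> x = snd (?D x) * (n p \<bullet> u)" for x
    by (rule linear_functional_kernel[OF linear_snd_frechet[OF lin] _ lm]) (simp add: u, blast intro: tan nt)
  have "\<nu> p \<bullet> u \<noteq> 0"
  proof
    assume "\<nu> p \<bullet> u = 0"
    then have "\<nu> p \<bullet> \<nu> p = 0" using e1[of "\<nu> p"] by (metis mult_zero_right)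
    then show False using nu_norm[OF pS] by simp
  qed
  define k where "k = (n p \<bullet> u) / (\<nu> p \<bullet> u)"
  have "n p \<bullet> x = (k *\<^sub>R \<nu> p) \<bullet> x" for x
    using e1[of x] e2[of x] \<open>\<nu> p \<bullet> u \<noteq> 0\<close> by (simp add: k_def)
  then have nk: "n p = k *\<^sub>R \<nu> p" using vector_eq_rdot by blast
  have "norm (n p) = 1" using n pS by (simp add: outward_normal_field_def unit_normal_field_def)
  then have "\<bar>k\<bar> = 1" using nk nu_norm[OF pS] by simp
  moreover have "k \<noteq> -1"
  proof
    assume "k = -1"
    then have "n p = - \<nu> p" using nk by simp
    have "\<forall>\<^sub>F t in at_right 0. p + t *\<^sub>R n p \<notin> enclosed S \<and> p - t *\<^sub>R n p \<in> enclosed S"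
      using n pi unfolding outward_normal_field_def by blast
    moreover have "\<forall>\<^sub>F t in at_right 0. p + t *\<^sub>R \<nu> p \<notin> enclosed S \<and> p - t *\<^sub>R \<nu> p \<in> enclosed S"
      using outward_nu pi unfolding outward_normal_field_def by blast
    ultimately have "\<forall>\<^sub>F t in at_right (0::real). False" by eventually_elim (simp add: \<open>n p = - \<nu> p\<close>)
    then show False by simp
  qed
  ultimately have "k = 1" by linarith
  then show "n p = \<nu> p" using nk by simp
qed

lemma outward_normal_eq: "p \<in> S \<Longrightarrow> outward_normal S p = \<nu> p"
  using outward_normal_unique[of "outward_normal S"] someI[of "outward_normal_field S", OF outward_nu] by (simp add: outward_normal_def)

end

section \<open>The area measure\<close>

lemma continuous_on_det:
  fixes A :: "'a::topological_space \<Rightarrow> real ^ 'n::finite ^ 'n"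
  assumes "\<And>i j. continuous_on X (\<lambda>x. A x $ i $ j)"
  shows "continuous_on X (\<lambda>x. det (A x))"
  unfolding det_def by (intro continuous_intros assms)

lemma emeasure_ambient_slices:
  fixes A :: "'n::finite ambient set"
  assumes "A \<in> sets borel"
  shows "emeasure lborel A = (\<integral>\<^sup>+h. emeasure lborel {w. (w, h) \<in> A} \<partial>lborel)"
proof -
  have A: "A \<in> sets (lborel \<Otimes>\<^sub>M (lborel :: real measure))" using assms by (metis lborel_prod sets_lborel)
  have "emeasure (lborel \<Otimes>\<^sub>M (lborel :: real measure)) A = (\<integral>\<^sup>+h. emeasure lborel ((\<lambda>w. (w, h)) -` A) \<partial>lborel)"
    by (rule lborel_pair.emeasure_pair_measure_alt2[OF A])
  then show ?thesis by (simp add: lborel_prod vimage_def)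
qed

lemma compact_linear_map_image:
  fixes f :: "'a::euclidean_space \<Rightarrow> 'b::real_normed_vector"
  assumes "linear f" "compact A"
  shows "compact (f ` A)"
proof -
  have "bounded_linear f" using assms(1) by (simp add: linear_conv_bounded_linear)
  then show ?thesis by (intro compact_continuous_image linear_continuous_on assms(2))
qed

lemma vol_factor_compose:
  fixes A B :: "'n::finite ambient \<Rightarrow> 'n ambient"
  assumes A: "linear A" and B: "linear B"
  shows "vol_factor (A \<circ> B) = vol_factor A * vol_factor B"
proof -
  have "compact (B ` cbox 0 One)" by (intro compact_linear_map_image B compact_cbox)
  from measure_linear_image_ambient[OF A this] show ?thesis by (simp add: vol_factor_def image_comp)
qed

text \<open>The Householder reflection in the hyperplane orthogonal to \<nu> - e.\<close>

lemma exists_reflection: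
  fixes \<nu> e :: "'a::euclidean_space"
  assumes "norm \<nu> = 1" "norm e = 1"
  obtains R :: "'a \<Rightarrow> 'a" where "linear R" "\<And>x. R (R x) = x" "\<And>x y. R x \<bullet> R y = x \<bullet> y" "R e = \<nu>" "R \<nu> = e"
proof (cases "\<nu> = e")
  case True
  then show ?thesis by (intro that[of "\<lambda>x. x"]) (auto simp: linear_ident)
next
  case False
  define u where "u = \<nu> - e"
  have uu: "u \<bullet> u \<noteq> 0" using False by (simp add: u_def)
  define R where "R x = x - (2 * (x \<bullet> u) / (u \<bullet> u)) *\<^sub>R u" for x
  have lin: "linear R" by (intro linearI) (simp_all add: R_def inner_add_left algebra_simps add_divide_distrib)
  have Ru: "R u = - u" using uu by (simp add: R_def scaleR_2)
  have RR: "R (R x) = x" for x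
  proof -
    define k where "k = 2 * (x \<bullet> u) / (u \<bullet> u)"
    have Rx: "R x = x - k *\<^sub>R u" by (simp only: R_def k_def)
    have "R (x - k *\<^sub>R u) = R x - k *\<^sub>R R u" using lin by (simp only: linear_diff linear_cmul)
    then show ?thesis by (simp add: Rx Ru)
  qed
  have inn: "R x \<bullet> R y = x \<bullet> y" for x y
  proof -
    define a b where "a = 2 * (x \<bullet> u) / (u \<bullet> u)" and "b = 2 * (y \<bullet> u) / (u \<bullet> u)"
    have "a * (u \<bullet> u) = 2 * (x \<bullet> u)" "b * (u \<bullet> u) = 2 * (y \<bullet> u)" using uu by (simp_all add: a_def b_def)
    then have e: "a * b * (u \<bullet> u) = 2 * (b * (x \<bullet> u))" "a * b * (u \<bullet> u) = 2 * (a * (y \<bullet> u))" by algebra+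
    have "R x \<bullet> R y = (x - a *\<^sub>R u) \<bullet> (y - b *\<^sub>R u)" by (simp only: R_def a_def b_def)
    also have "\<dots> = x \<bullet> y - b * (x \<bullet> u) - a * (y \<bullet> u) + a * b * (u \<bullet> u)"
      by (simp add: inner_diff_left inner_diff_right inner_commute[of u y] algebra_simps)
    finally show ?thesis using e by linarith
  qed
  have nn: "\<nu> \<bullet> \<nu> = 1" "e \<bullet> e = 1" using assms by (simp_all add: dot_square_norm)
  have "2 * (e \<bullet> u) = - (u \<bullet> u)" using nn by (simp add: u_def inner_diff_left inner_diff_right inner_commute)
  then have "R e = e + u" using uu by (simp add: R_def)
  then have Re: "R e = \<nu>" by (simp add: u_def)
  then have "R \<nu> = e" using RR by metis
  then show ?thesis by (rule that[OF lin RR inn Re])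
qed

text \<open>An isometric involution maps the unit ball onto itself, and this ball has positive
  volume.\<close>

lemma vol_factor_isometry:
  fixes R :: "'n::finite ambient \<Rightarrow> 'n ambient"
  assumes "linear R" "\<And>x. R (R x) = x" "\<And>x y. R x \<bullet> R y = x \<bullet> y"
  shows "vol_factor R = 1"
proof -
  have nR: "norm (R x) = norm x" for x using assms(3)[of x x] by (simp add: norm_eq_sqrt_inner)
  have "R ` cball 0 1 = cball 0 1"
  proof
    show "cball 0 1 \<subseteq> R ` cball 0 1"
    proof
      fix x :: "'n ambient" assume "x \<in> cball 0 1"
      then have "R x \<in> cball 0 1" "x = R (R x)" using nR assms(2) by simp_all
      then show "x \<in> R ` cball 0 1" by blast
    qed
  qed (use nR in auto)
  then have "vol (cball (0::'n ambient) 1) = vol_factor R * vol (cball (0::'n ambient) 1)"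
    using measure_linear_image_ambient[OF assms(1) compact_cball, of 0 1] by simp
  moreover have "vol (cball (0::'n ambient) 1) > 0"
  proof -
    have "vol (ball (0::'n ambient) 1) > 0" by (rule open_measure_pos) auto
    also have "vol (ball (0::'n ambient) 1) \<le> vol (cball (0::'n ambient) 1)" by (rule measure_mono_fmeasurable) auto
    finally show ?thesis .
  qed
  ultimately show ?thesis by simp
qed

lemma cbox_One_ambient: "cbox 0 (One :: 'n::finite ambient) = cbox 0 One \<times> {0..1}"
proof -
  have "(One :: 'n ambient) = (One, 1)"
  proof (rule euclidean_eqI)
    fix b :: "'n ambient" assume b: "b \<in> Basis"
    then have "(One, 1) \<bullet> b = 1" by (auto simp: Basis_prod_def)
    then show "One \<bullet> b = (One, 1) \<bullet> b" using b by (simp add: inner_sum_left inner_Basis)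
  qed
  then show ?thesis using cbox_Pair_eq[of "0::real^'n" "0::real" One 1] by (simp add: zero_prod_def)
qed

text \<open>A reflection moves the normal \<open>\<nu>\<close> of the range of \<open>L\<close> to the vertical direction; the image of
  the unit cube then has parallel translates as horizontal slices.\<close>

lemma vol_factor_cone:
  fixes L :: "real ^ 'n::finite \<Rightarrow> 'n ambient"
  assumes L: "linear L" and nu: "norm \<nu> = 1" "\<And>v. \<nu> \<bullet> L v = 0" and c: "x \<bullet> \<nu> > 0" and t: "t \<ge> 0"
  shows "vol_factor (\<lambda>z. snd z *\<^sub>R x + t *\<^sub>R L (fst z))
    = t ^ CARD('n) * (x \<bullet> \<nu>) * sqrt (det (\<chi> i j. L (axis i 1) \<bullet> L (axis j 1)))"
proof -
  let ?A = "\<lambda>z. snd z *\<^sub>R x + t *\<^sub>R L (fst z)"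
  have nE: "norm (E_last :: 'n ambient) = 1" by (simp add: E_last_def)
  obtain R :: "'n ambient \<Rightarrow> 'n ambient" where R: "linear R" "\<And>x. R (R x) = x" "\<And>x y. R x \<bullet> R y = x \<bullet> y"
      "R E_last = \<nu>" "R \<nu> = E_last" by (rule exists_reflection[OF nu(1) nE]) (rule that)
  have sR: "snd (R z) = z \<bullet> \<nu>" for z using R(3)[of z \<nu>] R(5) by simp
  define P where "P v = fst (R (L v))" for v
  have P: "linear P" unfolding P_def using L R(1) by (intro linearI) (simp_all add: linear_add linear_cmul)
  have RL: "R (L v) = (P v, 0)" for v using sR[of "L v"] nu(2)[of v] by (simp add: P_def prod_eq_iff inner_commute)
  define c where "c = x \<bullet> \<nu>"
  define w where "w = fst (R x)"
  have Rx: "R x = (w, c)" by (simp add: w_def c_def prod_eq_iff sR)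
  have c0: "c > 0" using c by (simp add: c_def)
  have RA: "R (?A z) = (snd z *\<^sub>R w + t *\<^sub>R P (fst z), snd z * c)" for z using R(1) by (simp add: linear_add linear_cmul Rx RL)
  have linA: "linear ?A" using L by (intro linearI) (simp_all add: linear_add linear_cmul algebra_simps)
  have linRA: "linear (\<lambda>z. R (?A z))" using linear_compose[OF linA R(1)] by (simp add: o_def)
  let ?Q = "P ` cbox 0 One"
  have cQ: "compact ?Q" by (intro compact_linear_map_image P compact_cbox)
  have mQ: "vol ?Q = \<bar>det (matrix P)\<bar>" using vol_factor_matrix(1)[OF P] by (simp add: vol_factor_def)
  let ?I = "(\<lambda>z. R (?A z)) ` cbox 0 One"
  have cI: "compact ?I" by (intro compact_linear_map_image linRA compact_cbox)
  \<comment> \<open>The height of the image is c = x . \<nu>; the shift (h / c) w records how x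
    leans away from the normal.\<close>
  have slice: "{w'. (w', h) \<in> ?I} = (if 0 \<le> h \<and> h \<le> c then (\<lambda>v. t *\<^sub>R v + (h / c) *\<^sub>R w) ` ?Q else {})" for h
  proof (cases "0 \<le> h \<and> h \<le> c")
    case True
    have "{w'. (w', h) \<in> ?I} = (\<lambda>v. t *\<^sub>R v + (h / c) *\<^sub>R w) ` ?Q"
    proof
      show "{w'. (w', h) \<in> ?I} \<subseteq> (\<lambda>v. t *\<^sub>R v + (h / c) *\<^sub>R w) ` ?Q"
      proof
        fix w' assume "w' \<in> {w'. (w', h) \<in> ?I}"
        then obtain z :: "'n ambient" where z: "z \<in> cbox 0 One" "(w', h) = R (?A z)" by auto
        then have "h = snd z * c" "w' = snd z *\<^sub>R w + t *\<^sub>R P (fst z)" "fst z \<in> cbox 0 One"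
          using RA[of z] unfolding cbox_One_ambient by (auto simp: prod_eq_iff)
        then show "w' \<in> (\<lambda>v. t *\<^sub>R v + (h / c) *\<^sub>R w) ` ?Q" using c0 by (auto simp: add.commute)
      qed
      show "(\<lambda>v. t *\<^sub>R v + (h / c) *\<^sub>R w) ` ?Q \<subseteq> {w'. (w', h) \<in> ?I}"
      proof
        fix w' assume "w' \<in> (\<lambda>v. t *\<^sub>R v + (h / c) *\<^sub>R w) ` ?Q"
        then obtain v where v: "v \<in> cbox 0 One" "w' = t *\<^sub>R P v + (h / c) *\<^sub>R w" by auto
        have "(v, h / c) \<in> cbox 0 (One :: 'n ambient)" unfolding cbox_One_ambient using v True c0 by simp
        moreover have "R (?A (v, h / c)) = (w', h)" using RA[of "(v, h / c)"] v c0 by (simp add: add.commute)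
        ultimately show "w' \<in> {w'. (w', h) \<in> ?I}" by (metis (mono_tags, lifting) image_eqI mem_Collect_eq)
      qed
    qed
    then show ?thesis using True by simp
  next
    case False
    have "(w', h) \<notin> ?I" for w'
    proof
      assume "(w', h) \<in> ?I"
      then obtain z :: "'n ambient" where z: "z \<in> cbox 0 One" "(w', h) = R (?A z)" by auto
      then have "h = snd z * c" "0 \<le> snd z" "snd z \<le> 1" using RA[of z] unfolding cbox_One_ambient by (auto simp: prod_eq_iff)
      then show False using False c0 by (simp add: mult_le_cancel_right1)
    qed
    then show ?thesis using False by simp
  qed
  have sl: "emeasure lborel {w'. (w', h) \<in> ?I} = ennreal (t ^ CARD('n) * \<bar>det (matrix P)\<bar>) * indicator {0..c} h" for h
  proof (cases "0 \<le> h \<and> h \<le> c")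
    case True
    let ?T = "(\<lambda>v. t *\<^sub>R v + (h / c) *\<^sub>R w) ` ?Q"
    have "compact ?T" by (intro compact_continuous_image cQ continuous_intros)
    then have "emeasure lborel ?T = ennreal (vol ?T)"
      using emeasure_compact_finite[of ?T] by (simp add: emeasure_eq_ennreal_measure borel_compact)
    also have "vol ?T = t ^ CARD('n) * \<bar>det (matrix P)\<bar>" using measure_lebesgue_affine[of t "(h / c) *\<^sub>R w" ?Q] t mQ by simp
    finally show ?thesis using True slice[of h] by simp
  next
    case False
    then show ?thesis unfolding slice by (auto simp: indicator_def)
  qed
  have "ennreal (vol ?I) = emeasure lborel ?I"
    using emeasure_compact_finite[OF cI] cI by (simp add: emeasure_eq_ennreal_measure borel_compact)
  also have "\<dots> = (\<integral>\<^sup>+h. ennreal (t ^ CARD('n) * \<bar>det (matrix P)\<bar>) * indicator {0..c} h \<partial>lborel)"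
    using emeasure_ambient_slices[of ?I] cI by (simp add: sl borel_compact)
  also have "\<dots> = ennreal (t ^ CARD('n) * \<bar>det (matrix P)\<bar> * c)"
    using c0 t by (simp add: nn_integral_cmult_indicator ennreal_mult'')
  finally have "vol ?I = t ^ CARD('n) * \<bar>det (matrix P)\<bar> * c" using c0 t by (subst (asm) ennreal_inj) auto
  then have vI: "vol_factor (\<lambda>z. R (?A z)) = t ^ CARD('n) * \<bar>det (matrix P)\<bar> * c" by (simp add: vol_factor_def)
  have "vol_factor ?A = vol_factor (R \<circ> (\<lambda>z. R (?A z)))" by (simp add: R(2) o_def)
  also have "\<dots> = vol_factor (\<lambda>z. R (?A z))" using vol_factor_compose[OF R(1) linRA] vol_factor_isometry[OF R(1-3)] by simp
  also have "\<dots> = t ^ CARD('n) * \<bar>det (matrix P)\<bar> * c" by (rule vI)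
  \<comment> \<open>P is L in the reflected coordinates, so the Gram matrix of L is the transpose of
    the square matrix of P times that matrix.\<close>
  also have "\<bar>det (matrix P)\<bar> = sqrt (det (\<chi> i j. L (axis i 1) \<bullet> L (axis j 1)))"
  proof -
    have "L (axis i 1) \<bullet> L (axis j 1) = P (axis i 1) \<bullet> P (axis j 1)" for i j
      using R(3)[of "L (axis i 1)" "L (axis j 1)"] by (simp add: RL inner_prod_def)
    then have "(\<chi> i j. L (axis i 1) \<bullet> L (axis j 1)) = transpose (matrix P) ** matrix P"
      by (simp add: vec_eq_iff matrix_matrix_mult_def transpose_def matrix_def inner_vec_def)
    then have "det (\<chi> i j. L (axis i 1) \<bullet> L (axis j 1)) = (det (matrix P))\<^sup>2"
      by (simp add: det_mul det_transpose power2_eq_square)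
    then show ?thesis by simp
  qed
  finally show ?thesis by (simp add: c_def mult_ac)
qed

context radial_surface
begin

text \<open>At a parametrised point on the hyperplane all derivatives would be horizontal, because
  the parameter domain is open and S stays in the closed half-space. By injectivity they would fill
  the horizontal hyperplane and so contain the point itself, against p . \<nu> p > 0.\<close>

lemma param_upper:
  assumes lp: "local_parametrization S V \<phi>" and y: "y \<in> V"
  shows "\<phi> y \<in> S" "\<phi> y \<in> upper" "\<nu> (\<phi> y) \<bullet> frechet_derivative \<phi> (at y) v = 0"
proof -
  have V: "open V" "smooth_on \<phi> V" "inj (frechet_derivative \<phi> (at y))" "\<phi> ` V \<subseteq> S"
    using lp y by (auto simp: local_parametrization_def)
  let ?D = "frechet_derivative \<phi> (at y)"
  have d: "(\<phi> has_derivative ?D) (at y)" using smooth_on_has_derivative[OF V(2) y] .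
  have lin: "linear ?D" using d has_derivative_linear by blast
  show pS: "\<phi> y \<in> S" using V y by blast
  have curve: "((\<lambda>t. (\<phi> (y + t *\<^sub>R v) - \<phi> y) /\<^sub>R t) \<longlongrightarrow> ?D v) (at_right 0)"
    "eventually (\<lambda>t. \<phi> (y + t *\<^sub>R v) \<in> S) (at_right 0)" for v
  proof -
    have line: "((\<lambda>t. y + t *\<^sub>R v) has_derivative (\<lambda>t. t *\<^sub>R v)) (at (0::real))"
      by (auto intro!: derivative_eq_intros)
    have "((\<lambda>t. \<phi> (y + t *\<^sub>R v)) has_derivative (\<lambda>t. ?D (t *\<^sub>R v))) (at 0)"
      using has_derivative_compose[OF line, of \<phi> ?D] d by simp
    moreover have "(\<lambda>t. ?D (t *\<^sub>R v)) = (\<lambda>t. t *\<^sub>R ?D v)" using lin by (simp add: linear_cmul)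
    ultimately have "((\<lambda>t. \<phi> (y + t *\<^sub>R v)) has_derivative (\<lambda>t. t *\<^sub>R ?D v)) (at 0)" by simp
    from has_derivative_quotient_tendsto[OF this]
    show "((\<lambda>t. (\<phi> (y + t *\<^sub>R v) - \<phi> y) /\<^sub>R t) \<longlongrightarrow> ?D v) (at_right 0)" by simp
    have "((\<lambda>t. y + t *\<^sub>R v) \<longlongrightarrow> y + 0 *\<^sub>R v) (at_right 0)" by (intro tendsto_intros)
    then have "eventually (\<lambda>t. y + t *\<^sub>R v \<in> V) (at_right 0)" using V(1) y by (intro topological_tendstoD) auto
    then show "eventually (\<lambda>t. \<phi> (y + t *\<^sub>R v) \<in> S) (at_right 0)" by eventually_elim (use V(4) in blast)
  qed
  have nu0: "\<nu> (\<phi> y) \<bullet> ?D v = 0" for v using normal_curve[OF pS curve[of v]] .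
  then show "\<nu> (\<phi> y) \<bullet> ?D v = 0" .
  show "\<phi> y \<in> upper"
  proof (rule ccontr)
    assume "\<phi> y \<notin> upper"
    then have s0: "snd (\<phi> y) = 0" using pS S_closed_upper by (force simp: halfspaces_snd)
    have sv: "snd (?D v) = 0" for v
      using upper_curve[OF pS s0 curve[of v]] upper_curve[OF pS s0 curve[of "- v"]] lin by (simp add: linear_neg)
    have lf: "linear (\<lambda>v. fst (?D v))" using lin by (intro linearI) (simp_all add: linear_add linear_cmul)
    have "inj (\<lambda>v. fst (?D v))"
    proof (rule injI)
      fix a b assume "fst (?D a) = fst (?D b)"
      then have "?D a = ?D b" using sv by (simp add: prod_eq_iff)
      then show "a = b" using V(3) by (simp add: inj_eq)
    qed
    then have "surj (\<lambda>v. fst (?D v))" using linear_injective_imp_surjective[OF lf] by blast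
    then obtain v where "fst (?D v) = fst (\<phi> y)" by (metis surjD)
    then have "?D v = \<phi> y" using sv s0 by (simp add: prod_eq_iff)
    then show False using nu0[of v] nu_pos[OF pS] by (simp add: inner_commute)
  qed
qed

end

section \<open>The area measure as an image of weighted volume\<close>

context radial_surface
begin

definition cone_weight :: "'n ambient \<Rightarrow> real" where
  "cone_weight x = indicator region x *\<^sub>R ((real CARD('n) + 1) / (proj x \<bullet> \<nu> (proj x)))"

definition surface_proj :: "'n ambient \<Rightarrow> 'n ambient" where
  "surface_proj x = indicator upper x *\<^sub>R proj x"

text \<open>The cone over a piece of \<open>S\<close> with area element \<open>dA\<close> at \<open>p\<close> has volume
  \<open>(p \<bullet> \<nu> p) dA / (n + 1)\<close>.\<close>

definition cone_measure :: "'n ambient measure" where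
  "cone_measure = distr (density lborel (\<lambda>x. ennreal (cone_weight x))) borel surface_proj"

lemma proj_continuous_upper: "continuous_on upper proj"
  by (rule continuous_on_subset[OF proj_continuous]) (use upper_subset_closed_upper upper_not_zero in blast)

lemma continuous_on_proj_compose:
  assumes "continuous_on S f"
  shows "continuous_on upper (\<lambda>x. f (proj x))"
  by (rule continuous_on_compose2[OF assms proj_continuous_upper]) (use proj_upper in blast)

lemma proj_nu_pos: "x \<in> upper \<Longrightarrow> proj x \<bullet> \<nu> (proj x) > 0"
  using proj_upper nu_pos by blast

lemma region_upper: "region \<subseteq> upper"
  by (auto simp: region_def)

lemma weight_continuous:
  "continuous_on upper (\<lambda>x. (real CARD('n) + 1) / (proj x \<bullet> \<nu> (proj x)))"
proof -
  have "continuous_on upper (\<lambda>x. proj x \<bullet> \<nu> (proj x))"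
    by (rule continuous_on_proj_compose) (intro continuous_intros nu_cont)
  then show ?thesis by (rule continuous_on_divide[OF continuous_on_const]) (use proj_nu_pos in force)
qed

lemma cone_weight_measurable [measurable]: "cone_weight \<in> borel_measurable borel"
  unfolding cone_weight_def
  by (rule borel_measurable_continuous_on_indicator) (use region_open weight_continuous region_upper continuous_on_subset in auto)

lemma surface_proj_measurable [measurable]: "surface_proj \<in> borel_measurable borel"
  unfolding surface_proj_def by (rule borel_measurable_continuous_on_indicator) (auto intro: proj_continuous_upper)

lemma cone_weight_nonneg: "cone_weight x \<ge> 0"
proof (cases "x \<in> region")
  case True
  then have "proj x \<bullet> \<nu> (proj x) > 0" using proj_nu_pos region_upper by blast
  then show ?thesis by (simp add: cone_weight_def)
qed (simp add: cone_weight_def)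

lemma S_closed: "closed S" using S_compact by (rule compact_imp_closed)

lemma emeasure_cone_measure:
  assumes "B \<in> sets borel"
  shows "emeasure cone_measure B = (\<integral>\<^sup>+x. ennreal (cone_weight x) * indicator (surface_proj -` B) x \<partial>lborel)"
proof -
  have "surface_proj -` B \<in> sets borel" using measurable_sets[OF surface_proj_measurable assms] by simp
  then show ?thesis unfolding cone_measure_def using assms by (subst emeasure_distr) (auto simp: emeasure_density)
qed

lemma emeasure_region_finite: "emeasure lborel region < \<infinity>"
  using emeasure_bounded_finite[of region] region_subset_cregion compact_imp_bounded[OF cregion_compact] bounded_subset by blast

lemma cone_weight_bounded: obtains B where "B > 0" "\<forall>x. cone_weight x \<le> B"
proof -
  obtain \<delta> where d0: "\<delta> > 0" and d: "\<forall>p\<in>S. p \<bullet> \<nu> p \<ge> \<delta>" by (rule nu_lower_bound) (rule that)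
  have "cone_weight x \<le> (real CARD('n) + 1) / \<delta>" for x
  proof (cases "x \<in> region")
    case True
    then have "proj x \<in> S" using proj_upper region_upper by blast
    then have "proj x \<bullet> \<nu> (proj x) \<ge> \<delta>" using d by blast
    then show ?thesis using True d0 by (simp add: cone_weight_def frac_le)
  next
    case False
    then show ?thesis using d0 by (simp add: cone_weight_def)
  qed
  then show ?thesis using d0 by (intro that[of "(real CARD('n) + 1) / \<delta>"]) auto
qed

lemma cone_measure_finite: "emeasure cone_measure B < \<infinity>"
proof (cases "B \<in> sets borel")
  case True
  obtain b where b: "b > 0" "\<forall>x. cone_weight x \<le> b" by (rule cone_weight_bounded) (rule that)
  have "emeasure cone_measure B \<le> (\<integral>\<^sup>+x. ennreal b * indicator region x \<partial>lborel)"
    unfolding emeasure_cone_measure[OF True]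
  proof (intro nn_integral_mono)
    fix x :: "'n ambient"
    show "ennreal (cone_weight x) * indicator (surface_proj -` B) x \<le> ennreal b * indicator region x"
    proof (cases "x \<in> region")
      case True
      then show ?thesis using b(2) by (simp add: indicator_def ennreal_leI)
    qed (simp add: cone_weight_def)
  qed
  also have "\<dots> = ennreal b * emeasure lborel region" using region_open by (simp add: nn_integral_cmult_indicator)
  also have "\<dots> < \<infinity>" using emeasure_region_finite by (simp add: ennreal_mult_less_top)
  finally show ?thesis .
next
  case False
  then have "emeasure cone_measure B = 0" by (intro emeasure_notin_sets) (simp add: cone_measure_def)
  then show ?thesis by simp
qed

lemma cone_measure_concentrated: "- manifold_interior S \<in> null_sets cone_measure"
proof -
  have b: "- manifold_interior S \<in> sets borel"
    unfolding manifold_interior_S using S_closed by (intro borel_comp sets.Int) (auto intro: borel_closed borel_open)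
  have "emeasure cone_measure (- manifold_interior S) = (\<integral>\<^sup>+x. 0 \<partial>(lborel :: 'n ambient measure))"
    unfolding emeasure_cone_measure[OF b]
  proof (intro nn_integral_cong)
    fix x :: "'n ambient"
    show "ennreal (cone_weight x) * indicator (surface_proj -` (- manifold_interior S)) x = 0"
    proof (cases "x \<in> region")
      case True
      then have "x \<in> upper" using region_upper by blast
      then have "surface_proj x \<in> manifold_interior S" using proj_upper by (simp add: manifold_interior_S surface_proj_def)
      then show ?thesis by simp
    qed (simp add: cone_weight_def)
  qed
  then show ?thesis using b by (intro null_setsI) (auto simp: cone_measure_def)
qed

text \<open>Change of variables for (y, t) -> t \<phi> y. Its Jacobian is t^n (\<phi> y . \<nu>)
  sqrt (det g); with the weight this leaves (n + 1) t^n sqrt (det g), whose integral over t gives 1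
  - \<delta>^(n+1). The truncation at \<delta> keeps away from the apex, where the map is not
  injective.\<close>

lemma cone_truncated:
  assumes lp: "local_parametrization S V \<phi>" and K: "compact K" "K \<subseteq> V" and d: "0 < \<delta>" "\<delta> < 1"
  defines "\<Phi> \<equiv> (\<lambda>z. snd z *\<^sub>R \<phi> (fst z))"
  shows "(\<integral>\<^sup>+x. ennreal ((real CARD('n) + 1) / (proj x \<bullet> \<nu> (proj x))) * indicator (\<Phi> ` (K \<times> {\<delta>..1})) x \<partial>lborel)
    = ennreal (1 - \<delta> ^ (CARD('n) + 1)) * (\<integral>\<^sup>+y\<in>K. ennreal (sqrt (det (gram_matrix \<phi> y))) \<partial>lborel)"
    and "\<Phi> ` (K \<times> {\<delta>..1}) \<in> sets borel"
proof -
  let ?N = "real CARD('n) + 1"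
  have V: "open V" "smooth_on \<phi> V" "inj_on \<phi> V" "\<phi> ` V \<subseteq> S" using lp by (auto simp: local_parametrization_def)
  let ?D = "\<lambda>y. frechet_derivative \<phi> (at y)"
  define S' where "S' = K \<times> {\<delta>..1}"
  have cS': "compact S'" unfolding S'_def using K by (intro compact_Times) auto
  define G where "G y = sqrt (det (gram_matrix \<phi> y))" for y
  have dphi: "(\<phi> has_derivative ?D y) (at y)" if "y \<in> V" for y using smooth_on_has_derivative[OF V(2) that] .
  define \<Phi>' where "\<Phi>' z = (\<lambda>w. snd w *\<^sub>R \<phi> (fst z) + snd z *\<^sub>R ?D (fst z) (fst w))" for z
  have dPhi: "(\<Phi> has_derivative \<Phi>' z) (at z within S')" if "z \<in> S'" for z
  proof -
    have yV: "fst z \<in> V" using that K by (auto simp: S'_def)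
    have "((\<lambda>z. \<phi> (fst z)) has_derivative (\<lambda>w. ?D (fst z) (fst w))) (at z)"
      by (rule has_derivative_compose[OF has_derivative_fst[OF has_derivative_ident] dphi[OF yV]])
    then have "(\<Phi> has_derivative (\<lambda>w. snd z *\<^sub>R ?D (fst z) (fst w) + snd w *\<^sub>R \<phi> (fst z))) (at z)"
      unfolding \<Phi>_def by (intro has_derivative_scaleR has_derivative_snd has_derivative_ident)
    then show ?thesis unfolding \<Phi>'_def by (simp add: add.commute has_derivative_at_withinI)
  qed
  have cPhi: "continuous_on S' \<Phi>" using dPhi has_derivative_continuous_on by blast
  have cim: "compact (\<Phi> ` S')" using cS' cPhi compact_continuous_image by blast
  then show "\<Phi> ` (K \<times> {\<delta>..1}) \<in> sets borel" by (simp add: S'_def borel_compact)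
  have Sz: "\<phi> (fst z) \<in> S" "\<phi> (fst z) \<in> upper" "snd z > 0" "fst z \<in> V" if "z \<in> S'" for z
    using param_upper[OF lp, of "fst z"] that K d by (auto simp: S'_def)
  have pr: "proj (\<Phi> z) = \<phi> (fst z)" if "z \<in> S'" for z
    using proj_scale[of "snd z" "\<phi> (fst z)"] Sz[OF that] upper_subset_closed_upper proj_S by (auto simp: \<Phi>_def)
  have ga: "gaugeS (\<Phi> z) = snd z" if "z \<in> S'" for z
    using gauge_scale[of "snd z" "\<phi> (fst z)"] Sz[OF that] upper_subset_closed_upper gauge_S by (auto simp: \<Phi>_def)
  have inj: "inj_on \<Phi> S'"
  proof (rule inj_onI)
    fix z z' assume z: "z \<in> S'" "z' \<in> S'" "\<Phi> z = \<Phi> z'"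
    then have "snd z = snd z'" "\<phi> (fst z) = \<phi> (fst z')" using pr ga by metis+
    then show "z = z'" using inj_onD[OF V(3)] Sz(4) z by (simp add: prod_eq_iff)
  qed
  have Phi_up: "\<Phi> ` S' \<subseteq> upper" using Sz by (auto simp: \<Phi>_def halfspaces_snd)
  define f where "f x = ?N / (proj x \<bullet> \<nu> (proj x))" for x
  have cf: "continuous_on (\<Phi> ` S') f" unfolding f_def using continuous_on_subset[OF weight_continuous Phi_up] .
  have vf: "vol_factor (\<Phi>' z) * f (\<Phi> z) = snd z ^ CARD('n) * ?N * G (fst z)" if z: "z \<in> S'" for z
  proof -
    have lin: "linear (?D (fst z))" using dphi[OF Sz(4)[OF z]] has_derivative_linear by blast
    have pos: "\<phi> (fst z) \<bullet> \<nu> (\<phi> (fst z)) > 0" using nu_pos Sz(1)[OF z] by blast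
    have "vol_factor (\<Phi>' z) = snd z ^ CARD('n) * (\<phi> (fst z) \<bullet> \<nu> (\<phi> (fst z))) * G (fst z)"
      unfolding \<Phi>'_def G_def gram_matrix_def
      by (rule vol_factor_cone[OF lin nu_norm[OF Sz(1)[OF z]] param_upper(3)[OF lp Sz(4)[OF z]] pos])
        (use Sz(3)[OF z] in simp)
    then show ?thesis using pos by (simp add: f_def pr[OF z])
  qed
  have cG: "continuous_on V G"
  proof -
    have "continuous_on V (\<lambda>y. gram_matrix \<phi> y $ i $ j)" for i j unfolding gram_matrix_def
      using smooth_on_imp_continuous_on[OF smooth_on_frechet_derivative[OF V(1,2)]] by (simp add: continuous_on_inner)
    then show ?thesis unfolding G_def by (intro continuous_on_real_sqrt continuous_on_det)
  qed
  \<comment> \<open>The sign is read off from the volume factor, which is a measure.\<close>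
  have G0: "G y \<ge> 0" if "y \<in> K" for y
  proof -
    have "(y, 1) \<in> S'" using that d by (simp add: S'_def)
    from vf[OF this] have "vol_factor (\<Phi>' (y, 1)) * f (\<Phi> (y, 1)) = ?N * G y" by simp
    moreover have "vol_factor (\<Phi>' (y, 1)) \<ge> 0" by (simp add: vol_factor_def)
    moreover have "f (\<Phi> (y, 1)) \<ge> 0"
      using proj_nu_pos[of "\<Phi> (y, 1)"] Phi_up \<open>(y, 1) \<in> S'\<close> unfolding f_def by (force intro!: divide_nonneg_pos)
    ultimately have "?N * G y \<ge> 0" by (metis mult_nonneg_nonneg)
    then show ?thesis by (simp add: zero_le_mult_iff)
  qed
  have cH: "continuous_on S' (\<lambda>z. snd z ^ CARD('n) * ?N * G (fst z))"
    by (intro continuous_intros continuous_on_compose2[OF cG]) (use Sz(4) in auto)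
  have iH: "set_integrable lborel S' (\<lambda>z. snd z ^ CARD('n) * ?N * G (fst z))"
    unfolding set_integrable_def by (rule borel_integrable_compact[OF cS' cH])
  have bS': "S' \<in> sets borel" using cS' by (rule borel_compact)
  have int: "set_integrable lborel S' (\<lambda>z. vol_factor (\<Phi>' z) * f (\<Phi> z))"
    using iH vf unfolding set_integrable_def by (subst (asm) Bochner_Integration.integrable_cong) (auto simp: indicator_def)
  have cov: "(LINT x:\<Phi> ` S'|lborel. f x) = (LINT z:S'|lborel. vol_factor (\<Phi>' z) * f (\<Phi> z))"
    by (rule change_of_variables_ambient[OF cS' dPhi inj cf int])
  also have "\<dots> = (LINT z:S'|lborel. snd z ^ CARD('n) * ?N * G (fst z))" by (rule set_lebesgue_integral_cong) (use bS' vf in auto)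
  finally have cov2: "(LINT x:\<Phi> ` S'|lborel. f x) = (LINT z:S'|lborel. snd z ^ CARD('n) * ?N * G (fst z))" .
  have "(\<integral>\<^sup>+x. ennreal (f x) * indicator (\<Phi> ` S') x \<partial>lborel) = (\<integral>\<^sup>+x. ennreal (indicator (\<Phi> ` S') x *\<^sub>R f x) \<partial>lborel)"
    by (intro nn_integral_cong) (simp add: indicator_def)
  also have "\<dots> = ennreal (LINT x:\<Phi> ` S'|lborel. f x)" unfolding set_lebesgue_integral_def
  proof (rule nn_integral_eq_integral)
    show "integrable lborel (\<lambda>x. indicator (\<Phi> ` S') x *\<^sub>R f x)" by (rule borel_integrable_compact[OF cim cf])
    show "AE x in lborel. 0 \<le> indicator (\<Phi> ` S') x *\<^sub>R f x"
    proof (intro AE_I2)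
      fix x :: "'n ambient"
      show "0 \<le> indicator (\<Phi> ` S') x *\<^sub>R f x"
      proof (cases "x \<in> \<Phi> ` S'")
        case True
        then have "proj x \<bullet> \<nu> (proj x) > 0" using Phi_up proj_nu_pos by blast
        then show ?thesis by (simp add: f_def)
      qed simp
    qed
  qed
  also have "\<dots> = ennreal (LINT z:S'|lborel. snd z ^ CARD('n) * ?N * G (fst z))" by (simp only: cov2)
  also have "\<dots> = (\<integral>\<^sup>+z. ennreal (indicator S' z *\<^sub>R (snd z ^ CARD('n) * ?N * G (fst z))) \<partial>lborel)"
    unfolding set_lebesgue_integral_def
  proof (rule nn_integral_eq_integral[symmetric])
    show "integrable lborel (\<lambda>z. indicator S' z *\<^sub>R (snd z ^ CARD('n) * ?N * G (fst z)))"
      using iH by (simp add: set_integrable_def)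
    show "AE z in lborel. 0 \<le> indicator S' z *\<^sub>R (snd z ^ CARD('n) * ?N * G (fst z))"
      using G0 d by (intro AE_I2) (auto simp: indicator_def S'_def)
  qed
  also have "\<dots> = (\<integral>\<^sup>+z. (ennreal (G (fst z)) * indicator K (fst z)) * (ennreal (?N * snd z ^ CARD('n)) * indicator {\<delta>..1} (snd z)) \<partial>lborel)"
    using G0 d by (intro nn_integral_cong) (auto simp: indicator_def S'_def ennreal_mult'[symmetric] mult_ac)
  also have "\<dots> = (\<integral>\<^sup>+t. (\<integral>\<^sup>+y. (ennreal (G y) * indicator K y) * (ennreal (?N * t ^ CARD('n)) * indicator {\<delta>..1} t) \<partial>lborel) \<partial>lborel)"
  proof -
    have mG: "(\<lambda>y. ennreal (G y) * indicator K y) \<in> borel_measurable borel"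
    proof -
      have "(\<lambda>y. indicator K y *\<^sub>R G y) \<in> borel_measurable borel"
        using K(1) continuous_on_subset[OF cG K(2)] by (intro borel_measurable_continuous_on_indicator borel_compact)
      then have "(\<lambda>y. ennreal (indicator K y *\<^sub>R G y)) \<in> borel_measurable borel" by simp
      moreover have "(\<lambda>y. ennreal (indicator K y *\<^sub>R G y)) = (\<lambda>y. ennreal (G y) * indicator K y)"
        by (auto simp: indicator_def)
      ultimately show ?thesis by simp
    qed
    note [measurable] = mG
    have "(\<lambda>z. (ennreal (G (fst z)) * indicator K (fst z)) * (ennreal (?N * snd z ^ CARD('n)) * indicator {\<delta>..1} (snd z)))
        \<in> borel_measurable (borel \<Otimes>\<^sub>M borel)" by measurable
    then have "(\<lambda>z. (ennreal (G (fst z)) * indicator K (fst z)) * (ennreal (?N * snd z ^ CARD('n)) * indicator {\<delta>..1} (snd z)))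
        \<in> borel_measurable (lborel \<Otimes>\<^sub>M (lborel :: real measure))" by (simp add: lborel_prod borel_prod)
    from lborel_pair.nn_integral_snd[OF this] show ?thesis by (simp add: lborel_prod)
  qed
  also have "\<dots> = (\<integral>\<^sup>+t. (\<integral>\<^sup>+y. ennreal (G y) * indicator K y \<partial>lborel) * (ennreal (?N * t ^ CARD('n)) * indicator {\<delta>..1} t) \<partial>lborel)"
  proof -
    have "(\<lambda>y. indicator K y *\<^sub>R G y) \<in> borel_measurable borel"
      using K(1) continuous_on_subset[OF cG K(2)] by (intro borel_measurable_continuous_on_indicator borel_compact)
    then have "(\<lambda>y. ennreal (indicator K y *\<^sub>R G y)) \<in> borel_measurable borel" by simp
    moreover have "(\<lambda>y. ennreal (indicator K y *\<^sub>R G y)) = (\<lambda>y. ennreal (G y) * indicator K y)"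
      by (auto simp: indicator_def)
    ultimately have "(\<lambda>y. ennreal (G y) * indicator K y) \<in> borel_measurable lborel" by simp
    then show ?thesis by (simp add: nn_integral_multc)
  qed
  also have "\<dots> = (\<integral>\<^sup>+y. ennreal (G y) * indicator K y \<partial>lborel) * (\<integral>\<^sup>+t. ennreal (?N * t ^ CARD('n)) * indicator {\<delta>..1} t \<partial>lborel)"
    by (rule nn_integral_cmult) simp
  also have "(\<integral>\<^sup>+t. ennreal (?N * t ^ CARD('n)) * indicator {\<delta>..1} t \<partial>lborel) = ennreal (1 ^ (CARD('n) + 1) - \<delta> ^ (CARD('n) + 1))"
  proof (rule nn_integral_FTC_Icc)
    fix t :: real
    assume t: "t \<in> {\<delta>..1}"
    show "((\<lambda>t. t ^ (CARD('n) + 1)) has_real_derivative ?N * t ^ CARD('n)) (at t)"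
      using DERIV_pow[of "CARD('n) + 1" t] by (simp add: add.commute)
    show "0 \<le> ?N * t ^ CARD('n)" using t d by simp
  qed (use d in auto)
  finally show "(\<integral>\<^sup>+x. ennreal (?N / (proj x \<bullet> \<nu> (proj x))) * indicator (\<Phi> ` (K \<times> {\<delta>..1})) x \<partial>lborel)
    = ennreal (1 - \<delta> ^ (CARD('n) + 1)) * (\<integral>\<^sup>+y\<in>K. ennreal (sqrt (det (gram_matrix \<phi> y))) \<partial>lborel)"
    by (simp add: f_def S'_def G_def mult.commute)
qed

text \<open>Monotone convergence as the truncation level tends to 0. The truncated cones contain
  points of S, which \<open>region\<close> excludes, but S is a null set.\<close>

lemma cone_measure_param:
  assumes lp: "local_parametrization S V \<phi>" and K: "compact K" "K \<subseteq> V"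
  shows "emeasure cone_measure (\<phi> ` K) = (\<integral>\<^sup>+y\<in>K. ennreal (sqrt (det (gram_matrix \<phi> y))) \<partial>lborel)"
proof -
  let ?N = "real CARD('n) + 1"
  define \<Phi> where "\<Phi> = (\<lambda>z::'n ambient. snd z *\<^sub>R \<phi> (fst z))"
  \<comment> \<open>The levels start at 1/2 because a truncation level must be strictly below
    1.\<close>
  define d where "d k = inverse (real (k + 2))" for k :: nat
  have d: "0 < d k" "d k < 1" for k by (simp_all add: d_def field_simps)
  define A where "A k = \<Phi> ` (K \<times> {d k..1})" for k
  let ?I = "\<integral>\<^sup>+y\<in>K. ennreal (sqrt (det (gram_matrix \<phi> y))) \<partial>lborel"
  define w where "w x = ennreal (?N / (proj x \<bullet> \<nu> (proj x)))" for x
  have V: "open V" "smooth_on \<phi> V" "\<phi> ` V \<subseteq> S" using lp by (auto simp: local_parametrization_def)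
  have eqA: "(\<integral>\<^sup>+x. w x * indicator (A k) x \<partial>lborel) = ennreal (1 - d k ^ (CARD('n) + 1)) * ?I"
    and bA: "A k \<in> sets borel" for k
    using cone_truncated[OF lp K d] by (auto simp: A_def \<Phi>_def w_def)
  have cK: "compact (\<phi> ` K)"
    using K continuous_on_subset[OF smooth_on_imp_continuous_on[OF V(2)]] by (intro compact_continuous_image) auto
  then have bK: "\<phi> ` K \<in> sets borel" by (rule borel_compact)
  have incA: "A j \<subseteq> A k" if "j \<le> k" for j k
    using that by (auto simp: A_def d_def intro!: image_mono Sigma_mono) (smt (verit) inverse_le_iff_le of_nat_0_le_iff of_nat_mono)
  have mem: "x \<in> (\<Union>k. A k) \<longleftrightarrow> x \<in> upper \<and> gaugeS x \<le> 1 \<and> proj x \<in> \<phi> ` K" for x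
  proof
    assume "x \<in> (\<Union>k. A k)"
    then obtain k y t where x: "y \<in> K" "d k \<le> t" "t \<le> 1" "x = t *\<^sub>R \<phi> y" by (auto simp: A_def \<Phi>_def)
    have t: "t > 0" using x d[of k] by simp
    have p: "\<phi> y \<in> S" "\<phi> y \<in> upper" using param_upper[OF lp] x K by blast+
    then have pc: "\<phi> y \<in> cupper" using upper_subset_closed_upper by blast
    have "proj x = \<phi> y" "gaugeS x = t" using proj_scale[OF t pc] gauge_scale[OF less_imp_le[OF t] pc] p x(4)
      by (simp_all add: proj_S gauge_S)
    then show "x \<in> upper \<and> gaugeS x \<le> 1 \<and> proj x \<in> \<phi> ` K" using p x t by (auto simp: halfspaces_snd)
  next
    assume x: "x \<in> upper \<and> gaugeS x \<le> 1 \<and> proj x \<in> \<phi> ` K"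
    then obtain y where y: "y \<in> K" "proj x = \<phi> y" by blast
    have xc: "x \<in> cupper" "x \<noteq> 0" using x upper_subset_closed_upper upper_not_zero by blast+
    have g: "gaugeS x > 0" using gauge_pos[OF xc] .
    obtain k where "inverse (real (Suc k)) < gaugeS x" using reals_Archimedean[OF g] by blast
    moreover have "d k \<le> inverse (real (Suc k))" by (simp add: d_def field_simps)
    ultimately have "d k \<le> gaugeS x" by simp
    moreover have "x = gaugeS x *\<^sub>R \<phi> y" using gauge_proj[OF xc(1)] y by simp
    ultimately have "x \<in> A k" using y(1) x unfolding A_def \<Phi>_def by (intro image_eqI[of _ _ "(y, gaugeS x)"]) auto
    then show "x \<in> (\<Union>k. A k)" by blast
  qed
  have sub: "A k \<subseteq> upper" for k using mem by blast
  define f where "f k x = w x * indicator (A k) x" for k x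
  have mf: "f k \<in> borel_measurable lborel" for k
  proof -
    have "(\<lambda>x. indicator (A k) x *\<^sub>R (?N / (proj x \<bullet> \<nu> (proj x)))) \<in> borel_measurable borel"
      using continuous_on_subset[OF weight_continuous sub] bA by (intro borel_measurable_continuous_on_indicator)
    then have "(\<lambda>x. ennreal (indicator (A k) x *\<^sub>R (?N / (proj x \<bullet> \<nu> (proj x))))) \<in> borel_measurable borel" by simp
    moreover have "(\<lambda>x. ennreal (indicator (A k) x *\<^sub>R (?N / (proj x \<bullet> \<nu> (proj x))))) = f k"
      by (rule ext) (simp add: f_def w_def indicator_def)
    ultimately show ?thesis by simp
  qed
  have incf: "incseq f"
  proof (intro incseq_SucI le_funI)
    fix k x
    have "A k \<subseteq> A (Suc k)" by (rule incA) simp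
    then show "f k x \<le> f (Suc k) x" by (cases "x \<in> A k") (simp_all add: f_def subsetD)
  qed
  have limf: "(\<lambda>k. f k x) \<longlonglongrightarrow> w x * indicator (\<Union>k. A k) x" for x
  proof (rule tendsto_eventually)
    show "\<forall>\<^sub>F k in sequentially. f k x = w x * indicator (\<Union>k. A k) x"
    proof (cases "x \<in> (\<Union>k. A k)")
      case True
      then obtain j where "x \<in> A j" by blast
      then have "\<forall>k\<ge>j. x \<in> A k" using incA by blast
      then show ?thesis using True unfolding eventually_sequentially f_def by (intro exI[of _ j]) simp
    next
      case False
      then show ?thesis by (intro always_eventually) (auto simp: f_def)
    qed
  qed
  have "(\<lambda>k. integral\<^sup>N lborel (f k)) \<longlonglongrightarrow> (\<integral>\<^sup>+x. w x * indicator (\<Union>k. A k) x \<partial>lborel)"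
    by (rule nn_integral_LIMSEQ[OF incf mf limf])
  moreover have "integral\<^sup>N lborel (f k) = ennreal (1 - d k ^ (CARD('n) + 1)) * ?I" for k
    using eqA[of k] by (simp add: f_def[abs_def])
  moreover have "(\<lambda>k. ennreal (1 - d k ^ (CARD('n) + 1)) * ?I) \<longlonglongrightarrow> ennreal (1 - 0 ^ (CARD('n) + 1)) * ?I"
  proof (rule tendsto_mult_ennreal)
    have "d \<longlonglongrightarrow> 0" unfolding d_def using LIMSEQ_ignore_initial_segment[OF LIMSEQ_inverse_real_of_nat, of 1] by simp
    then show "(\<lambda>k. ennreal (1 - d k ^ (CARD('n) + 1))) \<longlonglongrightarrow> ennreal (1 - 0 ^ (CARD('n) + 1))"
      by (intro tendsto_intros)
  qed auto
  ultimately have "(\<integral>\<^sup>+x. w x * indicator (\<Union>k. A k) x \<partial>lborel) = ?I" using LIMSEQ_unique by fastforce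
  moreover have "emeasure cone_measure (\<phi> ` K) = (\<integral>\<^sup>+x. w x * indicator (\<Union>k. A k) x \<partial>lborel)"
    unfolding emeasure_cone_measure[OF bK]
  proof (rule nn_integral_cong_AE)
    have "S \<in> null_sets lborel"
      using S_negligible S_closed by (simp add: negligible_iff_null_sets null_sets_completion_iff borel_closed)
    then have "AE x in lborel. x \<notin> S" by (rule AE_not_in)
    then show "AE x in lborel. ennreal (cone_weight x) * indicator (surface_proj -` \<phi> ` K) x = w x * indicator (\<Union>k. A k) x"
    proof eventually_elim
      case (elim x)
      show ?case
      proof (cases "x \<in> upper")
        case False
        then have "x \<notin> (\<Union>k. A k)" "x \<notin> region" using mem region_upper by blast+
        then show ?thesis by (simp add: cone_weight_def)
      next
        case True
        then have "gaugeS x \<noteq> 1" using elim S_iff upper_subset_closed_upper by blast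
        then have "x \<in> region \<longleftrightarrow> gaugeS x \<le> 1" using True by (auto simp: region_def)
        moreover have "surface_proj x = proj x" using True by (simp add: surface_proj_def)
        ultimately show ?thesis using True mem[of x] by (auto simp: cone_weight_def w_def indicator_def)
      qed
    qed
  qed
  ultimately show ?thesis by simp
qed

end

text \<open>The inverse of a slice chart, restricted to the slice, parametrises S. Its continuous
  inverse \<psi> turns compact pieces of S near p into compact parameter sets, to which the defining
  property of the area measure applies.\<close>

lemma interior_chart_param:
  fixes S :: "'n::finite ambient set"
  assumes "interior_chart S p U \<phi>0"
  obtains V \<phi> \<psi> where "local_parametrization S V \<phi>" "open U" "p \<in> U" "continuous_on U \<psi>"
    "\<forall>q\<in>S \<inter> U. \<psi> q \<in> V \<and> \<phi> (\<psi> q) = q"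
proof -
  from assms obtain V0 where dif: "diffeomorphism U V0 \<phi>0" and im: "\<phi>0 ` (S \<inter> U) = V0 \<inter> {x. snd x = 0}" and p: "p \<in> U"
    unfolding interior_chart_def by blast
  obtain g where g: "diffeomorphism V0 U g" "\<And>x. x \<in> U \<Longrightarrow> g (\<phi>0 x) = x" "\<And>y. y \<in> V0 \<Longrightarrow> \<phi>0 (g y) = y"
    "\<phi>0 ` U = V0" "g ` V0 = U" by (rule diffeomorphism_inverse[OF dif]) (rule that)
  have o: "open U" "open V0" "smooth_on \<phi>0 U" "smooth_on g V0" using dif g(1) by (simp_all add: diffeomorphism_def)
  define V where "V = {y. (y, 0::real) \<in> V0}"
  define \<phi> where "\<phi> y = g (y, 0)" for y
  define \<psi> where "\<psi> q = fst (\<phi>0 q)" for q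
  have bl: "bounded_linear (\<lambda>y::real^'n. (y, 0::real))" by (rule bounded_linear_Pair[OF bounded_linear_ident bounded_linear_zero])
  have "V = (\<lambda>y. (y, 0::real)) -` V0" by (auto simp: V_def)
  then have oV: "open V" using open_vimage[OF o(2)] bl linear_continuous_on by metis
  have sm: "smooth_on \<phi> V" unfolding \<phi>_def
    by (rule smooth_on_compose[OF o(4) smooth_on_bounded_linear_compose[OF bl smooth_on_ident]]) (auto simp: V_def)
  have inj: "inj_on \<phi> V"
  proof (rule inj_onI)
    fix a b assume ab: "a \<in> V" "b \<in> V" "\<phi> a = \<phi> b"
    then have "\<phi>0 (g (a, 0)) = \<phi>0 (g (b, 0))" by (simp add: \<phi>_def)
    then show "a = b" using ab g(3) by (simp add: V_def)
  qed
  have S: "\<phi> y \<in> S" if "y \<in> V" for y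
  proof -
    have "(y, 0) \<in> \<phi>0 ` (S \<inter> U)" unfolding im using that by (simp add: V_def)
    then obtain s where "s \<in> S" "s \<in> U" "(y, 0) = \<phi>0 s" by blast
    then show ?thesis using g(2) by (simp add: \<phi>_def)
  qed
  have injD: "inj (frechet_derivative \<phi> (at y))" if y: "y \<in> V" for y
  proof -
    have y0: "(y, 0) \<in> V0" using y by (simp add: V_def)
    note D = diffeomorphism_derivative[OF g(1) y0]
    have "(\<phi> has_derivative (\<lambda>v. frechet_derivative g (at (y, 0)) (v, 0))) (at y)"
      unfolding \<phi>_def by (rule has_derivative_compose[OF bounded_linear_imp_has_derivative[OF bl] D(1)])
    then have "frechet_derivative \<phi> (at y) = (\<lambda>v. frechet_derivative g (at (y, 0)) (v, 0))" by (metis frechet_derivative_at)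
    moreover obtain D' where D': "\<forall>v. D' (frechet_derivative g (at (y, 0)) v) = v" using D(2) by blast
    ultimately show ?thesis by (intro inj_on_inverseI[where g = "\<lambda>w. fst (D' w)"]) simp
  qed
  have "local_parametrization S V \<phi>" using oV sm inj injD S by (simp add: local_parametrization_def image_subset_iff)
  moreover have "continuous_on U \<psi>" unfolding \<psi>_def using smooth_on_imp_continuous_on[OF o(3)] by (intro continuous_intros)
  moreover have "\<forall>q\<in>S \<inter> U. \<psi> q \<in> V \<and> \<phi> (\<psi> q) = q"
  proof
    fix q assume q: "q \<in> S \<inter> U"
    then have "\<phi>0 q \<in> V0 \<inter> {x. snd x = 0}" using im by blast
    then have "\<phi>0 q = (\<psi> q, 0)" "\<phi>0 q \<in> V0" by (simp_all add: \<psi>_def prod_eq_iff)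
    then show "\<psi> q \<in> V \<and> \<phi> (\<psi> q) = q" using g(2)[of q] q by (simp add: V_def \<phi>_def)
  qed
  ultimately show ?thesis using that o(1) p by blast
qed

text \<open>Restricted to W both measures are finite, and finite Borel measures are inner
  regular.\<close>

lemma borel_measure_eq_on_compact:
  fixes M M' :: "'a::euclidean_space measure"
  assumes sets: "sets M = sets borel" "sets M' = sets borel" and W: "compact W"
    and eq: "\<And>C. compact C \<Longrightarrow> C \<subseteq> W \<Longrightarrow> emeasure M C = emeasure M' C"
    and fin: "emeasure M W < \<infinity>" and B: "B \<in> sets borel" "B \<subseteq> W"
  shows "emeasure M B = emeasure M' B"
proof -
  have bW: "W \<in> sets borel" using W by (rule borel_compact)
  have WW: "emeasure M W = emeasure M' W" using eq[OF W] by simp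
  have inn: "emeasure N B = (SUP K\<in>{K. K \<subseteq> B \<and> compact K}. emeasure N K)"
    if N: "sets N = sets borel" "emeasure N W < \<infinity>" for N :: "'a measure"
  proof -
    let ?N = "density N (indicator W)"
    have e: "emeasure ?N A = emeasure N A" if "A \<in> sets borel" "A \<subseteq> W" for A
      using emeasure_restricted[of W N A] that bW N by (simp add: Int_absorb1)
    have sp: "space N = UNIV" using sets_eq_imp_space_eq[OF N(1)] by simp
    have "emeasure ?N (space ?N) = emeasure N W" using emeasure_restricted[of W N UNIV] bW N sp by simp
    then have "emeasure ?N (space ?N) \<noteq> \<infinity>" using N(2) by simp
    from inner_regular[OF _ this B(1)] N(1)
    have "emeasure ?N B = (SUP K\<in>{K. K \<subseteq> B \<and> compact K}. emeasure ?N K)" by simp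
    also have "\<dots> = (SUP K\<in>{K. K \<subseteq> B \<and> compact K}. emeasure N K)"
      using B by (intro SUP_cong) (auto intro!: e borel_compact)
    finally show ?thesis using e[OF B] by simp
  qed
  have "emeasure M B = (SUP K\<in>{K. K \<subseteq> B \<and> compact K}. emeasure M K)" by (rule inn[OF sets(1) fin])
  also have "\<dots> = (SUP K\<in>{K. K \<subseteq> B \<and> compact K}. emeasure M' K)" using B(2) by (intro SUP_cong) (auto intro!: eq)
  also have "\<dots> = emeasure M' B" using inn[OF sets(2)] fin WW by simp
  finally show ?thesis .
qed

context radial_surface
begin

text \<open>Compact subsets of S near an interior point are images of compact parameter sets, so
  both measures agree on them, and inner regularity passes to Borel sets. By Lindelof countably many
  such neighbourhoods cover the interior of S; made disjoint, they add up the local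
  equalities.\<close>

lemma area_measure_unique:
  assumes M: "sets M = sets borel" and null: "N \<in> null_sets M" "- manifold_interior S \<subseteq> N"
    and par: "\<And>V \<phi> K. local_parametrization S V \<phi> \<Longrightarrow> compact K \<Longrightarrow> K \<subseteq> V \<Longrightarrow>
        emeasure M (\<phi> ` K) = (\<integral>\<^sup>+ y\<in>K. ennreal (sqrt (det (gram_matrix \<phi> y))) \<partial>lborel)"
  shows "M = cone_measure"
proof -
  let ?I = "S \<inter> upper"
  have bI: "?I \<in> sets borel" using S_closed by (intro sets.Int) (auto intro: borel_closed borel_open)
  have sc: "sets cone_measure = sets borel" by (simp add: cone_measure_def)
  define good where "good A \<longleftrightarrow> open A \<and> (\<forall>B. B \<in> sets borel \<longrightarrow> B \<subseteq> A \<inter> ?I \<longrightarrow> emeasure cone_measure B = emeasure M B)" for A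
  have ex: "\<exists>A. good A \<and> p \<in> A" if p: "p \<in> ?I" for p
  proof -
    obtain U0 \<phi>0 where ch: "interior_chart S p U0 \<phi>0" using chart p unfolding manifold_interior_def by blast
    obtain V \<phi> \<psi> where P: "local_parametrization S V \<phi>" "open U0" "p \<in> U0" "continuous_on U0 \<psi>"
        "\<forall>q\<in>S \<inter> U0. \<psi> q \<in> V \<and> \<phi> (\<psi> q) = q" by (rule interior_chart_param[OF ch]) (rule that)
    obtain e where e: "e > 0" "cball p e \<subseteq> U0" using P(2,3) open_contains_cball by blast
    let ?W = "S \<inter> cball p e"
    have W: "compact ?W" using S_compact by (intro compact_Int_closed) auto
    have eq: "emeasure cone_measure C = emeasure M C" if C: "compact C" "C \<subseteq> ?W" for C
    proof -
      have cK: "compact (\<psi> ` C)" by (rule compact_continuous_image[OF continuous_on_subset[OF P(4)] C(1)]) (use C e in blast)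
      have KV: "\<psi> ` C \<subseteq> V" using C e P(5) by blast
      have "\<phi> (\<psi> q) = q" if "q \<in> C" for q using C e P(5) that by blast
      then have "\<phi> ` \<psi> ` C = C" by (simp add: image_image cong: image_cong)
      then show ?thesis using cone_measure_param[OF P(1) cK KV] par[OF P(1) cK KV] by simp
    qed
    have "good (ball p e)" unfolding good_def
    proof (intro conjI allI impI)
      fix B assume B: "B \<in> sets borel" "B \<subseteq> ball p e \<inter> ?I"
      have "B \<subseteq> ?W" using B(2) ball_subset_cball by blast
      then show "emeasure cone_measure B = emeasure M B" by (intro borel_measure_eq_on_compact[OF sc M W eq cone_measure_finite B(1)])
    qed simp
    then show ?thesis using e(1) by (intro exI[of _ "ball p e"]) simp
  qed
  obtain \<F> where F: "\<F> \<subseteq> {A. good A}" "countable \<F>" "\<Union>\<F> = \<Union>{A. good A}"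
    using Lindelof[of "{A. good A}"] by (auto simp: good_def)
  have good0: "good {}" by (simp add: good_def)
  \<comment> \<open>The empty set is inserted because the enumeration needs a nonempty
    family.\<close>
  define A where "A i = from_nat_into (insert {} \<F>) i" for i
  have rA: "range A = insert {} \<F>" unfolding A_def by (rule range_from_nat_into) (use F(2) in auto)
  have gA: "good (A i)" for i
  proof -
    have "A i \<in> insert {} \<F>" using rangeI[of A i] unfolding rA .
    then show ?thesis using F(1) good0 by (cases "A i = {}") auto
  qed
  have cov: "?I \<subseteq> (\<Union>i. A i)"
  proof
    fix p assume "p \<in> ?I"
    then have "p \<in> \<Union>\<F>" using ex F(3) by blast
    then obtain X where X: "X \<in> \<F>" "p \<in> X" by blast
    then have "X \<in> range A" unfolding rA by simp
    then show "p \<in> (\<Union>i. A i)" using X(2) by blast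
  qed
  have red: "emeasure L B = emeasure L (B \<inter> ?I)"
    if L: "sets L = sets borel" "N' \<in> null_sets L" "- manifold_interior S \<subseteq> N'" and B: "B \<in> sets borel" for L N' B
  proof -
    have "B - ?I \<in> null_sets L" by (rule null_sets_subset[OF L(2)]) (use B bI L manifold_interior_S in auto)
    then have "emeasure L ((B \<inter> ?I) \<union> (B - ?I)) = emeasure L (B \<inter> ?I)"
      using B bI L(1) by (intro emeasure_Un_null_set) auto
    then show ?thesis by (simp add: Int_Diff_Un)
  qed
  have "emeasure M B = emeasure cone_measure B" if B: "B \<in> sets borel" for B
  proof -
    define D where "D i = disjointed (\<lambda>i. A i \<inter> (B \<inter> ?I)) i" for i
    have bA: "A i \<inter> (B \<inter> ?I) \<in> sets borel" for i using gA[of i] B bI by (auto simp: good_def)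
    have bD: "D i \<in> sets borel" for i
      using sets.range_disjointed_sets[of "\<lambda>i. A i \<inter> (B \<inter> ?I)" borel] bA unfolding D_def by blast
    have disD: "disjoint_family D" unfolding D_def by (rule disjoint_family_disjointed)
    have "(\<Union>i. D i) = (\<Union>i. A i \<inter> (B \<inter> ?I))" unfolding D_def by (rule UN_disjointed_eq)
    also have "\<dots> = B \<inter> ?I" using cov by blast
    finally have UD: "(\<Union>i. D i) = B \<inter> ?I" .
    have Dsub: "D i \<subseteq> A i \<inter> ?I" for i using disjointed_subset[of "\<lambda>i. A i \<inter> (B \<inter> ?I)" i] unfolding D_def by blast
    have eqD: "emeasure cone_measure (D i) = emeasure M (D i)" for i using gA[of i] bD[of i] Dsub[of i] by (simp add: good_def)
    have s: "emeasure L (B \<inter> ?I) = (\<Sum>i. emeasure L (D i))" if "sets L = sets borel" for L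
      using suminf_emeasure[of D L] bD disD that UD by (simp add: image_subset_iff)
    have "emeasure M B = emeasure M (B \<inter> ?I)" by (rule red[OF M null B])
    also have "\<dots> = emeasure cone_measure (B \<inter> ?I)" using s[OF M] s[OF sc] eqD by simp
    also have "\<dots> = emeasure cone_measure B" by (rule red[OF sc cone_measure_concentrated order_refl B, symmetric])
    finally show ?thesis .
  qed
  then show ?thesis using M sc by (intro measure_eqI) simp_all
qed

lemma area_measure_eq: "area_measure S = cone_measure"
  unfolding area_measure_def
proof (rule the_equality)
  show "sets cone_measure = sets borel \<and> (\<exists>N\<in>null_sets cone_measure. - manifold_interior S \<subseteq> N) \<and>
    (\<forall>V \<phi> K. local_parametrization S V \<phi> \<and> compact K \<and> K \<subseteq> V \<longrightarrow>
        emeasure cone_measure (\<phi> ` K) = (\<integral>\<^sup>+ y\<in>K. ennreal (sqrt (det (gram_matrix \<phi> y))) \<partial>lborel))"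
  proof (intro conjI allI impI)
    show "sets cone_measure = sets borel" by (simp add: cone_measure_def)
    show "\<exists>N\<in>null_sets cone_measure. - manifold_interior S \<subseteq> N" using cone_measure_concentrated by blast
  qed (elim conjE, rule cone_measure_param)
next
  fix M assume "sets M = sets borel \<and> (\<exists>N\<in>null_sets M. - manifold_interior S \<subseteq> N) \<and>
    (\<forall>V \<phi> K. local_parametrization S V \<phi> \<and> compact K \<and> K \<subseteq> V \<longrightarrow>
        emeasure M (\<phi> ` K) = (\<integral>\<^sup>+ y\<in>K. ennreal (sqrt (det (gram_matrix \<phi> y))) \<partial>lborel))"
  then obtain N where "sets M = sets borel" "N \<in> null_sets M" "- manifold_interior S \<subseteq> N"
    and par: "\<forall>V \<phi> K. local_parametrization S V \<phi> \<and> compact K \<and> K \<subseteq> V \<longrightarrow>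
        emeasure M (\<phi> ` K) = (\<integral>\<^sup>+ y\<in>K. ennreal (sqrt (det (gram_matrix \<phi> y))) \<partial>lborel)" by blast
  then show "M = cone_measure" by (intro area_measure_unique[of M N]) simp_all
qed

text \<open>The surface integral of f divided by n + 1, written as a volume integral; see
  \<open>area_integral\<close>.\<close>

definition cone_integral :: "('n ambient \<Rightarrow> real) \<Rightarrow> real" where
  "cone_integral f = (LINT x:region|lborel. f (proj x) / (proj x \<bullet> \<nu> (proj x)))"

lemma cone_integrable:
  assumes f: "continuous_on S f"
  shows "set_integrable lborel region (\<lambda>x. f (proj x) / (proj x \<bullet> \<nu> (proj x)))"
proof -
  obtain B where B: "\<forall>p\<in>S. \<bar>f p\<bar> \<le> B"
    using compact_imp_bounded[OF compact_continuous_image[OF f S_compact]] by (auto simp: bounded_iff)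
  obtain \<delta> where d0: "\<delta> > 0" and d: "\<forall>p\<in>S. p \<bullet> \<nu> p \<ge> \<delta>" by (rule nu_lower_bound) (rule that)
  have "continuous_on upper (\<lambda>x. f (proj x) / (proj x \<bullet> \<nu> (proj x)))"
  proof (rule continuous_on_divide)
    show "continuous_on upper (\<lambda>x. proj x \<bullet> \<nu> (proj x))"
      by (rule continuous_on_proj_compose) (intro continuous_intros nu_cont)
  qed (use proj_nu_pos continuous_on_proj_compose[OF f] in force)+
  then have m: "(\<lambda>x. indicator region x *\<^sub>R (f (proj x) / (proj x \<bullet> \<nu> (proj x)))) \<in> borel_measurable borel"
    using region_open region_upper continuous_on_subset by (intro borel_measurable_continuous_on_indicator) auto
  show ?thesis unfolding set_integrable_def
  proof (rule Bochner_Integration.integrable_bound)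
    show "integrable lborel (\<lambda>x. indicator region x *\<^sub>R (B / \<delta>))"
      using emeasure_region_finite region_open by (intro integrable_scaleR_left integrable_real_indicator) auto
    show "AE x in lborel. norm (indicator region x *\<^sub>R (f (proj x) / (proj x \<bullet> \<nu> (proj x)))) \<le> norm (indicator region x *\<^sub>R (B / \<delta>))"
    proof (intro AE_I2)
      fix x :: "'n ambient"
      show "norm (indicator region x *\<^sub>R (f (proj x) / (proj x \<bullet> \<nu> (proj x)))) \<le> norm (indicator region x *\<^sub>R (B / \<delta>))"
      proof (cases "x \<in> region")
        case True
        then have p: "proj x \<in> S" using region_upper proj_upper by blast
        then have "\<bar>f (proj x)\<bar> \<le> B" "proj x \<bullet> \<nu> (proj x) \<ge> \<delta>" using B d by blast+
        then have "\<bar>f (proj x)\<bar> / (proj x \<bullet> \<nu> (proj x)) \<le> B / \<delta>" using d0 by (intro frac_le) auto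
        moreover have "B / \<delta> \<le> \<bar>B\<bar> / \<delta>" using d0 by (intro divide_right_mono) auto
        ultimately show ?thesis using True \<open>proj x \<bullet> \<nu> (proj x) \<ge> \<delta>\<close> d0 by simp
      qed simp
    qed
  qed (use m in simp)
qed

lemma area_integral:
  assumes f: "continuous_on S f"
  shows "(LINT p:S|area_measure S. f p) = (real CARD('n) + 1) * cone_integral f"
proof -
  let ?N = "real CARD('n) + 1"
  have bS: "S \<in> sets borel" using S_closed by (rule borel_closed)
  have mf: "(\<lambda>p. indicator S p *\<^sub>R f p) \<in> borel_measurable borel"
    using bS f by (rule borel_measurable_continuous_on_indicator)
  have "(LINT p:S|area_measure S. f p) = (\<integral>x. indicator S (surface_proj x) *\<^sub>R f (surface_proj x) \<partial>density lborel (\<lambda>x. ennreal (cone_weight x)))"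
    unfolding set_lebesgue_integral_def area_measure_eq cone_measure_def by (rule integral_distr) (use mf in auto)
  also have "\<dots> = (\<integral>x. cone_weight x *\<^sub>R (indicator S (surface_proj x) *\<^sub>R f (surface_proj x)) \<partial>lborel)"
  proof (rule integral_density)
    show "(\<lambda>x. indicator S (surface_proj x) *\<^sub>R f (surface_proj x)) \<in> borel_measurable lborel"
      using measurable_compose[OF surface_proj_measurable mf] by simp
  qed (auto simp: cone_weight_nonneg)
  also have "\<dots> = (\<integral>x. ?N * (indicator region x *\<^sub>R (f (proj x) / (proj x \<bullet> \<nu> (proj x)))) \<partial>lborel)"
  proof (rule Bochner_Integration.integral_cong)
    fix x :: "'n ambient"
    show "cone_weight x *\<^sub>R (indicator S (surface_proj x) *\<^sub>R f (surface_proj x)) = ?N * (indicator region x *\<^sub>R (f (proj x) / (proj x \<bullet> \<nu> (proj x))))"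
    proof (cases "x \<in> region")
      case True
      then have "x \<in> upper" using region_upper by blast
      then show ?thesis using True proj_upper[of x] by (simp add: cone_weight_def surface_proj_def)
    qed (simp add: cone_weight_def)
  qed simp
  also have "\<dots> = ?N * cone_integral f" unfolding cone_integral_def set_lebesgue_integral_def by (rule integral_mult_right_zero)
  finally show ?thesis .
qed

lemma anisotropic_area_eq:
  assumes F: "continuous_on UNIV F"
  shows "anisotropic_area F S = (real CARD('n) + 1) * cone_integral (\<lambda>p. F (\<nu> p))"
proof -
  have "anisotropic_area F S = (LINT p:S|area_measure S. F (\<nu> p))" unfolding anisotropic_area_def set_lebesgue_integral_def
    by (rule Bochner_Integration.integral_cong) (auto simp: indicator_def outward_normal_eq)
  also have "\<dots> = (real CARD('n) + 1) * cone_integral (\<lambda>p. F (\<nu> p))"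
    by (rule area_integral) (rule continuous_on_compose2[OF F nu_cont], simp)
  finally show ?thesis .
qed

lemma cone_integral_add:
  assumes "continuous_on S f" "continuous_on S h"
  shows "cone_integral (\<lambda>p. f p + h p) = cone_integral f + cone_integral h"
  using set_integral_add(2)[OF cone_integrable[OF assms(1)] cone_integrable[OF assms(2)]]
  by (simp add: cone_integral_def add_divide_distrib)

lemma cone_integral_cmult: "cone_integral (\<lambda>p. c * f p) = c * cone_integral f"
proof -
  have "(\<lambda>x. indicator region x *\<^sub>R (c * f (proj x) / (proj x \<bullet> \<nu> (proj x))))
     = (\<lambda>x. c * (indicator region x *\<^sub>R (f (proj x) / (proj x \<bullet> \<nu> (proj x)))))" by (simp add: fun_eq_iff)
  then show ?thesis unfolding cone_integral_def set_lebesgue_integral_def by (simp only: integral_mult_right_zero)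
qed

lemma cone_integral_cong:
  assumes "\<And>p. p \<in> S \<inter> upper \<Longrightarrow> f p = h p"
  shows "cone_integral f = cone_integral h"
  unfolding cone_integral_def set_lebesgue_integral_def
proof (rule Bochner_Integration.integral_cong)
  fix x :: "'n ambient"
  show "indicator region x *\<^sub>R (f (proj x) / (proj x \<bullet> \<nu> (proj x))) = indicator region x *\<^sub>R (h (proj x) / (proj x \<bullet> \<nu> (proj x)))"
  proof (cases "x \<in> region")
    case True
    then have "proj x \<in> S \<inter> upper" using proj_upper region_upper by blast
    then show ?thesis using assms by simp
  qed simp
qed simp

text \<open>The weight cancels. Together with \<open>area_integral\<close> this is the formula for
  the volume as a flux of the position vector.\<close>

lemma cone_integral_radial: "cone_integral (\<lambda>p. p \<bullet> \<nu> p) = vol cregion"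
proof -
  have "cone_integral (\<lambda>p. p \<bullet> \<nu> p) = (\<integral>x. indicator region x \<partial>lborel)"
    unfolding cone_integral_def set_lebesgue_integral_def
  proof (rule Bochner_Integration.integral_cong)
    fix x :: "'n ambient"
    show "indicator region x *\<^sub>R (proj x \<bullet> \<nu> (proj x) / (proj x \<bullet> \<nu> (proj x))) = indicator region x"
      using proj_nu_pos[of x] region_upper by (cases "x \<in> region") (auto simp: subset_iff)
  qed simp
  also have "\<dots> = vol region" using region_open by simp
  finally show ?thesis by (simp add: measure_cregion)
qed

end

section \<open>First variation of volume\<close>

context radial_surface
begin

text \<open>A substitute for polar coordinates. The half-space is cut into cones B j on which R lies
  between j \<delta> and c j = (j + 1) \<delta>. There {gauge \<le> R} is contained in the dilate by
  c j of the part of \<open>region\<close> in B j, and c j is at most R + \<delta>.\<close>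

lemma polar_bound:
  assumes R [measurable]: "R \<in> borel_measurable borel" and R0: "\<And>x. R x \<ge> 0"
    and hom: "\<And>t x. t > 0 \<Longrightarrow> x \<in> upper \<Longrightarrow> R (t *\<^sub>R x) = R x" and d: "\<delta> > 0"
  shows "emeasure lborel {x \<in> upper. gaugeS x \<le> R x}
    \<le> (\<integral>\<^sup>+x\<in>region. ennreal ((R x + \<delta>) ^ (CARD('n) + 1)) \<partial>lborel)"
proof -
  let ?U = "upper :: 'n ambient set"
  define c where "c j = (real j + 1) * \<delta>" for j
  have c0: "c j > 0" for j using d by (simp add: c_def)
  define B where "B j = ?U \<inter> {x. real j * \<delta> \<le> R x \<and> R x < c j}" for j
  have mU [measurable]: "?U \<in> sets borel" by (intro borel_open) simp
  have bB: "B j \<in> sets borel" for j unfolding B_def by measurable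
  have bR: "region \<in> sets borel" using region_open by (rule borel_open)
  have oD: "open {x \<in> ?U. gaugeS x < s}" for s
    using continuous_open_preimage[OF gauge_continuous_upper open_upper_halfspace, of "{..<s}"] by (simp add: vimage_def Int_def)
  define D where "D j = B j \<inter> {x \<in> ?U. gaugeS x < c j}" for j
  have bD: "D j \<in> sets borel" for j unfolding D_def using bB borel_open[OF oD] by (rule sets.Int)
  have D_scale: "D j = (\<lambda>x. c j *\<^sub>R x + 0) ` (region \<inter> B j)" for j
  proof
    show "D j \<subseteq> (\<lambda>x. c j *\<^sub>R x + 0) ` (region \<inter> B j)"
    proof
      fix y assume y: "y \<in> D j"
      then have yU: "y \<in> ?U" "y \<in> cupper" using upper_subset_closed_upper by (auto simp: D_def)
      have up: "inverse (c j) *\<^sub>R y \<in> ?U" using yU c0[of j] by (simp add: halfspaces_snd)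
      have "gaugeS (inverse (c j) *\<^sub>R y) = inverse (c j) * gaugeS y" using yU c0[of j] by (intro gauge_scale) auto
      also have "\<dots> < inverse (c j) * c j" using y c0[of j] by (intro mult_strict_left_mono) (auto simp: D_def)
      finally have "inverse (c j) *\<^sub>R y \<in> region" using up c0[of j] by (simp add: region_def)
      moreover have "inverse (c j) *\<^sub>R y \<in> B j" using y up hom[of "inverse (c j)" y] c0[of j] yU by (simp add: B_def D_def)
      ultimately show "y \<in> (\<lambda>x. c j *\<^sub>R x + 0) ` (region \<inter> B j)"
        using c0[of j] by (intro image_eqI[of _ _ "inverse (c j) *\<^sub>R y"]) auto
    qed
    show "(\<lambda>x. c j *\<^sub>R x + 0) ` (region \<inter> B j) \<subseteq> D j"
    proof
      fix y assume "y \<in> (\<lambda>x. c j *\<^sub>R x + 0) ` (region \<inter> B j)"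
      then obtain x where x: "x \<in> region" "x \<in> B j" "y = c j *\<^sub>R x" by auto
      then have xU: "x \<in> ?U" "x \<in> cupper" using upper_subset_closed_upper by (auto simp: B_def)
      have "gaugeS y < c j * 1" unfolding x(3) using gauge_scale[of "c j" x] xU x(1) c0[of j] by (simp add: region_def)
      moreover have "y \<in> ?U" unfolding x(3) using xU c0[of j] by (simp add: halfspaces_snd)
      ultimately show "y \<in> D j" using x hom[OF c0 xU(1), of j] by (simp add: D_def B_def)
    qed
  qed
  define f where "f x = ennreal ((R x + \<delta>) ^ (CARD('n) + 1))" for x
  have mf [measurable]: "f \<in> borel_measurable borel" unfolding f_def by measurable
  define \<mu> where "\<mu> = density lborel f"
  have em: "emeasure \<mu> X = (\<integral>\<^sup>+x. f x * indicator X x \<partial>lborel)" if "X \<in> sets borel" for X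
    unfolding \<mu>_def using that by (simp add: emeasure_density)
  have Dj: "emeasure lborel (D j) \<le> emeasure \<mu> (region \<inter> B j)" for j
  proof -
    have b: "region \<inter> B j \<in> sets borel" using bB bR by (rule sets.Int[rotated])
    have "emeasure lborel (D j) = emeasure lebesgue ((\<lambda>x. c j *\<^sub>R x + 0) ` (region \<inter> B j))"
      unfolding D_scale[symmetric] using bD by simp
    also have "\<dots> = ennreal (c j ^ (CARD('n) + 1)) * emeasure lborel (region \<inter> B j)"
      using emeasure_lebesgue_affine[of "c j" 0 "region \<inter> B j"] c0[of j] b by simp
    also have "\<dots> = (\<integral>\<^sup>+x. ennreal (c j ^ (CARD('n) + 1)) * indicator (region \<inter> B j) x \<partial>lborel)"
      using b by (simp add: nn_integral_cmult_indicator)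
    also have "\<dots> \<le> emeasure \<mu> (region \<inter> B j)" unfolding em[OF b]
    proof (intro nn_integral_mono)
      fix x show "ennreal (c j ^ (CARD('n) + 1)) * indicator (region \<inter> B j) x \<le> f x * indicator (region \<inter> B j) x"
      proof (cases "x \<in> region \<inter> B j")
        case True
        then have "c j \<le> R x + \<delta>" by (simp add: B_def c_def algebra_simps)
        then have "c j ^ (CARD('n) + 1) \<le> (R x + \<delta>) ^ (CARD('n) + 1)" using c0[of j] by (intro power_mono) auto
        then have "ennreal (c j ^ (CARD('n) + 1)) \<le> f x" unfolding f_def by (rule ennreal_leI)
        then show ?thesis using True by simp
      qed simp
    qed
    finally show ?thesis .
  qed
  have cover: "{x \<in> ?U. gaugeS x \<le> R x} \<subseteq> (\<Union>j. D j)"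
  proof
    fix x assume x: "x \<in> {x \<in> ?U. gaugeS x \<le> R x}"
    define j where "j = nat \<lfloor>R x / \<delta>\<rfloor>"
    have "0 \<le> R x / \<delta>" using R0[of x] d by simp
    then have "real j \<le> R x / \<delta>" "R x / \<delta> < real j + 1" unfolding j_def by linarith+
    then have "real j * \<delta> \<le> R x" "R x < c j" using d by (simp_all add: c_def field_simps)
    then have "x \<in> D j" using x by (simp add: D_def B_def)
    then show "x \<in> (\<Union>j. D j)" by blast
  qed
  have "emeasure lborel {x \<in> ?U. gaugeS x \<le> R x} \<le> emeasure lborel (\<Union>j. D j)"
    using cover bD by (intro emeasure_mono) auto
  also have "\<dots> \<le> (\<Sum>j. emeasure lborel (D j))" by (rule emeasure_subadditive_countably) (use bD in auto)
  also have "\<dots> \<le> (\<Sum>j. emeasure \<mu> (region \<inter> B j))" by (intro suminf_le Dj) auto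
  also have "\<dots> = emeasure \<mu> (\<Union>j. region \<inter> B j)"
  proof (rule suminf_emeasure)
    show "range (\<lambda>j. region \<inter> B j) \<subseteq> sets \<mu>" using bB bR by (auto simp: \<mu>_def)
    have "i = j" if "x \<in> B i" "x \<in> B j" for x i j
    proof -
      have "real i * \<delta> < (real j + 1) * \<delta>" "real j * \<delta> < (real i + 1) * \<delta>" using that by (auto simp: B_def c_def)
      then have "real i < real j + 1" "real j < real i + 1" using d by simp_all
      then show ?thesis by linarith
    qed
    then show "disjoint_family (\<lambda>j. region \<inter> B j)" unfolding disjoint_family_on_def by blast
  qed
  also have "\<dots> \<le> emeasure \<mu> region" using bR by (intro emeasure_mono) (auto simp: \<mu>_def)
  finally show ?thesis using em[OF bR] by (simp add: f_def)
qed

lemma perturbed_gauge_bound: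
  assumes P: "compact P" "fst ` P \<subseteq> cregion"
  shows "\<exists>C>0. \<forall>x k e. (x, k) \<in> P \<longrightarrow> norm k \<le> C \<and> (0 \<le> e \<longrightarrow> x + e *\<^sub>R k \<in> cupper \<longrightarrow> gaugeS (x + e *\<^sub>R k) \<le> 1 + e * C)"
proof -
  obtain M where M: "M > 0" "\<forall>z\<in>P. norm z \<le> M" using compact_imp_bounded[OF P(1)] unfolding bounded_pos by blast
  obtain L where L: "L > 0" and lip: "\<forall>x\<in>cupper. \<forall>y\<in>cupper. \<bar>gaugeS x - gaugeS y\<bar> \<le> L * norm (x - y)"
    by (rule gauge_lipschitz) (rule that)
  have k: "norm k \<le> M" if "(x, k) \<in> P" for x k using M(2) that norm_snd_le[of k x] by fastforce
  have "gaugeS (x + e *\<^sub>R k) \<le> 1 + e * (M + L * M)" if xk: "(x, k) \<in> P" and e: "0 \<le> e" "x + e *\<^sub>R k \<in> cupper" for x k e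
  proof -
    have x: "x \<in> cupper" "gaugeS x \<le> 1" using P(2) imageI[OF xk, of fst] by (auto simp: cregion_def)
    then have "gaugeS (x + e *\<^sub>R k) - gaugeS x \<le> L * norm (x + e *\<^sub>R k - x)" using lip e by fastforce
    also have "\<dots> = e * (L * norm k)" using e by simp
    also have "\<dots> \<le> e * (M + L * M)" using e k[OF xk] L M(1) by (intro mult_left_mono) (auto intro: order_trans[OF mult_left_mono[OF k[OF xk]]])
    finally show ?thesis using x(2) by simp
  qed
  moreover have "norm k \<le> M + L * M" if "(x, k) \<in> P" for x k using k[OF that] L M(1) by (simp add: add_increasing2)
  ultimately show ?thesis using L M(1) by (intro exI[of _ "M + L * M"]) (simp add: add_pos_pos)
qed

text \<open>If \<open>t p = x + e k\<close> with \<open>x\<close> in the region, expand \<open>gaugeS (t p - e k) \<le> 1\<close> to first order at \<open>p\<close>.\<close>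

lemma perturbed_ray_bound:
  assumes P: "compact P" "fst ` P \<subseteq> cregion"
    and p: "p \<in> S" "p \<in> upper" and PQ: "\<And>k. (p, k) \<in> P \<Longrightarrow> \<nu> p \<bullet> k \<le> q * (p \<bullet> \<nu> p)" and \<kappa>: "\<kappa> > 0"
  shows "\<exists>d>0. \<forall>e t x k. 0 < e \<longrightarrow> e < d \<longrightarrow> (x, k) \<in> P \<longrightarrow> t *\<^sub>R p = x + e *\<^sub>R k \<longrightarrow> t \<le> 1 + e * (q + \<kappa>)"
proof -
  obtain C where C: "C > 0" and kC: "\<And>x k. (x, k) \<in> P \<Longrightarrow> norm k \<le> C"
    and Cb: "\<And>x k e. (x, k) \<in> P \<Longrightarrow> 0 \<le> e \<Longrightarrow> x + e *\<^sub>R k \<in> cupper \<Longrightarrow> gaugeS (x + e *\<^sub>R k) \<le> 1 + e * C"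
    using perturbed_gauge_bound[OF P] by blast
  have pn: "p \<bullet> \<nu> p > 0" and pc: "p \<in> cupper" using nu_pos p S_closed_upper by auto
  define C' where "C' = (C + \<bar>q\<bar>) * norm p + C"
  have C': "C' > 0" using C by (simp add: C'_def add_nonneg_pos)
  have gp: "grad p = \<nu> p /\<^sub>R (p \<bullet> \<nu> p)" using p proj_S by (simp add: grad_def)
  have "\<kappa> / (2 * C') > 0" using \<kappa> C' by simp
  then obtain d1 where d1: "d1 > 0" and D: "\<And>y. norm (y - p) < d1 \<Longrightarrow> norm (gaugeS y - gaugeS p - (y - p) \<bullet> grad p) \<le> \<kappa> / (2 * C') * norm (y - p)"
    using gauge_derivative[OF p(2)] unfolding has_derivative_at_alt by blast
  \<comment> \<open>The bound on k is assumed at p only. The base points of pairs that violate it by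
    \<kappa> / 2 form a compact set without p, so it holds up to \<kappa> / 2 near p.\<close>
  let ?X = "P \<inter> {z. \<nu> p \<bullet> snd z \<ge> (q + \<kappa> / 2) * (p \<bullet> \<nu> p)}"
  have "compact (fst ` ?X)" by (intro compact_continuous_image compact_Int_closed P(1) closed_Collect_le continuous_intros)
  moreover have "p \<notin> fst ` ?X"
  proof
    assume "p \<in> fst ` ?X"
    then obtain k where "(p, k) \<in> P" "\<nu> p \<bullet> k \<ge> (q + \<kappa> / 2) * (p \<bullet> \<nu> p)" by (auto simp: split_paired_Ex)
    with PQ have "(q + \<kappa> / 2) * (p \<bullet> \<nu> p) \<le> q * (p \<bullet> \<nu> p)" by fastforce
    then show False using pn \<kappa> by simp
  qed
  ultimately obtain d2 where d2: "d2 > 0" "ball p d2 \<subseteq> - fst ` ?X"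
    using compact_imp_closed open_Compl open_contains_ball by (metis ComplI)
  \<comment> \<open>As |x - p| \<le> e C', the first bound keeps x within d1 and d2 of p; the second
    makes t positive in the nontrivial case t > 1 - e |q|.\<close>
  define d where "d = min (min d1 d2 / C') (1 / (\<bar>q\<bar> + 1))"
  have d0: "d > 0" using d1 d2 C' by (simp add: d_def)
  have "t \<le> 1 + e * (q + \<kappa>)" if e: "0 < e" "e < d" and xk: "(x, k) \<in> P" and t: "t *\<^sub>R p = x + e *\<^sub>R k" for e t x k
  proof (cases "t \<le> 1 - e * \<bar>q\<bar>")
    case True
    moreover have "- (e * \<bar>q\<bar>) \<le> e * (q + \<kappa>)" using mult_left_mono[of "- \<bar>q\<bar>" "q + \<kappa>" e] e \<kappa> by simp
    ultimately show ?thesis by linarith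
  next
    case False
    have "e * (\<bar>q\<bar> + 1) < 1" using e by (simp add: d_def pos_less_divide_eq)
    then have "e * \<bar>q\<bar> < 1" using e by (simp add: algebra_simps)
    then have t0: "t > 0" using False by linarith
    have xp: "x - p = (t - 1) *\<^sub>R p - e *\<^sub>R k" using t by (simp add: algebra_simps)
    have tp: "x + e *\<^sub>R k \<in> cupper" unfolding t[symmetric] using t0 pc by (simp add: halfspaces_snd)
    have "t * gaugeS p = gaugeS (x + e *\<^sub>R k)" unfolding t[symmetric] using t0 pc by (intro gauge_scale[symmetric]) auto
    then have "t - 1 \<le> e * C" using Cb[OF xk _ tp] e gauge_S[OF p(1)] by simp
    moreover have "0 \<le> e * C" "0 \<le> e * \<bar>q\<bar>" using e C by simp_all
    ultimately have t1: "\<bar>t - 1\<bar> \<le> e * (C + \<bar>q\<bar>)" using False by (simp add: distrib_left abs_le_iff)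
    have "norm (x - p) \<le> \<bar>t - 1\<bar> * norm p + e * norm k"
      unfolding xp using norm_triangle_ineq4[of "(t - 1) *\<^sub>R p" "e *\<^sub>R k"] e by simp
    also have "\<dots> \<le> e * (C + \<bar>q\<bar>) * norm p + e * C" using t1 kC[OF xk] e by (intro add_mono mult_right_mono mult_left_mono) auto
    also have "\<dots> = e * C'" by (simp add: C'_def algebra_simps)
    finally have n: "norm (x - p) \<le> e * C'" .
    also have "\<dots> < min d1 d2" using e C' by (simp add: d_def pos_less_divide_eq)
    finally have n2: "norm (x - p) < d1" "x \<in> ball p d2" by (auto simp: dist_norm norm_minus_commute)
    have "gaugeS x \<le> 1" using P(2) imageI[OF xk, of fst] by (auto simp: cregion_def)
    then have "(x - p) \<bullet> grad p \<le> \<kappa> / (2 * C') * (e * C')"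
      using D[OF n2(1)] gauge_S[OF p(1)] mult_left_mono[OF n, of "\<kappa> / (2 * C')"] \<kappa> C'
      by (smt (verit, best) divide_pos_pos real_norm_def)
    then have a: "(x - p) \<bullet> grad p \<le> e * (\<kappa> / 2)" using C' by (simp add: mult.commute)
    have alg: "((t - 1) * s - e * r) / s = (t - 1) - e * (r / s)" if "s > 0" for s r :: real using that by (simp add: field_simps)
    have "(x - p) \<bullet> grad p = (t - 1) - e * ((\<nu> p \<bullet> k) / (p \<bullet> \<nu> p))"
      unfolding xp gp alg[OF pn, symmetric] by (simp add: inner_diff_left inner_commute[of k] divide_inverse mult.commute)
    moreover have "(\<nu> p \<bullet> k) / (p \<bullet> \<nu> p) \<le> q + \<kappa> / 2"
    proof -
      have "x \<notin> fst ` ?X" using d2(2) n2(2) by blast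
      then have "(x, k) \<notin> ?X" by force
      then show ?thesis using xk pn by (simp add: pos_divide_le_eq)
    qed
    then have "e * ((\<nu> p \<bullet> k) / (p \<bullet> \<nu> p)) \<le> e * (q + \<kappa> / 2)" using e by (intro mult_left_mono) auto
    ultimately show ?thesis using a by (simp add: algebra_simps)
  qed
  then show ?thesis using d0 by blast
qed

definition perturbed :: "('n ambient \<times> 'n ambient) set \<Rightarrow> real \<Rightarrow> 'n ambient set" where
  "perturbed P e = (\<lambda>z. fst z + e *\<^sub>R snd z) ` P"

lemma compact_perturbed: "compact P \<Longrightarrow> compact (perturbed P e)"
  unfolding perturbed_def by (intro compact_continuous_image continuous_intros)

text \<open>Taking the supremum over rationals makes the measurability evident.\<close>

definition radial_max :: "'n ambient set \<Rightarrow> 'n ambient \<Rightarrow> real" where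
  "radial_max X x = (SUP s\<in>\<rat> \<inter> {0<..}.
     if x \<in> upper \<and> proj x \<in> proj ` (X \<inter> {y \<in> cupper. s \<le> gaugeS y}) then s else 0)"

context
  fixes X :: "'n ambient set"
  assumes X: "compact X"
begin

lemma radial_max_bdd:
  "bdd_above ((\<lambda>s. if x \<in> upper \<and> proj x \<in> proj ` (X \<inter> {y \<in> cupper. s \<le> gaugeS y}) then s else 0) ` (\<rat> \<inter> {0<..}))"
proof -
  have "compact (X \<inter> cupper)" using X by (intro compact_Int_closed) auto
  then have "bdd_above (gaugeS ` (X \<inter> cupper))"
    by (intro bounded_imp_bdd_above compact_imp_bounded compact_continuous_image continuous_on_subset[OF gauge_continuous]) auto
  then obtain B where "\<And>y. y \<in> X \<Longrightarrow> y \<in> cupper \<Longrightarrow> gaugeS y \<le> B" unfolding bdd_above_def by blast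
  then show ?thesis by (intro bdd_aboveI2[of _ _ "max 0 B"]) (fastforce simp: le_max_iff_disj)
qed

lemma radial_max_nonneg: "0 \<le> radial_max X x"
  unfolding radial_max_def by (rule cSUP_upper2[OF radial_max_bdd, of 1]) auto

lemma radial_max_leI:
  assumes "0 \<le> b" "\<And>y. y \<in> X \<Longrightarrow> y \<in> cupper \<Longrightarrow> proj y = proj x \<Longrightarrow> gaugeS y \<le> b"
  shows "radial_max X x \<le> b"
  unfolding radial_max_def
proof (rule cSUP_least)
  have "(1::real) \<in> \<rat> \<inter> {0<..}" by simp
  then show "\<rat> \<inter> {0<..} \<noteq> ({} :: real set)" by blast
  fix s :: real assume "s \<in> \<rat> \<inter> {0<..}"
  then show "(if x \<in> upper \<and> proj x \<in> proj ` (X \<inter> {y \<in> cupper. s \<le> gaugeS y}) then s else 0) \<le> b"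
    using assms by (force intro: order_trans)
qed

lemma radial_max_ge:
  assumes y: "y \<in> X" "y \<in> upper"
  shows "gaugeS y \<le> radial_max X y"
proof (rule ccontr)
  assume "\<not> gaugeS y \<le> radial_max X y"
  then obtain s where s: "s \<in> \<rat>" "radial_max X y < s" "s < gaugeS y" using Rats_dense_in_real by (meson not_le)
  have yc: "y \<in> cupper" using y upper_subset_closed_upper by blast
  have s1: "s \<in> \<rat> \<inter> {0<..}" using s radial_max_nonneg[of y] by simp
  have "proj y \<in> proj ` (X \<inter> {y \<in> cupper. s \<le> gaugeS y})" using y yc s by auto
  then have "s \<le> radial_max X y" unfolding radial_max_def by (intro cSUP_upper2[OF radial_max_bdd s1]) (use y in auto)
  then show False using s by simp
qed

lemma radial_max_scale: "t > 0 \<Longrightarrow> x \<in> upper \<Longrightarrow> radial_max X (t *\<^sub>R x) = radial_max X x"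
  using proj_scale[of t x] upper_subset_closed_upper by (auto simp: radial_max_def halfspaces_snd)

text \<open>For a fixed rational level the condition places \<open>proj x\<close> in the image of a
  compact part of X, a compact set, and there are countably many levels.\<close>

lemma radial_max_measurable: "radial_max X \<in> borel_measurable borel"
  unfolding radial_max_def
proof (rule borel_measurable_cSUP)
  show "countable (\<rat> \<inter> {0<..} :: real set)" using countable_rat by blast
  fix s :: real assume s: "s \<in> \<rat> \<inter> {0<..}"
  let ?X = "X \<inter> {y \<in> cupper. s \<le> gaugeS y}"
  have "{y \<in> cupper. s \<le> gaugeS y} = cupper \<inter> gaugeS -` {s..}" by auto
  then have "closed {y \<in> cupper. s \<le> gaugeS y}" using continuous_closed_preimage[OF gauge_continuous] by simp
  then have "compact ?X" using X by (intro compact_Int_closed)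
  moreover have "0 \<notin> ?X" using s by simp
  then have "?X \<subseteq> cupper - {0}" by blast
  ultimately have "compact (proj ` ?X)" by (intro compact_continuous_image continuous_on_subset[OF proj_continuous])
  then have pX: "proj ` ?X \<in> sets borel" by (rule borel_compact)
  have gen: "{x. x \<in> upper \<and> proj x \<in> B} \<in> sets borel" if B: "B \<in> sets borel" for B
  proof -
    have "{x. x \<in> upper \<and> proj x \<in> B} = upper \<inter> surface_proj -` B"
      unfolding surface_proj_def by (intro set_eqI) (simp cong: conj_cong)
    moreover have "surface_proj -` B \<in> sets borel" using measurable_sets[OF surface_proj_measurable B] by simp
    moreover have "(upper :: 'n ambient set) \<in> sets borel" by (intro borel_open) simp
    ultimately show ?thesis by (simp only: sets.Int)
  qed
  have mI: "(\<lambda>x. if x \<in> W then s else 0) \<in> borel_measurable borel" if W: "W \<in> sets borel" for W :: "'n ambient set"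
    by (rule measurable_If_set) (use W in simp_all)
  show "(\<lambda>x. if x \<in> upper \<and> proj x \<in> proj ` ?X then s else 0) \<in> borel_measurable borel"
    using mI[OF gen[OF pX]] by (simp only: mem_Collect_eq)
qed (rule radial_max_bdd)

end

text \<open>By \<open>perturbed_ray_bound\<close> the gauge on the perturbed set along the ray of p
  is at most 1 + e (Q p + o(1)). Through \<open>polar_bound\<close> the volume is at most the
  integral of (1 + e w)^(n+1) over the region, with w tending to Q; the first order in e is
  compared. The o(1) may depend on the ray, as dominated convergence needs pointwise limits
  only.\<close>

lemma variation_le:
  assumes P: "compact P" "fst ` P \<subseteq> cregion"
    and Q [measurable]: "Q \<in> borel_measurable borel" and Qb: "\<And>p. p \<in> S \<Longrightarrow> \<bar>Q p\<bar> \<le> q"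
    and PQ: "\<And>p k. p \<in> S \<Longrightarrow> p \<in> upper \<Longrightarrow> (p, k) \<in> P \<Longrightarrow> \<nu> p \<bullet> k \<le> Q p * (p \<bullet> \<nu> p)"
    and vol: "\<forall>\<^sub>F e in at_right 0. vol cregion + e * c \<le> vol (perturbed P e \<inter> cupper)"
  shows "c \<le> (real CARD('n) + 1) * (LINT x:region|lborel. Q (proj x))"
proof -
  let ?N = "CARD('n) + 1"
  obtain C where C: "C > 0" and kC: "\<And>x k. (x, k) \<in> P \<Longrightarrow> norm k \<le> C"
    and Cb: "\<And>x k e. (x, k) \<in> P \<Longrightarrow> 0 \<le> e \<Longrightarrow> x + e *\<^sub>R k \<in> cupper \<Longrightarrow> gaugeS (x + e *\<^sub>R k) \<le> 1 + e * C"
    using perturbed_gauge_bound[OF P] by blast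
  define e where "e m = 1 / real (Suc m)" for m
  have e: "0 < e m" "e m \<le> 1" for m by (simp_all add: e_def)
  have e0: "e \<longlonglongrightarrow> 0" unfolding e_def by (rule LIMSEQ_Suc[OF lim_1_over_n])
  define Z where "Z m = perturbed P (e m) \<inter> cupper" for m
  have cZ: "compact (Z m)" for m unfolding Z_def using P(1) by (intro compact_Int_closed compact_perturbed) auto
  define R where "R m x = radial_max (Z m) x" for m x
  have mR [measurable]: "R m \<in> borel_measurable borel" for m using radial_max_measurable[OF cZ] by (simp add: R_def[abs_def])
  define Q' where "Q' x = indicator upper x *\<^sub>R Q (surface_proj x)" for x
  have mU [measurable]: "(upper :: 'n ambient set) \<in> sets borel" by (intro borel_open) simp
  have mQ' [measurable]: "Q' \<in> borel_measurable borel" unfolding Q'_def by measurable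
  have Q'_eq: "Q' x = Q (proj x)" if "x \<in> upper" for x using that by (simp add: Q'_def surface_proj_def)
  \<comment> \<open>Only upper bounds for (R - 1) / e are known; the maximum with Q' turns them into
    convergence to Q'. The summand e pays for the choice \<delta> = e^2 in
    \<open>polar_bound\<close>.\<close>
  define w where "w m x = max ((R m x - 1) / e m + e m) (Q' x)" for m x
  \<comment> \<open>The increment of (1 + e w)^(n+1) divided by e, factorised so that its limit (n +
    1) Q' and a uniform bound are visible.\<close>
  define h where "h m x = w m x * (\<Sum>i<?N. (1 + e m * w m x) ^ i)" for m x
  have h_eq: "1 + e m * h m x = (1 + e m * w m x) ^ ?N" for m x
    using power_diff_1_eq[of "1 + e m * w m x" ?N] by (simp add: h_def algebra_simps del: sum.lessThan_Suc power_Suc)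
  have R0: "0 \<le> R m x" for m x unfolding R_def by (rule radial_max_nonneg[OF cZ])
  have Rb: "R m x \<le> 1 + e m * C" for m x unfolding R_def
  proof (rule radial_max_leI[OF cZ])
    show "0 \<le> 1 + e m * C" using e[of m] C by simp
    fix y assume "y \<in> Z m"
    then obtain z where "z \<in> P" "y = fst z + e m *\<^sub>R snd z" "y \<in> cupper" unfolding Z_def perturbed_def by blast
    then show "gaugeS y \<le> 1 + e m * C" using Cb[of "fst z" "snd z" "e m"] e[of m] by simp
  qed
  define b where "b = C + 1 + \<bar>q\<bar>"
  have wb: "\<bar>w m x\<bar> \<le> b" "0 \<le> 1 + e m * w m x" "R m x + (e m)\<^sup>2 \<le> 1 + e m * w m x" if x: "x \<in> region" for m x
  proof -
    have p: "proj x \<in> S" "x \<in> upper" using x region_upper proj_upper by blast+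
    have "(R m x - 1) / e m \<le> C" using Rb[of m x] e[of m] by (simp add: pos_divide_le_eq mult.commute)
    moreover have "\<bar>Q' x\<bar> \<le> q" using Qb p by (simp add: Q'_eq)
    ultimately show "\<bar>w m x\<bar> \<le> b" using e[of m] C by (auto simp: w_def b_def max_def)
    have "e m * ((R m x - 1) / e m + e m) \<le> e m * w m x" using e[of m] by (intro mult_left_mono) (auto simp: w_def)
    then show *: "R m x + (e m)\<^sup>2 \<le> 1 + e m * w m x" using e[of m] by (simp add: distrib_left power2_eq_square)
    show "0 \<le> 1 + e m * w m x" using order_trans[OF add_nonneg_nonneg[OF R0 zero_le_power2] *] .
  qed
  have b0: "b \<ge> 0" using C by (simp add: b_def)
  have mw [measurable]: "w m \<in> borel_measurable borel" for m unfolding w_def by measurable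
  have mh [measurable]: "h m \<in> borel_measurable borel" for m unfolding h_def by measurable
  have mreg [measurable]: "region \<in> sets borel" using region_open by (rule borel_open)
  define hb where "hb = b * (\<Sum>i<?N. (1 + b) ^ i)"
  have hbnd: "\<bar>h m x\<bar> \<le> hb" if x: "x \<in> region" for m x
  proof -
    note w = wb[OF x, of m]
    have "e m * w m x \<le> e m * b" using w(1) e[of m] by (intro mult_left_mono) auto
    also have "\<dots> \<le> 1 * b" using e[of m] b0 by (intro mult_right_mono)
    finally have "(\<Sum>i<?N. (1 + e m * w m x) ^ i) \<le> (\<Sum>i<?N. (1 + b) ^ i)" using w(2) by (intro sum_mono power_mono) auto
    moreover have "0 \<le> (\<Sum>i<?N. (1 + e m * w m x) ^ i)" using w(2) by (intro sum_nonneg) simp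
    ultimately show ?thesis unfolding h_def hb_def abs_mult using w(1) b0 by (intro mult_mono) auto
  qed
  have inth: "integrable lborel (\<lambda>x. indicator region x *\<^sub>R h m x)" for m
  proof (rule Bochner_Integration.integrable_bound)
    show "integrable lborel (\<lambda>x. indicator region x *\<^sub>R hb)"
      using emeasure_region_finite by (intro integrable_scaleR_left integrable_real_indicator) auto
    show "AE x in lborel. norm (indicator region x *\<^sub>R h m x) \<le> norm (indicator region x *\<^sub>R hb)"
    proof (intro AE_I2)
      fix x show "norm (indicator region x *\<^sub>R h m x) \<le> norm (indicator region x *\<^sub>R hb)"
        using hbnd[of x m] by (cases "x \<in> region") auto
    qed
  qed measurable
  have step: "c \<le> (\<integral>x. indicator region x *\<^sub>R h m x \<partial>lborel)"
    if volm: "vol cregion + e m * c \<le> vol (Z m)" for m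
  proof -
    let ?Z = "Z m"
    let ?A = "{x \<in> upper. gaugeS x \<le> R m x}"
    let ?I = "\<integral>x. indicator region x *\<^sub>R h m x \<partial>lborel"
    \<comment> \<open>\<open>radial_max\<close> sees rays of the open half-space only; the rest of Z
      lies in the hyperplane, a null set.\<close>
    have "?Z \<subseteq> ?A \<union> boundary_hyperplane"
    proof
      fix y assume y: "y \<in> ?Z"
      then have "snd y \<ge> 0" by (simp add: Z_def halfspaces_snd)
      then show "y \<in> ?A \<union> boundary_hyperplane" using radial_max_ge[OF cZ y] by (auto simp: halfspaces_snd R_def)
    qed
    moreover have bA: "?A \<in> sets borel"
    proof -
      have "(\<lambda>x. indicator upper x *\<^sub>R gaugeS x) \<in> borel_measurable borel"
        by (rule borel_measurable_continuous_on_indicator) (use gauge_continuous_upper in auto)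
      then have "{x. indicator upper x *\<^sub>R gaugeS x \<le> R m x} \<in> sets borel" using borel_measurable_le[OF _ mR] by (simp only: space_borel UNIV_I simp_thms)
      then have "upper \<inter> {x. indicator upper x *\<^sub>R gaugeS x \<le> R m x} \<in> sets borel" using mU by (intro sets.Int)
      moreover have "upper \<inter> {x. indicator upper x *\<^sub>R gaugeS x \<le> R m x} = ?A" by (intro set_eqI) (simp cong: conj_cong)
      ultimately show ?thesis by (simp only:)
    qed
    moreover have null: "boundary_hyperplane \<in> null_sets (lebesgue :: 'n ambient measure)"
      using hyperplane_negligible negligible_iff_null_sets by blast
    moreover have bZ: "?Z \<in> sets borel" using cZ by (rule borel_compact)
    ultimately have "emeasure lebesgue ?Z \<le> emeasure lebesgue (?A \<union> boundary_hyperplane)"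
      by (intro emeasure_mono sets.Un) (auto dest: null_setsD2)
    also have "\<dots> = emeasure lebesgue ?A" by (rule emeasure_Un_null_set[OF _ null]) (use bA in simp)
    also have "\<dots> = emeasure lborel ?A" using bA by simp
    also have "\<dots> \<le> (\<integral>\<^sup>+x\<in>region. ennreal ((R m x + (e m)\<^sup>2) ^ ?N) \<partial>lborel)"
    proof (rule polar_bound)
      show "0 \<le> R m x" for x by (rule R0)
      show "R m (t *\<^sub>R x) = R m x" if "t > 0" "x \<in> upper" for t x unfolding R_def using radial_max_scale[OF cZ that] .
      show "0 < (e m)\<^sup>2" using e(1)[of m] by (rule zero_less_power)
    qed (rule mR)
    also have "\<dots> \<le> (\<integral>\<^sup>+x. ennreal (indicator region x *\<^sub>R (1 + e m * h m x)) \<partial>lborel)"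
    proof (intro nn_integral_mono)
      fix x show "ennreal ((R m x + (e m)\<^sup>2) ^ ?N) * indicator region x \<le> ennreal (indicator region x *\<^sub>R (1 + e m * h m x))"
      proof (cases "x \<in> region")
        case True
        have "(R m x + (e m)\<^sup>2) ^ ?N \<le> (1 + e m * w m x) ^ ?N" using R0[of m x] wb(3)[OF True, of m] by (intro power_mono) auto
        then show ?thesis using True by (simp only: h_eq[symmetric] indicator_simps) (simp add: ennreal_leI)
      qed simp
    qed
    also have "\<dots> = ennreal (\<integral>x. indicator region x *\<^sub>R (1 + e m * h m x) \<partial>lborel)"
    proof (rule nn_integral_eq_integral)
      have "integrable lborel (\<lambda>x. indicator region x + e m * (indicator region x *\<^sub>R h m x))"
        using emeasure_region_finite by (intro Bochner_Integration.integrable_add integrable_mult_right inth integrable_real_indicator) auto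
      then show "integrable lborel (\<lambda>x. indicator region x *\<^sub>R (1 + e m * h m x))" by (simp add: algebra_simps)
      show "AE x in lborel. 0 \<le> indicator region x *\<^sub>R (1 + e m * h m x)"
      proof (intro AE_I2)
        fix x show "0 \<le> indicator region x *\<^sub>R (1 + e m * h m x)"
          using wb(2)[of x m] h_eq[of m x] by (cases "x \<in> region") (simp_all del: power_Suc)
      qed
    qed
    also have I_eq: "(\<integral>x. indicator region x *\<^sub>R (1 + e m * h m x) \<partial>lborel) = vol cregion + e m * ?I"
    proof -
      have "(\<integral>x. indicator region x *\<^sub>R (1 + e m * h m x) \<partial>lborel) = (\<integral>x. indicator region x + e m * (indicator region x *\<^sub>R h m x) \<partial>lborel)"
        by (simp add: algebra_simps)
      then show ?thesis using emeasure_region_finite inth[of m]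
        by (subst (asm) Bochner_Integration.integral_add) (auto intro!: integrable_real_indicator simp: measure_cregion)
    qed
    finally have "emeasure lebesgue ?Z \<le> ennreal (vol cregion + e m * ?I)" .
    moreover have "0 \<le> (\<integral>x. indicator region x *\<^sub>R (1 + e m * h m x) \<partial>lborel)"
    proof (intro Bochner_Integration.integral_nonneg)
      fix x show "0 \<le> indicator region x *\<^sub>R (1 + e m * h m x)"
        using wb(2)[of x m] h_eq[of m x] by (cases "x \<in> region") (simp_all del: power_Suc)
    qed
    ultimately have "vol ?Z \<le> vol cregion + e m * ?I" unfolding measure_def I_eq by (intro enn2real_leI) auto
    then have "e m * c \<le> e m * ?I" using volm by linarith
    then show ?thesis using e[of m] by simp
  qed
  have "(\<lambda>m. \<integral>x. indicator region x *\<^sub>R h m x \<partial>lborel) \<longlonglongrightarrow> (\<integral>x. indicator region x *\<^sub>R (Q' x * ?N) \<partial>lborel)"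
  proof (rule integral_dominated_convergence[where w = "\<lambda>x. indicator region x *\<^sub>R hb"])
    show "integrable lborel (\<lambda>x. indicator region x *\<^sub>R hb)"
      using emeasure_region_finite by (intro integrable_scaleR_left integrable_real_indicator) auto
    show "AE x in lborel. norm (indicator region x *\<^sub>R h m x) \<le> indicator region x *\<^sub>R hb" for m
    proof (intro AE_I2)
      fix x show "norm (indicator region x *\<^sub>R h m x) \<le> indicator region x *\<^sub>R hb"
        using hbnd[of x m] by (cases "x \<in> region") auto
    qed
    show "AE x in lborel. (\<lambda>m. indicator region x *\<^sub>R h m x) \<longlonglongrightarrow> indicator region x *\<^sub>R (Q' x * ?N)"
    proof (intro AE_I2)
      fix x show "(\<lambda>m. indicator region x *\<^sub>R h m x) \<longlonglongrightarrow> indicator region x *\<^sub>R (Q' x * ?N)"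
      proof (cases "x \<in> region")
        case True
        then have xU: "x \<in> upper" and p: "proj x \<in> S" "proj x \<in> upper" using region_upper proj_upper by blast+
        have lim: "(\<lambda>m. w m x) \<longlonglongrightarrow> Q' x"
        proof (rule order_tendstoI)
          fix a assume "a < Q' x"
          then show "\<forall>\<^sub>F m in sequentially. a < w m x" by (auto simp: w_def less_max_iff_disj)
        next
          fix a assume a: "Q' x < a"
          \<comment> \<open>Half of the distance is spent on the ray bound and half on the summand e
            in w.\<close>
          define \<kappa> where "\<kappa> = (a - Q' x) / 2"
          have k: "\<kappa> > 0" using a by (simp add: \<kappa>_def)
          obtain d where d: "d > 0" and D: "\<And>e t y k. 0 < e \<Longrightarrow> e < d \<Longrightarrow> (y, k) \<in> P \<Longrightarrow> t *\<^sub>R proj x = y + e *\<^sub>R k \<Longrightarrow> t \<le> 1 + e * (Q (proj x) + \<kappa>)"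
            using perturbed_ray_bound[OF P p PQ[OF p] k] by blast
          define B where "B = \<bar>Q (proj x)\<bar> + \<kappa> + 1"
          have B: "B > 0" using k by (simp add: B_def)
          have "\<forall>\<^sub>F m in sequentially. e m < min (min d \<kappa>) (1 / B)" using order_tendstoD(2)[OF e0, of "min (min d \<kappa>) (1 / B)"] d k B by simp
          then show "\<forall>\<^sub>F m in sequentially. w m x < a"
          proof eventually_elim
            case (elim m)
            have "R m x \<le> 1 + e m * (Q (proj x) + \<kappa>)" unfolding R_def
            proof (rule radial_max_leI[OF cZ])
              have "e m * B < 1" using elim B by (simp add: pos_less_divide_eq)
              moreover have "e m * (- B) \<le> e m * (Q (proj x) + \<kappa>)" using e[of m] k by (intro mult_left_mono) (auto simp: B_def)
              ultimately show "0 \<le> 1 + e m * (Q (proj x) + \<kappa>)" by simp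
              fix y assume y: "y \<in> Z m" "y \<in> cupper" "proj y = proj x"
              then obtain z where "z \<in> P" "y = fst z + e m *\<^sub>R snd z" unfolding Z_def perturbed_def by blast
              moreover have "y = gaugeS y *\<^sub>R proj x" using gauge_proj[OF y(2)] y(3) by simp
              ultimately show "gaugeS y \<le> 1 + e m * (Q (proj x) + \<kappa>)"
                using D[of "e m" "fst z" "snd z" "gaugeS y"] e[of m] elim by simp
            qed
            then have "(R m x - 1) / e m \<le> Q' x + \<kappa>" using e[of m] Q'_eq[OF xU] by (simp add: pos_divide_le_eq mult.commute)
            moreover have "e m < \<kappa>" using elim by simp
            moreover have "Q' x + \<kappa> + \<kappa> = a" by (simp add: \<kappa>_def)
            ultimately show ?case using a by (simp add: w_def)
          qed
        qed
        have "(\<lambda>m. h m x) \<longlonglongrightarrow> Q' x * (\<Sum>i<?N. (1 + 0 * Q' x) ^ i)"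
          unfolding h_def by (intro tendsto_intros lim e0)
        then show ?thesis using True by (simp del: sum.lessThan_Suc)
      qed simp
    qed
  qed measurable
  moreover have "filterlim e (at_right 0) sequentially" using e0 e(1) by (simp add: filterlim_at less_imp_neq[symmetric])
  from eventually_compose_filterlim[OF vol this]
  have "\<forall>\<^sub>F m in sequentially. c \<le> (\<integral>x. indicator region x *\<^sub>R h m x \<partial>lborel)"
    by eventually_elim (rule step, simp add: Z_def)
  ultimately have "c \<le> (\<integral>x. indicator region x *\<^sub>R (Q' x * ?N) \<partial>lborel)"
    by (intro tendsto_lowerbound[of _ _ sequentially]) auto
  also have "\<dots> = (\<integral>x. ?N * (indicator region x *\<^sub>R Q (proj x)) \<partial>lborel)"
  proof (rule Bochner_Integration.integral_cong)
    fix x show "indicator region x *\<^sub>R (Q' x * ?N) = ?N * (indicator region x *\<^sub>R Q (proj x))"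
      using Q'_eq[of x] region_upper by (cases "x \<in> region") auto
  qed simp
  also have "\<dots> = ?N * (LINT x:region|lborel. Q (proj x))" unfolding set_lebesgue_integral_def by (rule integral_mult_right_zero)
  finally show ?thesis by (simp add: add.commute)
qed

end

section \<open>The divergence theorem\<close>

lemma measure_slab:
  fixes A :: "'a::euclidean_space set" and e :: real
  assumes A: "A \<in> sets borel" "A \<in> lmeasurable" and e: "e > 0"
  shows "A \<times> {0..e} \<in> lmeasurable" "vol (A \<times> {0..e}) = e * vol A"
proof -
  have "emeasure lborel A = ennreal (vol A)" using A(1) emeasure_eq_measure2[OF A(2)] by simp
  then have em: "emeasure lborel (A \<times> {0..e}) = ennreal (e * vol A)"
    using lborel.emeasure_pair_measure_Times[of A lborel "{0..e}"] A(1) e by (simp add: lborel_prod ennreal_mult' mult.commute)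
  have bor: "A \<times> {0..e} \<in> sets borel" using A(1) by (simp add: borel_Times)
  show "A \<times> {0..e} \<in> lmeasurable" using em bor by (intro fmeasurableI) auto
  show "vol (A \<times> {0..e}) = e * vol A" using em bor e by (simp add: measure_def)
qed

context radial_surface
begin

lemma trace_compact: "compact (enclosed_trace S)"
proof -
  have "enclosed_trace S = fst ` (cregion \<inter> {x. snd x = 0})"
  proof
    show "enclosed_trace S \<subseteq> fst ` (cregion \<inter> {x. snd x = 0})"
    proof
      fix y assume "y \<in> enclosed_trace S"
      then have "(y, 0) \<in> cregion \<inter> {x. snd x = 0}" by (simp add: enclosed_trace_def enclosed_eq)
      then show "y \<in> fst ` (cregion \<inter> {x. snd x = 0})" by (rule image_eqI[rotated]) simp
    qed
    show "fst ` (cregion \<inter> {x. snd x = 0}) \<subseteq> enclosed_trace S"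
    proof (rule image_subsetI)
      fix x assume "x \<in> cregion \<inter> {x. snd x = 0}"
      then have "(fst x, 0) \<in> cregion" by (metis IntE mem_Collect_eq prod.collapse)
      then show "fst x \<in> enclosed_trace S" by (simp add: enclosed_trace_def enclosed_eq)
    qed
  qed
  then show ?thesis by (auto intro!: compact_continuous_image compact_Int_closed cregion_compact closed_Collect_eq continuous_intros)
qed

text \<open>The displacement is prescribed only over points of S in the open half-space, so P may
  contain further pairs over the hyperplane without changing the bound; Q is the normal speed c .
  \<nu> p relative to p . \<nu> p.\<close>

lemma translation_variation:
  assumes P: "compact P" "fst ` P \<subseteq> cregion" "\<And>p k. p \<in> S \<Longrightarrow> p \<in> upper \<Longrightarrow> (p, k) \<in> P \<Longrightarrow> k = c"
    and vol: "\<forall>\<^sub>F e in at_right 0. vol cregion + e * d \<le> vol (perturbed P e \<inter> cupper)"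
  shows "d \<le> (real CARD('n) + 1) * cone_integral (\<lambda>p. c \<bullet> \<nu> p)"
proof -
  define Q where "Q p = indicator S p *\<^sub>R ((c \<bullet> \<nu> p) / (p \<bullet> \<nu> p))" for p
  have cq: "continuous_on S (\<lambda>p. (c \<bullet> \<nu> p) / (p \<bullet> \<nu> p))"
    by (intro continuous_intros nu_cont) (use nu_pos in force)
  obtain q where q: "\<forall>x\<in>(\<lambda>p. (c \<bullet> \<nu> p) / (p \<bullet> \<nu> p)) ` S. norm x \<le> q"
    using compact_imp_bounded[OF compact_continuous_image[OF cq S_compact]] unfolding bounded_iff by blast
  have "d \<le> (real CARD('n) + 1) * (LINT x:region|lborel. Q (proj x))"
  proof (rule variation_le[OF P(1,2) _ _ _ vol])
    show "Q \<in> borel_measurable borel" unfolding Q_def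
      by (rule borel_measurable_continuous_on_indicator[OF borel_closed[OF S_closed] cq])
    show "\<bar>Q p\<bar> \<le> q" if "p \<in> S" for p using q that by (simp add: Q_def)
    show "\<nu> p \<bullet> k \<le> Q p * (p \<bullet> \<nu> p)" if p: "p \<in> S" "p \<in> upper" "(p, k) \<in> P" for p k
      using P(3)[OF p] nu_pos[OF p(1)] p(1) by (simp add: Q_def inner_commute)
  qed
  also have "(LINT x:region|lborel. Q (proj x)) = cone_integral (\<lambda>p. c \<bullet> \<nu> p)"
    unfolding cone_integral_def set_lebesgue_integral_def
  proof (rule Bochner_Integration.integral_cong)
    fix x show "indicator region x *\<^sub>R Q (proj x) = indicator region x *\<^sub>R ((c \<bullet> \<nu> (proj x)) / (proj x \<bullet> \<nu> (proj x)))"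
      using proj_upper[of x] region_upper by (cases "x \<in> region") (auto simp: Q_def)
  qed simp
  finally show ?thesis .
qed

lemma perturbed_translate: "perturbed (A \<times> {c}) e = (+) (e *\<^sub>R c) ` A"
  unfolding perturbed_def by (force simp: image_iff add.commute)

lemma fst_product: "fst ` (cregion \<times> {c}) \<subseteq> cregion"
  by auto

text \<open>A horizontal translation stays in the half-space and preserves volume.\<close>

lemma horizontal_flux:
  assumes "snd c = 0"
  shows "0 \<le> (real CARD('n) + 1) * cone_integral (\<lambda>p. c \<bullet> \<nu> p)"
proof (rule translation_variation[OF _ fst_product])
  show "compact (cregion \<times> {c})" by (intro compact_Times cregion_compact) simp
  have "perturbed (cregion \<times> {c}) e \<inter> cupper = (+) (e *\<^sub>R c) ` cregion" for e
    unfolding perturbed_translate using assms by (auto simp: cregion_def halfspaces_snd)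
  then show "\<forall>\<^sub>F e in at_right 0. vol cregion + e * 0 \<le> vol (perturbed (cregion \<times> {c}) e \<inter> cupper)"
    by (simp add: measure_translation)
qed simp

text \<open>Translating the region upwards opens a gap above its trace. The slab filling this gap is
  invisible to first order along each ray through the open half-space.\<close>

lemma upward_flux: "vol (enclosed_trace S) \<le> (real CARD('n) + 1) * cone_integral (\<lambda>p. E_last \<bullet> \<nu> p)"
proof (rule translation_variation)
  let ?T = "enclosed_trace S"
  \<comment> \<open>Base points in the trace are displaced vertically by e s with s in [0, 1]; this
    fills the slab of height e.\<close>
  define B :: "('n ambient \<times> 'n ambient) set" where "B = (\<lambda>z. ((fst z, 0), (0, snd z))) ` (?T \<times> {0..1})"
  let ?P = "cregion \<times> {E_last} \<union> B"
  have cB: "compact B" unfolding B_def by (intro compact_continuous_image compact_Times trace_compact continuous_intros) auto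
  show "compact ?P" by (intro compact_Un compact_Times cregion_compact cB) simp
  show "fst ` ?P \<subseteq> cregion" by (auto simp: B_def enclosed_trace_def enclosed_eq)
  show "k = E_last" if "p \<in> upper" "(p, k) \<in> ?P" for p k using that by (auto simp: B_def halfspaces_snd)
  have "vol cregion + e * vol ?T \<le> vol (perturbed ?P e \<inter> cupper)" if e: "e > 0" for e
  proof -
    let ?A = "(+) (e *\<^sub>R E_last) ` cregion"
    have sl: "perturbed B e = ?T \<times> {0..e}"
    proof
      show "perturbed B e \<subseteq> ?T \<times> {0..e}" using e by (auto simp: perturbed_def B_def mult_left_le)
      show "?T \<times> {0..e} \<subseteq> perturbed B e"
      proof
        fix x assume "x \<in> ?T \<times> {0..e}"
        then have x: "fst x \<in> ?T" "0 \<le> snd x" "snd x \<le> e" by auto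
        then have "((fst x, 0), (0, snd x / e)) \<in> B" unfolding B_def using e by (intro image_eqI[of _ _ "(fst x, snd x / e)"]) auto
        then show "x \<in> perturbed B e" unfolding perturbed_def
          using e by (intro image_eqI[of _ _ "((fst x, 0), (0, snd x / e))"]) (auto simp: prod_eq_iff)
      qed
    qed
    have cA: "compact ?A" by (intro compact_translation cregion_compact)
    have cS: "compact (?T \<times> {0..e})" by (intro compact_Times trace_compact) simp
    have "perturbed ?P e = ?A \<union> ?T \<times> {0..e}"
      unfolding sl[symmetric] perturbed_translate[symmetric] by (simp add: perturbed_def image_Un)
    moreover have "?A \<union> ?T \<times> {0..e} \<subseteq> cupper" using e by (auto simp: halfspaces_snd cregion_def)
    ultimately have P: "perturbed ?P e \<inter> cupper = ?A \<union> ?T \<times> {0..e}" by blast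
    have "?A \<inter> (?T \<times> {0..e}) \<subseteq> {x. E_last \<bullet> x = e}"
    proof
      fix x assume x: "x \<in> ?A \<inter> (?T \<times> {0..e})"
      then obtain y where "y \<in> cregion" "x = e *\<^sub>R E_last + y" by blast
      then have "e \<le> snd x" by (simp add: cregion_def halfspaces_snd)
      moreover have "snd x \<le> e" using x by (simp add: mem_Times_iff)
      ultimately show "x \<in> {x. E_last \<bullet> x = e}" by simp
    qed
    moreover have "(E_last :: 'n ambient) \<noteq> 0" by simp
    ultimately have "negligible (?A \<inter> (?T \<times> {0..e}))" using negligible_hyperplane negligible_subset by blast
    then have "vol (?A \<union> ?T \<times> {0..e}) = vol ?A + vol (?T \<times> {0..e})"
      using measure_Un3[OF lmeasurable_compact[OF cA] lmeasurable_compact[OF cS]] by (simp add: negligible_imp_measure0)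
    moreover have "vol (?T \<times> {0..e}) = e * vol ?T" using trace_compact e by (intro measure_slab borel_compact lmeasurable_compact)
    ultimately show ?thesis unfolding P by (simp add: measure_translation)
  qed
  then show "\<forall>\<^sub>F e in at_right 0. vol cregion + e * vol ?T \<le> vol (perturbed ?P e \<inter> cupper)"
    by (auto intro: eventually_mono[OF eventually_at_right_less])
qed

text \<open>Outer regularity gives an open O' around the trace of almost the same measure. The part
  of the closed region over the complement of O' is compact and off the hyperplane, hence at
  positive height, so thin slabs of the region lie over O'.\<close>

lemma slab_volume:
  assumes "\<delta> > 0"
  shows "\<forall>\<^sub>F e in at_right 0. vol (cregion \<inter> {x. x \<bullet> E_last \<le> e}) \<le> e * (vol (enclosed_trace S) + \<delta>)"
proof -
  let ?T = "enclosed_trace S"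
  obtain O' where O': "open O'" "?T \<subseteq> O'" "O' \<in> lmeasurable" "vol O' < vol ?T + \<delta>"
  proof -
    have T: "?T \<in> lmeasurable" using trace_compact by (rule lmeasurable_compact)
    obtain G where G: "open G" "?T \<subseteq> G" "G - ?T \<in> lmeasurable" "emeasure lebesgue (G - ?T) < ennreal \<delta>"
      by (rule sets_lebesgue_outer_open[OF fmeasurableD[OF T] assms]) (rule that)
    have G': "G = ?T \<union> (G - ?T)" using G(2) by blast
    have "G \<in> lmeasurable" by (subst G') (rule fmeasurable.Un[OF T G(3)])
    moreover have "vol (G - ?T) < \<delta>" using G(3,4) assms by (simp add: emeasure_eq_measure2 ennreal_less_iff)
    then have "vol G < vol ?T + \<delta>"
      using measure_Un_le[OF fmeasurableD[OF T] fmeasurableD[OF G(3)]] unfolding G'[symmetric] by linarith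
    ultimately show ?thesis using G that by blast
  qed
  let ?D = "cregion \<inter> {x. fst x \<notin> O'}"
  have "{x :: 'n ambient. fst x \<notin> O'} = - (fst -` O')" by auto
  then have "closed {x :: 'n ambient. fst x \<notin> O'}" using open_vimage_fst[OF O'(1)] by (simp add: closed_def)
  then have cD: "compact ?D" by (intro compact_Int_closed cregion_compact)
  have pos: "snd x > 0" if x: "x \<in> ?D" for x
  proof (rule ccontr)
    assume "\<not> snd x > 0"
    then have "snd x = 0" using x by (simp add: cregion_def halfspaces_snd)
    then have "(fst x, 0) \<in> cregion" using x by (metis IntE prod.collapse)
    then have "fst x \<in> ?T" by (simp add: enclosed_trace_def enclosed_eq)
    then show False using x O'(2) by blast
  qed
  have "\<exists>d>0. \<forall>x\<in>?D. d \<le> snd x"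
  proof (cases "?D = {}")
    case False
    obtain a where "a \<in> ?D" "\<forall>x\<in>?D. snd a \<le> snd x"
      using continuous_attains_inf[OF cD False continuous_on_snd[OF continuous_on_id]] by blast
    then show ?thesis using pos by blast
  qed (auto intro: exI[of _ 1])
  then obtain d where d: "d > 0" "\<forall>x\<in>?D. d \<le> snd x" by blast
  have "vol (cregion \<inter> {x. x \<bullet> E_last \<le> e}) \<le> e * (vol ?T + \<delta>)" if e: "0 < e" "e < d" for e
  proof -
    have "cregion \<inter> {x. x \<bullet> E_last \<le> e} \<subseteq> O' \<times> {0..e}"
    proof
      fix x assume x: "x \<in> cregion \<inter> {x. x \<bullet> E_last \<le> e}"
      then have "\<not> d \<le> snd x" using e by simp
      then have "x \<notin> ?D" using d(2) by blast
      then show "x \<in> O' \<times> {0..e}" using x by (simp add: mem_Times_iff cregion_def halfspaces_snd)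
    qed
    then have "vol (cregion \<inter> {x. x \<bullet> E_last \<le> e}) \<le> vol (O' \<times> {0..e})"
    proof (rule measure_mono_fmeasurable)
      show "cregion \<inter> {x. x \<bullet> E_last \<le> e} \<in> sets lebesgue"
        by (intro fmeasurableD lmeasurable_compact compact_Int_closed cregion_compact closed_Collect_le continuous_intros)
      show "O' \<times> {0..e} \<in> lmeasurable" by (rule measure_slab(1)[OF borel_open[OF O'(1)] O'(3) e(1)])
    qed
    also have "\<dots> = e * vol O'" by (rule measure_slab(2)[OF borel_open[OF O'(1)] O'(3) e(1)])
    also have "\<dots> \<le> e * (vol ?T + \<delta>)" using O'(4) e by (intro mult_left_mono) auto
    finally show ?thesis .
  qed
  then show ?thesis using d(1) unfolding eventually_at_right_field by blast
qed

text \<open>Translation downwards by e pushes the slab of height e out of the half-space, and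
  \<open>slab_volume\<close> bounds what is lost.\<close>

lemma downward_flux: "- vol (enclosed_trace S) \<le> (real CARD('n) + 1) * cone_integral (\<lambda>p. (- E_last) \<bullet> \<nu> p)"
proof (rule field_le_epsilon)
  fix \<delta> :: real assume d: "\<delta> > 0"
  let ?P = "cregion \<times> {- E_last}"
  have u: "(E_last :: 'n ambient) \<noteq> 0" by simp
  have "- (vol (enclosed_trace S) + \<delta>) \<le> (real CARD('n) + 1) * cone_integral (\<lambda>p. (- E_last) \<bullet> \<nu> p)"
  proof (rule translation_variation[OF _ fst_product])
    show "compact ?P" by (intro compact_Times cregion_compact) simp
    have Z: "perturbed ?P e \<inter> cupper = (+) (e *\<^sub>R (- E_last)) ` (cregion \<inter> {x. x \<bullet> E_last \<ge> e})" for e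
      unfolding perturbed_translate by (auto simp: halfspaces_snd)
    have Zm: "vol (perturbed ?P e \<inter> cupper) = vol cregion - vol (cregion \<inter> {x. x \<bullet> E_last \<le> e})" for e
      unfolding Z measure_translation by (rule measure_halfspace_split(3)[OF lmeasurable_compact[OF cregion_compact] u])
    from slab_volume[OF d]
    show "\<forall>\<^sub>F e in at_right 0. vol cregion + e * - (vol (enclosed_trace S) + \<delta>) \<le> vol (perturbed ?P e \<inter> cupper)"
      by eventually_elim (unfold Zm mult_minus_right, linarith)
  qed simp
  then show "- vol (enclosed_trace S) \<le> (real CARD('n) + 1) * cone_integral (\<lambda>p. (- E_last) \<bullet> \<nu> p) + \<delta>" by linarith
qed

text \<open>The first variation bounds fluxes from below only, but the flux is linear in c, so the
  bounds for c and - c combine to equalities: horizontal directions contribute 0, the vertical one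
  the measure of the trace.\<close>

lemma divergence_theorem:
  "(real CARD('n) + 1) * cone_integral (\<lambda>p. c \<bullet> \<nu> p) = snd c * vol (enclosed_trace S)"
proof -
  let ?f = "\<lambda>c. (real CARD('n) + 1) * cone_integral (\<lambda>p. c \<bullet> \<nu> p)"
  have cont: "continuous_on S (\<lambda>p. d \<bullet> \<nu> p)" for d by (intro continuous_intros nu_cont)
  have add: "?f (a + b) = ?f a + ?f b" for a b using cone_integral_add[OF cont cont, of a b] by (simp add: inner_add_left distrib_left)
  have scale: "?f (s *\<^sub>R a) = s * ?f a" for s a using cone_integral_cmult[of s "\<lambda>p. a \<bullet> \<nu> p"] by simp
  have neg: "?f (- a) = - ?f a" for a using scale[of "- 1" a] by simp
  let ?h = "c - snd c *\<^sub>R E_last"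
  have "snd ?h = 0" "snd (- ?h) = 0" by simp_all
  from horizontal_flux[OF this(1)] horizontal_flux[OF this(2)] have "?f ?h = 0" unfolding neg by linarith
  moreover have "?f E_last = vol (enclosed_trace S)" using upward_flux downward_flux unfolding neg by linarith
  moreover have "?f c = ?f ?h + snd c * ?f E_last" unfolding scale[symmetric] add[symmetric] by simp
  ultimately show ?thesis by simp
qed

end

section \<open>The isoperimetric inequality\<close>

lemma (in radial_graph) measure_cregion_pos: "vol cregion > 0"
proof -
  have "region \<noteq> {}"
  proof -
    have x: "(E_last :: 'n ambient) \<in> upper" by (simp add: halfspaces_snd)
    then have g: "gaugeS E_last > 0" using gauge_pos upper_subset_closed_upper upper_not_zero by blast
    let ?y = "inverse (2 * gaugeS E_last) *\<^sub>R (E_last :: 'n ambient)"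
    have "gaugeS ?y = inverse (2 * gaugeS E_last) * gaugeS E_last" using g x upper_subset_closed_upper by (intro gauge_scale) auto
    then have "gaugeS ?y < 1" using g by simp
    moreover have "?y \<in> upper" using g by (simp add: halfspaces_snd)
    ultimately show ?thesis unfolding region_def by blast
  qed
  then show ?thesis using open_measure_pos[OF region_open] region_subset_cregion compact_imp_bounded[OF cregion_compact] bounded_subset
    by (metis measure_cregion)
qed

text \<open>Because the ratios match, Brunn--Minkowski for the two pairs of pieces gives \<theta>
  and 1 - \<theta> times (|\<Omega>|^(1/N) + e |K|^(1/N))^N, and the two sums overlap in a
  hyperplane at most.\<close>

lemma (in radial_surface) split_volume:
  fixes u :: "'n ambient"
  assumes K: "compact K" "vol K > 0" and u: "u \<noteq> 0"
    and match: "vol (cregion \<inter> {x. x \<bullet> u \<le> a}) * vol K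
      = vol (K \<inter> {x. x \<bullet> u \<le> b}) * vol cregion"
  defines "P \<equiv> (cregion \<inter> {x. x \<bullet> u \<le> a}) \<times> (K \<inter> {x. x \<bullet> u \<le> b}) \<union> (cregion \<inter> {x. x \<bullet> u \<ge> a}) \<times> (K \<inter> {x. x \<bullet> u \<ge> b})"
    and "N \<equiv> CARD('n) + 1"
  shows "compact P"
    and "0 < e \<Longrightarrow> vol cregion + e * (N * root N (vol K) * root N (vol cregion) ^ CARD('n))
      \<le> vol (perturbed P e)"
proof -
  let ?m = "measure (lebesgue :: 'n ambient measure)"
  let ?V = "?m cregion"
  have cl: "closed {x. x \<bullet> u \<le> c}" "closed {x. x \<bullet> u \<ge> c}" for c by (intro closed_Collect_le continuous_intros)+
  define A1 where "A1 = cregion \<inter> {x. x \<bullet> u \<le> a}"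
  define A2 where "A2 = cregion \<inter> {x. x \<bullet> u \<ge> a}"
  define K1 where "K1 = K \<inter> {x. x \<bullet> u \<le> b}"
  define K2 where "K2 = K \<inter> {x. x \<bullet> u \<ge> b}"
  have c: "compact A1" "compact A2" "compact K1" "compact K2"
    unfolding A1_def A2_def K1_def K2_def using cregion_compact K cl by (auto intro: compact_Int_closed)
  have P: "P = A1 \<times> K1 \<union> A2 \<times> K2" by (simp add: P_def A1_def A2_def K1_def K2_def)
  show "compact P" unfolding P using c by (intro compact_Un compact_Times)
  have V0: "?V > 0" by (rule measure_cregion_pos)
  define \<theta> where "\<theta> = ?m A1 / ?V"
  have A1: "?m A1 = \<theta> * ?V" using V0 by (simp add: \<theta>_def)
  have K1: "?m K1 = \<theta> * ?m K" using match V0 by (simp add: \<theta>_def A1_def K1_def field_simps)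
  have A2: "?m A2 = (1 - \<theta>) * ?V" using measure_halfspace_split(3)[OF lmeasurable_compact[OF cregion_compact] u, of a] A1
    by (simp add: A1_def A2_def algebra_simps)
  have K2: "?m K2 = (1 - \<theta>) * ?m K" using measure_halfspace_split(3)[OF lmeasurable_compact[OF K(1)] u, of b] K1
    by (simp add: K1_def K2_def algebra_simps)
  have "0 \<le> ?m A1" "0 \<le> ?m A2" by simp_all
  then have \<theta>: "0 \<le> \<theta>" "\<theta> \<le> 1" using V0 unfolding A1 A2 by (simp_all add: zero_le_mult_iff)
  assume e: "0 < e"
  let ?r = "root N ?V + e * root N (?m K)"
  have N: "N > 0" and dim: "DIM('n ambient) = N" by (simp_all add: N_def)
  have bm: "\<theta> * ?r ^ N \<le> ?m (minkowski_sum A ((*\<^sub>R) e ` B))"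
    if AB: "compact A" "compact B" "?m A = \<theta> * ?V" "?m B = \<theta> * ?m K" and \<theta>: "0 \<le> \<theta>" for A B \<theta>
  proof (cases "\<theta> = 0")
    case False
    then have t: "\<theta> > 0" using \<theta> by simp
    have "?m A > 0" "?m B > 0" using AB V0 K(2) t by simp_all
    then have ne: "A \<noteq> {}" "B \<noteq> {}" by auto
    have cB: "compact ((*\<^sub>R) e ` B)" using AB(2) by (rule compact_scaling)
    have "?m ((\<lambda>x. e *\<^sub>R x + 0) ` B) = e ^ N * ?m B" using measure_lebesgue_affine[of e 0 B] e by (simp add: N_def)
    then have mB: "?m ((*\<^sub>R) e ` B) = e ^ N * ?m B" by simp
    have "root N (?m A) + root N (?m ((*\<^sub>R) e ` B)) \<le> root N (?m (minkowski_sum A ((*\<^sub>R) e ` B)))"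
      using brunn_minkowski[OF AB(1) ne(1) cB] ne(2) unfolding dim by simp
    moreover have "root N (?m A) = root N \<theta> * root N ?V" using AB(3) by (simp add: real_root_mult)
    moreover have "root N (?m ((*\<^sub>R) e ` B)) = root N \<theta> * (e * root N (?m K))"
      unfolding mB AB(4) using e N by (simp add: real_root_mult real_root_power_cancel)
    ultimately have "root N \<theta> * ?r \<le> root N (?m (minkowski_sum A ((*\<^sub>R) e ` B)))" by (simp add: distrib_left)
    moreover have "0 \<le> root N \<theta> * ?r" using t V0 K(2) e N by (intro mult_nonneg_nonneg add_nonneg_nonneg) simp_all
    ultimately have "(root N \<theta> * ?r) ^ N \<le> root N (?m (minkowski_sum A ((*\<^sub>R) e ` B))) ^ N" by (rule power_mono)
    then show ?thesis using N t by (simp add: power_mult_distrib real_root_pow_pos2)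
  qed simp
  define Z1 where "Z1 = minkowski_sum A1 ((*\<^sub>R) e ` K1)"
  define Z2 where "Z2 = minkowski_sum A2 ((*\<^sub>R) e ` K2)"
  have cZ: "compact Z1" "compact Z2" unfolding Z1_def Z2_def using c by (intro compact_minkowski_sum compact_scaling; simp)+
  have Z: "perturbed P e = Z1 \<union> Z2"
  proof -
    have im: "(\<lambda>z. fst z + e *\<^sub>R snd z) ` (A \<times> B) = minkowski_sum A ((*\<^sub>R) e ` B)" for A B :: "'n ambient set"
      unfolding minkowski_sum_def by force
    show ?thesis unfolding P perturbed_def image_Un im Z1_def Z2_def ..
  qed
  have "Z1 \<inter> Z2 \<subseteq> {x. u \<bullet> x = a + e * b}"
  proof
    fix x assume x: "x \<in> Z1 \<inter> Z2"
    then obtain y k where 1: "y \<in> A1" "k \<in> K1" "x = y + e *\<^sub>R k" unfolding Z1_def minkowski_sum_def by blast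
    obtain y' k' where 2: "y' \<in> A2" "k' \<in> K2" "x = y' + e *\<^sub>R k'" using x unfolding Z2_def minkowski_sum_def by blast
    have "x \<bullet> u \<le> a + e * b" unfolding 1(3) using 1(1,2) e by (simp add: A1_def K1_def inner_add_left add_mono)
    moreover have "x \<bullet> u \<ge> a + e * b" unfolding 2(3) using 2(1,2) e by (simp add: A2_def K2_def inner_add_left add_mono)
    ultimately show "x \<in> {x. u \<bullet> x = a + e * b}" by (simp add: inner_commute)
  qed
  then have "negligible (Z1 \<inter> Z2)" using negligible_hyperplane u negligible_subset by blast
  then have "?m (Z1 \<union> Z2) = ?m Z1 + ?m Z2" using measure_Un3[OF cZ[THEN lmeasurable_compact]] by (simp add: negligible_imp_measure0)
  moreover have "\<theta> * ?r ^ N \<le> ?m Z1" unfolding Z1_def by (rule bm[OF c(1,3) A1 K1 \<theta>(1)])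
  moreover have "(1 - \<theta>) * ?r ^ N \<le> ?m Z2" unfolding Z2_def by (rule bm[OF c(2,4) A2 K2]) (use \<theta> in simp)
  moreover have "\<theta> * ?r ^ N + (1 - \<theta>) * ?r ^ N = ?r ^ N" by (simp add: algebra_simps)
  ultimately have "?r ^ N \<le> ?m (perturbed P e)" unfolding Z by linarith
  moreover have "?V + e * (N * root N (?m K) * root N ?V ^ CARD('n)) \<le> ?r ^ N"
  proof -
    \<comment> \<open>With |\<Omega>| factored out, Bernoulli's inequality for (1 + s)^N yields the
      bound linear in e.\<close>
    define s where "s = e * root N (?m K) / root N ?V"
    have r0: "root N ?V > 0" using V0 N by simp
    have s0: "s \<ge> 0" using e r0 K(2) N by (simp add: s_def)
    have "1 + N * s \<le> (1 + s) ^ N" using Bernoulli_inequality[of s N] s0 by simp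
    then have "root N ?V ^ N * (1 + N * s) \<le> root N ?V ^ N * (1 + s) ^ N" using r0 by (intro mult_left_mono) auto
    also have "\<dots> = ?r ^ N" using r0 by (simp add: power_mult_distrib[symmetric] s_def field_simps)
    finally have "root N ?V ^ N + root N ?V ^ CARD('n) * (N * (root N ?V * s)) \<le> ?r ^ N" by (simp add: N_def algebra_simps)
    moreover have "root N ?V * s = e * root N (?m K)" using r0 by (simp add: s_def)
    moreover have "root N ?V ^ N = ?V" using V0 N by simp
    moreover have "root N ?V ^ CARD('n) * (N * (root N ?V * s)) = e * (N * root N (?m K) * root N ?V ^ CARD('n))"
      unfolding calculation(2) by (simp only: mult_ac)
    ultimately show ?thesis by (simp only:)
  qed
  ultimately show "?V + e * (N * root N (?m K) * root N ?V ^ CARD('n)) \<le> ?m (perturbed P e)" by linarith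
qed

lemma (in anisotropic) compact_dual_ball: "compact {x. dual_norm F (x - a) \<le> r}"
proof -
  obtain C c where c: "c > 0" "\<And>\<xi>. c * norm \<xi> \<le> dual_norm F \<xi>" using dual_norm_bounds by metis
  have "norm x \<le> r / c + norm a" if "dual_norm F (x - a) \<le> r" for x
  proof -
    have "c * norm (x - a) \<le> r" using c(2) that by (rule order_trans)
    then have "norm (x - a) \<le> r / c" using c(1) by (simp add: pos_le_divide_eq mult.commute)
    then show ?thesis using norm_triangle_sub[of x a] by linarith
  qed
  then have "bounded {x. dual_norm F (x - a) \<le> r}" unfolding bounded_iff by blast
  moreover have "closed {x. dual_norm F (x - a) \<le> r}"
    by (intro closed_Collect_le continuous_on_const continuous_on_compose2[OF dual_norm_continuous[of UNIV]] continuous_intros) simp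
  ultimately show ?thesis using compact_eq_bounded_closed by blast
qed

text \<open>The inequality for \<open>x0\<close> places the origin strictly inside the translated
  Wulff shape. The theorem takes \<open>x0\<close> to be \<omega> \<open>E_F\<close>, and then
  \<open>body\<close> is the region enclosed by the model.\<close>

locale wulff_comparison = radial_surface S \<nu> + anisotropic F
  for S :: "'n::finite ambient set" and \<nu> and F :: "'n ambient \<Rightarrow> real" +
  fixes x0 :: "'n ambient"
  assumes x0: "dual_norm F (- x0) < 1"
begin

definition body :: "'n ambient set" where
  "body = {x \<in> cupper. dual_norm F (x - x0) \<le> 1}"

text \<open>The point of the translated Wulff shape with outer normal \<nu> p. It may leave the
  half-space; that it lies in \<open>body\<close> is a consequence of equality, see
  \<open>touching_body\<close>.\<close>

definition touching :: "'n ambient \<Rightarrow> 'n ambient" where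
  "touching p = wulff (\<nu> p) + x0"

text \<open>The support function, at \<nu> p, of the whole translated Wulff ball, of which
  \<open>body\<close> is only a part. By \<open>energy_support\<close> its integral over S is the
  capillary energy.\<close>

definition support :: "'n ambient \<Rightarrow> real" where
  "support p = F (\<nu> p) + x0 \<bullet> \<nu> p"

lemma body_upper: "body \<subseteq> cupper"
  by (auto simp: body_def)

lemma body_compact: "compact body"
  unfolding body_def Collect_conj_eq Collect_mem_eq using compact_dual_ball by (intro closed_Int_compact) auto

lemma body_convex: "convex body"
proof (rule convexI)
  fix x y :: "'n ambient" and u v :: real
  assume *: "x \<in> body" "y \<in> body" "0 \<le> u" "0 \<le> v" "u + v = 1"
  then have "u = 1 - v" by simp
  then have "u *\<^sub>R x + v *\<^sub>R y - x0 = (1 - v) *\<^sub>R (x - x0) + v *\<^sub>R (y - x0)" by (simp only:) (simp add: algebra_simps)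
  moreover have "dual_norm F ((1 - v) *\<^sub>R (x - x0) + v *\<^sub>R (y - x0)) \<le> 1"
    using * by (intro dual_norm_convex) (auto simp: body_def)
  moreover have "u *\<^sub>R x + v *\<^sub>R y \<in> cupper"
    using * by (intro convexD[OF convex_closed_upper_halfspace]) (auto simp: body_def)
  ultimately show "u *\<^sub>R x + v *\<^sub>R y \<in> body" by (simp add: body_def)
qed

lemma body_interior: "interior body \<noteq> {}"
proof -
  let ?G = "upper \<inter> {x. dual_norm F (x - x0) < 1}"
  have "open ?G"
    by (auto intro!: open_Int open_Collect_less continuous_on_const continuous_on_compose2[OF dual_norm_continuous[of UNIV]] continuous_intros)
  moreover have "?G \<subseteq> body" using upper_subset_closed_upper by (auto simp: body_def)
  moreover have "?G \<noteq> {}"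
  proof -
    have "continuous (at 0) (\<lambda>t. dual_norm F (t *\<^sub>R E_last - x0))"
      using continuous_on_compose2[OF dual_norm_continuous[of UNIV], of UNIV "\<lambda>t::real. t *\<^sub>R E_last - x0"]
      by (auto intro!: continuous_intros simp: continuous_on_eq_continuous_at)
    then have "((\<lambda>t. dual_norm F (t *\<^sub>R E_last - x0)) \<longlongrightarrow> dual_norm F (- x0)) (at_right 0)"
      by (simp add: isCont_def filterlim_at_split)
    then have "\<forall>\<^sub>F t in at_right 0. dual_norm F (t *\<^sub>R E_last - x0) < 1" using x0 by (rule order_tendstoD)
    then obtain t :: real where "t > 0" "dual_norm F (t *\<^sub>R E_last - x0) < 1"
      using eventually_at_right_less[of 0] by (metis (mono_tags, lifting) eventually_conj eventually_happens' trivial_limit_at_right_real)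
    then have "t *\<^sub>R E_last \<in> ?G" by (simp add: halfspaces_snd)
    then show ?thesis by blast
  qed
  ultimately show ?thesis using interior_maximal by blast
qed

lemma body_measure_pos: "vol body > 0"
proof -
  have bnd: "bounded (interior body)" using compact_imp_bounded[OF body_compact] interior_subset bounded_subset by blast
  have "0 < vol (interior body)" by (rule open_measure_pos[OF open_interior bnd body_interior])
  also have "\<dots> \<le> vol body" by (rule measure_mono_fmeasurable[OF interior_subset _ lmeasurable_compact[OF body_compact]]) simp
  finally show ?thesis .
qed

lemma support_ge:
  assumes p: "p \<in> S" and k: "k \<in> body"
  shows "\<nu> p \<bullet> k \<le> support p" and "\<nu> p \<bullet> k = support p \<Longrightarrow> k = touching p"
proof -
  have z: "norm (\<nu> p) = 1" using nu_norm p by blast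
  then have F0: "F (\<nu> p) > 0" by (intro F_pos) auto
  have d: "dual_norm F (k - x0) \<le> 1" using k by (simp add: body_def)
  have 1: "\<nu> p \<bullet> (k - x0) \<le> dual_norm F (k - x0) * F (\<nu> p)" by (rule dual_norm_ge)
  have 2: "dual_norm F (k - x0) * F (\<nu> p) \<le> 1 * F (\<nu> p)" using d F0 by (intro mult_right_mono) auto
  have s: "\<nu> p \<bullet> (k - x0) = \<nu> p \<bullet> k - x0 \<bullet> \<nu> p" by (simp add: inner_diff_right inner_commute)
  show "\<nu> p \<bullet> k \<le> support p" using 1 2 s by (simp add: support_def)
  assume eq: "\<nu> p \<bullet> k = support p"
  then have e: "\<nu> p \<bullet> (k - x0) = 1 * F (\<nu> p)" using s by (simp add: support_def)
  with 1 2 have "dual_norm F (k - x0) * F (\<nu> p) = 1 * F (\<nu> p)" by linarith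
  then have "dual_norm F (k - x0) = 1" using F0 by simp
  from support_point_unique[OF z this _ e] show "k = touching p" by (simp add: touching_def algebra_simps)
qed

lemma F_nu_continuous: "continuous_on S (\<lambda>p. F (\<nu> p))"
  by (rule continuous_on_compose2[OF F_continuous nu_cont]) simp

lemma support_continuous: "continuous_on S support"
  unfolding support_def by (intro continuous_intros F_nu_continuous nu_cont)

text \<open>\<open>variation_le\<close> with Q = support / (p . \<nu> p), lowered by \<kappa> on B.
  The gain is weighted by p . \<nu> p so that it becomes \<kappa> times the volume of a
  cone.\<close>

lemma weighted_variation_le:
  assumes P: "compact P" "P \<subseteq> cregion \<times> body"
    and vol: "\<And>e. 0 < e \<Longrightarrow> vol cregion + e * c \<le> vol (perturbed P e)"
    and \<kappa>: "0 \<le> \<kappa>" and B: "open B"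
    and PB: "\<And>p k. p \<in> S \<Longrightarrow> p \<in> B \<Longrightarrow> (p, k) \<in> P \<Longrightarrow> \<nu> p \<bullet> k \<le> support p - \<kappa> * (p \<bullet> \<nu> p)"
  shows "c \<le> (real CARD('n) + 1) * (cone_integral support - \<kappa> * vol (region \<inter> proj -` B))"
proof -
  define Q where "Q p = indicator S p *\<^sub>R (support p / (p \<bullet> \<nu> p)) - \<kappa> * indicator B p" for p
  have nz: "p \<bullet> \<nu> p > 0" if "p \<in> S" for p using nu_pos that .
  have cq: "continuous_on S (\<lambda>p. support p / (p \<bullet> \<nu> p))"
    by (intro continuous_intros support_continuous nu_cont) (use nz in force)
  have oW: "open (region \<inter> proj -` B)"
    by (rule continuous_open_preimage[OF continuous_on_subset[OF proj_continuous_upper region_upper] region_open B])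
  have mW: "region \<inter> proj -` B \<in> sets borel" using oW by (rule borel_open)
  obtain q where q: "\<forall>x\<in>(\<lambda>p. support p / (p \<bullet> \<nu> p)) ` S. norm x \<le> q"
    using compact_imp_bounded[OF compact_continuous_image[OF cq S_compact]] unfolding bounded_iff by blast
  have "c \<le> (real CARD('n) + 1) * (LINT x:region|lborel. Q (proj x))"
  proof (rule variation_le[OF P(1)])
    show "fst ` P \<subseteq> cregion" using P(2) by auto
    have "perturbed P e \<subseteq> cupper" if "e > 0" for e
    proof
      fix x assume "x \<in> perturbed P e"
      then obtain z where z: "z \<in> P" "x = fst z + e *\<^sub>R snd z" unfolding perturbed_def by blast
      then have "fst z \<in> cupper" "snd z \<in> cupper" using subsetD[OF P(2) z(1)] body_upper by (auto simp: cregion_def mem_Times_iff)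
      then show "x \<in> cupper" using z(2) that by (simp add: halfspaces_snd)
    qed
    then have "vol cregion + e * c \<le> vol (perturbed P e \<inter> cupper)" if "e > 0" for e
      using vol[OF that] that by (simp add: Int_absorb2)
    then show "\<forall>\<^sub>F e in at_right 0. vol cregion + e * c \<le> vol (perturbed P e \<inter> cupper)"
      by (auto intro: eventually_mono[OF eventually_at_right_less])
    have "(\<lambda>p. indicator S p *\<^sub>R (support p / (p \<bullet> \<nu> p))) \<in> borel_measurable borel"
      by (rule borel_measurable_continuous_on_indicator[OF borel_closed[OF S_closed] cq])
    moreover have "(\<lambda>p. \<kappa> * indicator B p) \<in> borel_measurable borel"
      using borel_open[OF B] by (intro borel_measurable_times borel_measurable_indicator) auto
    ultimately show "Q \<in> borel_measurable borel" unfolding Q_def by (rule borel_measurable_diff)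
    show "\<bar>Q p\<bar> \<le> q + \<kappa>" if "p \<in> S" for p
    proof -
      have "\<bar>support p / (p \<bullet> \<nu> p)\<bar> \<le> q" using q that by auto
      then show ?thesis using that \<kappa> unfolding Q_def by (cases "p \<in> B") (simp_all del: abs_divide)
    qed
    show "\<nu> p \<bullet> k \<le> Q p * (p \<bullet> \<nu> p)" if p: "p \<in> S" "p \<in> upper" "(p, k) \<in> P" for p k
    proof (cases "p \<in> B")
      case True
      then show ?thesis using PB[OF p(1) True p(3)] p(1) nz[OF p(1)] by (simp add: Q_def left_diff_distrib)
    next
      case False
      have "k \<in> body" using P(2) p(3) by blast
      then show ?thesis using support_ge(1)[OF p(1)] False p(1) nz[OF p(1)] by (simp add: Q_def)
    qed
  qed
  also have "(LINT x:region|lborel. Q (proj x)) = cone_integral support - \<kappa> * vol (region \<inter> proj -` B)"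
  proof -
    have i1: "integrable lborel (\<lambda>x. indicator region x *\<^sub>R (support (proj x) / (proj x \<bullet> \<nu> (proj x))))"
      using cone_integrable[OF support_continuous] by (simp add: set_integrable_def)
    have fin: "emeasure lborel (region \<inter> proj -` B) < \<infinity>"
      using emeasure_mono[of "region \<inter> proj -` B" region lborel] emeasure_region_finite region_open
      by (auto simp: borel_open intro: order_le_less_trans)
    have i2: "integrable lborel (\<lambda>x. \<kappa> * indicator (region \<inter> proj -` B) x)"
      using fin mW by (intro integrable_mult_right integrable_real_indicator) auto
    have "(LINT x:region|lborel. Q (proj x)) = (\<integral>x. indicator region x *\<^sub>R (support (proj x) / (proj x \<bullet> \<nu> (proj x))) - \<kappa> * indicator (region \<inter> proj -` B) x \<partial>lborel)"
      unfolding set_lebesgue_integral_def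
    proof (rule Bochner_Integration.integral_cong)
      fix x show "indicator region x *\<^sub>R Q (proj x) = indicator region x *\<^sub>R (support (proj x) / (proj x \<bullet> \<nu> (proj x))) - \<kappa> * indicator (region \<inter> proj -` B) x"
      proof (cases "x \<in> region")
        case True
        then have "proj x \<in> S" using region_upper proj_upper by blast
        then show ?thesis using True by (simp add: Q_def indicator_def)
      qed simp
    qed simp
    also have "\<dots> = cone_integral support - \<kappa> * vol (region \<inter> proj -` B)"
      unfolding Bochner_Integration.integral_diff[OF i1 i2] cone_integral_def set_lebesgue_integral_def using mW by simp
    finally show ?thesis .
  qed
  finally show ?thesis .
qed

text \<open>If the pair at p0 is missing, compactness keeps all pairs of P based near p0 below the
  support by a fixed amount. \<open>weighted_variation_le\<close> then gains on a cone of positive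
  volume, which contradicts the assumed growth.\<close>

lemma touching_in_extremal:
  assumes P: "compact P" "P \<subseteq> cregion \<times> body"
    and vol: "\<And>e. 0 < e \<Longrightarrow> vol cregion + e * ((real CARD('n) + 1) * cone_integral support) \<le> vol (perturbed P e)"
    and p0: "p0 \<in> S" "p0 \<in> upper"
  shows "(p0, touching p0) \<in> P"
proof (rule ccontr)
  assume notin: "(p0, touching p0) \<notin> P"
  define P' where "P' = P \<inter> (S \<times> UNIV)"
  define f where "f z = support (fst z) - \<nu> (fst z) \<bullet> snd z" for z
  have cP': "compact P'" unfolding P'_def using P(1) S_closed by (intro compact_Int_closed closed_Times) auto
  have fS: "fst ` P' \<subseteq> S" by (auto simp: P'_def)
  have cf: "continuous_on P' f" unfolding f_def using fS
    by (intro continuous_intros continuous_on_compose2[OF support_continuous] continuous_on_compose2[OF nu_cont]) auto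
  have f0: "f z \<ge> 0" and f0': "f z = 0 \<Longrightarrow> snd z = touching (fst z)" if "z \<in> P'" for z
    using support_ge[of "fst z" "snd z"] that P(2) by (auto simp: f_def P'_def)
  \<comment> \<open>Where f vanishes, P contains the touching pair of the base point, so p0 is not
    such a base point.\<close>
  let ?Z = "{z \<in> P'. f z = 0}"
  have "closed ?Z" using continuous_closed_preimage_constant[OF cf compact_imp_closed[OF cP']] .
  then have "compact (P' \<inter> ?Z)" using cP' by (rule compact_Int_closed[rotated])
  moreover have "P' \<inter> ?Z = ?Z" by blast
  ultimately have "compact (fst ` ?Z)" by (intro compact_continuous_image continuous_intros) simp
  moreover have "p0 \<notin> fst ` ?Z"
  proof
    assume "p0 \<in> fst ` ?Z"
    then obtain z where z: "z \<in> P'" "f z = 0" "fst z = p0" by blast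
    have "(fst z, snd z) \<in> P'" using z(1) by (simp only: prod.collapse)
    then have "(p0, touching p0) \<in> P'" using f0'[OF z(1,2)] z(3) by simp
    then show False using notin unfolding P'_def by blast
  qed
  ultimately have "open (- fst ` ?Z)" "p0 \<in> - fst ` ?Z" using compact_imp_closed open_Compl by blast+
  then obtain r where r: "r > 0" "cball p0 r \<subseteq> - fst ` ?Z" unfolding open_contains_cball by blast
  let ?Y = "P' \<inter> (cball p0 r \<times> UNIV)"
  have cY: "compact ?Y" using cP' by (intro compact_Int_closed closed_Times) auto
  have "\<exists>\<kappa>>0. \<forall>z\<in>?Y. \<kappa> \<le> f z"
  proof (cases "?Y = {}")
    case False
    then obtain z where z: "z \<in> ?Y" "\<forall>y\<in>?Y. f z \<le> f y"
      using continuous_attains_inf[OF cY False continuous_on_subset[OF cf]] by blast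
    have "fst z \<in> cball p0 r" using z(1) by auto
    then have "z \<notin> ?Z" using r(2) by blast
    then have "f z > 0" using f0[of z] z(1) by force
    then show ?thesis using z(2) by blast
  qed (auto intro: exI[of _ 1])
  then obtain \<kappa>1 where k1: "\<kappa>1 > 0" "\<forall>z\<in>?Y. \<kappa>1 \<le> f z" by blast
  obtain b where b: "b \<in> S" "\<forall>p\<in>S. p \<bullet> \<nu> p \<le> b \<bullet> \<nu> b"
    using continuous_attains_sup[OF S_compact S_nonempty continuous_on_inner[OF continuous_on_id nu_cont]] by blast
  have b0: "b \<bullet> \<nu> b > 0" using nu_pos b(1) by blast
  \<comment> \<open>Since b maximises p . \<nu> p, the weighted gain never exceeds the gap
    \<kappa>1.\<close>
  define \<kappa> where "\<kappa> = \<kappa>1 / (b \<bullet> \<nu> b)"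
  have k: "\<kappa> > 0" using k1(1) b0 by (simp add: \<kappa>_def)
  have "(real CARD('n) + 1) * cone_integral support
    \<le> (real CARD('n) + 1) * (cone_integral support - \<kappa> * vol (region \<inter> proj -` ball p0 r))"
  proof (rule weighted_variation_le[OF P vol])
    show "\<nu> p \<bullet> k \<le> support p - \<kappa> * (p \<bullet> \<nu> p)" if p: "p \<in> S" "p \<in> ball p0 r" "(p, k) \<in> P" for p k
    proof -
      have "(p, k) \<in> ?Y" using p by (simp add: P'_def less_imp_le)
      then have "\<kappa>1 \<le> support p - \<nu> p \<bullet> k" using k1(2) by (force simp: f_def)
      moreover have "\<kappa> * (p \<bullet> \<nu> p) \<le> \<kappa>1 / (b \<bullet> \<nu> b) * (b \<bullet> \<nu> b)"
        using b(2) p(1) k1(1) b0 nu_pos[OF p(1)] by (intro mult_mono) (auto simp: \<kappa>_def)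
      moreover have "\<kappa>1 / (b \<bullet> \<nu> b) * (b \<bullet> \<nu> b) = \<kappa>1" using b0 by simp
      ultimately show ?thesis by linarith
    qed
  qed (use k in auto)
  moreover have "vol (region \<inter> proj -` ball p0 r) > 0"
  proof (rule open_measure_pos)
    show "open (region \<inter> proj -` ball p0 r)"
      by (rule continuous_open_preimage[OF continuous_on_subset[OF proj_continuous_upper region_upper] region_open open_ball])
    show "bounded (region \<inter> proj -` ball p0 r)"
      using region_subset_cregion compact_imp_bounded[OF cregion_compact] bounded_subset by blast
    let ?y = "(1/2) *\<^sub>R p0"
    have "p0 \<in> cupper" using p0 S_closed_upper by blast
    then have "proj ?y = p0" "gaugeS ?y = 1/2" using proj_scale[of "1/2" p0] gauge_scale[of "1/2" p0] proj_S gauge_S p0(1) by auto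
    moreover have "?y \<in> upper" using p0(2) by (simp add: halfspaces_snd)
    ultimately have "?y \<in> region \<inter> proj -` ball p0 r" using r(1) by (simp add: region_def)
    then show "region \<inter> proj -` ball p0 r \<noteq> {}" by blast
  qed
  then have "\<kappa> * vol (region \<inter> proj -` ball p0 r) > 0" using k by simp
  then have "(real CARD('n) + 1) * (cone_integral support - \<kappa> * vol (region \<inter> proj -` ball p0 r)) < (real CARD('n) + 1) * cone_integral support"
    by (intro mult_strict_left_mono) auto
  ultimately show False by linarith
qed

section \<open>Cuts in equal volume ratio and the inequality\<close>

definition split_pairs :: "'n ambient \<Rightarrow> real \<Rightarrow> real \<Rightarrow> ('n ambient \<times> 'n ambient) set" where
  "split_pairs u a b = (cregion \<inter> {x. x \<bullet> u \<le> a}) \<times> (body \<inter> {x. x \<bullet> u \<le> b}) \<union> (cregion \<inter> {x. x \<bullet> u \<ge> a}) \<times> (body \<inter> {x. x \<bullet> u \<ge> b})"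

definition matched :: "'n ambient \<Rightarrow> real \<Rightarrow> real \<Rightarrow> bool" where
  "matched u a b \<longleftrightarrow> vol (cregion \<inter> {x. x \<bullet> u \<le> a}) * vol body
      = vol (body \<inter> {x. x \<bullet> u \<le> b}) * vol cregion"

lemma ex_matched:
  assumes "u \<noteq> 0"
  shows "\<exists>b. matched u a b"
proof -
  let ?t = "vol (cregion \<inter> {x. x \<bullet> u \<le> a}) / vol cregion"
  have "closed {x. x \<bullet> u \<le> a}" by (intro closed_Collect_le continuous_intros)
  then have "vol (cregion \<inter> {x. x \<bullet> u \<le> a}) \<le> vol cregion"
    using cregion_compact by (intro measure_mono_fmeasurable) (auto intro: lmeasurable_compact fmeasurableD compact_Int_closed)
  then have "0 \<le> ?t" "?t \<le> 1" using measure_cregion_pos by simp_all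
  then obtain b where "vol (body \<inter> {x. x \<bullet> u \<le> b}) = ?t * vol body"
    using halfspace_measure_IVT[OF lmeasurable_compact[OF body_compact] compact_imp_bounded[OF body_compact] assms] by blast
  then have "matched u a b" using measure_cregion_pos by (simp add: matched_def)
  then show ?thesis by blast
qed

text \<open>The derivative at e = 0 of the Brunn--Minkowski lower bound (|\<Omega>|^(1/N) + e
  |K|^(1/N))^N, with K = \<open>body\<close>.\<close>

definition iso_const :: real where
  "iso_const = real (CARD('n) + 1) * root (CARD('n) + 1) (vol body) * root (CARD('n) + 1) (vol cregion) ^ CARD('n)"

lemma matched_split:
  assumes "matched u a b" "u \<noteq> 0"
  shows "compact (split_pairs u a b)" "split_pairs u a b \<subseteq> cregion \<times> body"
    "0 < e \<Longrightarrow> vol cregion + e * iso_const \<le> vol (perturbed (split_pairs u a b) e)"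
  using split_volume[OF body_compact body_measure_pos assms(2) assms(1)[unfolded matched_def]] by (auto simp: split_pairs_def iso_const_def)

text \<open>Any matched cut serves. At level 0 in the vertical direction the lower pieces are null
  sets, so this is the argument without a genuine cut.\<close>

theorem isoperimetric_inequality: "iso_const \<le> (real CARD('n) + 1) * cone_integral support"
proof -
  have u: "(E_last :: 'n ambient) \<noteq> 0" by simp
  obtain b where m: "matched E_last 0 b" using ex_matched[OF u] by blast
  have "iso_const \<le> (real CARD('n) + 1) * (cone_integral support - 0 * vol (region \<inter> proj -` {}))"
    by (rule weighted_variation_le[OF matched_split(1,2)[OF m u] matched_split(3)[OF m u]]) simp_all
  then show ?thesis by simp
qed

end

section \<open>Wulff caps\<close>

text \<open>Instantiated with the model and with the Wulff shapes of the equality case. Having the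
  origin strictly inside is what makes the cap a radial graph.\<close>

locale wulff_cap = anisotropic F for F :: "'n::finite ambient \<Rightarrow> real" +
  fixes x1 :: "'n ambient" and r :: real
  assumes origin: "dual_norm F (- x1) < r"
begin

definition W :: "'n ambient set" where
  "W = {x \<in> cupper. dual_norm F (x - x1) = r}"

definition \<nu>W :: "'n ambient \<Rightarrow> 'n ambient" where
  "\<nu>W x = gauss (x - x1)"

lemma r_pos: "r > 0"
  using origin dual_norm_nonneg[of "- x1"] by linarith

lemma less_on_segment:
  assumes "dual_norm F (x - x1) \<le> r" "0 < t" "t < 1" "x \<noteq> 0"
  shows "dual_norm F (t *\<^sub>R x - x1) < r"
proof -
  have "(1 - t) *\<^sub>R (- x1) + t *\<^sub>R (x - x1) = t *\<^sub>R x - x1" by (simp add: algebra_simps)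
  moreover have "- x1 \<noteq> x - x1" using assms(4) by (metis add.right_neutral add_diff_cancel_left' diff_add_cancel minus_diff_eq uminus_add_conv_diff)
  ultimately show ?thesis using dual_norm_strictly_convex[OF assms(2,3), of "- x1" r "x - x1"] assms(1) origin by simp
qed

lemma W_ray_unique:
  assumes "x \<in> W" "t *\<^sub>R x \<in> W" "t > 0"
  shows "t = 1"
proof (rule ccontr)
  assume "t \<noteq> 1"
  have d: "dual_norm F (x - x1) = r" "dual_norm F (t *\<^sub>R x - x1) = r" using assms by (auto simp: W_def)
  have nz: "x \<noteq> 0" using d(1) origin by auto
  show False
  proof (cases "t < 1")
    case True
    then show False using less_on_segment[OF _ assms(3) True nz] d by simp
  next
    case False
    then have "inverse t < 1" "0 < inverse t" using \<open>t \<noteq> 1\<close> by (simp_all add: inverse_less_1_iff)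
    then show False using less_on_segment[of "t *\<^sub>R x" "inverse t"] d nz assms(3) by simp
  qed
qed

lemma ray_meets_W:
  assumes "x \<in> cupper" "norm x = 1"
  shows "\<exists>t>0. t *\<^sub>R x \<in> W"
proof -
  obtain c where c: "c > 0" "\<And>\<xi>. c * norm \<xi> \<le> dual_norm F \<xi>" using dual_norm_bounds by metis
  let ?f = "\<lambda>t. dual_norm F (t *\<^sub>R x - x1)"
  let ?b = "r / c + norm x1"
  have b0: "?b \<ge> 0" using r_pos c(1) by simp
  have "r \<le> ?f ?b"
  proof -
    have "c * (r / c) \<le> c * norm (?b *\<^sub>R x - x1)"
      using norm_triangle_ineq2[of "?b *\<^sub>R x" x1] assms(2) b0 c(1) by (intro mult_left_mono) auto
    then show ?thesis using c(2)[of "?b *\<^sub>R x - x1"] c(1) by simp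
  qed
  moreover have "?f 0 \<le> r" using origin by simp
  moreover have "continuous_on {0..?b} ?f"
    by (rule continuous_on_compose2[OF dual_norm_continuous[of UNIV]]) (auto intro!: continuous_intros)
  ultimately obtain t where t: "0 \<le> t" "?f t = r" using IVT'[of ?f 0 r ?b] b0 by blast
  moreover have "t \<noteq> 0" using t(2) origin by auto
  ultimately show ?thesis using assms(1) by (intro exI[of _ t]) (simp add: W_def halfspaces_snd)
qed

lemma W_compact: "compact W"
proof -
  have "W = cupper \<inter> ({x. r \<le> dual_norm F (x - x1)} \<inter> {x. dual_norm F (x - x1) \<le> r})" by (auto simp: W_def)
  moreover have "closed {x. r \<le> dual_norm F (x - x1)}"
    by (intro closed_Collect_le continuous_on_const continuous_on_compose2[OF dual_norm_continuous[of UNIV]] continuous_intros) simp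
  ultimately show ?thesis using closed_Int_compact[OF closed_closed_upper_halfspace closed_Int_compact[OF _ compact_dual_ball]] by simp
qed

lemma radial_graph_W: "radial_graph W"
proof
  show "compact W" by (rule W_compact)
  let ?H = "sphere 0 1 \<inter> (cupper :: 'n ambient set)"
  define \<rho> where "\<rho> \<theta> = (SOME t. t > 0 \<and> t *\<^sub>R \<theta> \<in> W)" for \<theta>
  have \<rho>: "\<rho> \<theta> > 0 \<and> \<rho> \<theta> *\<^sub>R \<theta> \<in> W" if "\<theta> \<in> ?H" for \<theta>
    unfolding \<rho>_def by (rule someI_ex) (use ray_meets_W[of \<theta>] that in auto)
  have "W \<subseteq> (\<lambda>\<theta>. \<rho> \<theta> *\<^sub>R \<theta>) ` ?H"
  proof
    fix x assume x: "x \<in> W"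
    then have nz: "x \<noteq> 0" using origin by (auto simp: W_def)
    have s: "sgn x \<in> ?H" using x nz by (auto simp: W_def halfspaces_snd norm_sgn sgn_div_norm)
    have "(\<rho> (sgn x) / norm x) *\<^sub>R x \<in> W" using \<rho>[OF s] by (simp add: sgn_div_norm divide_inverse)
    then have "\<rho> (sgn x) / norm x = 1" using W_ray_unique[OF x, of "\<rho> (sgn x) / norm x"] \<rho>[OF s] nz by simp
    then have "\<rho> (sgn x) *\<^sub>R sgn x = x" using nz by (simp add: sgn_div_norm)
    then show "x \<in> (\<lambda>\<theta>. \<rho> \<theta> *\<^sub>R \<theta>) ` ?H" using s by (intro image_eqI[of _ _ "sgn x"]) auto
  qed
  then show "\<exists>\<rho>. (\<forall>\<theta>\<in>?H. \<rho> \<theta> > 0) \<and> W = (\<lambda>\<theta>. \<rho> \<theta> *\<^sub>R \<theta>) ` ?H"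
    using \<rho> by (intro exI[of _ \<rho>]) auto
qed

lemma nuW:
  assumes "p \<in> W"
  shows "norm (\<nu>W p) = 1" "p - x1 = r *\<^sub>R wulff (\<nu>W p)" "\<nu>W p \<bullet> (p - x1) = r * F (\<nu>W p)" "0 < F (\<nu>W p)" "\<nu>W p \<bullet> (x - x1) \<le> dual_norm F (x - x1) * F (\<nu>W p)"
proof -
  have nz: "p - x1 \<noteq> 0" using assms r_pos dual_norm_zero by (auto simp: W_def)
  show n: "norm (\<nu>W p) = 1" unfolding \<nu>W_def by (rule gauss(1)[OF nz])
  show "p - x1 = r *\<^sub>R wulff (\<nu>W p)" using gauss(2)[OF nz] assms by (simp add: \<nu>W_def W_def)
  show "\<nu>W p \<bullet> (p - x1) = r * F (\<nu>W p)" using gauss_inner[OF nz] assms by (simp add: \<nu>W_def W_def)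
  show "0 < F (\<nu>W p)" using n by (intro F_pos) auto
  show "\<nu>W p \<bullet> (x - x1) \<le> dual_norm F (x - x1) * F (\<nu>W p)" by (rule dual_norm_ge)
qed

lemma nuW_continuous: "continuous_on W \<nu>W"
proof -
  have "continuous_on W (\<lambda>x. gauss ((1 / r) *\<^sub>R (x - x1)))" by (rule continuous_on_compose2[OF gauss_continuous_level])
      (use r_pos in \<open>auto intro!: continuous_intros simp: W_def dual_norm_scale\<close>)
  moreover have "gauss ((1 / r) *\<^sub>R (x - x1)) = \<nu>W x" if "x \<in> W" for x
    unfolding \<nu>W_def using that r_pos dual_norm_zero by (intro gauss_scale) (auto simp: W_def)
  ultimately show ?thesis by (simp cong: continuous_on_cong)
qed

text \<open>Near 0 the map X has dual norm r + \<open>snd v\<close> relative to the centre, so W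
  corresponds to \<open>snd v = 0\<close>. Its derivative is injective because the derivative of
  \<open>wulff\<close> at z0 is positive definite on the tangent plane and \<open>wulff z0\<close>
  is transversal to that plane; the inverse function theorem yields the chart.\<close>

lemma W_chart:
  assumes p: "p \<in> W" "p \<in> upper"
  shows "p \<in> manifold_interior W"
proof -
  define z0 where "z0 = \<nu>W p"
  have z0: "norm z0 = 1" "p - x1 = r *\<^sub>R wulff z0" using nuW[OF p(1)] by (simp_all add: z0_def)
  have nE: "norm (E_last :: 'n ambient) = 1" by (simp add: E_last_def)
  obtain M :: "'n ambient \<Rightarrow> 'n ambient" where M: "linear M" "\<And>x. M (M x) = x" "\<And>x y. M x \<bullet> M y = x \<bullet> y" "M E_last = z0" "M z0 = E_last"
    by (rule exists_reflection[OF z0(1) nE]) (rule that)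
  have bM: "bounded_linear M" using M(1) linear_conv_bounded_linear by blast
  have bfst: "bounded_linear (\<lambda>v :: 'n ambient. M (fst v, 0))"
    using bounded_linear_compose[OF bM, of "\<lambda>v. (fst v, 0)"] bounded_linear_Pair[OF bounded_linear_fst bounded_linear_zero] by blast
  \<comment> \<open>An affine parametrisation of the tangent plane to the sphere at z0: the
    reflection M takes horizontal vectors to vectors orthogonal to z0.\<close>
  define m where "m v = M (fst v, 0) + z0" for v :: "'n ambient"
  define X where "X v = x1 + (r + snd v) *\<^sub>R wulff (m v)" for v
  have m_inner: "M (y, 0) \<bullet> z0 = 0" for y using M(3)[of "(y, 0)" E_last] M(4) by simp
  have m_nz: "m v \<noteq> 0" for v
  proof
    assume "m v = 0"
    then have "m v \<bullet> z0 = 0" by simp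
    then show False using m_inner z0(1) by (simp add: m_def inner_add_left norm_eq_sqrt_inner)
  qed
  have sm: "smooth_on m UNIV" unfolding m_def
    by (intro smooth_on_add smooth_on_const smooth_on_bounded_linear_compose[OF bfst smooth_on_ident])
  have sw: "smooth_on (\<lambda>v. wulff (m v)) UNIV" by (rule smooth_on_compose[OF wulff_smooth sm]) (use m_nz in auto)
  have sX: "smooth_on X UNIV" unfolding X_def by (intro smooth_on_add smooth_on_const smooth_on_bilinear[OF bounded_bilinear_scaleR] sw
        smooth_on_bounded_linear_compose[OF bounded_linear_snd smooth_on_ident])
  have cX: "continuous_on UNIV X" using sX by (rule smooth_on_imp_continuous_on)
  have dX: "dual_norm F (X v - x1) = r + snd v" if "snd v > - r" for v
  proof -
    have "wulff (m v) = wulff (sgn (m v))" using wulff_scale[of "inverse (norm (m v))" "m v"] m_nz[of v] by (simp add: sgn_div_norm)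
    then have "dual_norm F (wulff (m v)) = 1" using dual_norm_wulff[of "sgn (m v)"] m_nz by (simp add: norm_sgn)
    then show ?thesis using that by (simp add: X_def dual_norm_scale)
  qed
  define U where "U = {v. - r < snd v} \<inter> X -` upper"
  have U: "open U" unfolding U_def by (intro open_Int open_Collect_less continuous_intros open_vimage[OF open_upper_halfspace cX])
  have m0: "m 0 = z0" using M(1) by (simp add: m_def linear_0 zero_prod_def[symmetric])
  have X0: "X 0 = p" using z0(2) by (simp add: X_def m0 algebra_simps)
  have U0: "0 \<in> U" using r_pos X0 p(2) by (simp add: U_def)
  have inj: "v = 0" if v: "frechet_derivative X (at 0) v = 0" for v
  proof -
    have "z0 \<noteq> 0" using z0(1) by auto
    have "(m has_derivative (\<lambda>v. M (fst v, 0) + 0)) (at 0)"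
      unfolding m_def by (intro has_derivative_add bounded_linear_imp_has_derivative[OF bfst] has_derivative_const)
    then have dm: "(m has_derivative (\<lambda>v. M (fst v, 0))) (at 0)" by simp
    have dw: "((\<lambda>v. wulff (m v)) has_derivative (\<lambda>v. dwulff z0 (M (fst v, 0)))) (at 0)"
      using has_derivative_compose[OF dm, of wulff "dwulff z0"] dwulff[OF \<open>z0 \<noteq> 0\<close>] m0 by simp
    have "((\<lambda>v :: 'n ambient. r + snd v) has_derivative (\<lambda>v. snd v)) (at 0)" by (auto intro!: derivative_eq_intros)
    from has_derivative_add[OF has_derivative_const[of x1] has_derivative_scaleR[OF this dw]]
    have dX0: "(X has_derivative (\<lambda>v. r *\<^sub>R dwulff z0 (M (fst v, 0)) + snd v *\<^sub>R wulff z0)) (at 0)"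
      unfolding X_def m0 by simp
    have "frechet_derivative X (at 0) v = r *\<^sub>R dwulff z0 (M (fst v, 0)) + snd v *\<^sub>R wulff z0"
      by (rule fun_cong[OF frechet_derivative_at[OF dX0], symmetric])
    with v have eq: "r *\<^sub>R dwulff z0 (M (fst v, 0)) + snd v *\<^sub>R wulff z0 = 0" by simp
    have "(r *\<^sub>R dwulff z0 (M (fst v, 0)) + snd v *\<^sub>R wulff z0) \<bullet> z0 = snd v * F z0"
      using dwulff_inner_self[OF \<open>z0 \<noteq> 0\<close>] wulff_inner_self[OF \<open>z0 \<noteq> 0\<close>]
      by (simp add: inner_add_left inner_commute[of "wulff z0"])
    then have s0: "snd v = 0" using eq F_pos[OF \<open>z0 \<noteq> 0\<close>] by simp
    then have d0: "dwulff z0 (M (fst v, 0)) = 0" using eq r_pos by simp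
    have "M (fst v, 0) = 0"
    proof (rule ccontr)
      assume "M (fst v, 0) \<noteq> 0"
      then show False using dwulff_pos_unit[OF z0(1), of "M (fst v, 0)"] m_inner d0 by (simp add: inner_commute)
    qed
    then have "(fst v, 0::real) = 0" using M(2) linear_0[OF M(1)] by metis
    then show "v = 0" using s0 by (simp add: prod_eq_iff zero_prod_def)
  qed
  obtain U' V where UV: "U' \<subseteq> U" "0 \<in> U'" "diffeomorphism U' V X"
    by (rule smooth_inverse_function[OF U U0 smooth_on_subset[OF sX subset_UNIV]]) (rule inj, assumption, rule that)
  obtain g where g: "diffeomorphism V U' g" "\<And>x. x \<in> U' \<Longrightarrow> g (X x) = x" "\<And>y. y \<in> V \<Longrightarrow> X (g y) = y" "X ` U' = V" "g ` V = U'"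
    by (rule diffeomorphism_inverse[OF UV(3)]) (rule that)
  have pV: "p \<in> W \<inter> V" using p(1) X0 UV(2) g(4) by (metis IntI imageI)
  have mem: "X v \<in> W \<longleftrightarrow> snd v = 0" if "v \<in> U'" for v
  proof -
    have v: "snd v > - r" "X v \<in> upper" using that UV(1) by (auto simp: U_def)
    then have "X v \<in> cupper" using upper_subset_closed_upper by blast
    then show ?thesis using dX[OF v(1)] by (simp add: W_def)
  qed
  have "g ` (W \<inter> V) = U' \<inter> {x. snd x = 0}"
  proof
    show "g ` (W \<inter> V) \<subseteq> U' \<inter> {x. snd x = 0}"
    proof (rule image_subsetI)
      fix y assume y: "y \<in> W \<inter> V"
      then have "g y \<in> U'" using g(5) by blast
      then show "g y \<in> U' \<inter> {x. snd x = 0}" using mem[of "g y"] g(3) y by simp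
    qed
    show "U' \<inter> {x. snd x = 0} \<subseteq> g ` (W \<inter> V)"
    proof
      fix v assume v: "v \<in> U' \<inter> {x. snd x = 0}"
      then have "X v \<in> W \<inter> V" using mem g(4) by blast
      then show "v \<in> g ` (W \<inter> V)" using g(2) v by (intro image_eqI[of _ _ "X v"]) auto
    qed
  qed
  then have "interior_chart W p V g" using pV g(1) unfolding interior_chart_def by blast
  then show ?thesis unfolding manifold_interior_def by blast
qed

text \<open>Tangency follows from convexity: q - p has nonpositive product with the normal at p and
  nonnegative product with the normal at q, so the former is bounded by |q - p| times the difference
  of the normals, which tends to 0. This includes boundary points.\<close>

lemma radial_surface_W: "radial_surface W \<nu>W"
proof -
  interpret radial_graph W by (rule radial_graph_W)
  show ?thesis
  proof
    show "W \<inter> upper \<subseteq> manifold_interior W" using W_chart by blast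
    show "continuous_on W \<nu>W" by (rule nuW_continuous)
    fix p assume p: "p \<in> W"
    note n = nuW[OF p]
    show "norm (\<nu>W p) = 1" by (rule n(1))
    have "\<nu>W p \<bullet> (0 - x1) \<le> dual_norm F (0 - x1) * F (\<nu>W p)" by (rule n(5))
    also have "\<dots> < r * F (\<nu>W p)" using origin n(4) by simp
    finally have "- (\<nu>W p \<bullet> x1) < \<nu>W p \<bullet> (p - x1)" using n(3) by simp
    then show "p \<bullet> \<nu>W p > 0" by (simp add: inner_diff_right inner_commute[of p])
    have le: "\<bar>\<nu>W p \<bullet> (q - p) / norm (q - p)\<bar> \<le> norm (\<nu>W p - \<nu>W q)" if q: "q \<in> W" for q
    proof -
      have "\<nu>W p \<bullet> (q - x1) \<le> \<nu>W p \<bullet> (p - x1)" using n(3) n(5)[of q] q by (simp add: W_def)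
      then have 1: "\<nu>W p \<bullet> (q - p) \<le> 0" by (simp add: inner_diff_right)
      have "\<nu>W q \<bullet> (p - x1) \<le> \<nu>W q \<bullet> (q - x1)" using nuW(3)[OF q] nuW(5)[OF q, of p] p by (simp add: W_def)
      then have 2: "0 \<le> \<nu>W q \<bullet> (q - p)" by (simp add: inner_diff_right)
      have "\<bar>\<nu>W p \<bullet> (q - p)\<bar> \<le> - ((\<nu>W p - \<nu>W q) \<bullet> (q - p))" using 1 2 by (simp add: inner_diff_left)
      also have "\<dots> \<le> norm (\<nu>W p - \<nu>W q) * norm (q - p)" using Cauchy_Schwarz_ineq2[of "\<nu>W p - \<nu>W q" "q - p"] by linarith
      finally show ?thesis by (cases "q = p") (simp_all add: pos_divide_le_eq)
    qed
    have "((\<lambda>q. norm (\<nu>W p - \<nu>W q)) \<longlongrightarrow> norm (\<nu>W p - \<nu>W p)) (at p within W)"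
      using nuW_continuous p unfolding continuous_on_def by (intro tendsto_intros) blast
    then have lim: "((\<lambda>q. norm (\<nu>W p - \<nu>W q)) \<longlongrightarrow> 0) (at p within W)" by simp
    show "((\<lambda>q. \<nu>W p \<bullet> (q - p) / norm (q - p)) \<longlongrightarrow> 0) (at p within W)"
      by (rule Lim_null_comparison[OF _ lim]) (use le in \<open>simp add: eventually_at_filter\<close>)
  qed
qed

sublocale WR: radial_surface W \<nu>W by (rule radial_surface_W)

lemma cregion_W: "WR.cregion = {x \<in> cupper. dual_norm F (x - x1) \<le> r}"
proof -
  have "WR.gaugeS x \<le> 1 \<longleftrightarrow> dual_norm F (x - x1) \<le> r" if x: "x \<in> cupper" for x
  proof (cases "x = 0")
    case True
    then show ?thesis using origin by simp
  next
    case False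
    let ?g = "WR.gaugeS x"
    have g: "?g > 0" "WR.proj x \<in> W" using WR.gauge_pos[OF x False] WR.proj_in_S[OF x False] by auto
    have xp: "x = ?g *\<^sub>R WR.proj x" using WR.gauge_proj[OF x] .
    have d: "dual_norm F (WR.proj x - x1) = r" using g(2) by (simp add: W_def)
    have pn: "WR.proj x \<noteq> 0" using WR.S_not_zero g(2) by blast
    consider "?g < 1" | "?g = 1" | "?g > 1" by linarith
    then show ?thesis
    proof cases
      case 1
      then show ?thesis using less_on_segment[of "WR.proj x" ?g] d g(1) pn xp by simp
    next
      case 2
      then show ?thesis using d xp by simp
    next
      case 3
      have "WR.proj x = inverse ?g *\<^sub>R x" by (simp add: WR.proj_def)
      then show ?thesis using less_on_segment[of x "inverse ?g"] d 3 False by (auto simp: inverse_less_1_iff)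
    qed
  qed
  then show ?thesis unfolding WR.cregion_def by blast
qed

text \<open>On the cap p . \<nu> = r F \<nu> + x1 . \<nu>. Integration turns the left side into n +
  1 times the volume and, by the divergence theorem, the last term into r \<omega> times the measure
  of the trace, that is, r times the boundary term of the energy.\<close>

lemma energy_W:
  assumes "snd x1 = r * \<omega>"
  shows "capillary_energy F \<omega> W = (real CARD('n) + 1) * vol (enclosed W) / r"
proof -
  let ?N = "real CARD('n) + 1"
  have cn: "continuous_on W (\<lambda>p. p \<bullet> \<nu>W p)" "continuous_on W (\<lambda>p. (- x1) \<bullet> \<nu>W p)"
    using WR.nu_cont by (auto intro!: continuous_intros)
  have "F (\<nu>W p) = (1 / r) * (p \<bullet> \<nu>W p + (- x1) \<bullet> \<nu>W p)" if "p \<in> W" for p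
  proof -
    have "p \<bullet> \<nu>W p + (- x1) \<bullet> \<nu>W p = r * F (\<nu>W p)"
      using nuW(3)[OF that] by (simp add: inner_diff_right inner_commute[of _ "\<nu>W p"])
    then show ?thesis using r_pos by simp
  qed
  then have "WR.cone_integral (\<lambda>p. F (\<nu>W p)) = WR.cone_integral (\<lambda>p. (1 / r) * (p \<bullet> \<nu>W p + (- x1) \<bullet> \<nu>W p))"
    by (intro WR.cone_integral_cong) blast
  also have "\<dots> = (1 / r) * (vol WR.cregion + WR.cone_integral (\<lambda>p. (- x1) \<bullet> \<nu>W p))"
    unfolding WR.cone_integral_cmult WR.cone_integral_add[OF cn] WR.cone_integral_radial ..
  finally have "?N * WR.cone_integral (\<lambda>p. F (\<nu>W p)) = (1 / r) * (?N * vol WR.cregion + ?N * WR.cone_integral (\<lambda>p. (- x1) \<bullet> \<nu>W p))"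
    by (simp only: distrib_left mult.left_commute)
  also have "?N * WR.cone_integral (\<lambda>p. (- x1) \<bullet> \<nu>W p) = - (r * \<omega>) * vol (enclosed_trace W)"
    using WR.divergence_theorem[of "- x1"] assms by simp
  finally show ?thesis using r_pos unfolding capillary_energy_def WR.anisotropic_area_eq[OF F_continuous] WR.enclosed_eq
    by (simp add: field_simps)
qed

end

section \<open>The equality case\<close>

text \<open>Used to see the origin strictly between two points of S, and to have a point of S on the
  hyperplane at all.\<close>

lemma (in radial_graph) equator_points:
  fixes i :: 'n
  shows "\<exists>s>0. \<exists>t>0. s *\<^sub>R (axis i 1, 0) \<in> S \<and> - (t *\<^sub>R (axis i 1, 0)) \<in> S"
proof -
  let ?e = "(axis i 1, 0) :: 'n ambient"
  have "?e \<in> cupper" "?e \<noteq> 0" "- ?e \<in> cupper" "- ?e \<noteq> 0" by (simp_all add: halfspaces_snd zero_prod_def axis_eq_0_iff)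
  from ray_meets_S[OF this(1,2)] ray_meets_S[OF this(3,4)]
  obtain s t where "s > 0" "?e /\<^sub>R s \<in> S" "t > 0" "(- ?e) /\<^sub>R t \<in> S" by blast
  then show ?thesis by (intro exI[of _ "inverse s"] conjI exI[of _ "inverse t"]) auto
qed

locale radial_graph_wulff = radial_graph S + anisotropic F
  for S :: "'n::finite ambient set" and F :: "'n ambient \<Rightarrow> real"
begin

text \<open>The origin lies strictly between two opposite equatorial points of S, both in the dual
  ball, and the dual norm ball is strictly convex.\<close>

lemma origin_inside:
  assumes "\<And>p. p \<in> S \<Longrightarrow> dual_norm F (p - x1) \<le> r"
  shows "dual_norm F (- x1) < r"
proof -
  obtain i :: 'n where True by blast
  let ?e = "(axis i 1, 0) :: 'n ambient"
  obtain s t where st: "s > 0" "t > 0" "s *\<^sub>R ?e \<in> S" "- (t *\<^sub>R ?e) \<in> S" using equator_points by blast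
  let ?l = "s / (s + t)"
  have l: "0 < ?l" "?l < 1" using st by simp_all
  have "(1 - ?l) * s = ?l * t" using st by (simp add: field_simps)
  then have "(1 - ?l) *\<^sub>R (s *\<^sub>R ?e) + ?l *\<^sub>R (- (t *\<^sub>R ?e)) = 0" by (simp add: zero_prod_def[symmetric])
  then have "(1 - ?l) *\<^sub>R (s *\<^sub>R ?e - x1) + ?l *\<^sub>R (- (t *\<^sub>R ?e) - x1) = - x1" by (simp add: algebra_simps)
  moreover have "s *\<^sub>R ?e - x1 \<noteq> - (t *\<^sub>R ?e) - x1"
  proof
    assume "s *\<^sub>R ?e - x1 = - (t *\<^sub>R ?e) - x1"
    moreover have "(s + t) *\<^sub>R v = 0" if "s *\<^sub>R v - x1 = - (t *\<^sub>R v) - x1" for v :: "'n ambient"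
      using that by (simp add: scaleR_add_left)
    ultimately have "(s + t) *\<^sub>R ?e = 0" by blast
    then show False using st by (simp add: zero_prod_def axis_eq_0_iff)
  qed
  ultimately show ?thesis using dual_norm_strictly_convex[OF l, of "s *\<^sub>R ?e - x1" r "- (t *\<^sub>R ?e) - x1"] assms st by simp
qed

text \<open>Both sets meet each ray of the closed half-space exactly once, so one inclusion is
  enough.\<close>

lemma wulff_part_eqI:
  assumes "\<And>p. p \<in> S \<Longrightarrow> dual_norm F (p - x1) = r"
  shows "S = {x \<in> cupper. dual_norm F (x - x1) = r}"
proof -
  have "dual_norm F (- x1) < r" by (rule origin_inside) (simp add: assms)
  then interpret D: wulff_cap F x1 r by unfold_locales
  have "S \<subseteq> D.W" using assms S_closed_upper by (auto simp: D.W_def)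
  moreover have "D.W \<subseteq> S"
  proof
    fix x assume x: "x \<in> D.W"
    then have x0: "x \<in> cupper" "x \<noteq> 0" using D.WR.S_not_zero by (auto simp: D.W_def)
    then have "proj x \<in> D.W" using proj_in_S \<open>S \<subseteq> D.W\<close> by blast
    then have "inverse (gaugeS x) *\<^sub>R x \<in> D.W" by (simp add: proj_def)
    then have "inverse (gaugeS x) = 1" using gauge_pos[OF x0] by (intro D.W_ray_unique[OF x]) auto
    then show "x \<in> S" using x0 S_iff by simp
  qed
  ultimately show ?thesis by (simp add: D.W_def)
qed

end

sublocale wulff_comparison \<subseteq> radial_graph_wulff ..

section \<open>Rigidity of the touching map under equality\<close>

context wulff_comparison
begin

context
  assumes eq: "iso_const = (real CARD('n) + 1) * cone_integral support"
begin

lemma touching_matched: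
  assumes "matched u a b" "u \<noteq> 0" "p \<in> S" "p \<in> upper"
  shows "(p, touching p) \<in> split_pairs u a b"
  using touching_in_extremal[OF matched_split(1,2)[OF assms(1,2)] _ assms(3,4)] matched_split(3)[OF assms(1,2)] eq by simp

lemma touching_body:
  assumes "p \<in> S" "p \<in> upper"
  shows "touching p \<in> body"
proof -
  have u: "(E_last :: 'n ambient) \<noteq> 0" by simp
  then obtain b where "matched E_last 0 b" using ex_matched by blast
  from touching_matched[OF this u assms] show ?thesis by (auto simp: split_pairs_def)
qed

lemma touching_less:
  assumes "matched u a b" "u \<noteq> 0" "p \<in> S" "p \<in> upper"
  shows "p \<bullet> u < a \<Longrightarrow> touching p \<bullet> u \<le> b" "a < p \<bullet> u \<Longrightarrow> b \<le> touching p \<bullet> u"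
  using touching_matched[OF assms] by (auto simp: split_pairs_def)

text \<open>A matched cut halfway between the two levels separates p from q, and equality keeps each
  touching point on the side of its own piece.\<close>

lemma touching_mono:
  assumes u: "u \<noteq> 0" and p: "p \<in> S" "p \<in> upper" and q: "q \<in> S" "q \<in> upper" and less: "p \<bullet> u < q \<bullet> u"
  shows "touching p \<bullet> u \<le> touching q \<bullet> u"
proof -
  let ?a = "(p \<bullet> u + q \<bullet> u) / 2"
  obtain b where m: "matched u ?a b" using ex_matched[OF u] by blast
  show ?thesis using touching_less(1)[OF m u p] touching_less(2)[OF m u q] less by simp
qed

text \<open>The midpoint of p and q lies strictly between the levels and, since the body is convex
  with interior points, in the closure of its interior; so an open part of the body lies between the
  levels.\<close>

lemma body_slab_pos:
  assumes p: "p \<in> body" "q \<in> body" and less: "p \<bullet> u < q \<bullet> u"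
  shows "vol (body \<inter> {x. x \<bullet> u \<le> p \<bullet> u}) < vol (body \<inter> {x. x \<bullet> u \<le> q \<bullet> u})"
proof -
  let ?m = "(1/2) *\<^sub>R p + (1/2) *\<^sub>R q"
  let ?H = "{x. p \<bullet> u < x \<bullet> u} \<inter> {x. x \<bullet> u < q \<bullet> u}"
  have "?m \<in> body" using body_convex p by (auto intro: convexD)
  then have "?m \<in> closure (interior body)" using convex_closure_interior[OF body_convex body_interior] closure_subset by blast
  moreover have oH: "open ?H" by (intro open_Int open_Collect_less continuous_intros)
  moreover have "?m \<in> ?H" using less by (simp add: inner_add_left)
  ultimately have ne: "interior body \<inter> ?H \<noteq> {}" using open_Int_closure_eq_empty[OF oH, of "interior body"] by blast
  let ?G = "interior body \<inter> ?H"
  have oG: "open ?G" using oH by blast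
  have bG: "bounded ?G" using compact_imp_bounded[OF body_compact] interior_subset bounded_subset by blast
  have G0: "vol ?G > 0" by (rule open_measure_pos[OF oG bG ne])
  have c: "compact (body \<inter> {x. x \<bullet> u \<le> c})" for c
    by (intro compact_Int_closed body_compact closed_Collect_le continuous_intros)
  have "vol (body \<inter> {x. x \<bullet> u \<le> p \<bullet> u}) + vol ?G
      = vol ((body \<inter> {x. x \<bullet> u \<le> p \<bullet> u}) \<union> ?G)"
    by (rule measure_Un3[THEN trans, symmetric, OF lmeasurable_compact[OF c] lmeasurable_open_bounded[OF oG bG]])
      (simp add: Int_def conj_commute conj_left_commute cong: conj_cong)
  also have "\<dots> \<le> vol (body \<inter> {x. x \<bullet> u \<le> q \<bullet> u})"
    using less interior_subset[of body] lmeasurable_compact[OF c] lmeasurable_open_bounded[OF oG bG]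
    by (intro measure_mono_fmeasurable) (auto intro: fmeasurableD)
  finally show ?thesis using G0 by linarith
qed

text \<open>If two points on the same level had touching points on different levels, then the volume of the
  body below a level would have to jump while that of the region varies continuously.\<close>

lemma touching_level_le:
  assumes u: "u \<noteq> 0" and p: "p \<in> S" "p \<in> upper" and q: "q \<in> S" "q \<in> upper" and eqpq: "p \<bullet> u = q \<bullet> u"
  shows "touching q \<bullet> u \<le> touching p \<bullet> u"
proof (rule ccontr)
  assume "\<not> ?thesis"
  then have less: "touching p \<bullet> u < touching q \<bullet> u" by simp
  let ?g = "\<lambda>c. vol (cregion \<inter> {x. x \<bullet> u \<le> c})"
  let ?k = "\<lambda>c. vol (body \<inter> {x. x \<bullet> u \<le> c})"
  let ?s = "p \<bullet> u"
  define \<mu> where "\<mu> = ?k (touching q \<bullet> u) - ?k (touching p \<bullet> u)"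
  have mu: "\<mu> > 0" using body_slab_pos[OF touching_body[OF p] touching_body[OF q] less] by (simp add: \<mu>_def)
  have kmono: "?k c \<le> ?k d" if "c \<le> d" for c d using that body_compact by (intro measure_mono_fmeasurable)
      (auto intro!: lmeasurable_compact fmeasurableD compact_Int_closed closed_Collect_le continuous_intros)
  \<comment> \<open>Cuts just below and just above the common level are matched with cuts of the
    body that enclose the levels of both touching points.\<close>
  have jump: "\<mu> * vol cregion \<le> (?g (?s + h) - ?g (?s - h)) * vol body" if h: "h > 0" for h
  proof -
    obtain b b' where m: "matched u (?s - h) b" "matched u (?s + h) b'" using ex_matched[OF u] by blast
    have "b \<le> touching p \<bullet> u" using touching_less(2)[OF m(1) u p] h by simp
    moreover have "touching q \<bullet> u \<le> b'" using touching_less(1)[OF m(2) u q] h eqpq by simp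
    ultimately have "\<mu> \<le> ?k b' - ?k b" unfolding \<mu>_def using kmono by (meson diff_mono)
    then have "\<mu> * vol cregion \<le> (?k b' - ?k b) * vol cregion" by (rule mult_right_mono) simp
    then show ?thesis using m by (simp add: matched_def left_diff_distrib)
  qed
  have cg: "continuous_on UNIV ?g" by (rule halfspace_measure_continuous[OF lmeasurable_compact[OF cregion_compact] u])
  have "continuous_on UNIV (\<lambda>h. (?g (?s + h) - ?g (?s - h)) * vol body)"
    by (intro continuous_intros continuous_on_compose2[OF cg]) auto
  then have "((\<lambda>h. (?g (?s + h) - ?g (?s - h)) * vol body) \<longlongrightarrow> (?g (?s + 0) - ?g (?s - 0)) * vol body) (at_right 0)"
    unfolding continuous_on_def by (intro tendsto_within_subset[of _ _ 0 UNIV "{0<..}"]) (simp_all only: UNIV_I ball_UNIV subset_UNIV)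
  then have lim: "((\<lambda>h. (?g (?s + h) - ?g (?s - h)) * vol body) \<longlongrightarrow> 0) (at_right 0)" by simp
  have "\<mu> * vol cregion \<le> 0" by (rule tendsto_lowerbound[OF lim _ trivial_limit_at_right_real])
      (use jump in \<open>auto simp: eventually_at_right_less intro: eventually_mono[OF eventually_at_right_less]\<close>)
  then show False using mu measure_cregion_pos by (simp add: mult_le_0_iff)
qed

text \<open>The component u of T p - T q orthogonal to p - q is a direction in which p and q have
  equal levels. By \<open>touching_level_le\<close> T p and T q then have equal levels too, so u is
  orthogonal to T p - T q and must vanish. Monotonicity in the direction p - q gives the
  sign.\<close>

lemma touching_parallel:
  assumes p: "p \<in> S" "p \<in> upper" and q: "q \<in> S" "q \<in> upper"
  shows "\<exists>c\<ge>0. touching p - touching q = c *\<^sub>R (p - q)"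
proof (cases "p = q")
  case False
  define d where "d = p - q"
  define w where "w = touching p - touching q"
  have d0: "d \<noteq> 0" using False by (simp add: d_def)
  define c where "c = (w \<bullet> d) / (d \<bullet> d)"
  define u where "u = w - c *\<^sub>R d"
  have ud: "u \<bullet> d = 0" using d0 by (simp add: u_def c_def inner_diff_left)
  have "u = 0"
  proof (rule ccontr)
    assume u: "u \<noteq> 0"
    have "p \<bullet> u = q \<bullet> u" using ud by (simp add: d_def inner_diff_right inner_commute)
    then have "touching p \<bullet> u = touching q \<bullet> u" using touching_level_le[OF u p q] touching_level_le[OF u q p] by simp
    then have "u \<bullet> w = 0" by (simp add: w_def inner_diff_right inner_commute)
    moreover have "u \<bullet> u = u \<bullet> w - c * (u \<bullet> d)" by (simp add: u_def inner_diff_right)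
    ultimately show False using u ud by simp
  qed
  moreover have "w \<bullet> d \<ge> 0"
  proof -
    have "q \<bullet> d < p \<bullet> d" using d0 inner_gt_zero_iff[of d] by (simp add: d_def inner_diff_left)
    then show ?thesis using touching_mono[OF d0 q p] by (simp add: w_def inner_diff_left)
  qed
  ultimately show ?thesis by (intro exI[of _ c]) (simp add: u_def c_def w_def d_def)
qed auto

text \<open>If the open part of S lay on one line, the rays through it would put the half-space, and
  hence the whole space, into the span of two vectors, although the dimension n + 1 is at least
  3.\<close>

lemma not_collinear:
  assumes n: "CARD('n) \<ge> 2"
  shows "\<exists>q\<in>S \<inter> upper. \<nexists>t. q - p = t *\<^sub>R v"
proof (rule ccontr)
  assume "\<not> ?thesis"
  then have H: "\<And>q. q \<in> S \<inter> upper \<Longrightarrow> \<exists>t. q - p = t *\<^sub>R v" by blast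
  have up: "x \<in> span {p, v}" if "x \<in> upper" for x :: "'n ambient"
  proof -
    obtain t where "proj x - p = t *\<^sub>R v" using H proj_upper \<open>x \<in> upper\<close> by blast
    then have "proj x = p + t *\<^sub>R v" by (simp add: algebra_simps)
    then have "proj x \<in> span {p, v}" by (auto intro!: span_add span_mul intro: span_base)
    moreover have "x = gaugeS x *\<^sub>R proj x" using gauge_proj upper_subset_closed_upper that by blast
    ultimately show ?thesis by (metis span_mul)
  qed
  have "x \<in> span {p, v}" for x :: "'n ambient"
  proof -
    let ?t = "\<bar>snd x\<bar> + 1"
    have "x + ?t *\<^sub>R E_last \<in> span {p, v}" "?t *\<^sub>R E_last \<in> span {p, v}" by (auto intro!: up simp: halfspaces_snd)
    from span_diff[OF this] show ?thesis by simp
  qed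
  then have "span {p, v} = UNIV" by blast
  then have "DIM('n ambient) = dim {p, v}" by (metis dim_UNIV dim_span)
  also have "\<dots> \<le> card {p, v}" by (rule dim_le_card') simp
  also have "\<dots> \<le> 2" by (simp add: card_insert_if)
  finally show False using n by simp
qed

text \<open>In a nondegenerate triangle of points of S all sides are mapped to parallel sides, so
  the three factors coincide. This carries the factor c from p0 p1 to every point off that line, and
  through an auxiliary point r to the points on it. With c = 0 the normal would be constant on S,
  which opposite equatorial points exclude.\<close>

lemma touching_affine:
  assumes n: "CARD('n) \<ge> 2"
  shows "\<exists>c d. c > 0 \<and> (\<forall>q\<in>S \<inter> upper. touching q = c *\<^sub>R q + d)"
proof -
  define p0 :: "'n ambient" where "p0 = proj E_last"
  have p0: "p0 \<in> S" "p0 \<in> upper" using proj_upper[of E_last] by (auto simp: p0_def halfspaces_snd)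
  obtain p1 where p1: "p1 \<in> S" "p1 \<in> upper" "p1 - p0 \<noteq> 0" using not_collinear[OF n, of p0 0] by auto
  obtain c where c: "c \<ge> 0" "touching p1 - touching p0 = c *\<^sub>R (p1 - p0)" using touching_parallel[OF p1(1,2) p0] by blast
  have indep: "touching r - touching p0 = e *\<^sub>R (r - p0)"
    if r: "r \<in> S" "r \<in> upper" and q: "q \<in> S" "q \<in> upper"
      and e: "touching q - touching p0 = e *\<^sub>R (q - p0)" and ni: "\<nexists>t. r - p0 = t *\<^sub>R (q - p0)" and nq: "q \<noteq> p0" for r q e
  proof -
    obtain \<alpha> where a: "touching r - touching p0 = \<alpha> *\<^sub>R (r - p0)" using touching_parallel[OF r p0] by blast
    obtain \<beta> where b: "touching r - touching q = \<beta> *\<^sub>R (r - q)" using touching_parallel[OF r q] by blast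
    have "(\<alpha> - \<beta>) *\<^sub>R (r - p0) = (touching r - touching p0) - \<beta> *\<^sub>R (r - q) - \<beta> *\<^sub>R (q - p0)"
      unfolding a by (simp add: algebra_simps)
    also have "\<dots> = (e - \<beta>) *\<^sub>R (q - p0)" unfolding b[symmetric] scaleR_diff_left e[symmetric] by simp
    finally have eq1: "(\<alpha> - \<beta>) *\<^sub>R (r - p0) = (e - \<beta>) *\<^sub>R (q - p0)" .
    have ab: "\<alpha> = \<beta>"
    proof (rule ccontr)
      assume "\<alpha> \<noteq> \<beta>"
      then have "r - p0 = ((e - \<beta>) / (\<alpha> - \<beta>)) *\<^sub>R (q - p0)"
        using arg_cong[OF eq1, of "\<lambda>x. inverse (\<alpha> - \<beta>) *\<^sub>R x"] by (simp add: divide_inverse mult.commute)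
      then show False using ni by blast
    qed
    then have "e = \<beta>" using eq1 nq by simp
    then show ?thesis using a ab by simp
  qed
  have all: "touching q - touching p0 = c *\<^sub>R (q - p0)" if q: "q \<in> S \<inter> upper" for q
  proof (cases "\<exists>t. q - p0 = t *\<^sub>R (p1 - p0)")
    case True
    obtain r where r: "r \<in> S \<inter> upper" "\<nexists>t. r - p0 = t *\<^sub>R (p1 - p0)" using not_collinear[OF n] by blast
    then have tr: "touching r - touching p0 = c *\<^sub>R (r - p0)" using indep[OF _ _ p1(1,2) c(2)] p1(3) by auto
    have rp: "r \<noteq> p0"
    proof
      assume "r = p0"
      then have "r - p0 = 0 *\<^sub>R (p1 - p0)" by simp
      then show False using r(2) by blast
    qed
    show ?thesis
    proof (cases "q = p0")
      case False
      have "\<nexists>t. q - p0 = t *\<^sub>R (r - p0)"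
      proof
        assume "\<exists>t. q - p0 = t *\<^sub>R (r - p0)"
        then obtain t where t: "q - p0 = t *\<^sub>R (r - p0)" by blast
        obtain t' where t': "q - p0 = t' *\<^sub>R (p1 - p0)" using True by blast
        have "t \<noteq> 0" using t False by auto
        then have "r - p0 = (t' / t) *\<^sub>R (p1 - p0)"
          using arg_cong[OF trans[OF t[symmetric] t'], of "\<lambda>x. inverse t *\<^sub>R x"] by (simp add: divide_inverse mult.commute)
        then show False using r(2) by blast
      qed
      then show ?thesis using indep[OF _ _ _ _ tr] q r(1) rp by blast
    qed simp
  next
    case False
    then show ?thesis using indep[OF _ _ p1(1,2) c(2)] q p1(3) by auto
  qed
  have "c \<noteq> 0"
  proof
    assume "c = 0"
    then have const: "\<nu> q = \<nu> p0" if "q \<in> S \<inter> upper" for q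
      using all[OF that] wulff_inj[of "\<nu> q" "\<nu> p0"] nu_norm p0 that by (simp add: touching_def)
    have "\<nu> q = \<nu> p0" if "q \<in> S" for q by (rule eq_on_S[OF nu_cont continuous_on_const const that])
    moreover obtain i :: 'n where True by blast
    moreover obtain s t where st: "s > 0" "t > 0" "s *\<^sub>R (axis i 1, 0) \<in> S" "- (t *\<^sub>R (axis i 1, 0)) \<in> S" using equator_points by blast
    ultimately have "s *\<^sub>R (axis i 1, 0) \<bullet> \<nu> p0 > 0" "- (t *\<^sub>R (axis i 1, 0)) \<bullet> \<nu> p0 > 0"
      using nu_pos by metis+
    then show False
      unfolding inner_scaleR_left inner_minus_left using st(1,2) by (simp only: zero_less_mult_iff neg_0_less_iff_less mult_less_0_iff) linarith
  qed
  then have "c > 0" using c(1) by simp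
  moreover have "\<forall>q\<in>S \<inter> upper. touching q = c *\<^sub>R q + (touching p0 - c *\<^sub>R p0)"
    using all by (auto simp: algebra_simps)
  ultimately show ?thesis by blast
qed

text \<open>Solving T q = c q + d for the Wulff point of \<nu> q gives c (q - x1), and Wulff points
  have dual norm 1; so q lies on the Wulff shape with centre x1 and radius 1 / c.\<close>

theorem equality_wulff:
  assumes n: "CARD('n) \<ge> 2"
  shows "\<exists>r>0. \<exists>x1. S = {x \<in> cupper. dual_norm F (x - x1) = r}"
proof -
  obtain c d where c: "c > 0" and T: "\<And>q. q \<in> S \<inter> upper \<Longrightarrow> touching q = c *\<^sub>R q + d" using touching_affine[OF n] by blast
  define x1 where "x1 = (1 / c) *\<^sub>R (x0 - d)"
  have up: "dual_norm F (q - x1) = 1 / c" if q: "q \<in> S \<inter> upper" for q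
  proof -
    have "wulff (\<nu> q) = c *\<^sub>R q + d - x0" using T[OF q] by (simp add: touching_def algebra_simps)
    also have "\<dots> = c *\<^sub>R (q - x1)" using c by (simp add: x1_def scaleR_diff_right)
    finally have "c * dual_norm F (q - x1) = 1" using c dual_norm_wulff[of "\<nu> q"] nu_norm q by (simp add: dual_norm_scale)
    then show ?thesis using c by (simp add: field_simps)
  qed
  have "continuous_on S (\<lambda>q. dual_norm F (q - x1))"
    by (rule continuous_on_compose2[OF dual_norm_continuous[of UNIV]]) (auto intro!: continuous_intros)
  from eq_on_S[OF this continuous_on_const up]
  have "S = {x \<in> cupper. dual_norm F (x - x1) = 1 / c}" by (intro wulff_part_eqI)
  then show ?thesis using c by (intro exI[of _ "1 / c"]) auto
qed

end

end

section \<open>Star-shaped capillary hypersurfaces\<close>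

text \<open>Leads from the hypotheses of the theorem to the axioms of \<open>radial_surface\<close>.
  The field \<nu>0 is any unit normal: \<open>outward_normal\<close> is defined by choice, so an
  outward field has to be shown to exist first.\<close>

locale capillary_graph = radial_graph S for S :: "'n::finite ambient set" +
  fixes \<nu>0 :: "'n ambient \<Rightarrow> 'n ambient"
  assumes embedded: "embedded_hypersurface S"
    and interior_upper: "manifold_interior S \<subseteq> upper"
    and boundary_hyper: "manifold_boundary S \<subseteq> boundary_hyperplane"
    and normal: "unit_normal_field S \<nu>0"
begin

lemma interior_eq: "manifold_interior S = S \<inter> upper"
  using embedded interior_upper boundary_hyper unfolding embedded_hypersurface_def by (force simp: halfspaces_snd)

definition outward_at :: "('n ambient \<Rightarrow> 'n ambient) \<Rightarrow> 'n ambient \<Rightarrow> bool" where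
  "outward_at n p \<longleftrightarrow> (\<forall>\<^sub>F t in at_right 0. p + t *\<^sub>R n p \<notin> cregion \<and> p - t *\<^sub>R n p \<in> cregion)"

lemma outward_at_exclusive: "outward_at n p \<Longrightarrow> \<not> outward_at (\<lambda>q. - n q) p"
proof
  assume "outward_at n p" "outward_at (\<lambda>q. - n q) p"
  then have "\<forall>\<^sub>F t :: real in at_right 0. False" unfolding outward_at_def by eventually_elim simp
  then show False by simp
qed

text \<open>Otherwise w would itself be tangent, hence orthogonal to itself.\<close>

lemma chart_normal_nonzero:
  assumes ch: "interior_chart S p U \<phi> \<or> boundary_chart S p U \<phi>" and n: "norm w = 1" "\<forall>v\<in>tangent_space S p. w \<bullet> v = 0"
  shows "snd (frechet_derivative \<phi> (at p) w) \<noteq> 0"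
proof
  assume "snd (frechet_derivative \<phi> (at p) w) = 0"
  then have "w \<in> tangent_space S p" using ch unfolding tangent_space_def by blast
  then have "w \<bullet> w = 0" using n(2) by blast
  then show False using n(1) by simp
qed

text \<open>The two halves of a small ball in the chart are connected and avoid S, so the gauge
  stays on one side of 1 in each. The radial points (1 - t0) p and (1 + t0) p show that the sides
  differ; \<epsilon> records which is which.\<close>

lemma chart_sides:
  assumes p: "p \<in> S" "p \<in> upper"
  shows "\<exists>U V (\<phi> :: 'n ambient \<Rightarrow> 'n ambient) U' \<epsilon>. diffeomorphism U V \<phi> \<and> \<phi> ` (S \<inter> U) = V \<inter> {x. snd x = 0} \<and> open U' \<and> p \<in> U' \<and> U' \<subseteq> U \<inter> upper \<and> \<bar>\<epsilon>\<bar> = 1 \<and>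
    (\<forall>x\<in>U'. (0 < \<epsilon> * snd (\<phi> x) \<longrightarrow> 1 < gaugeS x) \<and> (\<epsilon> * snd (\<phi> x) < 0 \<longrightarrow> gaugeS x < 1))"
proof -
  have "p \<in> manifold_interior S" using p by (simp add: interior_eq)
  then obtain U \<phi> where "interior_chart S p U \<phi>" unfolding manifold_interior_def by blast
  then obtain V where ch: "p \<in> U" "diffeomorphism U V \<phi>" "\<phi> ` (S \<inter> U) = V \<inter> {x. snd x = 0}"
    unfolding interior_chart_def by blast
  obtain \<psi> where psi: "diffeomorphism V U \<psi>" "\<And>x. x \<in> U \<Longrightarrow> \<psi> (\<phi> x) = x" "\<And>y. y \<in> V \<Longrightarrow> \<phi> (\<psi> y) = y" "\<phi> ` U = V" "\<psi> ` V = U"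
    by (rule diffeomorphism_inverse[OF ch(2)]) (rule that)
  have o: "open U" "open V" "continuous_on U \<phi>" "continuous_on V \<psi>"
    using ch(2) psi(1) by (auto simp: diffeomorphism_def intro: smooth_on_imp_continuous_on)
  have "open (V \<inter> \<psi> -` upper)" using o by (intro continuous_open_preimage) auto
  moreover have "\<phi> p \<in> V \<inter> \<psi> -` upper" using psi(2,4) ch(1) p(2) by auto
  ultimately obtain e where e: "e > 0" "ball (\<phi> p) e \<subseteq> V \<inter> \<psi> -` upper" using open_contains_ball by blast
  let ?B = "ball (\<phi> p) e"
  define U' where "U' = U \<inter> \<phi> -` ?B"
  have oU': "open U'" unfolding U'_def using o by (intro continuous_open_preimage) auto
  have pU': "p \<in> U'" using ch(1) e(1) by (simp add: U'_def)
  have sub: "U' \<subseteq> U \<inter> upper"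
  proof
    fix x assume "x \<in> U'"
    then have "x \<in> U" "\<psi> (\<phi> x) \<in> upper" using e(2) by (auto simp: U'_def)
    then show "x \<in> U \<inter> upper" using psi(2) by simp
  qed
  have S0: "x \<in> S \<longleftrightarrow> snd (\<phi> x) = 0" if "x \<in> U'" for x
  proof
    have xU: "x \<in> U" using that by (simp add: U'_def)
    show "snd (\<phi> x) = 0" if "x \<in> S" using that xU ch(3) by blast
    assume "snd (\<phi> x) = 0"
    then have "\<phi> x \<in> \<phi> ` (S \<inter> U)" using xU psi(4) ch(3) by blast
    then obtain y where "y \<in> S" "y \<in> U" "\<phi> x = \<phi> y" by blast
    then show "x \<in> S" using psi(2) xU by metis
  qed
  have side: "(\<forall>x\<in>U'. 0 < \<epsilon> * snd (\<phi> x) \<longrightarrow> gaugeS x < 1) \<or> (\<forall>x\<in>U'. 0 < \<epsilon> * snd (\<phi> x) \<longrightarrow> 1 < gaugeS x)" for \<epsilon> :: real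
  proof -
    let ?C = "?B \<inter> {v. 0 < \<epsilon> * snd v}"
    have "convex {v :: 'n ambient. 0 < (0, \<epsilon>) \<bullet> v}" by (rule convex_halfspace_gt)
    then have "convex {v :: 'n ambient. 0 < \<epsilon> * snd v}" by (simp add: inner_prod_def)
    then have "convex ?C" by (intro convex_Int) auto
    have CV: "?C \<subseteq> V" "\<psi> ` ?C \<subseteq> upper" using e(2) by auto
    then have "continuous_on ?C (\<lambda>v. gaugeS (\<psi> v))"
      by (intro continuous_on_compose2[OF gauge_continuous_upper] continuous_on_subset[OF o(4)]) auto
    then have con: "connected ((\<lambda>v. gaugeS (\<psi> v)) ` ?C)"
      using \<open>convex ?C\<close> convex_connected connected_continuous_image by blast
    have "1 \<notin> (\<lambda>v. gaugeS (\<psi> v)) ` ?C"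
    proof
      assume "1 \<in> (\<lambda>v. gaugeS (\<psi> v)) ` ?C"
      then obtain v where v: "v \<in> ?B" "0 < \<epsilon> * snd v" "gaugeS (\<psi> v) = 1" by auto
      then have vV: "v \<in> V" "\<psi> v \<in> upper" using e(2) by auto
      then have "\<psi> v \<in> U'" using v psi(3,5) by (auto simp: U'_def)
      moreover have "\<psi> v \<in> S" using vV v(3) upper_subset_closed_upper S_iff by blast
      ultimately show False using S0[of "\<psi> v"] psi(3) vV v(2) by simp
    qed
    moreover have "Y = {} \<or> (\<forall>y\<in>Y. y < 1) \<or> (\<forall>y\<in>Y. 1 < y)" if "connected Y" "1 \<notin> Y" for Y :: "real set"
      using connectedD_interval[OF that(1), of _ _ 1] that(2) by (metis less_eq_real_def linorder_less_linear)
    ultimately have "(\<forall>y\<in>(\<lambda>v. gaugeS (\<psi> v)) ` ?C. y < 1) \<or> (\<forall>y\<in>(\<lambda>v. gaugeS (\<psi> v)) ` ?C. 1 < y)"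
      using con by blast
    moreover have "gaugeS x \<in> (\<lambda>v. gaugeS (\<psi> v)) ` ?C" if "x \<in> U'" "0 < \<epsilon> * snd (\<phi> x)" for x
      using that psi(2) by (intro image_eqI[of _ _ "\<phi> x"]) (auto simp: U'_def)
    ultimately show ?thesis by blast
  qed
  have scale: "\<exists>d>0. \<forall>t. \<bar>t - 1\<bar> < d \<longrightarrow> t *\<^sub>R p \<in> U'"
  proof -
    obtain d where d: "d > 0" "ball p d \<subseteq> U'" using oU' pU' open_contains_ball by blast
    have "t *\<^sub>R p \<in> U'" if t: "\<bar>t - 1\<bar> < d / (norm p + 1)" for t
    proof -
      have "norm (p - t *\<^sub>R p) = \<bar>t - 1\<bar> * norm p"
        using norm_scaleR[of "1 - t" p] by (simp add: scaleR_diff_left abs_minus_commute)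
      also have "\<dots> \<le> \<bar>t - 1\<bar> * (norm p + 1)" by (intro mult_left_mono) auto
      also have "\<dots> < d" using t by (simp add: pos_less_divide_eq add_nonneg_pos)
      finally show ?thesis using d(2) by (auto simp: dist_norm)
    qed
    then show ?thesis using d(1) by (intro exI[of _ "d / (norm p + 1)"]) (auto simp: add_nonneg_pos)
  qed
  then obtain d where d: "d > 0" "\<And>t. \<bar>t - 1\<bar> < d \<Longrightarrow> t *\<^sub>R p \<in> U'" by blast
  define t0 where "t0 = min d 1 / 2"
  have t0: "0 < t0" "t0 < 1" "t0 < d" using d(1) by (auto simp: t0_def)
  have pc: "p \<in> cupper" using p(2) upper_subset_closed_upper by blast
  have in1: "(1 - t0) *\<^sub>R p \<in> U'" "(1 + t0) *\<^sub>R p \<in> U'" using d(2)[of "1 - t0"] d(2)[of "1 + t0"] t0 by auto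
  have ga: "gaugeS ((1 - t0) *\<^sub>R p) = 1 - t0" "gaugeS ((1 + t0) *\<^sub>R p) = 1 + t0"
    using gauge_scale[OF _ pc] gauge_S[OF p(1)] t0 by simp_all
  have nS: "snd (\<phi> ((1 - t0) *\<^sub>R p)) \<noteq> 0" "snd (\<phi> ((1 + t0) *\<^sub>R p)) \<noteq> 0"
  proof -
    have "(1 - t0) *\<^sub>R p \<notin> S" "(1 + t0) *\<^sub>R p \<notin> S" using gauge_S ga t0 by fastforce+
    then show "snd (\<phi> ((1 - t0) *\<^sub>R p)) \<noteq> 0" "snd (\<phi> ((1 + t0) *\<^sub>R p)) \<noteq> 0" using S0 in1 by blast+
  qed
  have "\<exists>\<epsilon>::real. \<bar>\<epsilon>\<bar> = 1 \<and> (\<forall>x\<in>U'. (0 < \<epsilon> * snd (\<phi> x) \<longrightarrow> 1 < gaugeS x) \<and> (\<epsilon> * snd (\<phi> x) < 0 \<longrightarrow> gaugeS x < 1))"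
    using side[of 1] side[of "- 1"]
  proof (elim disjE)
    assume *: "\<forall>x\<in>U'. 0 < 1 * snd (\<phi> x) \<longrightarrow> gaugeS x < 1" "\<forall>x\<in>U'. 0 < - 1 * snd (\<phi> x) \<longrightarrow> gaugeS x < 1"
    have "gaugeS ((1 + t0) *\<^sub>R p) < 1" using * in1(2) nS(2) by (cases "0 < snd (\<phi> ((1 + t0) *\<^sub>R p))") auto
    then show ?thesis using ga t0 by simp
  next
    assume *: "\<forall>x\<in>U'. 0 < 1 * snd (\<phi> x) \<longrightarrow> 1 < gaugeS x" "\<forall>x\<in>U'. 0 < - 1 * snd (\<phi> x) \<longrightarrow> 1 < gaugeS x"
    have "1 < gaugeS ((1 - t0) *\<^sub>R p)" using * in1(1) nS(1) by (cases "0 < snd (\<phi> ((1 - t0) *\<^sub>R p))") auto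
    then show ?thesis using ga t0 by simp
  next
    assume "\<forall>x\<in>U'. 0 < 1 * snd (\<phi> x) \<longrightarrow> gaugeS x < 1" "\<forall>x\<in>U'. 0 < - 1 * snd (\<phi> x) \<longrightarrow> 1 < gaugeS x"
    then show ?thesis by (intro exI[of _ "- 1"]) auto
  next
    assume "\<forall>x\<in>U'. 0 < 1 * snd (\<phi> x) \<longrightarrow> 1 < gaugeS x" "\<forall>x\<in>U'. 0 < - 1 * snd (\<phi> x) \<longrightarrow> gaugeS x < 1"
    then show ?thesis by (intro exI[of _ 1]) auto
  qed
  then show ?thesis using ch(2,3) oU' pU' sub by blast
qed

text \<open>The derivative d along \<nu>0 of the last chart coordinate, oriented by \<epsilon>,
  decides whether \<nu>0 points outwards. It is continuous and nonzero on S near p, so its sign is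
  locally constant.\<close>

lemma outward_local:
  assumes p: "p \<in> S" "p \<in> upper"
  shows "\<exists>A. open A \<and> p \<in> A \<and> ((\<forall>q\<in>S \<inter> A. outward_at \<nu>0 q) \<or> (\<forall>q\<in>S \<inter> A. outward_at (\<lambda>q. - \<nu>0 q) q))"
proof -
  obtain U V U' and \<phi> :: "'n ambient \<Rightarrow> 'n ambient" and \<epsilon> :: real where ch: "diffeomorphism U V \<phi>" "\<phi> ` (S \<inter> U) = V \<inter> {x. snd x = 0}" "open U'" "p \<in> U'" "U' \<subseteq> U \<inter> upper" "\<bar>\<epsilon>\<bar> = 1"
    and side: "\<And>x. x \<in> U' \<Longrightarrow> 0 < \<epsilon> * snd (\<phi> x) \<Longrightarrow> 1 < gaugeS x" "\<And>x. x \<in> U' \<Longrightarrow> \<epsilon> * snd (\<phi> x) < 0 \<Longrightarrow> gaugeS x < 1"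
    using chart_sides[OF p] by blast
  have oU: "open U" and smphi: "smooth_on \<phi> U" using ch(1) by (auto simp: diffeomorphism_def)
  define d where "d q = \<epsilon> * snd (frechet_derivative \<phi> (at q) (\<nu>0 q))" for q
  have icq: "interior_chart S q U \<phi>" if "q \<in> S \<inter> U'" for q using that ch(1,2,5) unfolding interior_chart_def by blast
  have d0: "d q \<noteq> 0" if q: "q \<in> S \<inter> U'" for q
  proof -
    have "snd (frechet_derivative \<phi> (at q) (\<nu>0 q)) \<noteq> 0"
      by (rule chart_normal_nonzero) (use icq[OF q] normal q in \<open>auto simp: unit_normal_field_def\<close>)
    then show ?thesis using ch(6) by (auto simp: d_def)
  qed
  have sgn_out: "outward_at (\<lambda>q. s *\<^sub>R \<nu>0 q) q" if q: "q \<in> S \<inter> U'" and s: "s * d q > 0" for q s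
  proof -
    have qU: "q \<in> U" "q \<in> upper" using q ch(5) by blast+
    have z: "snd (\<phi> q) = 0" using q qU ch(2) by blast
    let ?D = "frechet_derivative \<phi> (at q)"
    have D: "(\<phi> has_derivative ?D) (at q)" "linear ?D" using diffeomorphism_derivative[OF ch(1) qU(1)] by blast+
    have ev: "\<forall>\<^sub>F t in at_right 0. q + t *\<^sub>R w \<in> U' \<and> 0 < (\<epsilon> * c) * snd (\<phi> (q + t *\<^sub>R w))"
      if w: "c * (\<epsilon> * snd (?D w)) > 0" for w and c :: real
    proof -
      have line: "((\<lambda>t. q + t *\<^sub>R w) has_derivative (\<lambda>t. t *\<^sub>R w)) (at (0::real))"
        by (auto intro!: derivative_eq_intros)
      have "((\<lambda>t. \<phi> (q + t *\<^sub>R w)) has_derivative (\<lambda>t. ?D (t *\<^sub>R w))) (at 0)"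
        using has_derivative_compose[OF line, of \<phi> ?D] D(1) by simp
      then have "((\<lambda>t. \<phi> (q + t *\<^sub>R w)) has_derivative (\<lambda>t. t *\<^sub>R ?D w)) (at 0)" using D(2) by (simp add: linear_cmul)
      from has_derivative_quotient_tendsto[OF this]
      have "((\<lambda>t. snd ((\<phi> (q + t *\<^sub>R w) - \<phi> q) /\<^sub>R t)) \<longlongrightarrow> snd (?D w)) (at_right 0)"
        using tendsto_snd by fastforce
      then have "((\<lambda>t. (\<epsilon> * c) * snd ((\<phi> (q + t *\<^sub>R w) - \<phi> q) /\<^sub>R t)) \<longlongrightarrow> (\<epsilon> * c) * snd (?D w)) (at_right 0)"
        by (rule tendsto_mult_left)
      then have "\<forall>\<^sub>F t in at_right 0. 0 < (\<epsilon> * c) * snd ((\<phi> (q + t *\<^sub>R w) - \<phi> q) /\<^sub>R t)"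
        using w by (intro order_tendstoD) (auto simp: mult_ac)
      moreover have "((\<lambda>t. q + t *\<^sub>R w) \<longlongrightarrow> q + 0 *\<^sub>R w) (at_right 0)" by (intro tendsto_intros)
      then have "\<forall>\<^sub>F t in at_right 0. q + t *\<^sub>R w \<in> U'" using topological_tendstoD[of _ _ _ U'] ch(3) q by fastforce
      moreover have "\<forall>\<^sub>F t in at_right 0. (0::real) < t" by (simp add: eventually_at_right_less)
      ultimately show ?thesis
      proof eventually_elim
        case (elim t)
        have eq: "(\<epsilon> * c) * snd ((\<phi> (q + t *\<^sub>R w) - \<phi> q) /\<^sub>R t) = inverse t * ((\<epsilon> * c) * snd (\<phi> (q + t *\<^sub>R w)))"
          using z by (simp add: mult_ac)
        have "0 < inverse t * ((\<epsilon> * c) * snd (\<phi> (q + t *\<^sub>R w)))" using elim(1) unfolding eq .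
        moreover have "0 < inverse t" using elim by simp
        ultimately show ?case using elim zero_less_mult_pos by blast
      qed
    qed
    have "\<forall>\<^sub>F t in at_right 0. q + t *\<^sub>R (1 *\<^sub>R s *\<^sub>R \<nu>0 q) \<in> U' \<and> 0 < (\<epsilon> * 1) * snd (\<phi> (q + t *\<^sub>R (1 *\<^sub>R s *\<^sub>R \<nu>0 q)))"
      by (rule ev) (use s in \<open>simp add: linear_cmul[OF D(2)] linear_neg[OF D(2)] d_def mult_ac\<close>)
    moreover have "\<forall>\<^sub>F t in at_right 0. q + t *\<^sub>R ((- 1) *\<^sub>R s *\<^sub>R \<nu>0 q) \<in> U' \<and> 0 < (\<epsilon> * (- 1)) * snd (\<phi> (q + t *\<^sub>R ((- 1) *\<^sub>R s *\<^sub>R \<nu>0 q)))"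
      by (rule ev) (use s in \<open>simp add: linear_cmul[OF D(2)] linear_neg[OF D(2)] d_def mult_ac\<close>)
    ultimately show ?thesis unfolding outward_at_def
    proof eventually_elim
      case (elim t)
      then have "1 < gaugeS (q + t *\<^sub>R s *\<^sub>R \<nu>0 q)" "gaugeS (q - t *\<^sub>R s *\<^sub>R \<nu>0 q) < 1" "q - t *\<^sub>R s *\<^sub>R \<nu>0 q \<in> upper"
        using side(1)[of "q + t *\<^sub>R s *\<^sub>R \<nu>0 q"] side(2)[of "q - t *\<^sub>R s *\<^sub>R \<nu>0 q"] ch(5) by auto
      then show ?case using upper_subset_closed_upper by (auto simp: cregion_def)
    qed
  qed
  have cd: "continuous_on (S \<inter> U') d"
  proof -
    have "continuous_on (S \<inter> U') (\<lambda>q. \<Sum>b\<in>Basis. (\<nu>0 q \<bullet> b) *\<^sub>R frechet_derivative \<phi> (at q) b)"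
    proof (intro continuous_intros)
      show "continuous_on (S \<inter> U') \<nu>0" using normal continuous_on_subset unfolding unit_normal_field_def by blast
      show "continuous_on (S \<inter> U') (\<lambda>q. frechet_derivative \<phi> (at q) b)" for b
        using continuous_on_subset[OF smooth_on_imp_continuous_on[OF smooth_on_frechet_derivative[OF oU smphi]]] ch(5) by blast
    qed
    moreover have "(\<Sum>b\<in>Basis. (\<nu>0 q \<bullet> b) *\<^sub>R frechet_derivative \<phi> (at q) b) = frechet_derivative \<phi> (at q) (\<nu>0 q)" if "q \<in> S \<inter> U'" for q
    proof -
      have "linear (frechet_derivative \<phi> (at q))" using diffeomorphism_derivative[OF ch(1)] that ch(5) by blast
      from linear_basis_expansion[OF this, of "\<nu>0 q"] show ?thesis by simp
    qed
    ultimately have "continuous_on (S \<inter> U') (\<lambda>q. frechet_derivative \<phi> (at q) (\<nu>0 q))" by (rule continuous_on_eq)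
    then show ?thesis unfolding d_def by (intro continuous_intros)
  qed
  have pS: "p \<in> S \<inter> U'" using p ch(4) by blast
  define s where "s = sgn (d p)"
  have "s * d p > 0" using d0[OF pS] by (simp add: s_def sgn_if)
  moreover have "continuous_on (S \<inter> U') (\<lambda>q. s * d q)" by (intro continuous_intros cd)
  ultimately obtain A where A: "open A" "p \<in> A" "\<And>q. q \<in> S \<inter> U' \<Longrightarrow> q \<in> A \<Longrightarrow> s * d q > 0"
    using pS unfolding continuous_on_topological by (metis open_greaterThan greaterThan_iff)
  have "outward_at (\<lambda>q. s *\<^sub>R \<nu>0 q) q" if "q \<in> S \<inter> (A \<inter> U')" for q
    using sgn_out[of q s] A(3)[of q] that by blast
  moreover have "s = 1 \<or> s = -1" using d0[OF pS] by (auto simp: s_def sgn_if)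
  ultimately have "(\<forall>q\<in>S \<inter> (A \<inter> U'). outward_at \<nu>0 q) \<or> (\<forall>q\<in>S \<inter> (A \<inter> U'). outward_at (\<lambda>q. - \<nu>0 q) q)" by auto
  then show ?thesis using A(1,2) ch(3,4) by (intro exI[of _ "A \<inter> U'"]) auto
qed

text \<open>Near each interior point one of \<open>\<plusminus>\<nu>0\<close> is outward, so the sign is constant on the interior of \<open>S\<close>,
  which is a radial projection of the half-space and hence connected.\<close>

lemma ex_outward: "\<exists>n. outward_normal_field S n"
proof -
  let ?I = "S \<inter> upper"
  define A where "A n = \<Union>{A. open A \<and> (\<forall>q\<in>S \<inter> A. outward_at n q)}" for n
  have "proj ` upper = ?I"
  proof
    show "proj ` upper \<subseteq> ?I" using proj_upper by blast
    show "?I \<subseteq> proj ` upper" using proj_S by force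
  qed
  moreover have "continuous_on upper proj"
    by (rule continuous_on_subset[OF proj_continuous]) (use upper_subset_closed_upper upper_not_zero in blast)
  ultimately have con: "connected ?I" using connected_continuous_image convex_connected[OF convex_upper_halfspace] by metis
  have o: "open (A n)" for n by (auto simp: A_def)
  have out: "outward_at n q" if "q \<in> ?I" "q \<in> A n" for n q using that by (auto simp: A_def)
  have cover: "?I \<subseteq> A \<nu>0 \<union> A (\<lambda>q. - \<nu>0 q)" using outward_local by (fastforce simp: A_def)
  have "A \<nu>0 \<inter> A (\<lambda>q. - \<nu>0 q) \<inter> ?I = {}" using out outward_at_exclusive by blast
  then have "A \<nu>0 \<inter> ?I = {} \<or> A (\<lambda>q. - \<nu>0 q) \<inter> ?I = {}" using connectedD[OF con o o _ cover] by blast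
  then obtain n where n: "n = \<nu>0 \<or> n = (\<lambda>q. - \<nu>0 q)" "\<And>q. q \<in> ?I \<Longrightarrow> outward_at n q" using cover out by blast
  have "unit_normal_field S n" using n(1) normal unfolding unit_normal_field_def by (auto intro: continuous_on_minus)
  then show ?thesis using n(2) unfolding outward_normal_field_def interior_eq enclosed_eq outward_at_def by blast
qed

text \<open>In both kinds of chart the last coordinate of \<phi> vanishes on S, so the last
  coordinate of its derivative at q - p is a Taylor remainder; n p is a multiple of this functional
  because it vanishes on its kernel.\<close>

lemma normal_first_order:
  assumes n: "unit_normal_field S n" and p: "p \<in> S"
  shows "((\<lambda>q. n p \<bullet> (q - p) / norm (q - p)) \<longlongrightarrow> 0) (at p within S)"
proof -
  obtain U \<phi> where ic: "interior_chart S p U \<phi> \<or> boundary_chart S p U \<phi>"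
    using p embedded unfolding embedded_hypersurface_def manifold_interior_def manifold_boundary_def by blast
  then obtain V where ch: "p \<in> U" "diffeomorphism U V \<phi>" "\<phi> ` (S \<inter> U) \<subseteq> {x. snd x = 0}"
    unfolding interior_chart_def boundary_chart_def by blast
  let ?D = "frechet_derivative \<phi> (at p)"
  have D: "(\<phi> has_derivative ?D) (at p)" "linear ?D" using diffeomorphism_derivative[OF ch(2,1)] by blast+
  have np: "norm (n p) = 1" "\<forall>v\<in>tangent_space S p. n p \<bullet> v = 0" using n p by (auto simp: unit_normal_field_def)
  define a where "a = snd (?D (n p))"
  have a: "a \<noteq> 0" unfolding a_def by (rule chart_normal_nonzero[OF ic np])
  have "n p \<bullet> x = snd (?D x) * (n p \<bullet> (inverse a *\<^sub>R n p))" for x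
  proof (rule linear_functional_kernel[OF linear_snd_frechet[OF D(2)]])
    show "snd (?D (inverse a *\<^sub>R n p)) = 1" using D(2) a by (simp add: linear_cmul a_def[symmetric])
    show "linear ((\<bullet>) (n p))" by (simp add: bounded_linear.linear bounded_linear_inner_right)
    show "n p \<bullet> v = 0" if "snd (?D v) = 0" for v using np(2) ic that unfolding tangent_space_def by blast
  qed
  then have np_eq: "n p \<bullet> x = snd (?D x) / a" for x using np(1) by (metis (no_types) divide_inverse inner_scaleR_right mult.right_neutral norm_eq_1)
  have "((\<lambda>q. norm (\<phi> q - \<phi> p - ?D (q - p)) / norm (q - p)) \<longlongrightarrow> 0) (at p within S)"
    using has_derivative_at_withinI[OF D(1)] unfolding has_derivative_iff_norm by blast
  from tendsto_mult[OF tendsto_const[of "inverse \<bar>a\<bar>"] this]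
  have lim: "((\<lambda>q. inverse \<bar>a\<bar> * (norm (\<phi> q - \<phi> p - ?D (q - p)) / norm (q - p))) \<longlongrightarrow> 0) (at p within S)" by simp
  have oU: "open U" using ch(2) by (simp add: diffeomorphism_def)
  have "\<forall>\<^sub>F q in at p within S. q \<in> S \<inter> U" using oU ch(1) by (auto simp: eventually_at_topological)
  then have "\<forall>\<^sub>F q in at p within S. norm (n p \<bullet> (q - p) / norm (q - p)) \<le> inverse \<bar>a\<bar> * (norm (\<phi> q - \<phi> p - ?D (q - p)) / norm (q - p))"
  proof eventually_elim
    case (elim q)
    have "snd (\<phi> q) = 0" "snd (\<phi> p) = 0" using ch(1,3) elim p by blast+
    then have "\<bar>snd (?D (q - p))\<bar> \<le> norm (\<phi> q - \<phi> p - ?D (q - p))"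
    proof -
      have "norm (snd z) \<le> norm z" for z :: "'n ambient" by (metis norm_snd_le prod.collapse)
      from this[of "\<phi> q - \<phi> p - ?D (q - p)"] show ?thesis using \<open>snd (\<phi> q) = 0\<close> \<open>snd (\<phi> p) = 0\<close> by simp
    qed
    then have "\<bar>snd (?D (q - p))\<bar> * inverse \<bar>a\<bar> \<le> norm (\<phi> q - \<phi> p - ?D (q - p)) * inverse \<bar>a\<bar>"
      by (rule mult_right_mono) simp
    then have "\<bar>snd (?D (q - p))\<bar> * inverse \<bar>a\<bar> / norm (q - p) \<le> norm (\<phi> q - \<phi> p - ?D (q - p)) * inverse \<bar>a\<bar> / norm (q - p)"
      by (rule divide_right_mono) simp
    then show ?case unfolding np_eq by (simp add: abs_mult divide_inverse mult_ac)
  qed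
  then show ?thesis using lim by (rule Lim_null_comparison)
qed

end

lemma capillary_radial_surface:
  assumes "halfspace_hypersurface S" "star_shaped S"
  shows "radial_surface S (outward_normal S)"
proof -
  obtain \<nu>0 where "unit_normal_field S \<nu>0" using assms(1) by (auto simp: halfspace_hypersurface_def orientable_def)
  then interpret capillary_graph S \<nu>0 using assms unfolding halfspace_hypersurface_def star_shaped_def by unfold_locales auto
  have "outward_normal_field S (outward_normal S)" unfolding outward_normal_def using ex_outward by (rule someI_ex)
  then have u: "unit_normal_field S (outward_normal S)" by (simp add: outward_normal_field_def)
  show ?thesis
  proof
    show "S \<inter> upper \<subseteq> manifold_interior S" using interior_eq by simp
    show "continuous_on S (outward_normal S)" "\<And>p. p \<in> S \<Longrightarrow> norm (outward_normal S p) = 1"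
      using u by (auto simp: unit_normal_field_def)
    show "\<And>p. p \<in> S \<Longrightarrow> 0 < p \<bullet> outward_normal S p" using assms(2) by (simp add: star_shaped_def)
  qed (rule normal_first_order[OF u])
qed

section \<open>The main theorem\<close>

text \<open>Translates the roots in \<open>iso_const\<close> into the power in the theorem; the
  factor m + 1 and one root of K cancel.\<close>

lemma root_ratio_powr:
  fixes V K :: real
  assumes "V > 0" "K > 0"
  shows "real (m + 1) * root (m + 1) K * root (m + 1) V ^ m / (real (m + 1) * K) = (V / K) powr (real m / (real m + 1))"
proof -
  define v where "v = root (m + 1) V"
  define k where "k = root (m + 1) K"
  have vk: "v > 0" "k > 0" using assms by (simp_all add: v_def k_def)
  have VK: "V = v ^ (m + 1)" "K = k ^ (m + 1)" using assms by (simp_all add: v_def k_def del: power_Suc power_Suc2)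
  have "V / K = (v / k) powr real (m + 1)" using vk unfolding VK by (simp only: powr_realpow power_divide divide_pos_pos)
  moreover have "real (m + 1) * (real m / (real m + 1)) = real m" by (simp add: field_simps)
  ultimately have "(V / K) powr (real m / (real m + 1)) = (v / k) powr real m" by (simp only: powr_powr)
  also have "\<dots> = (v / k) ^ m" using vk by (simp add: powr_realpow)
  also have "\<dots> = real (m + 1) * k * v ^ m / (real (m + 1) * k ^ (m + 1))" using vk by (simp add: power_divide del: of_nat_Suc)
  finally show ?thesis unfolding VK(2)[symmetric] by (simp only: v_def k_def)
qed

context anisotropic
begin

lemma wulff_unit_inner: "norm z = 1 \<Longrightarrow> Psi F z \<bullet> z = F z"
  using wulff_inner_self[of z] wulff_unit[of z] by (metis inner_commute norm_zero zero_neq_one)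

end

text \<open>The identity \<open>Psi F z\<close> . z = F z at z = \<plusminus>\<open>E_last\<close>
  explains the normalisation of \<open>E_F\<close>.\<close>

lemma E_F_snd:
  assumes "anisotropy F"
  shows "snd (E_F F \<omega>) = 1"
proof -
  interpret anisotropic F by unfold_locales (rule assms)
  have n: "norm (E_last :: 'a ambient) = 1" by (simp add: E_last_def)
  then have "F E_last > 0" "F (- E_last) > 0" by (auto intro!: F_pos)
  moreover have "snd (Psi F E_last) = F E_last" "snd (Psi F (- E_last)) = - F (- E_last)"
    using wulff_unit_inner[of E_last] wulff_unit_inner[of "- E_last"] n by simp_all
  ultimately show ?thesis by (simp add: E_F_def)
qed

text \<open>For nonzero \<omega> the vector is a point of the Wulff shape, of dual norm 1, scaled by
  |\<omega>| / F (\<plusminus>\<open>E_last\<close>); the range of \<omega> says that this factor is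
  below 1.\<close>

lemma E_F_inside:
  assumes F: "anisotropy F" and w: "\<omega> \<in> {- F E_last <..< F (- E_last)}"
  shows "dual_norm F (- (\<omega> *\<^sub>R E_F F \<omega>)) < 1"
proof -
  interpret anisotropic F by unfold_locales (rule F)
  have n: "norm (E_last :: 'a ambient) = 1" "norm (- E_last :: 'a ambient) = 1" by (simp_all add: E_last_def)
  then have pos: "F E_last > 0" "F (- E_last) > 0" by (auto intro!: F_pos)
  have d: "dual_norm F (Psi F E_last) = 1" "dual_norm F (Psi F (- E_last)) = 1" using dual_norm_wulff wulff_unit n by metis+
  consider "\<omega> < 0" | "\<omega> = 0" | "\<omega> > 0" by linarith
  then show ?thesis
  proof cases
    case 1
    then have "- (\<omega> *\<^sub>R E_F F \<omega>) = (- \<omega> / F E_last) *\<^sub>R Psi F E_last" by (simp add: E_F_def divide_inverse)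
    then show ?thesis using 1 pos w d by (simp only:) (subst dual_norm_scale, auto simp: divide_simps)
  next
    case 3
    then have "- (\<omega> *\<^sub>R E_F F \<omega>) = (\<omega> / F (- E_last)) *\<^sub>R Psi F (- E_last)" by (simp add: E_F_def divide_inverse)
    then show ?thesis using 3 pos w d by (simp only:) (subst dual_norm_scale, auto simp: divide_simps)
  qed (simp add: dual_norm_zero)
qed

context wulff_comparison
begin

text \<open>As \<omega> is the last coordinate of \<open>x0\<close>, the divergence theorem turns
  the boundary term of the energy into the integral of x0 . \<nu>.\<close>

lemma energy_support:
  "capillary_energy F (snd x0) S = (real CARD('n) + 1) * cone_integral support"
proof -
  have "cone_integral support = cone_integral (\<lambda>p. F (\<nu> p)) + cone_integral (\<lambda>p. x0 \<bullet> \<nu> p)"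
    unfolding support_def by (intro cone_integral_add F_nu_continuous continuous_intros nu_cont)
  then show ?thesis using divergence_theorem[of x0] by (simp add: capillary_energy_def anisotropic_area_eq[OF F_continuous] distrib_left)
qed

text \<open>The capillary condition at one boundary point fixes the height of the centre:
  \<open>snd x1 = r * snd x0\<close>. Hence the homothety between the two Wulff balls preserves the
  half-space, the region is a homothetic copy of \<open>body\<close>, and both sides can be
  computed.\<close>

lemma wulff_shape_equality:
  assumes S: "S = {x \<in> cupper. dual_norm F (x - x1) = r}" and r: "r > 0"
    and cap: "capillary_hypersurface F (snd x0) S"
  shows "(real CARD('n) + 1) * cone_integral support = iso_const"
proof -
  let ?m = "measure (lebesgue :: 'n ambient measure)"
  have "dual_norm F (- x1) < r" by (rule origin_inside) (use S in blast)
  then interpret D: wulff_cap F x1 r by unfold_locales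
  have SW: "S = D.W" using S by (simp only: D.W_def)
  \<comment> \<open>An equatorial point of S, necessarily a boundary point because the interior lies
    in the open half-space.\<close>
  obtain p where p: "p \<in> S" "snd p = 0" using equator_points by (metis snd_conv scaleR_zero_right snd_scaleR)
  have "p \<in> manifold_boundary S" using cap p unfolding capillary_hypersurface_def halfspace_hypersurface_def embedded_hypersurface_def
    by (force simp: halfspaces_snd)
  then have "Psi F (outward_normal S p) \<bullet> (- E_last) = snd x0"
    using cap unfolding capillary_hypersurface_def capillary_condition_def by blast
  moreover have on: "outward_normal S p = D.\<nu>W p" using D.WR.outward_normal_eq p(1) unfolding SW .
  moreover have nW: "norm (D.\<nu>W p) = 1" "p - x1 = r *\<^sub>R wulff (D.\<nu>W p)" using D.nuW[of p] p(1) SW by blast+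
  ultimately have "snd (wulff (D.\<nu>W p)) = - snd x0" by (simp add: wulff_unit)
  moreover have "snd (p - x1) = r * snd (wulff (D.\<nu>W p))" using nW(2) by (metis snd_scaleR real_scaleR_def)
  ultimately have x1: "snd x1 = r * snd x0" using p(2) by simp
  have "(real CARD('n) + 1) * cone_integral support = (real CARD('n) + 1) * ?m cregion / r"
    using D.energy_W[OF x1] energy_support unfolding SW[symmetric] enclosed_eq by simp
  moreover have "cregion = (\<lambda>x. r *\<^sub>R x + (x1 - r *\<^sub>R x0)) ` body"
  proof -
    have "D.WR.cregion = cregion" using D.WR.enclosed_eq enclosed_eq SW by simp
    then have cr: "cregion = {x \<in> cupper. dual_norm F (x - x1) \<le> r}" using D.cregion_W by simp
    have dn: "dual_norm F (r *\<^sub>R x + (x1 - r *\<^sub>R x0) - x1) = r * dual_norm F (x - x0)" for x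
    proof -
      have "r *\<^sub>R x + (x1 - r *\<^sub>R x0) - x1 = r *\<^sub>R (x - x0)" by (simp add: algebra_simps)
      then show ?thesis using r by (simp add: dual_norm_scale)
    qed
    have mem: "r *\<^sub>R x + (x1 - r *\<^sub>R x0) \<in> cregion \<longleftrightarrow> x \<in> body" for x
      unfolding cr body_def using r x1 dn[of x] by (simp add: halfspaces_snd zero_le_mult_iff)
    show ?thesis
    proof
      show "(\<lambda>x. r *\<^sub>R x + (x1 - r *\<^sub>R x0)) ` body \<subseteq> cregion" using mem by blast
      show "cregion \<subseteq> (\<lambda>x. r *\<^sub>R x + (x1 - r *\<^sub>R x0)) ` body"
      proof
        fix y assume y: "y \<in> cregion"
        let ?x = "inverse r *\<^sub>R (y - (x1 - r *\<^sub>R x0))"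
        have "r *\<^sub>R ?x + (x1 - r *\<^sub>R x0) = y" using r by simp
        then show "y \<in> (\<lambda>x. r *\<^sub>R x + (x1 - r *\<^sub>R x0)) ` body" using mem[of ?x] y by (intro image_eqI[of _ _ ?x]) auto
      qed
    qed
  qed
  then have "?m cregion = r ^ (CARD('n) + 1) * ?m body" using measure_lebesgue_affine[of r "x1 - r *\<^sub>R x0" body] r by simp
  moreover have "root (CARD('n) + 1) (r ^ (CARD('n) + 1) * ?m body) = r * root (CARD('n) + 1) (?m body)"
    using r by (simp only: real_root_mult) (simp add: real_root_power_cancel del: power_Suc)
  moreover have "root (CARD('n) + 1) (?m body) * root (CARD('n) + 1) (?m body) ^ CARD('n) = ?m body"
    using real_root_pow_pos2[of "CARD('n) + 1" "?m body"] by simp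
  ultimately show ?thesis using r by (simp add: iso_const_def power_mult_distrib mult_ac)
qed

end

theorem theorem1p3:
  fixes F :: "'n::finite ambient \<Rightarrow> real"
    and \<omega>\<^sub>0 :: real
    and \<Sigma> :: "'n ambient set"
  assumes n: "CARD('n) \<ge> 2"
    and F: "anisotropy F"
    and \<omega>\<^sub>0: "\<omega>\<^sub>0 \<in> {- F E_last <..< F (- E_last)}"
    and cap: "capillary_hypersurface F \<omega>\<^sub>0 \<Sigma>"
    and star: "star_shaped \<Sigma>"
  shows
    "capillary_energy F \<omega>\<^sub>0 \<Sigma> / capillary_energy F \<omega>\<^sub>0 (model_wulff F 1 \<omega>\<^sub>0)
       \<ge> (measure lebesgue (enclosed \<Sigma>) / measure lebesgue (enclosed (model_wulff F 1 \<omega>\<^sub>0)))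
           powr (real CARD('n) / (real CARD('n) + 1))
     \<and> (capillary_energy F \<omega>\<^sub>0 \<Sigma> / capillary_energy F \<omega>\<^sub>0 (model_wulff F 1 \<omega>\<^sub>0)
          = (measure lebesgue (enclosed \<Sigma>) / measure lebesgue (enclosed (model_wulff F 1 \<omega>\<^sub>0)))
              powr (real CARD('n) / (real CARD('n) + 1))
        \<longleftrightarrow> capillary_wulff_shape F \<omega>\<^sub>0 \<Sigma>)
     \<and> capillary_energy F \<omega>\<^sub>0 (model_wulff F 1 \<omega>\<^sub>0)
         = (real CARD('n) + 1) * measure lebesgue (enclosed (model_wulff F 1 \<omega>\<^sub>0))"
proof -
  define x0 where "x0 = \<omega>\<^sub>0 *\<^sub>R E_F F \<omega>\<^sub>0"
  have snd_x0: "snd x0 = \<omega>\<^sub>0" by (simp add: x0_def E_F_snd[OF F])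
  have inside: "dual_norm F (- x0) < 1" unfolding x0_def by (rule E_F_inside[OF F \<omega>\<^sub>0])
  interpret C: wulff_cap F x0 1 using F inside by unfold_locales
  have "halfspace_hypersurface \<Sigma>" using cap by (simp add: capillary_hypersurface_def)
  then interpret radial_surface \<Sigma> "outward_normal \<Sigma>" using star by (rule capillary_radial_surface)
  interpret wulff_comparison \<Sigma> "outward_normal \<Sigma>" F x0 using inside by unfold_locales
  let ?M = "model_wulff F 1 \<omega>\<^sub>0"
  have M: "?M = C.W" unfolding model_wulff_def C.W_def unfolding x0_def by simp
  have encM: "enclosed ?M = body" unfolding M C.WR.enclosed_eq C.cregion_W body_def ..
  have energyM: "capillary_energy F \<omega>\<^sub>0 ?M = (real CARD('n) + 1) * vol (enclosed ?M)"
    using C.energy_W[of \<omega>\<^sub>0] snd_x0 by (simp add: M)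
  let ?E = "capillary_energy F \<omega>\<^sub>0 \<Sigma>"
  let ?D = "(real CARD('n) + 1) * vol body"
  have E: "?E = (real CARD('n) + 1) * cone_integral support" using energy_support snd_x0 by simp
  have D: "?D > 0" using body_measure_pos by simp
  have ratio: "iso_const / ?D = (vol (enclosed \<Sigma>) / vol body) powr (real CARD('n) / (real CARD('n) + 1))"
    using root_ratio_powr[OF measure_cregion_pos body_measure_pos, of "CARD('n)"] by (simp add: iso_const_def enclosed_eq add.commute)
  have "?E = iso_const \<longleftrightarrow> capillary_wulff_shape F \<omega>\<^sub>0 \<Sigma>"
  proof
    assume "?E = iso_const"
    then have "iso_const = (real CARD('n) + 1) * cone_integral support" using E by simp
    from equality_wulff[OF this n] show "capillary_wulff_shape F \<omega>\<^sub>0 \<Sigma>"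
      using cap by (auto simp: capillary_wulff_shape_def)
  next
    assume "capillary_wulff_shape F \<omega>\<^sub>0 \<Sigma>"
    then obtain r x1 where "r > 0" "\<Sigma> = {x \<in> cupper. dual_norm F (x - x1) = r}" by (auto simp: capillary_wulff_shape_def)
    then show "?E = iso_const" using wulff_shape_equality cap snd_x0 E by simp
  qed
  moreover have "?E / ?D = iso_const / ?D \<longleftrightarrow> ?E = iso_const" using body_measure_pos by simp
  moreover have "iso_const / ?D \<le> ?E / ?D" using isoperimetric_inequality D unfolding E by (intro divide_right_mono) auto
  ultimately show ?thesis unfolding energyM unfolding encM ratio[symmetric] by blast
qed

end
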